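(* Let $H,K$ be Hilbert spaces, and let $U\in M_n(B(H))$ and $V\in M_m(B(K))$ be magic unitaries. Let $A$ be the Hopf image for $U$ and $B$ the Hopf image for $V$. Then the Hopf algebra associated to the magic unitary $U\otimes V$ is a quotient of $A\otimes B$.
   Context: C*-algebras and morphisms are unital. A magic unitary over a C*-algebra $A$ is a matrix $u\in M_n(A)$ of projections such that on each row and each column the entries are pairwise orthogonal and sum to $1$. The tensor product $W=U\otimes V$ is the $nm\times nm$ magic unitary over $B(H\otimes K)$ given by $W_{ia,jb}=U_{ij}\otimes V_{ab}$. $A_s(n)$ is the universal C*-algebra generated by $n^2$ elements $u_{ij}$ with the relations making $(u_{ij})$ a magic unitary. A quantum permutation algebra is a C*-algebra $A$ with a magic unitary $u\in M_n(A)$ whose entries generate $A$, and such that $\Delta(u_{ij})=\sum_k u_{ik}\otimes u_{kj}$, $\varepsilon(u_{ij})=\delta_{ij}$, $S(u_{ij})=u_{ji}$ define morphisms $\Delta:A\to A\otimes A$, $\varepsilon:A\to\mathbb C$, $S:A\to A^{op}$. All quantum permutation algebras are taken full: $A$ is the enveloping C*-algebra of the $*$-algebra generated by the $u_{ij}$; accordingly $A\otimes B$ in the claim is the full (maximal) tensor product, a Hopf C*-algebra with its usual structure. Quotients are quotients as Hopf C*-algebras. Given a representation $\pi:A_s(n)\to B(H)$, its Hopf image is the smallest quantum permutation algebra $A$ (with $n\times n$ magic unitary) realizing a factorization $A_s(n)\to A\to B(H)$ of $\pi$, the first map sending generators to generators; smallest means that any other algebra realizing such a factorization maps onto $A$,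 generators being sent to generators. The Hopf image for (or Hopf algebra associated to) a magic unitary $U\in M_n(B(H))$ is the Hopf image of the representation $A_s(n)\to B(H)$, $u_{ij}\mapsto U_{ij}$. *)

theory Defs
  imports "HOL-Analysis.Analysis" "HOL-Algebra.Module"
begin

section \<open>Unital *-algebras and C*-algebras\<close>

definition complex_ring :: "complex ring" where
  "complex_ring = \<lparr>carrier = UNIV, mult = (*), one = 1, zero = 0, add = (+)\<rparr>"

record 'a star_alg = "(complex, 'a) module" +
  star :: "'a \<Rightarrow> 'a"

record 'a cstar = "'a star_alg" +
  cnorm :: "'a \<Rightarrow> real"

text \<open>The locale \<open>algebra\<close> of HOL-Algebra is commutative, so it is not used here.\<close>

locale star_algebra = ring A + module complex_ring A for A (structure) +
  assumes smult_mult_left: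
      "\<lbrakk>x \<in> carrier A; y \<in> carrier A\<rbrakk> \<Longrightarrow> (c \<odot> x) \<otimes> y = c \<odot> (x \<otimes> y)"
    and smult_mult_right:
      "\<lbrakk>x \<in> carrier A; y \<in> carrier A\<rbrakk> \<Longrightarrow> x \<otimes> (c \<odot> y) = c \<odot> (x \<otimes> y)"
    and star_closed: "x \<in> carrier A \<Longrightarrow> star A x \<in> carrier A"
    and star_star: "x \<in> carrier A \<Longrightarrow> star A (star A x) = x"
    and star_add: "\<lbrakk>x \<in> carrier A; y \<in> carrier A\<rbrakk> \<Longrightarrow> star A (x \<oplus> y) = star A x \<oplus> star A y"
    and star_mult: "\<lbrakk>x \<in> carrier A; y \<in> carrier A\<rbrakk> \<Longrightarrow> star A (x \<otimes> y) = star A y \<otimes> star A x"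
    and star_smult: "x \<in> carrier A \<Longrightarrow> star A (c \<odot> x) = cnj c \<odot> star A x"

definition cstar_seminorm :: "('a, 'm) star_alg_scheme \<Rightarrow> ('a \<Rightarrow> real) \<Rightarrow> bool" where
  "cstar_seminorm P p \<longleftrightarrow>
     (\<forall>x \<in> carrier P. 0 \<le> p x \<and> p (star P x \<otimes>\<^bsub>P\<^esub> x) = (p x)\<^sup>2 \<and>
        (\<forall>c. p (c \<odot>\<^bsub>P\<^esub> x) = cmod c * p x) \<and>
        (\<forall>y \<in> carrier P. p (x \<oplus>\<^bsub>P\<^esub> y) \<le> p x + p y \<and> p (x \<otimes>\<^bsub>P\<^esub> y) \<le> p x * p y))"

text \<open>The zero algebra is allowed (it is \<open>B(H)\<close> for \<open>H = 0\<close>).\<close>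

locale cstar_algebra = star_algebra A for A (structure) +
  assumes cstar_seminorm: "cstar_seminorm A (cnorm A)"
    and cnorm_definite: "\<lbrakk>x \<in> carrier A; cnorm A x = 0\<rbrakk> \<Longrightarrow> x = \<zero>"
    and complete: "Metric_space.mcomplete (carrier A) (\<lambda>x y. cnorm A (x \<ominus> y))"

definition star_hom ::
    "('a, 'm) star_alg_scheme \<Rightarrow> ('b, 'n) star_alg_scheme \<Rightarrow> ('a \<Rightarrow> 'b) set" where
  "star_hom A B = {f \<in> ring_hom A B. \<forall>x \<in> carrier A.
     f (star A x) = star B (f x) \<and> (\<forall>c. f (c \<odot>\<^bsub>A\<^esub> x) = c \<odot>\<^bsub>B\<^esub> f x)}"

definition opposite :: "('a, 'm) star_alg_scheme \<Rightarrow> ('a, 'm) star_alg_scheme" where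
  "opposite A = A\<lparr>mult := \<lambda>x y. y \<otimes>\<^bsub>A\<^esub> x\<rparr>"

definition complex_cstar :: "complex cstar" where
  "complex_cstar = \<lparr>carrier = UNIV, mult = (*), one = 1, zero = 0, add = (+), smult = (*),
     star = cnj, cnorm = cmod\<rparr>"

inductive_set star_gen :: "('a, 'm) star_alg_scheme \<Rightarrow> 'a set \<Rightarrow> 'a set"
  for A :: "('a, 'm) star_alg_scheme" and G :: "'a set" where
    gen: "x \<in> G \<Longrightarrow> x \<in> star_gen A G"
  | one: "\<one>\<^bsub>A\<^esub> \<in> star_gen A G"
  | add: "\<lbrakk>x \<in> star_gen A G; y \<in> star_gen A G\<rbrakk> \<Longrightarrow> x \<oplus>\<^bsub>A\<^esub> y \<in> star_gen A G"
  | mult: "\<lbrakk>x \<in> star_gen A G; y \<in> star_gen A G\<rbrakk> \<Longrightarrow> x \<otimes>\<^bsub>A\<^esub> y \<in> star_gen A G"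
  | smult: "x \<in> star_gen A G \<Longrightarrow> c \<odot>\<^bsub>A\<^esub> x \<in> star_gen A G"
  | star: "x \<in> star_gen A G \<Longrightarrow> star A x \<in> star_gen A G"

definition generates_cstar :: "('a, 'm) cstar_scheme \<Rightarrow> 'a set \<Rightarrow> bool" where
  "generates_cstar A G \<longleftrightarrow>
     (\<forall>x \<in> carrier A. \<forall>e > 0. \<exists>y \<in> star_gen A G. cnorm A (x \<ominus>\<^bsub>A\<^esub> y) < e)"


section \<open>Enveloping and universal C*-algebras\<close>

text \<open>
  The completion of a *-algebra \<open>P\<close> for a C*-seminorm \<open>p\<close>: equivalence classes of
  \<open>p\<close>-Cauchy sequences, where two sequences are equivalent if their difference is \<open>p\<close>-null.
\<close>

definition cauchy_seqs :: "('a, 'm) star_alg_scheme \<Rightarrow> ('a \<Rightarrow> real) \<Rightarrow> (nat \<Rightarrow> 'a) set" where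
  "cauchy_seqs P p = {X. (\<forall>k. X k \<in> carrier P) \<and>
     (\<forall>e > 0. \<exists>N. \<forall>i \<ge> N. \<forall>j \<ge> N. p (X i \<ominus>\<^bsub>P\<^esub> X j) < e)}"

definition null_class ::
    "('a, 'm) star_alg_scheme \<Rightarrow> ('a \<Rightarrow> real) \<Rightarrow> (nat \<Rightarrow> 'a) \<Rightarrow> (nat \<Rightarrow> 'a) set" where
  "null_class P p X = {Y \<in> cauchy_seqs P p. (\<lambda>k. p (Y k \<ominus>\<^bsub>P\<^esub> X k)) \<longlonglongrightarrow> 0}"

definition rep :: "(nat \<Rightarrow> 'a) set \<Rightarrow> nat \<Rightarrow> 'a" where
  "rep S = (SOME X. X \<in> S)"

definition completion ::
    "('a, 'm) star_alg_scheme \<Rightarrow> ('a \<Rightarrow> real) \<Rightarrow> (nat \<Rightarrow> 'a) set cstar" where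
  "completion P p =
     \<lparr>carrier = null_class P p ` cauchy_seqs P p,
      mult = \<lambda>S T. null_class P p (\<lambda>k. rep S k \<otimes>\<^bsub>P\<^esub> rep T k),
      one = null_class P p (\<lambda>_. \<one>\<^bsub>P\<^esub>),
      zero = null_class P p (\<lambda>_. \<zero>\<^bsub>P\<^esub>),
      add = \<lambda>S T. null_class P p (\<lambda>k. rep S k \<oplus>\<^bsub>P\<^esub> rep T k),
      smult = \<lambda>c S. null_class P p (\<lambda>k. c \<odot>\<^bsub>P\<^esub> rep S k),
      star = \<lambda>S. null_class P p (\<lambda>k. star P (rep S k)),
      cnorm = \<lambda>S. lim (\<lambda>k. p (rep S k))\<rparr>"

text \<open>
  The largest C*-seminorm on \<open>P\<close> that vanishes on the relations \<open>R\<close>. It is only used where the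
  set on the right-hand side is bounded above. With \<open>R = {}\<close> it is the enveloping C*-seminorm.
\<close>

definition universal_seminorm ::
    "('a, 'm) star_alg_scheme \<Rightarrow> 'a set \<Rightarrow> 'a \<Rightarrow> real" where
  "universal_seminorm P R x = Sup {p x | p. cstar_seminorm P p \<and> (\<forall>r \<in> R. p r = 0)}"

definition universal_cstar ::
    "('a, 'm) star_alg_scheme \<Rightarrow> 'a set \<Rightarrow> (nat \<Rightarrow> 'a) set cstar" where
  "universal_cstar P R = completion P (universal_seminorm P R)"

definition universal_map ::
    "('a, 'm) star_alg_scheme \<Rightarrow> 'a set \<Rightarrow> 'a \<Rightarrow> (nat \<Rightarrow> 'a) set" where
  "universal_map P R x = null_class P (universal_seminorm P R) (\<lambda>_. x)"

text \<open>The *-algebra of a monoid \<open>M\<close> with an involutive anti-automorphism \<open>s\<close>.\<close>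

definition supp :: "('a \<Rightarrow> complex) \<Rightarrow> 'a set" where
  "supp f = {x. f x \<noteq> 0}"

definition delta :: "'a \<Rightarrow> 'a \<Rightarrow> complex" where
  "delta x = (\<lambda>y. if y = x then 1 else 0)"

definition monoid_star_alg ::
    "('a, 'm) monoid_scheme \<Rightarrow> ('a \<Rightarrow> 'a) \<Rightarrow> ('a \<Rightarrow> complex) star_alg" where
  "monoid_star_alg M s =
     \<lparr>carrier = {f. finite (supp f) \<and> supp f \<subseteq> carrier M},
      mult = \<lambda>f g z. \<Sum>x \<in> supp f. \<Sum>y \<in> supp g. if x \<otimes>\<^bsub>M\<^esub> y = z then f x * g y else 0,
      one = delta \<one>\<^bsub>M\<^esub>,
      zero = \<lambda>_. 0,
      add = \<lambda>f g z. f z + g z,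
      smult = \<lambda>c f z. c * f z,
      star = \<lambda>f z. \<Sum>x \<in> supp f. if s x = z then cnj (f x) else 0\<rparr>"


section \<open>Maximal tensor products\<close>

type_synonym ('a, 'b) tens = "(nat \<Rightarrow> 'a \<times> 'b \<Rightarrow> complex) set"

text \<open>
  The algebraic tensor product of \<open>A\<close> and \<open>B\<close> is the *-algebra of formal linear combinations
  of pairs \<open>(a, b)\<close> modulo the bilinearity relations; the maximal tensor product is
  its enveloping C*-algebra.
\<close>

definition pair_alg ::
    "('a, 'm) star_alg_scheme \<Rightarrow> ('b, 'n) star_alg_scheme \<Rightarrow> ('a \<times> 'b \<Rightarrow> complex) star_alg" where
  "pair_alg A B = monoid_star_alg (A \<times>\<times> B) (\<lambda>(a, b). (star A a, star B b))"

definition bilinear_relations ::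
    "('a, 'm) star_alg_scheme \<Rightarrow> ('b, 'n) star_alg_scheme \<Rightarrow> ('a \<times> 'b \<Rightarrow> complex) set" where
  "bilinear_relations A B =
     (let P = pair_alg A B in
      {delta (a \<oplus>\<^bsub>A\<^esub> a', b) \<ominus>\<^bsub>P\<^esub> (delta (a, b) \<oplus>\<^bsub>P\<^esub> delta (a', b)) | a a' b.
         a \<in> carrier A \<and> a' \<in> carrier A \<and> b \<in> carrier B} \<union>
      {delta (a, b \<oplus>\<^bsub>B\<^esub> b') \<ominus>\<^bsub>P\<^esub> (delta (a, b) \<oplus>\<^bsub>P\<^esub> delta (a, b')) | a b b'.
         a \<in> carrier A \<and> b \<in> carrier B \<and> b' \<in> carrier B} \<union>
      {delta (c \<odot>\<^bsub>A\<^esub> a, b) \<ominus>\<^bsub>P\<^esub> c \<odot>\<^bsub>P\<^esub> delta (a, b) | c a b.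
         a \<in> carrier A \<and> b \<in> carrier B} \<union>
      {delta (a, c \<odot>\<^bsub>B\<^esub> b) \<ominus>\<^bsub>P\<^esub> c \<odot>\<^bsub>P\<^esub> delta (a, b) | c a b.
         a \<in> carrier A \<and> b \<in> carrier B})"

definition max_tensor ::
    "('a, 'm) cstar_scheme \<Rightarrow> ('b, 'n) cstar_scheme \<Rightarrow> ('a, 'b) tens cstar" where
  "max_tensor A B = universal_cstar (pair_alg A B) (bilinear_relations A B)"

definition tensor_elem ::
    "('a, 'm) cstar_scheme \<Rightarrow> ('b, 'n) cstar_scheme \<Rightarrow> 'a \<Rightarrow> 'b \<Rightarrow> ('a, 'b) tens" where
  "tensor_elem A B a b = universal_map (pair_alg A B) (bilinear_relations A B) (delta (a, b))"

text \<open>The morphism \<open>A \<otimes> B \<rightarrow> D\<close> with prescribed values \<open>F a b\<close> on elementary tensors.\<close>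

definition tensor_ext ::
    "('a, 'm) cstar_scheme \<Rightarrow> ('b, 'n) cstar_scheme \<Rightarrow> ('d, 'k) cstar_scheme \<Rightarrow>
     ('a \<Rightarrow> 'b \<Rightarrow> 'd) \<Rightarrow> ('a, 'b) tens \<Rightarrow> 'd" where
  "tensor_ext A B D F = (THE h. h \<in> star_hom (max_tensor A B) D \<and>
     h \<in> extensional (carrier (max_tensor A B)) \<and>
     (\<forall>a \<in> carrier A. \<forall>b \<in> carrier B. h (tensor_elem A B a b) = F a b))"

definition tensor_map ::
    "('a, 'm) cstar_scheme \<Rightarrow> ('b, 'n) cstar_scheme \<Rightarrow>
     ('c, 'k) cstar_scheme \<Rightarrow> ('d, 'l) cstar_scheme \<Rightarrow>
     ('a \<Rightarrow> 'c) \<Rightarrow> ('b \<Rightarrow> 'd) \<Rightarrow> ('a, 'b) tens \<Rightarrow> ('c, 'd) tens" where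
  "tensor_map A B C D f g =
     tensor_ext A B (max_tensor C D) (\<lambda>a b. tensor_elem C D (f a) (g b))"

text \<open>The isomorphism \<open>(A \<otimes> A) \<otimes> (B \<otimes> B) \<rightarrow> (A \<otimes> B) \<otimes> (A \<otimes> B)\<close> exchanging the middle factors.\<close>

definition middle_swap ::
    "('a, 'm) cstar_scheme \<Rightarrow> ('b, 'n) cstar_scheme \<Rightarrow>
     (('a, 'a) tens, ('b, 'b) tens) tens \<Rightarrow> (('a, 'b) tens, ('a, 'b) tens) tens" where
  "middle_swap A B =
     (let AA = max_tensor A A; BB = max_tensor B B; AB = max_tensor A B in
      THE h. h \<in> star_hom (max_tensor AA BB) (max_tensor AB AB) \<and>
        h \<in> extensional (carrier (max_tensor AA BB)) \<and>
        (\<forall>a \<in> carrier A. \<forall>a' \<in> carrier A. \<forall>b \<in> carrier B. \<forall>b' \<in> carrier B.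
           h (tensor_elem AA BB (tensor_elem A A a a') (tensor_elem B B b b')) =
           tensor_elem AB AB (tensor_elem A B a b) (tensor_elem A B a' b')))"


section \<open>Magic unitaries and quantum permutation algebras\<close>

definition projection :: "('a, 'm) star_alg_scheme \<Rightarrow> 'a \<Rightarrow> bool" where
  "projection A p \<longleftrightarrow> p \<in> carrier A \<and> star A p = p \<and> p \<otimes>\<^bsub>A\<^esub> p = p"

text \<open>Matrix indices run over \<open>{..<n}\<close>.\<close>

definition magic_unitary ::
    "('a, 'm) star_alg_scheme \<Rightarrow> nat \<Rightarrow> (nat \<Rightarrow> nat \<Rightarrow> 'a) \<Rightarrow> bool" where
  "magic_unitary A n u \<longleftrightarrow>
     (\<forall>i < n. \<forall>j < n. projection A (u i j)) \<and>
     (\<forall>i < n. \<forall>j < n. \<forall>k < n. j \<noteq> k \<longrightarrow>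
        u i j \<otimes>\<^bsub>A\<^esub> u i k = \<zero>\<^bsub>A\<^esub> \<and> u j i \<otimes>\<^bsub>A\<^esub> u k i = \<zero>\<^bsub>A\<^esub>) \<and>
     (\<forall>i < n. (\<Oplus>\<^bsub>A\<^esub>j \<in> {..<n}. u i j) = \<one>\<^bsub>A\<^esub> \<and> (\<Oplus>\<^bsub>A\<^esub>j \<in> {..<n}. u j i) = \<one>\<^bsub>A\<^esub>)"

definition entries :: "nat \<Rightarrow> (nat \<Rightarrow> nat \<Rightarrow> 'a) \<Rightarrow> 'a set" where
  "entries n u = {u i j | i j. i < n \<and> j < n}"

text \<open>
  The free unital *-algebra on a set \<open>G\<close>: words in letters \<open>(g, False)\<close>, standing for \<open>g\<close>, and
  \<open>(g, True)\<close>, standing for the adjoint of \<open>g\<close>.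
\<close>

definition free_star_alg :: "'g set \<Rightarrow> (('g \<times> bool) list \<Rightarrow> complex) star_alg" where
  "free_star_alg G =
     monoid_star_alg \<lparr>carrier = lists (G \<times> UNIV), mult = (@), one = []\<rparr>
       (\<lambda>w. rev (map (\<lambda>(g, b). (g, \<not> b)) w))"

definition free_gen :: "'g \<Rightarrow> ('g \<times> bool) list \<Rightarrow> complex" where
  "free_gen g = delta [(g, False)]"

type_synonym qp_word = "((nat \<times> nat) \<times> bool) list"

definition magic_relations :: "nat \<Rightarrow> (qp_word \<Rightarrow> complex) set" where
  "magic_relations n =
     (let P = free_star_alg ({..<n} \<times> {..<n}); x = (\<lambda>i j. free_gen (i, j)) in
      {star P (x i j) \<ominus>\<^bsub>P\<^esub> x i j | i j. i < n \<and> j < n} \<union>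
      {x i j \<otimes>\<^bsub>P\<^esub> x i j \<ominus>\<^bsub>P\<^esub> x i j | i j. i < n \<and> j < n} \<union>
      {x i j \<otimes>\<^bsub>P\<^esub> x i k | i j k. i < n \<and> j < n \<and> k < n \<and> j \<noteq> k} \<union>
      {x j i \<otimes>\<^bsub>P\<^esub> x k i | i j k. i < n \<and> j < n \<and> k < n \<and> j \<noteq> k} \<union>
      {(\<Oplus>\<^bsub>P\<^esub>j \<in> {..<n}. x i j) \<ominus>\<^bsub>P\<^esub> \<one>\<^bsub>P\<^esub> | i. i < n} \<union>
      {(\<Oplus>\<^bsub>P\<^esub>j \<in> {..<n}. x j i) \<ominus>\<^bsub>P\<^esub> \<one>\<^bsub>P\<^esub> | i. i < n})"

definition A_s :: "nat \<Rightarrow> (nat \<Rightarrow> qp_word \<Rightarrow> complex) set cstar" where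
  "A_s n = universal_cstar (free_star_alg ({..<n} \<times> {..<n})) (magic_relations n)"

definition A_s_gen :: "nat \<Rightarrow> nat \<Rightarrow> nat \<Rightarrow> (nat \<Rightarrow> qp_word \<Rightarrow> complex) set" where
  "A_s_gen n i j =
     universal_map (free_star_alg ({..<n} \<times> {..<n})) (magic_relations n) (free_gen (i, j))"

record 'a hopf_cstar = "'a cstar" +
  comult :: "'a \<Rightarrow> ('a, 'a) tens"
  counit :: "'a \<Rightarrow> complex"
  antipode :: "'a \<Rightarrow> 'a"

text \<open>
  \<open>A\<close> is full: its norm restricts to the enveloping C*-seminorm of the *-algebra
  generated by the entries of \<open>u\<close>, which is dense in \<open>A\<close> by \<open>generates_cstar\<close>.
\<close>

definition full_on :: "('a, 'm) cstar_scheme \<Rightarrow> nat \<Rightarrow> (nat \<Rightarrow> nat \<Rightarrow> 'a) \<Rightarrow> bool" where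
  "full_on A n u \<longleftrightarrow> (\<forall>x \<in> star_gen A (entries n u).
     cnorm A x = universal_seminorm (A\<lparr>carrier := star_gen A (entries n u)\<rparr>) {} x)"

definition quantum_permutation_algebra ::
    "nat \<Rightarrow> ('a, 'm) hopf_cstar_scheme \<Rightarrow> (nat \<Rightarrow> nat \<Rightarrow> 'a) \<Rightarrow> bool" where
  "quantum_permutation_algebra n A u \<longleftrightarrow>
     cstar_algebra A \<and> magic_unitary A n u \<and> generates_cstar A (entries n u) \<and> full_on A n u \<and>
     comult A \<in> star_hom A (max_tensor A A) \<and>
     counit A \<in> star_hom A complex_cstar \<and>
     antipode A \<in> star_hom A (opposite A) \<and>
     (\<forall>i < n. \<forall>j < n.
        comult A (u i j) =
          (\<Oplus>\<^bsub>max_tensor A A\<^esub>k \<in> {..<n}. tensor_elem A A (u i k) (u k j)) \<and>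
        counit A (u i j) = (if i = j then 1 else 0) \<and>
        antipode A (u i j) = u j i)"


section \<open>Quotients and tensor products of Hopf C*-algebras\<close>

definition hopf_quotient ::
    "('a, 'm) hopf_cstar_scheme \<Rightarrow> ('b, 'n) hopf_cstar_scheme \<Rightarrow> bool" where
  "hopf_quotient A C \<longleftrightarrow> (\<exists>\<phi> \<in> star_hom A C. \<phi> ` carrier A = carrier C \<and>
     (\<forall>x \<in> carrier A.
        comult C (\<phi> x) = tensor_map A A C C \<phi> \<phi> (comult A x) \<and>
        counit C (\<phi> x) = counit A x \<and>
        antipode C (\<phi> x) = \<phi> (antipode A x)))"

definition hopf_tensor ::
    "('a, 'm) hopf_cstar_scheme \<Rightarrow> ('b, 'n) hopf_cstar_scheme \<Rightarrow> ('a, 'b) tens hopf_cstar" where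
  "hopf_tensor A B =
     cstar.extend (max_tensor A B)
       (hopf_cstar.fields
         (\<lambda>z. middle_swap A B
            (tensor_map A B (max_tensor A A) (max_tensor B B) (comult A) (comult B) z))
         (tensor_ext A B complex_cstar (\<lambda>a b. counit A a * counit B b))
         (tensor_ext A B (opposite (max_tensor A B))
            (\<lambda>a b. tensor_elem A B (antipode A a) (antipode B b))))"


section \<open>Hopf images\<close>

text \<open>\<open>\<pi>\<close> factors as \<open>A_s n \<rightarrow> A \<rightarrow> D\<close>, the first map sending generators to generators.\<close>

definition factorizes ::
    "nat \<Rightarrow> ('d, 'k) cstar_scheme \<Rightarrow> ((nat \<Rightarrow> qp_word \<Rightarrow> complex) set \<Rightarrow> 'd) \<Rightarrow>
     ('a, 'm) cstar_scheme \<Rightarrow> (nat \<Rightarrow> nat \<Rightarrow> 'a) \<Rightarrow> bool" where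
  "factorizes n D \<pi> A u \<longleftrightarrow>
     (\<exists>\<sigma> \<in> star_hom (A_s n) A. \<exists>\<rho> \<in> star_hom A D.
        (\<forall>i < n. \<forall>j < n. \<sigma> (A_s_gen n i j) = u i j) \<and>
        (\<forall>x \<in> carrier (A_s n). \<pi> x = \<rho> (\<sigma> x)))"

text \<open>
  Minimality refers to all quantum permutation algebras. These are separable, hence have
  at most continuum many elements, so each of them is isomorphic to one with carrier
  contained in the type \<open>nat set\<close>; it is therefore enough to quantify over that type.
\<close>

definition hopf_image ::
    "nat \<Rightarrow> ('d, 'k) cstar_scheme \<Rightarrow> ((nat \<Rightarrow> qp_word \<Rightarrow> complex) set \<Rightarrow> 'd) \<Rightarrow>
     ('a, 'm) hopf_cstar_scheme \<Rightarrow> (nat \<Rightarrow> nat \<Rightarrow> 'a) \<Rightarrow> bool" where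
  "hopf_image n D \<pi> A u \<longleftrightarrow>
     quantum_permutation_algebra n A u \<and> factorizes n D \<pi> A u \<and>
     (\<forall>(A' :: nat set hopf_cstar) u'.
        quantum_permutation_algebra n A' u' \<and> factorizes n D \<pi> A' u' \<longrightarrow>
        (\<exists>\<theta> \<in> star_hom A' A. \<theta> ` carrier A' = carrier A \<and>
           (\<forall>i < n. \<forall>j < n. \<theta> (u' i j) = u i j)))"

text \<open>The representation \<open>\<pi>\<close> of \<open>A_s n\<close> given by a magic unitary \<open>U\<close> over \<open>D\<close> is unique.\<close>

definition hopf_image_for ::
    "nat \<Rightarrow> ('d, 'k) cstar_scheme \<Rightarrow> (nat \<Rightarrow> nat \<Rightarrow> 'd) \<Rightarrow>
     ('a, 'm) hopf_cstar_scheme \<Rightarrow> (nat \<Rightarrow> nat \<Rightarrow> 'a) \<Rightarrow> bool" where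
  "hopf_image_for n D U A u \<longleftrightarrow>
     (\<exists>\<pi> \<in> star_hom (A_s n) D.
        (\<forall>i < n. \<forall>j < n. \<pi> (A_s_gen n i j) = U i j) \<and> hopf_image n D \<pi> A u)"


section \<open>Hilbert spaces and bounded operators\<close>

text \<open>Complex Hilbert spaces; the inner product is linear in the first argument.\<close>

class chilbert_space = banach +
  fixes scaleC :: "complex \<Rightarrow> 'a \<Rightarrow> 'a"
    and cinner :: "'a \<Rightarrow> 'a \<Rightarrow> complex"
  assumes scaleC_of_real: "scaleC (complex_of_real r) x = scaleR r x"
    and scaleC_add_right: "scaleC c (x + y) = scaleC c x + scaleC c y"
    and scaleC_add_left: "scaleC (c + d) x = scaleC c x + scaleC d x"
    and scaleC_scaleC: "scaleC c (scaleC d x) = scaleC (c * d) x"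
    and cinner_commute: "cinner x y = cnj (cinner y x)"
    and cinner_add_left: "cinner (x + y) z = cinner x z + cinner y z"
    and cinner_scaleC_left: "cinner (scaleC c x) y = c * cinner x y"
    and cinner_self: "cinner x x = complex_of_real ((norm x)\<^sup>2)"

instantiation complex :: chilbert_space
begin
definition scaleC_complex :: "complex \<Rightarrow> complex \<Rightarrow> complex" where "scaleC_complex = (*)"
definition cinner_complex :: "complex \<Rightarrow> complex \<Rightarrow> complex" where "cinner_complex x y = x * cnj y"
instance
proof
  fix x :: complex
  show "cinner x x = complex_of_real ((norm x)\<^sup>2)"
    by (simp only: cinner_complex_def complex_norm_square)
qed (simp_all add: scaleC_complex_def cinner_complex_def scaleR_conv_of_real ring_distribs)
end

text \<open>Elements of \<open>'h \<Rightarrow>\<^sub>L 'h\<close> are real-linear, so the carrier selects the complex-linear ones.\<close>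

definition adjoint_op :: "('h :: chilbert_space \<Rightarrow>\<^sub>L 'h) \<Rightarrow> 'h \<Rightarrow>\<^sub>L 'h" where
  "adjoint_op T = (THE S. \<forall>x y. cinner (blinfun_apply T x) y = cinner x (blinfun_apply S y))"

definition bounded_ops :: "('h :: chilbert_space \<Rightarrow>\<^sub>L 'h) cstar" where
  "bounded_ops =
     \<lparr>carrier = {T. \<forall>c x. blinfun_apply T (scaleC c x) = scaleC c (blinfun_apply T x)},
      mult = (o\<^sub>L), one = id_blinfun, zero = 0, add = (+),
      smult = \<lambda>c T. Blinfun (\<lambda>x. scaleC c (blinfun_apply T x)),
      star = adjoint_op, cnorm = norm\<rparr>"

text \<open>
  The Hilbert space \<open>'l\<close> together with \<open>t\<close> is a Hilbert space tensor product of \<open>'h\<close> and \<open>'k\<close>;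
  this determines it up to a unique unitary. Since the elementary tensors are closed under
  complex scalars, their real \<open>span\<close> is also their complex span.
\<close>

definition hilbert_tensor ::
    "('h :: chilbert_space \<Rightarrow> 'k :: chilbert_space \<Rightarrow> 'l :: chilbert_space) \<Rightarrow> bool" where
  "hilbert_tensor t \<longleftrightarrow>
     (\<forall>x x' y. t (x + x') y = t x y + t x' y) \<and>
     (\<forall>x y y'. t x (y + y') = t x y + t x y') \<and>
     (\<forall>c x y. t (scaleC c x) y = scaleC c (t x y) \<and> t x (scaleC c y) = scaleC c (t x y)) \<and>
     (\<forall>x x' y y'. cinner (t x y) (t x' y') = cinner x x' * cinner y y') \<and>
     closure (span {t x y | x y. True}) = UNIV"

definition op_tensor ::
    "('h :: chilbert_space \<Rightarrow> 'k :: chilbert_space \<Rightarrow> 'l :: chilbert_space) \<Rightarrow>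
     ('h \<Rightarrow>\<^sub>L 'h) \<Rightarrow> ('k \<Rightarrow>\<^sub>L 'k) \<Rightarrow> 'l \<Rightarrow>\<^sub>L 'l" where
  "op_tensor t S T = (THE W. \<forall>x y. blinfun_apply W (t x y) =
     t (blinfun_apply S x) (blinfun_apply T y))"

text \<open>
  The \<open>n m \<times> n m\<close> matrix \<open>W\<^bsub>ia,jb\<^esub> = U\<^bsub>ij\<^esub> \<otimes> V\<^bsub>ab\<^esub>\<close>, the pair \<open>(i, a)\<close> with \<open>i < n\<close>, \<open>a < m\<close>
  being encoded as \<open>i * m + a\<close>.
\<close>

definition magic_tensor ::
    "('h :: chilbert_space \<Rightarrow> 'k :: chilbert_space \<Rightarrow> 'l :: chilbert_space) \<Rightarrow> nat \<Rightarrow>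
     (nat \<Rightarrow> nat \<Rightarrow> 'h \<Rightarrow>\<^sub>L 'h) \<Rightarrow> (nat \<Rightarrow> nat \<Rightarrow> 'k \<Rightarrow>\<^sub>L 'k) \<Rightarrow> nat \<Rightarrow> nat \<Rightarrow> 'l \<Rightarrow>\<^sub>L 'l" where
  "magic_tensor t m U V p q =
     op_tensor t (U (p div m) (q div m)) (V (p mod m) (q mod m))"

end

theory Submission
  imports Defs
begin

text \<open>
  The maximal tensor product \<open>A \<otimes> B\<close> with the magic unitary \<open>W\<^bsub>ia,jb\<^esub> = u\<^bsub>ij\<^esub> \<otimes> v\<^bsub>ab\<^esub>\<close> is itself a quantum
  permutation algebra: summing over a row of \<open>v\<close> or of \<open>u\<close> recovers the generators \<open>u\<^bsub>ij\<^esub> \<otimes> 1\<close> and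
  \<open>1 \<otimes> v\<^bsub>ab\<^esub>\<close>, and the universal property of \<open>\<otimes>\<close> provides the comultiplication, the counit and the
  antipode. The representation given by \<open>U \<otimes> V\<close> factors through \<open>A \<otimes> B\<close>, because \<open>A\<close> and \<open>B\<close> act by
  commuting operators on \<open>H \<otimes> K\<close>. Hence the minimality of the Hopf image \<open>C\<close> yields a surjection
  \<open>A \<otimes> B \<rightarrow> C\<close>, which respects the Hopf structure since it does so on generators.

  Minimality is only available against algebras whose carrier consists of sets of natural numbers, so
  \<open>A \<otimes> B\<close> has to be transported to such a carrier; this is possible because it is separable.
\<close>

section \<open>Star algebras and C*-seminorms\<close>

text \<open>Norm estimates come from one device rather than from spectral theory: commuting
  self-adjoint \<open>c\<close> and \<open>s\<close> with \<open>c^2 + s^2 = 1\<close> have size at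
  most 1 under every C*-seminorm, because \<open>c + \<i> s\<close> is unitary. With square roots
  supplied by Banach's fixed point theorem it yields the contractivity of morphisms, the bounded
  lifting that makes dense images complete, and the decomposition into isometries from which
  \<open>S \<otimes> T\<close> is built on a Hilbert space tensor product. Completeness of
  \<open>A\<close>, \<open>B\<close> and \<open>C\<close> is obtained from the morphisms that they
  receive from \<open>A_s\<close>. The delicate clause is fullness of the tensor product: a
  C*-seminorm on the algebra of entries is completed, fullness of \<open>A\<close> and
  \<open>B\<close> sends both into the completion, their images commute, and the maximality of the
  tensor norm combines them into one contraction.\<close>

lemma complex_ring_simps [simp]:
  "carrier complex_ring = UNIV" "mult complex_ring = (*)" "one complex_ring = 1"
  "zero complex_ring = 0" "add complex_ring = (+)"
  by (simp_all add: complex_ring_def)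

lemma cring_complex_ring: "cring complex_ring"
  by unfold_locales
     (auto simp: algebra_simps Units_def intro: exI[of _ "- _"] add.left_inverse add.right_inverse)

text \<open>Additive inverses are not among the premises: \<open>(-1) \<odot> x\<close> is one, by
  \<open>smult_add_left\<close>, \<open>smult_one\<close> and \<open>smult_zero\<close>.\<close>

lemma star_algebraI:
  fixes A (structure)
  assumes add_closed: "\<And>x y. x \<in> carrier A \<Longrightarrow> y \<in> carrier A \<Longrightarrow> x \<oplus> y \<in> carrier A"
    and zero_closed: "\<zero> \<in> carrier A"
    and add_assoc: "\<And>x y z. x \<in> carrier A \<Longrightarrow> y \<in> carrier A \<Longrightarrow> z \<in> carrier A \<Longrightarrow>
      (x \<oplus> y) \<oplus> z = x \<oplus> (y \<oplus> z)"
    and add_comm: "\<And>x y. x \<in> carrier A \<Longrightarrow> y \<in> carrier A \<Longrightarrow> x \<oplus> y = y \<oplus> x"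
    and zero_add: "\<And>x. x \<in> carrier A \<Longrightarrow> \<zero> \<oplus> x = x"
    and mult_closed: "\<And>x y. x \<in> carrier A \<Longrightarrow> y \<in> carrier A \<Longrightarrow> x \<otimes> y \<in> carrier A"
    and one_closed: "\<one> \<in> carrier A"
    and mult_assoc: "\<And>x y z. x \<in> carrier A \<Longrightarrow> y \<in> carrier A \<Longrightarrow> z \<in> carrier A \<Longrightarrow>
      (x \<otimes> y) \<otimes> z = x \<otimes> (y \<otimes> z)"
    and one_mult: "\<And>x. x \<in> carrier A \<Longrightarrow> \<one> \<otimes> x = x"
    and mult_one: "\<And>x. x \<in> carrier A \<Longrightarrow> x \<otimes> \<one> = x"
    and l_distr: "\<And>x y z. x \<in> carrier A \<Longrightarrow> y \<in> carrier A \<Longrightarrow> z \<in> carrier A \<Longrightarrow>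
      (x \<oplus> y) \<otimes> z = x \<otimes> z \<oplus> y \<otimes> z"
    and r_distr: "\<And>x y z. x \<in> carrier A \<Longrightarrow> y \<in> carrier A \<Longrightarrow> z \<in> carrier A \<Longrightarrow>
      z \<otimes> (x \<oplus> y) = z \<otimes> x \<oplus> z \<otimes> y"
    and smult_closed: "\<And>c x. x \<in> carrier A \<Longrightarrow> c \<odot> x \<in> carrier A"
    and smult_add_left: "\<And>c d x. x \<in> carrier A \<Longrightarrow> (c + d) \<odot> x = c \<odot> x \<oplus> d \<odot> x"
    and smult_add_right: "\<And>c x y. x \<in> carrier A \<Longrightarrow> y \<in> carrier A \<Longrightarrow> c \<odot> (x \<oplus> y) = c \<odot> x \<oplus> c \<odot> y"
    and smult_smult: "\<And>c d x. x \<in> carrier A \<Longrightarrow> (c * d) \<odot> x = c \<odot> (d \<odot> x)"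
    and smult_one: "\<And>x. x \<in> carrier A \<Longrightarrow> 1 \<odot> x = x"
    and smult_zero: "\<And>x. x \<in> carrier A \<Longrightarrow> 0 \<odot> x = \<zero>"
    and smult_mult_left: "\<And>c x y. x \<in> carrier A \<Longrightarrow> y \<in> carrier A \<Longrightarrow> (c \<odot> x) \<otimes> y = c \<odot> (x \<otimes> y)"
    and smult_mult_right: "\<And>c x y. x \<in> carrier A \<Longrightarrow> y \<in> carrier A \<Longrightarrow> x \<otimes> (c \<odot> y) = c \<odot> (x \<otimes> y)"
    and star_closed: "\<And>x. x \<in> carrier A \<Longrightarrow> star A x \<in> carrier A"
    and star_star: "\<And>x. x \<in> carrier A \<Longrightarrow> star A (star A x) = x"
    and star_add: "\<And>x y. x \<in> carrier A \<Longrightarrow> y \<in> carrier A \<Longrightarrow> star A (x \<oplus> y) = star A x \<oplus> star A y"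
    and star_mult: "\<And>x y. x \<in> carrier A \<Longrightarrow> y \<in> carrier A \<Longrightarrow> star A (x \<otimes> y) = star A y \<otimes> star A x"
    and star_smult: "\<And>c x. x \<in> carrier A \<Longrightarrow> star A (c \<odot> x) = cnj c \<odot> star A x"
  shows "star_algebra A"
proof -
  have inv: "\<exists>y \<in> carrier A. y \<oplus> x = \<zero>" if "x \<in> carrier A" for x
  proof
    show "(-1) \<odot> x \<oplus> x = \<zero>"
      using smult_add_left[of x "-1" 1] smult_one smult_zero that by simp
  qed (use smult_closed that in blast)
  have "abelian_group A"
    by (rule abelian_groupI) (use assms inv in auto)
  moreover from this have "ring A"
    by (intro ringI monoidI) (use assms in auto)
  moreover have "module complex_ring A"
    by (intro moduleI cring_complex_ring \<open>abelian_group A\<close>) (use assms in auto)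
  ultimately show ?thesis
    by (intro star_algebra.intro star_algebra_axioms.intro) (use assms in auto)
qed

context star_algebra
begin

text \<open>The facts of \<open>cring complex_ring\<close>, inherited through \<open>module\<close>, shadow those of \<open>ring A\<close>, which are
  therefore named anew.\<close>

lemma ring_A: "ring A"
  using star_algebra_axioms by (rule star_algebra.axioms)

lemma abelian_group_A: "abelian_group A"
  using ring_A by (rule ring.axioms)

lemma abelian_monoid_A: "abelian_monoid A"
  using abelian_group_A by (rule abelian_group.axioms)

lemmas a_closed = abelian_monoid.a_closed[OF abelian_monoid_A]
lemmas zero_closed = abelian_monoid.zero_closed[OF abelian_monoid_A]
lemmas a_inv_closed = abelian_group.a_inv_closed[OF abelian_group_A]
lemmas m_closed = ring.ring_simprules(5)[OF ring_A]
lemmas one_closed = ring.ring_simprules(6)[OF ring_A]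
lemmas a_assoc = abelian_monoid.a_assoc[OF abelian_monoid_A]
lemmas a_comm = abelian_monoid.a_comm[OF abelian_monoid_A]
lemmas a_lcomm = abelian_monoid.a_lcomm[OF abelian_monoid_A]
lemmas a_ac = a_assoc a_comm a_lcomm
lemmas r_neg = abelian_group.r_neg[OF abelian_group_A]
lemmas l_neg = abelian_group.l_neg[OF abelian_group_A]
lemmas r_neg1 = abelian_group.r_neg1[OF abelian_group_A]
lemmas r_neg2 = abelian_group.r_neg2[OF abelian_group_A]
lemmas minus_add = abelian_group.minus_add[OF abelian_group_A]
lemmas minus_equality = abelian_group.minus_equality[OF abelian_group_A]
lemmas l_distr = ring.ring_simprules(13)[OF ring_A]
lemmas r_distr = ring.ring_simprules(23)[OF ring_A]
lemmas l_minus = ring.l_minus[OF ring_A]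
lemmas r_minus = ring.r_minus[OF ring_A]
lemmas m_assoc = ring.ring_simprules(11)[OF ring_A]
lemmas l_one = ring.ring_simprules(12)[OF ring_A]
lemmas finsum_infinite = abelian_monoid.finsum_infinite[OF abelian_monoid_A]

lemma smult_closed' [simp, intro]: "x \<in> carrier A \<Longrightarrow> c \<odot> x \<in> carrier A"
  using smult_closed[of c x] by simp

lemma smult_add_left: "x \<in> carrier A \<Longrightarrow> (c + d) \<odot> x = c \<odot> x \<oplus> d \<odot> x"
  using smult_l_distr[of c d x] by simp

lemma smult_add_right: "x \<in> carrier A \<Longrightarrow> y \<in> carrier A \<Longrightarrow> c \<odot> (x \<oplus> y) = c \<odot> x \<oplus> c \<odot> y"
  using smult_r_distr[of c x y] by simp

lemma smult_smult: "x \<in> carrier A \<Longrightarrow> c \<odot> (d \<odot> x) = (c * d) \<odot> x"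
  using smult_assoc1[of c d x] by simp

lemma smult_1 [simp]: "x \<in> carrier A \<Longrightarrow> 1 \<odot> x = x"
  using smult_one[of x] by simp

lemma smult_0 [simp]: "x \<in> carrier A \<Longrightarrow> 0 \<odot> x = \<zero>"
  using smult_l_null[of x] by simp

lemma smult_cancel: "x \<in> carrier A \<Longrightarrow> c + d = 0 \<Longrightarrow> c \<odot> x \<oplus> d \<odot> x = \<zero>"
  using smult_add_left[of x c d] by simp

lemma smult_zero_right [simp]: "c \<odot> \<zero> = \<zero>"
  using smult_r_null[of c] by simp

declare star_closed [simp, intro] star_star [simp]

lemma uminus_eq_smult: "x \<in> carrier A \<Longrightarrow> \<ominus> x = (-1) \<odot> x"
  using smult_add_left[of x "-1" 1] by (intro minus_equality) simp_all

lemma minus_eq_smult: "x \<in> carrier A \<Longrightarrow> y \<in> carrier A \<Longrightarrow> x \<ominus> y = x \<oplus> (-1) \<odot> y"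
  by (simp add: a_minus_def uminus_eq_smult)

lemma star_zero [simp]: "star A \<zero> = \<zero>"
  using star_smult[of \<zero> 0] by simp

lemma star_one [simp]: "star A \<one> = \<one>"
proof -
  have "star A (star A \<one>) = star A (star A \<one>) \<otimes> star A \<one>"
    using star_mult[of \<one> "star A \<one>"] by simp
  then show ?thesis by simp
qed

lemma star_minus: "x \<in> carrier A \<Longrightarrow> y \<in> carrier A \<Longrightarrow> star A (x \<ominus> y) = star A x \<ominus> star A y"
  by (simp add: minus_eq_smult star_add star_smult)

lemma minus_add_minus:
  "x \<in> carrier A \<Longrightarrow> y \<in> carrier A \<Longrightarrow> z \<in> carrier A \<Longrightarrow> (x \<ominus> y) \<oplus> (y \<ominus> z) = x \<ominus> z"
  by (simp add: a_minus_def a_assoc r_neg1)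

lemma add_minus_add:
  "x \<in> carrier A \<Longrightarrow> y \<in> carrier A \<Longrightarrow> x' \<in> carrier A \<Longrightarrow> y' \<in> carrier A \<Longrightarrow>
    (x \<oplus> y) \<ominus> (x' \<oplus> y') = (x \<ominus> x') \<oplus> (y \<ominus> y')"
  by (simp add: a_minus_def minus_add a_ac)

lemma smult_minus: "x \<in> carrier A \<Longrightarrow> y \<in> carrier A \<Longrightarrow> c \<odot> (x \<ominus> y) = c \<odot> x \<ominus> c \<odot> y"
  by (simp add: minus_eq_smult smult_add_right smult_smult)

lemma mult_minus_mult:
  assumes "x \<in> carrier A" "y \<in> carrier A" "x' \<in> carrier A" "y' \<in> carrier A"
  shows "x \<otimes> y \<ominus> x' \<otimes> y' = x \<otimes> (y \<ominus> y') \<oplus> (x \<ominus> x') \<otimes> y'"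
proof -
  have "x \<otimes> (y \<ominus> y') = x \<otimes> y \<ominus> x \<otimes> y'" "(x \<ominus> x') \<otimes> y' = x \<otimes> y' \<ominus> x' \<otimes> y'"
    using assms by (simp_all add: a_minus_def l_distr r_distr l_minus r_minus)
  with assms show ?thesis by (simp add: minus_add_minus)
qed

lemma commute_mult:
  assumes "a \<in> carrier A" "y \<in> carrier A" "z \<in> carrier A" "a \<otimes> y = y \<otimes> a" "a \<otimes> z = z \<otimes> a"
  shows "a \<otimes> (y \<otimes> z) = y \<otimes> z \<otimes> a"
proof -
  have "a \<otimes> (y \<otimes> z) = a \<otimes> y \<otimes> z" using assms(1-3) by (simp add: m_assoc)
  also have "\<dots> = y \<otimes> (a \<otimes> z)" unfolding assms(4) using assms(1-3) by (simp add: m_assoc)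
  also have "\<dots> = y \<otimes> z \<otimes> a" unfolding assms(5) using assms(1-3) by (simp add: m_assoc)
  finally show ?thesis .
qed

lemma add_minus_cancel: "x \<in> carrier A \<Longrightarrow> y \<in> carrier A \<Longrightarrow> x \<oplus> (y \<ominus> x) = y"
  by (simp add: a_minus_def a_lcomm[of x y] r_neg)

lemma add_minus_cancel': "x \<in> carrier A \<Longrightarrow> y \<in> carrier A \<Longrightarrow> (x \<oplus> y) \<ominus> x = y"
  by (simp add: a_minus_def a_assoc a_comm[of y] r_neg2)

lemma minus_self [simp]: "x \<in> carrier A \<Longrightarrow> x \<ominus> x = \<zero>"
  by (simp add: a_minus_def r_neg)

lemma minus_zero_right [simp]: "x \<in> carrier A \<Longrightarrow> x \<ominus> \<zero> = x"
  by (simp add: minus_eq_smult)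

lemma minus_eq_zeroD: "x \<in> carrier A \<Longrightarrow> y \<in> carrier A \<Longrightarrow> x \<ominus> y = \<zero> \<Longrightarrow> x = y"
  using minus_add_minus[of x y \<zero>] by simp

lemma minus_swap: "x \<in> carrier A \<Longrightarrow> y \<in> carrier A \<Longrightarrow> y \<ominus> x = (-1) \<odot> (x \<ominus> y)"
  by (simp add: minus_eq_smult smult_add_right smult_smult a_comm)

end

text \<open>Apart from closure, the axioms are equations, so they may be checked in \<open>A\<close>
  after applying the injective \<open>k\<close>. With \<open>k\<close> the identity this handles
  subalgebras, with \<open>k\<close> a bijection it handles transported structures.\<close>

lemma star_algebra_if_inj:
  fixes T :: "('a, 'm) star_alg_scheme" and A :: "('b, 'k) star_alg_scheme"
  assumes A: "star_algebra A"
    and k: "k ` carrier T \<subseteq> carrier A" "inj_on k (carrier T)"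
    and closed: "\<And>x y. x \<in> carrier T \<Longrightarrow> y \<in> carrier T \<Longrightarrow>
        x \<oplus>\<^bsub>T\<^esub> y \<in> carrier T \<and> k (x \<oplus>\<^bsub>T\<^esub> y) = k x \<oplus>\<^bsub>A\<^esub> k y"
      "\<And>x y. x \<in> carrier T \<Longrightarrow> y \<in> carrier T \<Longrightarrow>
        x \<otimes>\<^bsub>T\<^esub> y \<in> carrier T \<and> k (x \<otimes>\<^bsub>T\<^esub> y) = k x \<otimes>\<^bsub>A\<^esub> k y"
      "\<And>c x. x \<in> carrier T \<Longrightarrow> c \<odot>\<^bsub>T\<^esub> x \<in> carrier T \<and> k (c \<odot>\<^bsub>T\<^esub> x) = c \<odot>\<^bsub>A\<^esub> k x"
      "\<And>x. x \<in> carrier T \<Longrightarrow> star T x \<in> carrier T \<and> k (star T x) = star A (k x)"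
      "\<zero>\<^bsub>T\<^esub> \<in> carrier T \<and> k \<zero>\<^bsub>T\<^esub> = \<zero>\<^bsub>A\<^esub>"
      "\<one>\<^bsub>T\<^esub> \<in> carrier T \<and> k \<one>\<^bsub>T\<^esub> = \<one>\<^bsub>A\<^esub>"
  shows "star_algebra T"
proof -
  interpret A: star_algebra A by (fact A)
  have kc [simp]: "x \<in> carrier T \<Longrightarrow> k x \<in> carrier A" for x using k by auto
  note c = closed(1)[THEN conjunct1] closed(2)[THEN conjunct1] closed(3)[THEN conjunct1]
     closed(4)[THEN conjunct1] closed(5)[THEN conjunct1] closed(6)[THEN conjunct1]
  note h = closed(1)[THEN conjunct2] closed(2)[THEN conjunct2] closed(3)[THEN conjunct2]
     closed(4)[THEN conjunct2] closed(5)[THEN conjunct2] closed(6)[THEN conjunct2]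
  note e = inj_onD[OF k(2)]
  show ?thesis
    by (rule star_algebraI; (rule e)?)
       (simp_all add: c h A.a_ac A.m_assoc A.l_distr A.r_distr A.smult_add_left
         A.smult_add_right A.smult_smult A.smult_mult_left A.smult_mult_right
         A.star_add A.star_mult A.star_smult)
qed

lemma star_homI:
  assumes "\<And>x. x \<in> carrier A \<Longrightarrow> f x \<in> carrier D"
    "\<And>x y. x \<in> carrier A \<Longrightarrow> y \<in> carrier A \<Longrightarrow> f (x \<otimes>\<^bsub>A\<^esub> y) = f x \<otimes>\<^bsub>D\<^esub> f y"
    "\<And>x y. x \<in> carrier A \<Longrightarrow> y \<in> carrier A \<Longrightarrow> f (x \<oplus>\<^bsub>A\<^esub> y) = f x \<oplus>\<^bsub>D\<^esub> f y"
    "f \<one>\<^bsub>A\<^esub> = \<one>\<^bsub>D\<^esub>"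
    "\<And>x. x \<in> carrier A \<Longrightarrow> f (star A x) = star D (f x)"
    "\<And>c x. x \<in> carrier A \<Longrightarrow> f (c \<odot>\<^bsub>A\<^esub> x) = c \<odot>\<^bsub>D\<^esub> f x"
  shows "f \<in> star_hom A D"
  using assms by (auto simp: star_hom_def intro!: ring_hom_memI)

lemma star_homD:
  assumes "f \<in> star_hom A D"
  shows "x \<in> carrier A \<Longrightarrow> f x \<in> carrier D"
    "x \<in> carrier A \<Longrightarrow> y \<in> carrier A \<Longrightarrow> f (x \<otimes>\<^bsub>A\<^esub> y) = f x \<otimes>\<^bsub>D\<^esub> f y"
    "x \<in> carrier A \<Longrightarrow> y \<in> carrier A \<Longrightarrow> f (x \<oplus>\<^bsub>A\<^esub> y) = f x \<oplus>\<^bsub>D\<^esub> f y"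
    "f \<one>\<^bsub>A\<^esub> = \<one>\<^bsub>D\<^esub>"
    "x \<in> carrier A \<Longrightarrow> f (star A x) = star D (f x)"
    "x \<in> carrier A \<Longrightarrow> f (c \<odot>\<^bsub>A\<^esub> x) = c \<odot>\<^bsub>D\<^esub> f x"
  using assms ring_hom_memE[of f A D] by (auto simp: star_hom_def)

lemma star_hom_comp:
  "f \<in> star_hom A D \<Longrightarrow> g \<in> star_hom D E \<Longrightarrow> (\<lambda>x. g (f x)) \<in> star_hom A E"
  by (rule star_homI) (simp_all add: star_homD)

lemma star_hom_id: "(\<lambda>x. x) \<in> star_hom A A"
  by (rule star_homI) simp_all

text \<open>\<open>star_hom\<close> constrains a map only on the carrier, so values elsewhere may be
  changed freely, for instance by \<open>restrict\<close>.\<close>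

lemma star_hom_cong:
  assumes "star_algebra A" "f \<in> star_hom A D" "\<And>x. x \<in> carrier A \<Longrightarrow> g x = f x"
  shows "g \<in> star_hom A D"
proof -
  interpret star_algebra A by fact
  show ?thesis by (rule star_homI) (simp_all add: star_homD[OF assms(2)] assms(3))
qed

lemma star_hom_zero:
  assumes "star_algebra A" "star_algebra D" "f \<in> star_hom A D"
  shows "f \<zero>\<^bsub>A\<^esub> = \<zero>\<^bsub>D\<^esub>"
proof -
  interpret A: star_algebra A by fact
  interpret D: star_algebra D by fact
  show ?thesis using star_homD(6)[OF assms(3), of "\<zero>\<^bsub>A\<^esub>" 0] star_homD(1)[OF assms(3), of "\<zero>\<^bsub>A\<^esub>"] by simp
qed

lemma star_hom_minus:
  assumes "star_algebra A" "star_algebra D" "f \<in> star_hom A D" "x \<in> carrier A" "y \<in> carrier A"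
  shows "f (x \<ominus>\<^bsub>A\<^esub> y) = f x \<ominus>\<^bsub>D\<^esub> f y"
proof -
  interpret A: star_algebra A by fact
  interpret D: star_algebra D by fact
  show ?thesis using assms(4,5) 
    by (simp add: A.minus_eq_smult D.minus_eq_smult star_homD[OF assms(3)])
qed

lemma star_hom_finsum:
  assumes "star_algebra A" "star_algebra D" "f \<in> star_hom A D" "\<And>i. i \<in> I \<Longrightarrow> x i \<in> carrier A"
  shows "f (\<Oplus>\<^bsub>A\<^esub>i \<in> I. x i) = (\<Oplus>\<^bsub>D\<^esub>i \<in> I. f (x i))"
proof -
  interpret A: star_algebra A by fact
  interpret D: star_algebra D by fact
  show ?thesis
  proof (cases "finite I")
    case True
    then show ?thesis using assms(4)
      by (induction I)
        (simp_all add: star_hom_zero[OF assms(1-3)] star_homD[OF assms(3)] Pi_iff)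
  next
    case False
    then show ?thesis by (simp add: star_hom_zero[OF assms(1-3)] A.finsum_infinite D.finsum_infinite)
  qed
qed

section \<open>Elementary estimates for a C*-seminorm\<close>

locale seminormed = star_algebra A for A (structure) +
  fixes p :: "'a \<Rightarrow> real"
  assumes sn: "cstar_seminorm A p"
begin

lemma p_nonneg [simp]: "x \<in> carrier A \<Longrightarrow> 0 \<le> p x"
  and p_star_mult: "x \<in> carrier A \<Longrightarrow> p (star A x \<otimes> x) = (p x)\<^sup>2"
  and p_smult: "x \<in> carrier A \<Longrightarrow> p (c \<odot> x) = cmod c * p x"
  and p_add: "x \<in> carrier A \<Longrightarrow> y \<in> carrier A \<Longrightarrow> p (x \<oplus> y) \<le> p x + p y"
  and p_mult: "x \<in> carrier A \<Longrightarrow> y \<in> carrier A \<Longrightarrow> p (x \<otimes> y) \<le> p x * p y"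
  using sn by (auto simp: cstar_seminorm_def)

lemma p_zero [simp]: "p \<zero> = 0"
  using p_smult[of \<zero> 0] by simp

text \<open>Isometry of the adjoint is not part of \<open>cstar_seminorm\<close>. It follows from
  the C*-identity and submultiplicativity: \<open>p x ^ 2\<close> is at most
  \<open>p (star A x) * p x\<close>.\<close>

lemma p_star_le: assumes "x \<in> carrier A" shows "p x \<le> p (star A x)"
proof (cases "p x = 0")
  case False
  then have "p x * p x \<le> p (star A x) * p x"
    using p_star_mult[of x] p_mult[of "star A x" x] assms by (simp add: power2_eq_square)
  with False assms show ?thesis by (simp add: less_le)
qed (use assms in simp)

lemma p_star [simp]: "x \<in> carrier A \<Longrightarrow> p (star A x) = p x"
  using p_star_le[of x] p_star_le[of "star A x"] by simp

text \<open>By the C*-identity \<open>p x\<close> is a root of \<open>r^2 = r\<close>; the bound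
  does not depend on \<open>p\<close>.\<close>

lemma p_projection: assumes "x \<in> carrier A" "star A x = x" "x \<otimes> x = x" shows "p x \<le> 1"
proof -
  have "p x * p x = p x * 1" using p_star_mult[of x] assms by (simp add: power2_eq_square)
  then show ?thesis by (simp only: mult_cancel_left) auto
qed

text \<open>Only an inequality can hold, since \<open>p\<close> may vanish identically.\<close>

lemma p_one: "p \<one> \<le> 1"
  by (rule p_projection) auto

lemma p_minus_commute: "x \<in> carrier A \<Longrightarrow> y \<in> carrier A \<Longrightarrow> p (x \<ominus> y) = p (y \<ominus> x)"
  by (subst minus_swap) (simp_all add: p_smult)

lemma p_triangle: 
  "x \<in> carrier A \<Longrightarrow> y \<in> carrier A \<Longrightarrow> z \<in> carrier A \<Longrightarrow> p (x \<ominus> z) \<le> p (x \<ominus> y) + p (y \<ominus> z)"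
  using p_add[of "x \<ominus> y" "y \<ominus> z"] by (simp add: minus_add_minus)

lemma p_abs_diff: assumes "x \<in> carrier A" "y \<in> carrier A" shows "\<bar>p x - p y\<bar> \<le> p (x \<ominus> y)"
proof -
  show ?thesis
    using p_triangle[of x y \<zero>] p_triangle[of y x \<zero>] assms by (simp add: p_minus_commute[of y x])
qed

lemma p_mult_diff:
  assumes "x \<in> carrier A" "y \<in> carrier A" "x' \<in> carrier A" "y' \<in> carrier A"
  shows "p (x \<otimes> y \<ominus> x' \<otimes> y') \<le> p x * p (y \<ominus> y') + p (x \<ominus> x') * p y'"
  using assms p_mult[of x "y \<ominus> y'"] p_mult[of "x \<ominus> x'" y'] 
    p_add[of "x \<otimes> (y \<ominus> y')" "(x \<ominus> x') \<otimes> y'"]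
  by (simp add: mult_minus_mult)

lemma p_add_diff:
  assumes "x \<in> carrier A" "y \<in> carrier A" "x' \<in> carrier A" "y' \<in> carrier A"
  shows "p ((x \<oplus> y) \<ominus> (x' \<oplus> y')) \<le> p (x \<ominus> x') + p (y \<ominus> y')"
  using assms p_add[of "x \<ominus> x'" "y \<ominus> y'"] by (simp add: add_minus_add)

lemma p_smult_diff:
  assumes "x \<in> carrier A" "y \<in> carrier A"
  shows "p (c \<odot> x \<ominus> c \<odot> y) = cmod c * p (x \<ominus> y)"
  using assms by (simp add: p_smult flip: smult_minus)

lemma p_star_diff:
  assumes "x \<in> carrier A" "y \<in> carrier A"
  shows "p (star A x \<ominus> star A y) = p (x \<ominus> y)"
  using assms by (simp flip: star_minus)

section \<open>Convergence, equivalence and Cauchy sequences for a C*-seminorm\<close>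

definition conv :: "(nat \<Rightarrow> 'a) \<Rightarrow> 'a \<Rightarrow> bool" where
  "conv X l \<longleftrightarrow> (\<forall>k. X k \<in> carrier A) \<and> l \<in> carrier A \<and> (\<lambda>k. p (X k \<ominus> l)) \<longlonglongrightarrow> 0"

definition equiv :: "(nat \<Rightarrow> 'a) \<Rightarrow> (nat \<Rightarrow> 'a) \<Rightarrow> bool" where
  "equiv X Y \<longleftrightarrow> (\<lambda>k. p (X k \<ominus> Y k)) \<longlonglongrightarrow> 0"

lemma cauchy_carrier: "X \<in> cauchy_seqs A p \<Longrightarrow> X k \<in> carrier A"
  by (simp add: cauchy_seqs_def)

lemma cauchy_norm: assumes "X \<in> cauchy_seqs A p" shows "convergent (\<lambda>k. p (X k))"
proof -
  have "Cauchy (\<lambda>k. p (X k))"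
  proof (rule metric_CauchyI)
    fix e :: real assume "0 < e"
    with assms obtain N where N: "\<And>i j. i \<ge> N \<Longrightarrow> j \<ge> N \<Longrightarrow> p (X i \<ominus> X j) < e"
      by (fastforce simp: cauchy_seqs_def)
    have "dist (p (X i)) (p (X j)) < e" if "i \<ge> N" "j \<ge> N" for i j
      using N[OF that] p_abs_diff[of "X i" "X j"] cauchy_carrier[OF assms] 
      by (auto simp: dist_real_def intro: le_less_trans)
    then show "\<exists>M. \<forall>m\<ge>M. \<forall>n\<ge>M. dist (p (X m)) (p (X n)) < e" by blast
  qed
  then show ?thesis by (simp add: Cauchy_convergent_iff)
qed

lemma cauchy_bounded:
  assumes "X \<in> cauchy_seqs A p" shows "\<exists>K>0. \<forall>k. p (X k) \<le> K"
proof -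
  obtain K where "K > 0" "\<And>k. norm (p (X k)) \<le> K"
    using convergent_imp_Bseq[OF cauchy_norm[OF assms]] by (auto simp: Bseq_def)
  then show ?thesis by (intro exI[of _ K]) (auto intro: order_trans[OF abs_ge_self])
qed

lemma cauchy_const: "x \<in> carrier A \<Longrightarrow> (\<lambda>_. x) \<in> cauchy_seqs A p"
  by (simp add: cauchy_seqs_def)

lemma cauchyD: 
  "X \<in> cauchy_seqs A p \<Longrightarrow> 0 < e \<Longrightarrow> \<exists>N. \<forall>i \<ge> N. \<forall>j \<ge> N. p (X i \<ominus> X j) < e"
  by (simp add: cauchy_seqs_def)

text \<open>One estimate serves all operations: sums, products, scalar multiples and adjoints change
  by at most a fixed multiple of the changes in their arguments. For unary operations
  \<open>Y\<close> is taken equal to \<open>X\<close>.\<close>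

lemma cauchy_comb:
  assumes X: "X \<in> cauchy_seqs A p" and Y: "Y \<in> cauchy_seqs A p" and K: "K \<ge> 0"
    and Z: "\<And>k. Z k \<in> carrier A"
    and le: "\<And>i j. p (Z i \<ominus> Z j) \<le> K * p (X i \<ominus> X j) + K * p (Y i \<ominus> Y j)"
  shows "Z \<in> cauchy_seqs A p"
  unfolding cauchy_seqs_def
proof (intro CollectI conjI allI impI Z)
  fix e :: real assume e: "0 < e"
  \<comment> \<open>The summand 1 keeps the denominator positive when \<open>K = 0\<close>.\<close>
  let ?d = "e / (2 * (K + 1))"
  have d: "?d > 0" using e K by simp
  obtain N M where N: "\<And>i j. i \<ge> N \<Longrightarrow> j \<ge> N \<Longrightarrow> p (X i \<ominus> X j) < ?d"
    and M: "\<And>i j. i \<ge> M \<Longrightarrow> j \<ge> M \<Longrightarrow> p (Y i \<ominus> Y j) < ?d"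
    using cauchyD[OF X d] cauchyD[OF Y d] by blast
  have "p (Z i \<ominus> Z j) < e" if "i \<ge> max N M" "j \<ge> max N M" for i j
  proof -
    have "p (Z i \<ominus> Z j) \<le> K * ?d + K * ?d"
      using le[of i j] N[of i j] M[of i j] that K by (smt (verit) mult_left_mono max.bounded_iff)
    also have "K + 1 \<noteq> 0" using K by simp
    then have "K * ?d + K * ?d = e * (K / (K + 1))" by (simp add: divide_simps)
    also have "\<dots> < e * 1" using K e by (intro mult_strict_left_mono) auto
    finally show ?thesis by simp
  qed
  then show "\<exists>N. \<forall>i\<ge>N. \<forall>j\<ge>N. p (Z i \<ominus> Z j) < e" by blast
qed

lemma cauchy_add:
  assumes "X \<in> cauchy_seqs A p" "Y \<in> cauchy_seqs A p"
  shows "(\<lambda>k. X k \<oplus> Y k) \<in> cauchy_seqs A p"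
  by (rule cauchy_comb[OF assms, of 1]) (use assms[THEN cauchy_carrier] p_add_diff in auto)

lemma cauchy_mult:
  assumes "X \<in> cauchy_seqs A p" "Y \<in> cauchy_seqs A p"
  shows "(\<lambda>k. X k \<otimes> Y k) \<in> cauchy_seqs A p"
proof -
  note c = assms[THEN cauchy_carrier]
  obtain K L where K: "K > 0" "\<And>k. p (X k) \<le> K" and L: "L > 0" "\<And>k. p (Y k) \<le> L"
    using assms[THEN cauchy_bounded] by auto
  show ?thesis
  proof (rule cauchy_comb[OF assms, of "K + L"])
    fix i j
    have "p (X i) * p (Y i \<ominus> Y j) \<le> (K + L) * p (Y i \<ominus> Y j)"
      using K(2)[of i] L(1) c by (intro mult_right_mono) auto
    moreover have "p (X i \<ominus> X j) * p (Y j) \<le> p (X i \<ominus> X j) * (K + L)"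
      using K(1) L(2)[of j] c by (intro mult_left_mono) auto
    ultimately show "p (X i \<otimes> Y i \<ominus> X j \<otimes> Y j) \<le> (K + L) * p (X i \<ominus> X j) + (K + L) * p (Y i \<ominus> Y j)"
      using p_mult_diff[of "X i" "Y i" "X j" "Y j"] c by (simp add: mult.commute)
  qed (use K L c in auto)
qed

lemma cauchy_smult:
  assumes "X \<in> cauchy_seqs A p" shows "(\<lambda>k. c \<odot> X k) \<in> cauchy_seqs A p"
  by (rule cauchy_comb[OF assms assms, of "cmod c"]) 
    (use assms[THEN cauchy_carrier] in \<open>auto simp: p_smult_diff\<close>)

lemma cauchy_star:
  assumes "X \<in> cauchy_seqs A p" shows "(\<lambda>k. star A (X k)) \<in> cauchy_seqs A p"
  by (rule cauchy_comb[OF assms assms, of 1]) 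
    (use assms[THEN cauchy_carrier] in \<open>auto simp: p_star_diff\<close>)

lemma cauchy_minus:
  assumes "X \<in> cauchy_seqs A p" "Y \<in> cauchy_seqs A p"
  shows "(\<lambda>k. X k \<ominus> Y k) \<in> cauchy_seqs A p"
  using cauchy_add[OF assms(1) cauchy_smult[OF assms(2), of "-1"]] assms[THEN cauchy_carrier]
  by (simp add: minus_eq_smult)

lemma null_squeeze:
  fixes f :: "nat \<Rightarrow> real"
  assumes "\<And>k. 0 \<le> f k" "\<And>k. f k \<le> K * g k + L * h k" "g \<longlonglongrightarrow> 0" "h \<longlonglongrightarrow> 0"
  shows "f \<longlonglongrightarrow> 0"
proof (rule tendsto_sandwich[of "\<lambda>_. 0" _ _ "\<lambda>k. K * g k + L * h k"])
  show "(\<lambda>k. K * g k + L * h k) \<longlonglongrightarrow> 0"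
    using tendsto_add[OF tendsto_mult_left[OF assms(3), of K] tendsto_mult_left[OF assms(4), of L]] by simp
qed (use assms in auto)

context
  fixes X Y X' Y' :: "nat \<Rightarrow> 'a"
  assumes c: "\<And>k. X k \<in> carrier A" "\<And>k. X' k \<in> carrier A"
    and e: "equiv X X'"
begin

lemma equiv_add:
  assumes "\<And>k. Y k \<in> carrier A" "\<And>k. Y' k \<in> carrier A" "equiv Y Y'"
  shows "equiv (\<lambda>k. X k \<oplus> Y k) (\<lambda>k. X' k \<oplus> Y' k)"
  unfolding equiv_def
  by (rule null_squeeze[where K=1 and L=1, OF _ _ e[unfolded equiv_def] assms(3)[unfolded equiv_def]])
     (use c assms p_add_diff in auto)

text \<open>Writing \<open>x y - x' y'\<close> as \<open>x (y - y') + (x - x') y'\<close> shows that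
  only \<open>X\<close> and \<open>Y'\<close> have to be bounded.\<close>

lemma equiv_mult:
  assumes "\<And>k. Y k \<in> carrier A" "\<And>k. Y' k \<in> carrier A" "equiv Y Y'"
    "\<And>k. p (X k) \<le> K" "\<And>k. p (Y' k) \<le> L"
  shows "equiv (\<lambda>k. X k \<otimes> Y k) (\<lambda>k. X' k \<otimes> Y' k)"
  unfolding equiv_def
proof (rule null_squeeze[where K=K and L=L, OF _ _ assms(3)[unfolded equiv_def] e[unfolded equiv_def]])
  fix k
  have "p (X k) * p (Y k \<ominus> Y' k) \<le> K * p (Y k \<ominus> Y' k)"
    using assms c by (intro mult_right_mono) auto
  moreover have "p (X k \<ominus> X' k) * p (Y' k) \<le> p (X k \<ominus> X' k) * L"
    using assms c by (intro mult_left_mono) auto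
  ultimately show "p (X k \<otimes> Y k \<ominus> X' k \<otimes> Y' k) \<le> K * p (Y k \<ominus> Y' k) + L * p (X k \<ominus> X' k)"
    using p_mult_diff[of "X k" "Y k" "X' k" "Y' k"] c assms by (simp add: mult.commute)
qed (use c assms in auto)

lemma equiv_smult: "equiv (\<lambda>k. z \<odot> X k) (\<lambda>k. z \<odot> X' k)"
  using tendsto_mult_left[OF e[unfolded equiv_def], of "cmod z"] by (simp add: equiv_def p_smult_diff c)

lemma equiv_star: "equiv (\<lambda>k. star A (X k)) (\<lambda>k. star A (X' k))"
  using e by (simp add: equiv_def p_star_diff c)

lemma equiv_sym: "equiv X' X"
  using e by (simp add: equiv_def p_minus_commute[OF c(1) c(2)])

lemma equiv_trans:
  assumes "\<And>k. Y k \<in> carrier A" "equiv X' Y" shows "equiv X Y"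
  unfolding equiv_def
  by (rule null_squeeze[where K=1 and L=1, OF _ _ e[unfolded equiv_def] assms(2)[unfolded equiv_def]])
     (use c assms p_triangle in auto)

lemma equiv_norm: "(\<lambda>k. p (X k)) \<longlonglongrightarrow> l \<longleftrightarrow> (\<lambda>k. p (X' k)) \<longlonglongrightarrow> l"
proof -
  have "(\<lambda>k. p (X k) - p (X' k)) \<longlonglongrightarrow> 0"
    by (rule Lim_null_comparison[OF _ e[unfolded equiv_def]]) (use p_abs_diff c in auto)
  then show ?thesis by (rule Lim_transform_eq)
qed

end

lemma equiv_refl: "(\<And>k. X k \<in> carrier A) \<Longrightarrow> equiv X X"
  by (simp add: equiv_def)

lemma conv_iff_equiv: 
  "conv X l \<longleftrightarrow> (\<forall>k. X k \<in> carrier A) \<and> l \<in> carrier A \<and> equiv X (\<lambda>_. l)"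
  by (simp add: conv_def equiv_def)

lemma conv_carrier: "conv X l \<Longrightarrow> X k \<in> carrier A" "conv X l \<Longrightarrow> l \<in> carrier A"
  by (simp_all add: conv_def)

lemma conv_const: "x \<in> carrier A \<Longrightarrow> conv (\<lambda>_. x) x"
  by (simp add: conv_def)

lemma conv_norm: "conv X l \<Longrightarrow> (\<lambda>k. p (X k)) \<longlonglongrightarrow> p l"
  using equiv_norm[of X "\<lambda>_. l" "p l"] by (simp add: conv_iff_equiv)

lemma conv_add: "conv X l \<Longrightarrow> conv Y l' \<Longrightarrow> conv (\<lambda>k. X k \<oplus> Y k) (l \<oplus> l')"
  using equiv_add[of X "\<lambda>_. l" Y "\<lambda>_. l'"] by (simp add: conv_iff_equiv)

lemma conv_smult: "conv X l \<Longrightarrow> conv (\<lambda>k. c \<odot> X k) (c \<odot> l)"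
  using equiv_smult[of X "\<lambda>_. l"] by (simp add: conv_iff_equiv)

lemma conv_star: "conv X l \<Longrightarrow> conv (\<lambda>k. star A (X k)) (star A l)"
  using equiv_star[of X "\<lambda>_. l"] by (simp add: conv_iff_equiv)

lemma conv_mult: assumes "conv X l" "conv Y l'" shows "conv (\<lambda>k. X k \<otimes> Y k) (l \<otimes> l')"
proof -
  obtain K where "\<And>k. norm (p (X k)) \<le> K"
    using convergent_imp_Bseq[OF convergentI[OF conv_norm[OF assms(1)]]] by (auto simp: Bseq_def)
  then have "p (X k) \<le> K" for k by (metis abs_ge_self order_trans real_norm_def)
  then show ?thesis
    using assms equiv_mult[of X "\<lambda>_. l" Y "\<lambda>_. l'" K "p l'"] by (simp add: conv_iff_equiv)
qed

lemma conv_minus: assumes "conv X l" "conv Y l'" shows "conv (\<lambda>k. X k \<ominus> Y k) (l \<ominus> l')"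
  using conv_add[OF assms(1) conv_smult[OF assms(2), of "-1"]] conv_carrier[OF assms(1)]
    conv_carrier[OF assms(2)] by (simp add: minus_eq_smult)

lemma conv_Cauchy: assumes "conv X l" shows "X \<in> cauchy_seqs A p"
  unfolding cauchy_seqs_def
proof (intro CollectI conjI allI impI)
  fix e :: real assume "0 < e"
  then obtain N where N: "\<And>k. k \<ge> N \<Longrightarrow> p (X k \<ominus> l) < e / 2"
    using assms LIMSEQ_D[of "\<lambda>k. p (X k \<ominus> l)" 0 "e/2"] by (auto simp: conv_def)
  have "p (X i \<ominus> X j) < e" if "i \<ge> N" "j \<ge> N" for i j
    using p_triangle[of "X i" l "X j"] N[OF that(1)] N[OF that(2)] p_minus_commute[of l "X j"] 
      conv_carrier[OF assms] by simp
  then show "\<exists>N. \<forall>i\<ge>N. \<forall>j\<ge>N. p (X i \<ominus> X j) < e" by blast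
qed (use assms in \<open>auto simp: conv_def\<close>)

text \<open>\<open>p\<close> may have a kernel, so limits are unique only up to elements on which it
  vanishes; \<open>conv_unique\<close> sharpens this under definiteness.\<close>

lemma conv_uniq: assumes "conv X l" "conv X l'" shows "p (l \<ominus> l') = 0"
proof -
  have "(\<lambda>k. p (X k \<ominus> X k)) \<longlonglongrightarrow> p (l \<ominus> l')" by (rule conv_norm[OF conv_minus[OF assms]])
  then show ?thesis using assms by (simp add: conv_carrier LIMSEQ_const_iff)
qed

lemma conv_approx:
  assumes "\<And>k. X k \<in> carrier A" "l \<in> carrier A" "\<And>k. p (X k \<ominus> l) < 1 / (Suc k)"
  shows "conv X l"
  unfolding conv_def
proof (intro conjI allI)
  show "(\<lambda>k. p (X k \<ominus> l)) \<longlonglongrightarrow> 0"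
    by (rule tendsto_sandwich[OF _ _ tendsto_const lim_1_over_n[THEN LIMSEQ_Suc]])
      (use assms in \<open>auto intro!: always_eventually less_imp_le\<close>)
qed (use assms in auto)

end

section \<open>Completions\<close>

text \<open>
  The locale predicate \<open>Metric_space\<close> requires the metric to be nonnegative and symmetric outside of
  its carrier as well, and the definition of \<open>mcomplete\<close> is only available under this premise. Hence
  the assumption \<open>complete\<close> of \<open>cstar_algebra\<close> cannot be unfolded for a given algebra with
  arbitrary junk values. We use the following notion of completeness instead; it is
  satisfied by every algebra that receives a morphism with dense range from some \<open>A_s n\<close>.
\<close>

locale pre_cstar = seminormed A "cnorm A" for A (structure) +
  assumes definite: "\<lbrakk>x \<in> carrier A; cnorm A x = 0\<rbrakk> \<Longrightarrow> x = \<zero>"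
begin

lemma eq_if_norm: "x \<in> carrier A \<Longrightarrow> y \<in> carrier A \<Longrightarrow> cnorm A (x \<ominus> y) = 0 \<Longrightarrow> x = y"
  by (rule minus_eq_zeroD) (auto intro: definite)

lemma conv_unique: "conv X l \<Longrightarrow> conv X l' \<Longrightarrow> l = l'"
  by (rule eq_if_norm) (auto simp: conv_carrier conv_uniq)

end

locale complete_cstar = pre_cstar +
  assumes cauchy_conv: "X \<in> cauchy_seqs A (cnorm A) \<Longrightarrow> \<exists>l. conv X l"

lemma complete_cstarI:
  fixes A (structure)
  assumes "star_algebra A" "cstar_seminorm A (cnorm A)"
    and "\<And>x. x \<in> carrier A \<Longrightarrow> cnorm A x = 0 \<Longrightarrow> x = \<zero>"
    and "\<And>X. X \<in> cauchy_seqs A (cnorm A) \<Longrightarrow> \<exists>l. seminormed.conv A (cnorm A) X l"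
  shows "complete_cstar A"
  using assms by (intro complete_cstar.intro pre_cstar.intro seminormed.intro seminormed_axioms.intro
    pre_cstar_axioms.intro complete_cstar_axioms.intro)

lemma pre_cstar_star [simp, intro]: "pre_cstar A \<Longrightarrow> star_algebra A"
  by (simp add: pre_cstar_def seminormed_def)

lemma complete_cstar_pre [simp, intro]: "complete_cstar A \<Longrightarrow> pre_cstar A"
  by (rule complete_cstar.axioms)

text \<open>The completeness axiom is given up here; for the algebras of the theorem it is recovered
  in \<open>complete_cstar_if_factorizes\<close>.\<close>

lemma cstar_algebra_pre: "cstar_algebra A \<Longrightarrow> pre_cstar A"
  by (intro pre_cstar.intro seminormed.intro seminormed_axioms.intro pre_cstar_axioms.intro
    cstar_algebra.axioms(1) cstar_algebra.cstar_seminorm cstar_algebra.cnorm_definite)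

text \<open>The last two premises range over all elements of the type, because
  \<open>Metric_space\<close> asks for nonnegativity and symmetry outside of the carrier too. They
  are verified for the copy built in \<open>transport\<close>, whose values there are under
  control.\<close>

lemma cstar_algebraI:
  fixes A (structure)
  assumes A: "complete_cstar A"
    and "\<And>x y. 0 \<le> cnorm A (x \<ominus> y)" "\<And>x y. cnorm A (x \<ominus> y) = cnorm A (y \<ominus> x)"
  shows "cstar_algebra A"
proof -
  interpret complete_cstar A by (fact A)
  interpret M: Metric_space "carrier A" "\<lambda>x y. cnorm A (x \<ominus> y)"
    by unfold_locales (use assms in \<open>auto simp: p_triangle intro: eq_if_norm\<close>)
  have "M.mcomplete"
    unfolding M.mcomplete_def
  proof (intro allI impI)
    fix X assume X: "M.MCauchy X"
    then have c: "X k \<in> carrier A" for k by (auto simp: M.MCauchy_def)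
    from X have "X \<in> cauchy_seqs A (cnorm A)"
      unfolding M.MCauchy_def cauchy_seqs_def by auto
    from cauchy_conv[OF this] obtain l where "conv X l" ..
    with c show "\<exists>l. limitin M.mtopology X l sequentially"
      unfolding M.limitin_metric_dist_null conv_def by auto
  qed
  then show ?thesis
    by (intro cstar_algebra.intro cstar_algebra_axioms.intro star_algebra_axioms sn definite)
qed

section \<open>The completion is a complete C*-algebra\<close>

context seminormed
begin

abbreviation "cls \<equiv> null_class A p"
abbreviation "Cp \<equiv> completion A p"

lemma cls_eq:
  assumes "X \<in> cauchy_seqs A p" "Y \<in> cauchy_seqs A p" "equiv X Y"
  shows "cls X = cls Y"
proof -
  note c = assms(1,2)[THEN cauchy_carrier]
  have "equiv Z X \<longleftrightarrow> equiv Z Y" if "Z \<in> cauchy_seqs A p" for Z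
    using equiv_trans[of Z X Y] equiv_trans[of Z Y X] equiv_sym[of X Y] c assms(3)
      cauchy_carrier[OF that] by blast
  then show ?thesis by (auto simp: null_class_def equiv_def)
qed

text \<open>\<open>rep\<close> returns some representative, not the sequence that defined the class.
  Since it is equivalent to that sequence, operations on classes can be computed on any
  representative.\<close>

lemma rep_cls:
  assumes "X \<in> cauchy_seqs A p"
  shows "rep (cls X) \<in> cauchy_seqs A p" "equiv (rep (cls X)) X" "equiv X (rep (cls X))"
proof -
  have "X \<in> cls X"
    using assms equiv_refl[of X] cauchy_carrier[OF assms] by (simp add: null_class_def equiv_def)
  then have "rep (cls X) \<in> cls X" unfolding rep_def by (rule someI[where P="\<lambda>Z. Z \<in> cls X"])
  then show "rep (cls X) \<in> cauchy_seqs A p" "equiv (rep (cls X)) X" by (auto simp: null_class_def equiv_def)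
  then show "equiv X (rep (cls X))" using equiv_sym assms cauchy_carrier by blast
qed

lemma completionE:
  assumes "S \<in> carrier Cp" obtains X where "X \<in> cauchy_seqs A p" "S = cls X"
  using assms by (auto simp: completion_def)

lemma cls_closed [simp]: "X \<in> cauchy_seqs A p \<Longrightarrow> cls X \<in> carrier Cp"
  by (auto simp: completion_def)

lemma completion_zero: "\<zero>\<^bsub>Cp\<^esub> = cls (\<lambda>_. \<zero>)" and completion_one: "\<one>\<^bsub>Cp\<^esub> = cls (\<lambda>_. \<one>)"
  by (simp_all add: completion_def)

context
  fixes X Y :: "nat \<Rightarrow> 'a"
  assumes X: "X \<in> cauchy_seqs A p"
begin

lemma completion_smult: "c \<odot>\<^bsub>Cp\<^esub> cls X = cls (\<lambda>k. c \<odot> X k)"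
  by (simp add: completion_def) 
    (intro cls_eq cauchy_smult equiv_smult rep_cls X cauchy_carrier)

lemma completion_star: "star Cp (cls X) = cls (\<lambda>k. star A (X k))"
  by (simp add: completion_def) 
    (intro cls_eq cauchy_star equiv_star rep_cls X cauchy_carrier)

lemma completion_norm: "(\<lambda>k. p (X k)) \<longlonglongrightarrow> cnorm Cp (cls X)"
proof -
  have "(\<lambda>k. p (rep (cls X) k)) \<longlonglongrightarrow> lim (\<lambda>k. p (rep (cls X) k))"
    using cauchy_norm[OF rep_cls(1)[OF X]] by (simp add: convergent_LIMSEQ_iff)
  then show ?thesis
    using equiv_norm[of "rep (cls X)" X] rep_cls[OF X] X cauchy_carrier by (simp add: completion_def)
qed

context
  assumes Y: "Y \<in> cauchy_seqs A p"
begin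

lemma completion_add: "cls X \<oplus>\<^bsub>Cp\<^esub> cls Y = cls (\<lambda>k. X k \<oplus> Y k)"
  by (simp add: completion_def) 
    (intro cls_eq cauchy_add equiv_add rep_cls X Y cauchy_carrier)

lemma completion_mult: "cls X \<otimes>\<^bsub>Cp\<^esub> cls Y = cls (\<lambda>k. X k \<otimes> Y k)"
proof -
  obtain K L where "\<And>k. p (rep (cls X) k) \<le> K" "\<And>k. p (Y k) \<le> L"
    using cauchy_bounded[OF rep_cls(1)[OF X]] cauchy_bounded[OF Y] by blast
  then show ?thesis
    by (simp add: completion_def) 
       (rule cls_eq[OF cauchy_mult cauchy_mult equiv_mult], simp_all add: rep_cls X Y cauchy_carrier)
qed

end

end

lemmas completion_ops = completion_zero completion_one completion_smult completion_star
  completion_add completion_mult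

lemmas cauchy_closed = cauchy_add cauchy_mult cauchy_smult cauchy_star cauchy_const

lemma star_algebra_completion: "star_algebra Cp"
  by (rule star_algebraI; (elim completionE)?; hypsubst?)
    (simp_all add: completion_ops cauchy_closed cauchy_carrier a_ac m_assoc l_distr r_distr
      smult_add_left smult_add_right smult_mult_left smult_mult_right star_add star_mult star_smult
      flip: smult_smult)

lemma completion_minus:
  assumes "X \<in> cauchy_seqs A p" "Y \<in> cauchy_seqs A p"
  shows "cls X \<ominus>\<^bsub>Cp\<^esub> cls Y = cls (\<lambda>k. X k \<ominus> Y k)"
proof -
  interpret C: star_algebra Cp by (rule star_algebra_completion)
  from assms show ?thesis
    by (simp add: C.minus_eq_smult completion_ops cauchy_closed minus_eq_smult cauchy_carrier)
qed

lemma cstar_seminorm_completion: "cstar_seminorm Cp (cnorm Cp)"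
  unfolding cstar_seminorm_def
proof (intro ballI conjI allI; elim completionE; hypsubst)
  fix X assume X: "X \<in> cauchy_seqs A p"
  note c [simp] = cauchy_carrier[OF X]
  note n = completion_norm[OF X]
  show "0 \<le> cnorm Cp (cls X)"
    by (rule LIMSEQ_le_const[OF n]) simp
  show "cnorm Cp (star Cp (cls X) \<otimes>\<^bsub>Cp\<^esub> cls X) = (cnorm Cp (cls X))\<^sup>2"
  proof (rule LIMSEQ_unique)
    show "(\<lambda>k. p (star A (X k) \<otimes> X k)) \<longlonglongrightarrow> cnorm Cp (star Cp (cls X) \<otimes>\<^bsub>Cp\<^esub> cls X)"
      using completion_norm[of "\<lambda>k. star A (X k) \<otimes> X k"] X by (simp add: completion_ops cauchy_closed)
    show "(\<lambda>k. p (star A (X k) \<otimes> X k)) \<longlonglongrightarrow> (cnorm Cp (cls X))\<^sup>2"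
      using tendsto_power[OF n, of 2] by (simp add: p_star_mult)
  qed
  show "cnorm Cp (c \<odot>\<^bsub>Cp\<^esub> cls X) = cmod c * cnorm Cp (cls X)" for c
  proof (rule LIMSEQ_unique)
    show "(\<lambda>k. p (c \<odot> X k)) \<longlonglongrightarrow> cnorm Cp (c \<odot>\<^bsub>Cp\<^esub> cls X)"
      using completion_norm[of "\<lambda>k. c \<odot> X k"] X by (simp add: completion_ops cauchy_closed)
    show "(\<lambda>k. p (c \<odot> X k)) \<longlonglongrightarrow> cmod c * cnorm Cp (cls X)"
      using tendsto_mult_left[OF n, of "cmod c"] by (simp add: p_smult)
  qed
  fix Y assume Y: "Y \<in> cauchy_seqs A p"
  note d [simp] = cauchy_carrier[OF Y]
  note m = completion_norm[OF Y]
  show "cnorm Cp (cls X \<oplus>\<^bsub>Cp\<^esub> cls Y) \<le> cnorm Cp (cls X) + cnorm Cp (cls Y)"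
  proof (rule LIMSEQ_le)
    show "(\<lambda>k. p (X k \<oplus> Y k)) \<longlonglongrightarrow> cnorm Cp (cls X \<oplus>\<^bsub>Cp\<^esub> cls Y)"
      using completion_norm[of "\<lambda>k. X k \<oplus> Y k"] X Y by (simp add: completion_ops cauchy_closed)
    show "(\<lambda>k. p (X k) + p (Y k)) \<longlonglongrightarrow> cnorm Cp (cls X) + cnorm Cp (cls Y)"
      by (rule tendsto_add[OF n m])
  qed (simp add: p_add)
  show "cnorm Cp (cls X \<otimes>\<^bsub>Cp\<^esub> cls Y) \<le> cnorm Cp (cls X) * cnorm Cp (cls Y)"
  proof (rule LIMSEQ_le)
    show "(\<lambda>k. p (X k \<otimes> Y k)) \<longlonglongrightarrow> cnorm Cp (cls X \<otimes>\<^bsub>Cp\<^esub> cls Y)"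
      using completion_norm[of "\<lambda>k. X k \<otimes> Y k"] X Y by (simp add: completion_ops cauchy_closed)
    show "(\<lambda>k. p (X k) * p (Y k)) \<longlonglongrightarrow> cnorm Cp (cls X) * cnorm Cp (cls Y)"
      by (rule tendsto_mult[OF n m])
  qed (simp add: p_mult)
qed

definition emb :: "'a \<Rightarrow> (nat \<Rightarrow> 'a) set" where
  "emb x = cls (\<lambda>_. x)"

lemma emb_star_hom: "emb \<in> star_hom A Cp"
  by (rule star_homI) (simp_all add: emb_def completion_ops cauchy_const)

lemma cnorm_emb: "x \<in> carrier A \<Longrightarrow> cnorm Cp (emb x) = p x"
  using completion_norm[of "\<lambda>_. x"] by (simp add: emb_def cauchy_const LIMSEQ_const_iff)

text \<open>The norm of a class is a limit of seminorms, so a bound on all late terms passes to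
  it.\<close>

lemma cnorm_minus_emb_le:
  assumes X: "X \<in> cauchy_seqs A p" and N: "\<And>k. k \<ge> N \<Longrightarrow> p (X k \<ominus> x) \<le> e" and x: "x \<in> carrier A"
  shows "cnorm Cp (cls X \<ominus>\<^bsub>Cp\<^esub> emb x) \<le> e"
proof (rule LIMSEQ_le_const2)
  show "(\<lambda>k. p (X k \<ominus> x)) \<longlonglongrightarrow> cnorm Cp (cls X \<ominus>\<^bsub>Cp\<^esub> emb x)"
    using completion_norm[OF cauchy_minus[OF X cauchy_const[OF x]]] X x
    by (simp add: emb_def completion_minus cauchy_const)
qed (use N in blast)

lemma emb_dense:
  assumes "S \<in> carrier Cp" "0 < e"
  shows "\<exists>x \<in> carrier A. cnorm Cp (S \<ominus>\<^bsub>Cp\<^esub> emb x) < e"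
proof -
  obtain X where X: "X \<in> cauchy_seqs A p" "S = cls X" using assms by (elim completionE)
  have "0 < e / 2" using assms by simp
  from cauchyD[OF X(1) this] obtain N where N: "\<And>i j. i \<ge> N \<Longrightarrow> j \<ge> N \<Longrightarrow> p (X i \<ominus> X j) < e / 2"
    by blast
  have "cnorm Cp (S \<ominus>\<^bsub>Cp\<^esub> emb (X N)) \<le> e / 2"
    unfolding X(2) by (rule cnorm_minus_emb_le[OF X(1)]) (use N less_imp_le X cauchy_carrier in auto)
  then show ?thesis using assms X cauchy_carrier by (intro bexI[of _ "X N"]) auto
qed

text \<open>Diagonal argument: the k-th class of a Cauchy sequence is replaced by a single element
  \<open>x k\<close> of \<open>A\<close> within \<open>1 / Suc k\<close>. The sequence
  \<open>x\<close> is then Cauchy in \<open>A\<close>, and its class is the limit.\<close>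

lemma complete_cstar_completion: "complete_cstar Cp"
proof (rule complete_cstarI)
  interpret C: seminormed Cp "cnorm Cp"
    by (intro seminormed.intro seminormed_axioms.intro star_algebra_completion cstar_seminorm_completion)
  have emb [simp]: "x \<in> carrier A \<Longrightarrow> emb x \<in> carrier Cp" for x
    using star_homD(1)[OF emb_star_hom] .
  show "star_algebra Cp" by (rule star_algebra_completion)
  show "cstar_seminorm Cp (cnorm Cp)" by (rule cstar_seminorm_completion)
  show "S = \<zero>\<^bsub>Cp\<^esub>" if S: "S \<in> carrier Cp" "cnorm Cp S = 0" for S
  proof -
    obtain X where X: "X \<in> cauchy_seqs A p" "S = cls X" using S by (elim completionE)
    have "equiv X (\<lambda>_. \<zero>)"
      using completion_norm[OF X(1)] X S cauchy_carrier[OF X(1)] by (simp add: equiv_def)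
    then show ?thesis using X cauchy_const[of \<zero>] by (simp add: completion_zero cls_eq)
  qed
  fix S assume S: "S \<in> cauchy_seqs Cp (cnorm Cp)"
  then have Sc [simp]: "S k \<in> carrier Cp" for k by (rule C.cauchy_carrier)
  have "\<exists>x \<in> carrier A. cnorm Cp (S k \<ominus>\<^bsub>Cp\<^esub> emb x) < 1 / Suc k" for k
    by (rule emb_dense) simp_all
  then obtain x where xc [simp]: "x k \<in> carrier A" and x: "cnorm Cp (S k \<ominus>\<^bsub>Cp\<^esub> emb (x k)) < 1 / Suc k" for k
    by metis
  have e0: "(\<lambda>k. cnorm Cp (S k \<ominus>\<^bsub>Cp\<^esub> emb (x k))) \<longlonglongrightarrow> 0"
    by (rule tendsto_sandwich[OF _ _ tendsto_const lim_1_over_n[THEN LIMSEQ_Suc]])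
      (use x in \<open>auto intro!: always_eventually less_imp_le\<close>)
  then have S': "C.equiv S (\<lambda>k. emb (x k))" by (simp add: C.equiv_def)
  have X: "x \<in> cauchy_seqs A p"
    unfolding cauchy_seqs_def
  proof (intro CollectI conjI allI impI xc)
    fix e :: real assume "0 < e"
    then have e: "0 < e / 3" by simp
    obtain N where N: "\<And>i j. i \<ge> N \<Longrightarrow> j \<ge> N \<Longrightarrow> cnorm Cp (S i \<ominus>\<^bsub>Cp\<^esub> S j) < e / 3"
      using C.cauchyD[OF S e] by blast
    obtain M where M: "\<And>k. k \<ge> M \<Longrightarrow> cnorm Cp (S k \<ominus>\<^bsub>Cp\<^esub> emb (x k)) < e / 3"
      using LIMSEQ_D[OF e0 e] by auto
    have "p (x i \<ominus> x j) < e" if "i \<ge> max N M" "j \<ge> max N M" for i j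
    proof -
      have "p (x i \<ominus> x j) = cnorm Cp (emb (x i) \<ominus>\<^bsub>Cp\<^esub> emb (x j))"
        using star_hom_minus[OF star_algebra_axioms star_algebra_completion emb_star_hom, of "x i" "x j"]
        by (simp add: cnorm_emb[symmetric] del: cnorm_emb)
      also have "\<dots> \<le> cnorm Cp (emb (x i) \<ominus>\<^bsub>Cp\<^esub> S i) + cnorm Cp (S i \<ominus>\<^bsub>Cp\<^esub> emb (x j))"
        by (rule C.p_triangle) simp_all
      also have "cnorm Cp (S i \<ominus>\<^bsub>Cp\<^esub> emb (x j)) \<le> cnorm Cp (S i \<ominus>\<^bsub>Cp\<^esub> S j) + cnorm Cp (S j \<ominus>\<^bsub>Cp\<^esub> emb (x j))"
        by (rule C.p_triangle) simp_all
      also have "cnorm Cp (emb (x i) \<ominus>\<^bsub>Cp\<^esub> S i) = cnorm Cp (S i \<ominus>\<^bsub>Cp\<^esub> emb (x i))"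
        by (rule C.p_minus_commute) simp_all
      finally show ?thesis using N[of i j] M[of i] M[of j] that by simp
    qed
    then show "\<exists>N. \<forall>i\<ge>N. \<forall>j\<ge>N. p (x i \<ominus> x j) < e" by blast
  qed
  have "(\<lambda>k. cnorm Cp (emb (x k) \<ominus>\<^bsub>Cp\<^esub> cls x)) \<longlonglongrightarrow> 0"
  proof (rule LIMSEQ_I)
    fix r :: real assume "0 < r"
    then have "0 < r / 2" by simp
    from cauchyD[OF X this] obtain N where N: "\<And>i j. i \<ge> N \<Longrightarrow> j \<ge> N \<Longrightarrow> p (x i \<ominus> x j) < r / 2"
      by blast
    have "cnorm Cp (emb (x k) \<ominus>\<^bsub>Cp\<^esub> cls x) \<le> r / 2" if "k \<ge> N" for k
      using cnorm_minus_emb_le[OF X, of N "x k" "r / 2"] N that less_imp_le X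
      by (subst C.p_minus_commute) auto
    then show "\<exists>no. \<forall>n\<ge>no. norm (cnorm Cp (emb (x n) \<ominus>\<^bsub>Cp\<^esub> cls x) - 0) < r"
      using \<open>0 < r\<close> X by (intro exI[of _ N]) fastforce
  qed
  then have "C.equiv (\<lambda>k. emb (x k)) (\<lambda>_. cls x)" by (simp add: C.equiv_def)
  with S' X have "C.conv S (cls x)"
    unfolding C.conv_iff_equiv using C.equiv_trans[of S "\<lambda>k. emb (x k)" "\<lambda>_. cls x"] by simp
  then show "\<exists>l. C.conv S l" by blast
qed

end

subsection \<open>Extension of contractive morphisms\<close>

text \<open>Extension by continuity. \<open>i\<close> may fail to be injective: if two sequences
  have the same limit through \<open>i\<close>, contractivity gives their images under
  \<open>f\<close> the same limit, so the value depends only on the element of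
  \<open>A\<close>.\<close>

lemma extend_contraction:
  fixes A :: "('a, 'm) cstar_scheme" and D :: "('d, 'k) cstar_scheme" and P :: "('p, 'l) star_alg_scheme"
  assumes A: "pre_cstar A" and D: "complete_cstar D" and P: "star_algebra P"
    and i: "i \<in> star_hom P A" and f: "f \<in> star_hom P D"
    and dense: "\<And>a e. a \<in> carrier A \<Longrightarrow> e > 0 \<Longrightarrow> \<exists>x \<in> carrier P. cnorm A (a \<ominus>\<^bsub>A\<^esub> i x) < e"
    and le: "\<And>x. x \<in> carrier P \<Longrightarrow> cnorm D (f x) \<le> cnorm A (i x)"
  shows "\<exists>h \<in> star_hom A D. \<forall>x \<in> carrier P. h (i x) = f x"
proof -
  interpret A: pre_cstar A by (fact A)
  interpret D: complete_cstar D by (fact D)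
  interpret P: star_algebra P by (fact P)
  note [simp] = star_homD[OF i] star_homD[OF f]
    star_hom_minus[OF P _ i] star_hom_minus[OF P _ f]
  \<comment> \<open>The closure of the relation between \<open>i x\<close> and \<open>f x\<close>.
    By \<open>total\<close> and \<open>uniq\<close> it is the graph of a function, and the algebraic
    operations pass to it termwise.\<close>
  define R where "R a l \<longleftrightarrow> (\<exists>X. (\<forall>k. X k \<in> carrier P) \<and> A.conv (\<lambda>k. i (X k)) a \<and> D.conv (\<lambda>k. f (X k)) l)"
    for a l
  have total: "\<exists>l. R a l" if a: "a \<in> carrier A" for a
  proof -
    have "\<exists>x \<in> carrier P. cnorm A (a \<ominus>\<^bsub>A\<^esub> i x) < 1 / Suc k" for k
      by (rule dense[OF a]) simp
    then obtain X where X [simp]: "X k \<in> carrier P" and XA: "cnorm A (a \<ominus>\<^bsub>A\<^esub> i (X k)) < 1 / Suc k" for k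
      by metis
    have XA': "A.conv (\<lambda>k. i (X k)) a"
      by (rule A.conv_approx) (use XA a in \<open>simp_all add: A.p_minus_commute[of _ a]\<close>)
    then have "(\<lambda>k. i (X k)) \<in> cauchy_seqs A (cnorm A)" by (rule A.conv_Cauchy)
    moreover have "cnorm D (f (X k) \<ominus>\<^bsub>D\<^esub> f (X j)) \<le> cnorm A (i (X k) \<ominus>\<^bsub>A\<^esub> i (X j))" for k j
      using le[of "X k \<ominus>\<^bsub>P\<^esub> X j"] A D by simp
    ultimately have "(\<lambda>k. f (X k)) \<in> cauchy_seqs D (cnorm D)"
      unfolding cauchy_seqs_def by simp (meson le_less_trans)
    with D.cauchy_conv XA' show ?thesis unfolding R_def using X by blast
  qed
  have R_carrier: "l \<in> carrier D" if "R a l" for a l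
    using that D.conv_carrier unfolding R_def by blast
  have uniq: "l = l'" if "R a l" "R a l'" for a l l'
  proof -
    obtain X where X: "\<forall>k. X k \<in> carrier P" and X': "A.conv (\<lambda>k. i (X k)) a" "D.conv (\<lambda>k. f (X k)) l"
      using \<open>R a l\<close> unfolding R_def by blast
    note [simp] = X[rule_format]
    obtain Y where Y: "\<forall>k. Y k \<in> carrier P" and Y': "A.conv (\<lambda>k. i (Y k)) a" "D.conv (\<lambda>k. f (Y k)) l'"
      using \<open>R a l'\<close> unfolding R_def by blast
    note [simp] = Y[rule_format]
    have "(\<lambda>k. cnorm A (i (X k) \<ominus>\<^bsub>A\<^esub> i (Y k))) \<longlonglongrightarrow> cnorm A (a \<ominus>\<^bsub>A\<^esub> a)"
      by (intro A.conv_norm A.conv_minus X' Y')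
    then have "(\<lambda>k. cnorm A (i (X k) \<ominus>\<^bsub>A\<^esub> i (Y k))) \<longlonglongrightarrow> 0"
      using A.conv_carrier(2)[OF X'(1)] by simp
    moreover have "cnorm D (f (X k) \<ominus>\<^bsub>D\<^esub> f (Y k)) \<le> cnorm A (i (X k) \<ominus>\<^bsub>A\<^esub> i (Y k))" for k
      using le[of "X k \<ominus>\<^bsub>P\<^esub> Y k"] A D by simp
    ultimately have "(\<lambda>k. cnorm D (f (X k) \<ominus>\<^bsub>D\<^esub> f (Y k))) \<longlonglongrightarrow> 0"
      by (rule_tac tendsto_sandwich[OF _ _ tendsto_const]) (auto intro: always_eventually)
    moreover have "(\<lambda>k. cnorm D (f (X k) \<ominus>\<^bsub>D\<^esub> f (Y k))) \<longlonglongrightarrow> cnorm D (l \<ominus>\<^bsub>D\<^esub> l')"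
      by (intro D.conv_norm D.conv_minus X' Y')
    ultimately have "cnorm D (l \<ominus>\<^bsub>D\<^esub> l') = 0" using LIMSEQ_unique by blast
    then show ?thesis using D.eq_if_norm R_carrier that by blast
  qed
  define h where "h a = (SOME l. R a l)" for a
  have h: "R a (h a)" if "a \<in> carrier A" for a
    unfolding h_def using total[OF that] by (rule someI_ex)
  have heq: "h a = l" if "a \<in> carrier A" "R a l" for a l
    using uniq h that by blast
  have Ri: "R (i x) (f x)" if "x \<in> carrier P" for x
    unfolding R_def by (rule exI[of _ "\<lambda>_. x"]) (simp add: that A.conv_const D.conv_const)
  have "h \<in> star_hom A D"
  proof (rule star_homI)
    show hc: "h a \<in> carrier D" if "a \<in> carrier A" for a using h[OF that] by (rule R_carrier)
    fix a assume a: "a \<in> carrier A"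
    obtain X where X: "\<forall>k. X k \<in> carrier P" and X': "A.conv (\<lambda>k. i (X k)) a" "D.conv (\<lambda>k. f (X k)) (h a)"
      using h[OF a] unfolding R_def by blast
    note [simp] = X[rule_format]
    show "h (star A a) = star D (h a)"
      by (rule heq) (use a A.conv_star[OF X'(1)] D.conv_star[OF X'(2)] in
        \<open>auto simp: R_def intro!: exI[of _ "\<lambda>k. star P (X k)"]\<close>)
    show "h (c \<odot>\<^bsub>A\<^esub> a) = c \<odot>\<^bsub>D\<^esub> h a" for c
      by (rule heq) (use a A.conv_smult[OF X'(1)] D.conv_smult[OF X'(2)] in
        \<open>auto simp: R_def intro!: exI[of _ "\<lambda>k. c \<odot>\<^bsub>P\<^esub> X k"]\<close>)
    fix b assume b: "b \<in> carrier A"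
    obtain Y where Y: "\<forall>k. Y k \<in> carrier P" and Y': "A.conv (\<lambda>k. i (Y k)) b" "D.conv (\<lambda>k. f (Y k)) (h b)"
      using h[OF b] unfolding R_def by blast
    note [simp] = Y[rule_format]
    show "h (a \<otimes>\<^bsub>A\<^esub> b) = h a \<otimes>\<^bsub>D\<^esub> h b"
      by (rule heq) (use a b A.conv_mult[OF X'(1) Y'(1)] D.conv_mult[OF X'(2) Y'(2)] in
        \<open>auto simp: R_def intro!: exI[of _ "\<lambda>k. X k \<otimes>\<^bsub>P\<^esub> Y k"]\<close>)
    show "h (a \<oplus>\<^bsub>A\<^esub> b) = h a \<oplus>\<^bsub>D\<^esub> h b"
      by (rule heq) (use a b A.conv_add[OF X'(1) Y'(1)] D.conv_add[OF X'(2) Y'(2)] in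
        \<open>auto simp: R_def intro!: exI[of _ "\<lambda>k. X k \<oplus>\<^bsub>P\<^esub> Y k"]\<close>)
  next
    show "h \<one>\<^bsub>A\<^esub> = \<one>\<^bsub>D\<^esub>"
      using heq[of "i \<one>\<^bsub>P\<^esub>"] Ri[of "\<one>\<^bsub>P\<^esub>"] by simp
  qed
  moreover have "h (i x) = f x" if "x \<in> carrier P" for x
    using that Ri by (intro heq) auto
  ultimately show ?thesis by blast
qed

section \<open>Automatic contractivity\<close>

lemma (in seminormed) geometric_cauchy:
  assumes X: "\<And>k. X k \<in> carrier A" and r: "0 \<le> r" "r < 1" and K: "0 \<le> K"
    and step: "\<And>k. p (X (Suc k) \<ominus> X k) \<le> K * r ^ k"
  shows "X \<in> cauchy_seqs A p"
proof -
  \<comment> \<open>The geometric sum from \<open>i\<close> to \<open>j\<close> is kept in closed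
    form, so that the induction step becomes an identity.\<close>
  have le: "p (X j \<ominus> X i) \<le> (K * r ^ i - K * r ^ j) / (1 - r)" if "i \<le> j" for i j
    using that
  proof (induction j rule: dec_induct)
    case base
    then show ?case using X by simp
  next
    case (step j)
    have "p (X (Suc j) \<ominus> X i) \<le> p (X (Suc j) \<ominus> X j) + p (X j \<ominus> X i)"
      using X by (intro p_triangle)
    also have "\<dots> \<le> K * r ^ j + (K * r ^ i - K * r ^ j) / (1 - r)"
      using assms(5)[of j] step by simp
    also have "\<dots> = (K * r ^ i - K * r ^ Suc j) / (1 - r)"
      using r by (simp add: field_simps)
    finally show ?case .
  qed
  show ?thesis
    unfolding cauchy_seqs_def
  proof (intro CollectI conjI allI impI X)
    fix e :: real assume e: "0 < e"
    have "(\<lambda>k. K / (1 - r) * r ^ k) \<longlonglongrightarrow> K / (1 - r) * 0"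
      using r by (intro tendsto_mult_left LIMSEQ_power_zero) simp
    from LIMSEQ_D[OF this e] obtain N where N: "\<And>k. k \<ge> N \<Longrightarrow> K / (1 - r) * r ^ k < e"
      using K r by auto
    have *: "p (X j \<ominus> X i) < e" if "i \<ge> N" "i \<le> j" for i j
    proof -
      have "(K * r ^ i - K * r ^ j) / (1 - r) \<le> K / (1 - r) * r ^ i"
        using K r by (simp add: divide_simps)
      with le[OF that(2)] N[OF that(1)] show ?thesis by linarith
    qed
    have "p (X i \<ominus> X j) < e" if "i \<ge> N" "j \<ge> N" for i j
      using *[of i j] *[of j i] that p_minus_commute[of "X i" "X j"] X by (cases "i \<le> j") auto
    then show "\<exists>N. \<forall>i\<ge>N. \<forall>j\<ge>N. p (X i \<ominus> X j) < e" by blast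
  qed
qed

text \<open>Banach's fixed point theorem on a subset closed under limits. Conditions such as
  self-adjointness or commutation are put into \<open>S\<close>, so that the fixed point inherits
  them.\<close>

lemma (in complete_cstar) fixed_point:
  assumes S: "S \<subseteq> carrier A" "s \<in> S" and F: "\<And>x. x \<in> S \<Longrightarrow> F x \<in> S"
    and r: "0 \<le> r" "r < 1"
    and contr: "\<And>x y. x \<in> S \<Longrightarrow> y \<in> S \<Longrightarrow> cnorm A (F x \<ominus> F y) \<le> r * cnorm A (x \<ominus> y)"
    and closed: "\<And>X l. (\<And>k. X k \<in> S) \<Longrightarrow> conv X l \<Longrightarrow> l \<in> S"
  shows "\<exists>x \<in> S. F x = x"
proof -
  define X where "X k = (F ^^ k) s" for k
  have XS: "X k \<in> S" for k by (induction k) (auto simp: X_def S F)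
  then have Xc: "X k \<in> carrier A" for k using S by blast
  have Xs: "X (Suc k) = F (X k)" for k by (simp add: X_def)
  have step: "cnorm A (X (Suc k) \<ominus> X k) \<le> cnorm A (X 1 \<ominus> X 0) * r ^ k" for k
  proof (induction k)
    case (Suc k)
    have "cnorm A (X (Suc (Suc k)) \<ominus> X (Suc k)) \<le> r * cnorm A (X (Suc k) \<ominus> X k)"
      unfolding Xs[of "Suc k"] Xs[of k] by (rule contr) (use XS F in auto)
    also have "\<dots> \<le> r * (cnorm A (X 1 \<ominus> X 0) * r ^ k)"
      using Suc r by (intro mult_left_mono)
    finally show ?case by (simp add: algebra_simps)
  qed simp
  have "X \<in> cauchy_seqs A (cnorm A)"
    by (rule geometric_cauchy[OF Xc r _ step]) (simp add: Xc)
  then obtain l where l: "conv X l" using cauchy_conv by blast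
  have lS: "l \<in> S" by (rule closed[OF XS l])
  have Fl: "F l \<in> carrier A" using F lS S by blast
  have "conv (\<lambda>k. X (Suc k)) (F l)"
    unfolding conv_def
  proof (intro conjI allI Xc Fl)
    show "(\<lambda>k. cnorm A (X (Suc k) \<ominus> F l)) \<longlonglongrightarrow> 0"
      by (rule null_squeeze[where K=r and L=0 and g="\<lambda>k. cnorm A (X k \<ominus> l)" and h="\<lambda>_. 0"])
        (use contr[OF XS lS] Xc Xc[of "Suc _"] Fl l in \<open>auto simp: Xs conv_def\<close>)
  qed
  moreover have "conv (\<lambda>k. X (Suc k)) l"
    using l LIMSEQ_Suc by (auto simp: conv_def)
  ultimately show ?thesis using conv_unique lS by blast
qed

section \<open>Cosines, sines and square roots\<close>

lemma (in seminormed) p_isometry: "u \<in> carrier A \<Longrightarrow> star A u \<otimes> u = \<one> \<Longrightarrow> p u \<le> 1"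
  using p_star_mult[of u] p_one by (metis abs_square_le_1 abs_le_iff)

context star_algebra
begin

text \<open>The mixed terms \<open>\<i> c s\<close> and \<open>- \<i> s c\<close> cancel because
  \<open>c\<close> and \<open>s\<close> commute, which leaves \<open>c^2 + s^2\<close>.\<close>

lemma unitary_cos_sin:
  assumes c: "c \<in> carrier A" "star A c = c" and s: "s \<in> carrier A" "star A s = s"
    and cs: "c \<otimes> s = s \<otimes> c" and one: "c \<otimes> c \<oplus> s \<otimes> s = \<one>"
  shows "star A (c \<oplus> \<i> \<odot> s) \<otimes> (c \<oplus> \<i> \<odot> s) = \<one>" "(c \<oplus> \<i> \<odot> s) \<otimes> star A (c \<oplus> \<i> \<odot> s) = \<one>"
proof -
  have canc: "x \<oplus> (\<i> \<odot> y \<oplus> (- \<i> \<odot> y \<oplus> z)) = x \<oplus> z" "x \<oplus> (- \<i> \<odot> y \<oplus> (\<i> \<odot> y \<oplus> z)) = x \<oplus> z"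
    if "x \<in> carrier A" "y \<in> carrier A" "z \<in> carrier A" for x y z
    using that by (simp_all add: smult_cancel flip: a_assoc[of "\<i> \<odot> y"] a_assoc[of "- \<i> \<odot> y"])
  show "star A (c \<oplus> \<i> \<odot> s) \<otimes> (c \<oplus> \<i> \<odot> s) = \<one>" "(c \<oplus> \<i> \<odot> s) \<otimes> star A (c \<oplus> \<i> \<odot> s) = \<one>"
    using c s one by (simp_all add: smult_add_right star_add star_smult l_distr r_distr smult_mult_left smult_mult_right
        smult_smult a_assoc cs canc)
qed

lemma cos_sin_halves:
  assumes "c \<in> carrier A" "star A c = c" "s \<in> carrier A" "star A s = s"
  defines "u \<equiv> c \<oplus> \<i> \<odot> s"
  shows "c = (1/2) \<odot> (u \<oplus> star A u)" "s = (-\<i>/2) \<odot> (u \<oplus> (-1) \<odot> star A u)"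
proof -
  have "u \<oplus> star A u = 2 \<odot> c \<oplus> (\<i> \<odot> s \<oplus> - \<i> \<odot> s)"
    using assms smult_add_left[of c 1 1] by (simp add: u_def star_add star_smult a_ac)
  then show "c = (1/2) \<odot> (u \<oplus> star A u)"
    using assms by (simp add: smult_smult smult_cancel)
  have "u \<oplus> (-1) \<odot> star A u = (c \<oplus> (-1) \<odot> c) \<oplus> (\<i> \<odot> s \<oplus> \<i> \<odot> s)"
    using assms by (simp add: u_def star_add star_smult smult_add_right smult_smult a_ac)
  also have "\<dots> = (2 * \<i>) \<odot> s"
    using assms smult_add_left[of s \<i> \<i>] smult_add_left[of c 1 "-1"] by simp
  finally show "s = (-\<i>/2) \<odot> (u \<oplus> (-1) \<odot> star A u)"
    using assms by (simp add: smult_smult)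
qed

end

context seminormed
begin

text \<open>Turns an algebraic identity into a bound valid for every C*-seminorm. As
  \<open>u = c + \<i> s\<close> is unitary, \<open>u\<close> and its adjoint have seminorm at most
  1; up to a factor of modulus 1, \<open>c\<close> and \<open>s\<close> are half their sum and half
  their difference.\<close>

lemma p_cos_sin:
  assumes "c \<in> carrier A" "star A c = c" "s \<in> carrier A" "star A s = s"
    and "c \<otimes> s = s \<otimes> c" "c \<otimes> c \<oplus> s \<otimes> s = \<one>"
  shows "p c \<le> 1" "p s \<le> 1"
proof -
  define u where "u = c \<oplus> \<i> \<odot> s"
  have uc [simp]: "u \<in> carrier A" using assms by (simp add: u_def)
  have u: "p u \<le> 1" "p (star A u) \<le> 1"
    using p_isometry[of u] unitary_cos_sin(1)[OF assms] by (simp_all add: u_def assms)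
  note h = cos_sin_halves[OF assms(1-4), folded u_def]
  have "p c = (1/2) * p (u \<oplus> star A u)" by (subst h(1), subst p_smult) simp_all
  also have "p (u \<oplus> star A u) \<le> p u + p (star A u)" by (rule p_add) simp_all
  finally show "p c \<le> 1" using u by simp
  have "p s = (1/2) * p (u \<oplus> (-1) \<odot> star A u)" by (subst h(2), subst p_smult) simp_all
  also have "p (u \<oplus> (-1) \<odot> star A u) \<le> p u + p ((-1) \<odot> star A u)" by (rule p_add) simp_all
  finally show "p s \<le> 1" using u by (simp add: p_smult)
qed

end

context complete_cstar
begin

text \<open>With \<open>y = 1 - z\<close> the equation \<open>y^2 = 1 - x\<close> becomes
  \<open>z = (x + z^2) / 2\<close>. On the ball of radius \<open>cnorm A x < 1\<close> the
  right-hand side is a contraction with that same ratio. Membership in \<open>S\<close> carries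
  self-adjointness, and commutation with all that commutes with \<open>x\<close>, over to
  \<open>z\<close>.\<close>

lemma sqrt_one_minus:
  assumes x: "x \<in> carrier A" "star A x = x" "cnorm A x < 1"
  shows "\<exists>y \<in> carrier A. star A y = y \<and> y \<otimes> y = \<one> \<ominus> x \<and>
    (\<forall>a \<in> carrier A. a \<otimes> x = x \<otimes> a \<longrightarrow> a \<otimes> y = y \<otimes> a)"
proof -
  let ?r = "cnorm A x"
  define S where "S = {z \<in> carrier A. cnorm A z \<le> ?r \<and> star A z = z \<and>
    (\<forall>a \<in> carrier A. a \<otimes> x = x \<otimes> a \<longrightarrow> a \<otimes> z = z \<otimes> a)}"
  define F where "F z = (1/2) \<odot> (x \<oplus> z \<otimes> z)" for z
  have "\<exists>z \<in> S. F z = z"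
  proof (rule fixed_point[where r="?r" and s=x])
    show "F z \<in> S" if z: "z \<in> S" for z
    proof -
      have zc [simp]: "z \<in> carrier A" using z by (simp add: S_def)
      have "cnorm A (F z) \<le> (1/2) * (?r + cnorm A z * cnorm A z)"
        using p_add[of x "z \<otimes> z"] p_mult[of z z] x by (simp add: F_def p_smult)
      also have "cnorm A z * cnorm A z \<le> ?r * 1"
        using z x by (intro mult_mono) (auto simp: S_def)
      finally have "cnorm A (F z) \<le> ?r" by simp
      moreover have "a \<otimes> F z = F z \<otimes> a" if a: "a \<in> carrier A" "a \<otimes> x = x \<otimes> a" for a
      proof -
        have az: "a \<otimes> z = z \<otimes> a" using z a by (simp add: S_def)
        have "a \<otimes> (z \<otimes> z) = z \<otimes> z \<otimes> a"
          by (rule commute_mult) (simp_all add: a az)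
        then show ?thesis
          using a x by (simp add: F_def smult_mult_left smult_mult_right l_distr r_distr)
      qed
      moreover have zs: "star A z = z" using z by (simp add: S_def)
      then have "star A (F z) = F z" using x by (simp add: F_def star_smult star_add star_mult)
      moreover have "F z \<in> carrier A" using x by (simp add: F_def)
      ultimately show ?thesis unfolding S_def by blast
    qed
    fix z w assume zw: "z \<in> S" "w \<in> S"
    then have c [simp]: "z \<in> carrier A" "w \<in> carrier A" by (auto simp: S_def)
    have "F z \<ominus> F w = (1/2) \<odot> (z \<otimes> z \<ominus> w \<otimes> w)"
      using x by (simp add: F_def add_minus_add flip: smult_minus)
    then have "cnorm A (F z \<ominus> F w) = (1/2) * cnorm A (z \<otimes> z \<ominus> w \<otimes> w)"
      by (simp add: p_smult)
    also have "\<dots> \<le> (1/2) * (cnorm A z * cnorm A (z \<ominus> w) + cnorm A (z \<ominus> w) * cnorm A w)"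
      using p_mult_diff[of z z w w] by simp
    also have "\<dots> \<le> (1/2) * (?r * cnorm A (z \<ominus> w) + cnorm A (z \<ominus> w) * ?r)"
      using zw by (intro mult_left_mono add_mono mult_right_mono) (auto simp: S_def)
    finally show "cnorm A (F z \<ominus> F w) \<le> ?r * cnorm A (z \<ominus> w)" by simp
  next
    fix X l assume X: "\<And>k. X k \<in> S" and l: "conv X l"
    note [simp] = conv_carrier[OF l]
    have "cnorm A l \<le> ?r"
      by (rule LIMSEQ_le_const2[OF conv_norm[OF l]]) (use X in \<open>auto simp: S_def\<close>)
    moreover have "star A l = l"
      using conv_star[OF l] X l by (intro conv_unique[of X]) (simp_all add: S_def)
    moreover have "a \<otimes> l = l \<otimes> a" if a: "a \<in> carrier A" "a \<otimes> x = x \<otimes> a" for a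
    proof (rule conv_unique)
      show "conv (\<lambda>k. a \<otimes> X k) (a \<otimes> l)" by (intro conv_mult conv_const a l)
      show "conv (\<lambda>k. a \<otimes> X k) (l \<otimes> a)"
        using conv_mult[OF l conv_const[OF a(1)]] X a by (simp add: S_def)
    qed
    ultimately show "l \<in> S" unfolding S_def using conv_carrier(2)[OF l] by blast
  qed (use x in \<open>auto simp: S_def\<close>)
  then obtain z where z: "z \<in> S" "F z = z" by blast
  then have zc [simp]: "z \<in> carrier A" by (simp add: S_def)
  have "z \<oplus> z = 2 \<odot> F z" using smult_add_left[of z 1 1] z by simp
  also have "\<dots> = x \<oplus> z \<otimes> z" using x by (simp add: F_def smult_smult)
  finally have zz: "z \<oplus> z = x \<oplus> z \<otimes> z" .
  have "(\<one> \<ominus> z) \<otimes> (\<one> \<ominus> z) = \<one> \<ominus> (z \<oplus> z) \<oplus> z \<otimes> z"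
    by (simp add: a_minus_def l_distr r_distr l_minus r_minus minus_add a_assoc)
  also have "\<dots> = \<one> \<ominus> (x \<oplus> z \<otimes> z) \<oplus> z \<otimes> z" by (simp only: zz)
  also have "\<dots> = \<one> \<ominus> x"
    using x by (simp add: a_minus_def minus_add a_assoc l_neg)
  finally have "(\<one> \<ominus> z) \<otimes> (\<one> \<ominus> z) = \<one> \<ominus> x" .
  moreover have "star A (\<one> \<ominus> z) = \<one> \<ominus> z" using z by (simp add: S_def star_minus)
  moreover have "a \<otimes> (\<one> \<ominus> z) = (\<one> \<ominus> z) \<otimes> a" if "a \<in> carrier A" "a \<otimes> x = x \<otimes> a" for a
  proof -
    have "a \<otimes> z = z \<otimes> a" using z that unfolding S_def by blast
    then show ?thesis using that(1) by (simp add: a_minus_def l_distr r_distr l_minus r_minus)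
  qed
  ultimately show ?thesis by (intro bexI[of _ "\<one> \<ominus> z"]) simp_all
qed

text \<open>\<open>y\<close> is the square root of \<open>1 - a^2\<close>. It commutes with
  \<open>a\<close> because \<open>a\<close> commutes with \<open>a^2\<close>.\<close>

lemma cos_sin_exists:
  assumes a: "a \<in> carrier A" "star A a = a" "cnorm A a < 1"
  shows "\<exists>y \<in> carrier A. star A y = y \<and> a \<otimes> y = y \<otimes> a \<and> a \<otimes> a \<oplus> y \<otimes> y = \<one> \<and> y \<otimes> y = \<one> \<ominus> a \<otimes> a"
proof -
  have "cnorm A (a \<otimes> a) = (cnorm A a)\<^sup>2" using p_star_mult[of a] a by simp
  also have "\<dots> < 1" using a by (simp add: abs_square_less_1)
  finally obtain y where y: "y \<in> carrier A" "star A y = y" "y \<otimes> y = \<one> \<ominus> a \<otimes> a"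
    "\<forall>b \<in> carrier A. b \<otimes> (a \<otimes> a) = a \<otimes> a \<otimes> b \<longrightarrow> b \<otimes> y = y \<otimes> b"
    using sqrt_one_minus[OF m_closed[OF a(1) a(1)]] star_mult[OF a(1) a(1)] unfolding a(2) by blast
  have "a \<otimes> (a \<otimes> a) = a \<otimes> a \<otimes> a" using a by (simp add: m_assoc)
  moreover have "a \<otimes> a \<oplus> y \<otimes> y = \<one>"
    unfolding y(3) using a a_lcomm[of "a \<otimes> a" \<one> "\<ominus> (a \<otimes> a)"] by (simp add: a_minus_def r_neg)
  ultimately show ?thesis using y(1-3) y(4)[rule_format, OF a(1)] by blast
qed

text \<open>A self-adjoint element of norm less than 1 is the real part of a unitary.\<close>

theorem seminorm_le_cnorm:
  assumes q: "cstar_seminorm A q" and x: "x \<in> carrier A"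
  shows "q x \<le> cnorm A x"
proof -
  interpret q: seminormed A q
    by (intro seminormed.intro seminormed_axioms.intro star_algebra_axioms q)
  \<comment> \<open>The sine was constructed with \<open>cnorm A\<close>, but the identities that it
    satisfies do not mention a norm, so \<open>p_cos_sin\<close> applies to
    \<open>q\<close>.\<close>
  have one: "q a \<le> 1" if a: "a \<in> carrier A" "star A a = a" "cnorm A a < 1" for a
    using cos_sin_exists[OF a] q.p_cos_sin(1)[OF a(1,2)] by blast
  \<comment> \<open>Every \<open>r\<close> above the norm scales \<open>a\<close> into the open unit
    ball, and \<open>r\<close> is then let tend to the norm.\<close>
  have sa: "q a \<le> cnorm A a" if a: "a \<in> carrier A" "star A a = a" for a
  proof (rule dense_ge)
    fix r assume r: "cnorm A a < r"
    then have r0: "0 < r" using p_nonneg[OF a(1)] by linarith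
    have "q (complex_of_real (1/r) \<odot> a) \<le> 1"
      using a r r0 by (intro one) (simp_all add: star_smult p_smult norm_divide)
    then show "q a \<le> r" using r0 a by (simp add: q.p_smult norm_divide field_simps)
  qed
  \<comment> \<open>The C*-identity, used for both \<open>q\<close> and \<open>cnorm A\<close>,
    reduces to a self-adjoint element.\<close>
  have "(q x)\<^sup>2 = q (star A x \<otimes> x)" using x by (simp add: q.p_star_mult)
  also have "\<dots> \<le> cnorm A (star A x \<otimes> x)" using x by (intro sa) (simp_all add: star_mult)
  also have "\<dots> = (cnorm A x)\<^sup>2" using x by (simp add: p_star_mult)
  finally show ?thesis by (rule power2_le_imp_le) (simp add: x)
qed

end

lemma cstar_seminorm_pullback:
  assumes "star_algebra A" "f \<in> star_hom A D" "seminormed D q"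
  shows "cstar_seminorm A (\<lambda>x. q (f x))"
proof -
  interpret A: star_algebra A by fact
  interpret D: seminormed D q by fact
  show ?thesis
    unfolding cstar_seminorm_def
    by (auto simp: star_homD[OF assms(2)] D.p_star_mult D.p_smult D.p_add D.p_mult)
qed

lemma pre_cstar_seminormed: "pre_cstar A \<Longrightarrow> seminormed A (cnorm A)"
  by (rule pre_cstar.axioms)

text \<open>The norm of \<open>D\<close> pulled back along \<open>f\<close> is a C*-seminorm on
  \<open>A\<close>, hence below the norm of \<open>A\<close>. Completeness is asked of the source
  only, which allows targets whose completeness is still to be proved.\<close>

lemma star_hom_contractive:
  assumes "complete_cstar A" "pre_cstar D" "f \<in> star_hom A D" "x \<in> carrier A"
  shows "cnorm D (f x) \<le> cnorm A x"
  using complete_cstar.seminorm_le_cnorm[OF assms(1) cstar_seminorm_pullback[OF _ assms(3)] assms(4)]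
    pre_cstar_seminormed[OF assms(2)] assms(1) by simp

section \<open>Images of morphisms\<close>

text \<open>The inverse of \<open>1 + x^2\<close> solves \<open>b = c + k b\<close> as soon as
  \<open>1 - k = c (1 + x^2)\<close>, and Banach's theorem applies once \<open>k\<close> has norm
  below 1. Again the side conditions on \<open>b\<close> are carried by \<open>S\<close>.\<close>

lemma (in complete_cstar) resolvent:
  assumes x: "x \<in> carrier A" "star A x = x"
  shows "\<exists>b \<in> carrier A. cnorm A b \<le> 1 \<and> star A b = b \<and> x \<otimes> b = b \<otimes> x \<and> (\<one> \<oplus> x \<otimes> x) \<otimes> b = \<one>"
proof -
  define R where "R = cnorm A x + 1"
  have R: "cnorm A x < R" "0 < R" using x by (simp_all add: R_def add_pos_nonneg add_nonneg_pos)
  \<comment> \<open>Chosen so that \<open>c + c R^2 = 1\<close>; then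
    \<open>b \<mapsto> c + k b\<close> maps the unit ball into itself.\<close>
  define c where "c = 1 / (1 + R\<^sup>2)"
  have c: "0 < c" "c * R\<^sup>2 < 1" "c + c * R\<^sup>2 = 1"
  proof -
    have "0 < 1 + R\<^sup>2" by (simp add: add_pos_nonneg)
    then show "0 < c" "c * R\<^sup>2 < 1" "c + c * R\<^sup>2 = 1" by (simp_all add: c_def divide_simps)
  qed
  define k where "k = complex_of_real c \<odot> (complex_of_real (R\<^sup>2) \<odot> \<one> \<ominus> x \<otimes> x)"
  have kc [simp]: "k \<in> carrier A" using x by (simp add: k_def)
  have ksa: "star A k = k" using x by (simp add: k_def star_smult star_minus star_mult)
  \<comment> \<open>The triangle inequality would only bound \<open>R^2 - x^2\<close> by
    \<open>R^2 + cnorm A x ^ 2\<close>, which is too large. With \<open>a = x / R\<close> this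
    element equals \<open>R^2 (1 - a^2) = R^2 y^2\<close>, and the sine \<open>y\<close> has norm at
    most 1.\<close>
  have kn: "cnorm A k \<le> c * R\<^sup>2"
  proof -
    define a where "a = complex_of_real (1 / R) \<odot> x"
    have a: "a \<in> carrier A" "star A a = a" "cnorm A a < 1"
      using x R by (simp_all add: a_def star_smult p_smult norm_divide)
    obtain y where y: "y \<in> carrier A" "star A y = y" "a \<otimes> y = y \<otimes> a" "a \<otimes> a \<oplus> y \<otimes> y = \<one>"
      "y \<otimes> y = \<one> \<ominus> a \<otimes> a"
      using cos_sin_exists[OF a] by blast
    have y1: "cnorm A y \<le> 1" using p_cos_sin(2)[OF a(1,2) y(1-4)] .
    have "x \<otimes> x = complex_of_real (R\<^sup>2) \<odot> (a \<otimes> a)"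
      using x R by (simp add: a_def smult_mult_left smult_mult_right smult_smult power2_eq_square)
    then have "k = complex_of_real c \<odot> (complex_of_real (R\<^sup>2) \<odot> (y \<otimes> y))"
      using a by (simp add: k_def y(5) smult_minus)
    then have "cnorm A k = c * R\<^sup>2 * cnorm A (y \<otimes> y)"
      using y(1-3) y(5) a c by (simp add: p_smult norm_power norm_mult)
    moreover have "cnorm A (y \<otimes> y) \<le> 1"
      using p_mult[of y y] y y1 mult_mono[of "cnorm A y" 1 "cnorm A y" 1] by simp
    ultimately show ?thesis using c(1) mult_left_mono[of "cnorm A (y \<otimes> y)" 1 "c * R\<^sup>2"] by simp
  qed
  define S where "S = {b \<in> carrier A. cnorm A b \<le> 1 \<and> star A b = b \<and> x \<otimes> b = b \<otimes> x}"
  have comm: "k \<otimes> b = b \<otimes> k" if "b \<in> S" for b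
  proof -
    have b: "b \<in> carrier A" "x \<otimes> b = b \<otimes> x" using that by (auto simp: S_def)
    have "x \<otimes> x \<otimes> b = b \<otimes> (x \<otimes> x)" 
      by (rule commute_mult[OF b(1) x(1) x(1) b(2)[symmetric] b(2)[symmetric], symmetric])
    then show ?thesis
      using b(1) x(1) by (simp add: k_def smult_mult_left smult_mult_right a_minus_def l_distr r_distr l_minus r_minus)
  qed
  define F where "F b = complex_of_real c \<odot> \<one> \<oplus> k \<otimes> b" for b
  have "\<exists>b \<in> S. F b = b"
  proof (rule fixed_point[where r="c * R\<^sup>2" and s=\<zero>])
    show "F b \<in> S" if b: "b \<in> S" for b
    proof -
      have bc [simp]: "b \<in> carrier A" using b by (simp add: S_def)
      have "cnorm A (F b) \<le> c * cnorm A \<one> + cnorm A k * cnorm A b"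
        using p_add[of "complex_of_real c \<odot> \<one>" "k \<otimes> b"] p_mult[of k b] c by (simp add: F_def p_smult)
      also have "\<dots> \<le> c * 1 + c * R\<^sup>2 * 1"
        using kn c b p_one by (intro add_mono mult_mono) (auto simp: S_def)
      also have "\<dots> = 1" using c by simp
      finally have "cnorm A (F b) \<le> 1" .
      moreover have "star A (F b) = F b"
        using comm[OF b] ksa b by (simp add: F_def star_add star_smult star_mult S_def)
      moreover have "x \<otimes> F b = F b \<otimes> x"
      proof -
        have xk: "x \<otimes> k = k \<otimes> x" 
          using x by (simp add: k_def smult_mult_left smult_mult_right a_minus_def l_distr r_distr l_minus r_minus m_assoc)
        have "x \<otimes> (k \<otimes> b) = k \<otimes> b \<otimes> x"
          using b xk x by (intro commute_mult) (simp_all add: S_def)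
        then show ?thesis using x by (simp add: F_def l_distr r_distr smult_mult_left smult_mult_right)
      qed
      moreover have "F b \<in> carrier A" by (simp add: F_def)
      ultimately show ?thesis unfolding S_def by blast
    qed
    fix b d assume "b \<in> S" "d \<in> S"
    then have [simp]: "b \<in> carrier A" "d \<in> carrier A" by (auto simp: S_def)
    have "F b \<ominus> F d = k \<otimes> (b \<ominus> d)"
      by (simp add: F_def add_minus_add mult_minus_mult)
    then show "cnorm A (F b \<ominus> F d) \<le> c * R\<^sup>2 * cnorm A (b \<ominus> d)"
      using p_mult[of k "b \<ominus> d"] mult_right_mono[OF kn, of "cnorm A (b \<ominus> d)"] by simp
  next
    fix X l assume X: "\<And>k. X k \<in> S" and l: "conv X l"
    note [simp] = conv_carrier[OF l]
    have "cnorm A l \<le> 1"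
      by (rule LIMSEQ_le_const2[OF conv_norm[OF l]]) (use X in \<open>auto simp: S_def\<close>)
    moreover have "star A l = l"
      using conv_star[OF l] X l by (intro conv_unique[of X]) (simp_all add: S_def)
    moreover have "x \<otimes> l = l \<otimes> x"
    proof (rule conv_unique)
      show "conv (\<lambda>k. x \<otimes> X k) (x \<otimes> l)" by (intro conv_mult conv_const x l)
      show "conv (\<lambda>k. x \<otimes> X k) (l \<otimes> x)"
        using conv_mult[OF l conv_const[OF x(1)]] X by (simp add: S_def)
    qed
    ultimately show "l \<in> S" unfolding S_def using conv_carrier(2)[OF l] by blast
  qed (use c x R in \<open>auto simp: S_def\<close>)
  then obtain b where b: "b \<in> S" "F b = b" by blast
  then have bc [simp]: "b \<in> carrier A" by (simp add: S_def)
  have "complex_of_real c \<odot> (\<one> \<oplus> x \<otimes> x) = \<one> \<ominus> k"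
  proof -
    have "\<one> = complex_of_real (c + c * R\<^sup>2) \<odot> \<one>" using c by simp
    also have "\<dots> = complex_of_real c \<odot> \<one> \<oplus> complex_of_real (c * R\<^sup>2) \<odot> \<one>"
      by (simp only: of_real_add smult_add_left[OF one_closed])
    finally have one: "\<one> = complex_of_real c \<odot> \<one> \<oplus> complex_of_real (c * R\<^sup>2) \<odot> \<one>" .
    have kk: "k = complex_of_real (c * R\<^sup>2) \<odot> \<one> \<ominus> complex_of_real c \<odot> (x \<otimes> x)"
      using x by (simp add: k_def smult_minus smult_smult)
    have "\<one> \<ominus> k = (complex_of_real c \<odot> \<one> \<oplus> complex_of_real (c * R\<^sup>2) \<odot> \<one>) \<ominus>
        (complex_of_real (c * R\<^sup>2) \<odot> \<one> \<ominus> complex_of_real c \<odot> (x \<otimes> x))"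
      by (rule arg_cong2[where f="a_minus A", OF one kk])
    then show ?thesis
      using x by (simp add: a_minus_def minus_add smult_add_right a_assoc r_neg2)
  qed
  moreover have "(\<one> \<ominus> k) \<otimes> b = complex_of_real c \<odot> \<one>"
  proof -
    have "(\<one> \<ominus> k) \<otimes> b = b \<ominus> k \<otimes> b" by (simp add: a_minus_def l_distr l_minus)
    also have "\<dots> = F b \<ominus> k \<otimes> b" using b by simp
    also have "\<dots> = complex_of_real c \<odot> \<one>" by (simp add: F_def a_minus_def a_assoc r_neg)
    finally show ?thesis .
  qed
  ultimately have "complex_of_real c \<odot> ((\<one> \<oplus> x \<otimes> x) \<otimes> b) = complex_of_real c \<odot> \<one>"
    using x by (simp add: smult_mult_left[symmetric])
  then have "complex_of_real (1/c) \<odot> (complex_of_real c \<odot> ((\<one> \<oplus> x \<otimes> x) \<otimes> b)) =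
      complex_of_real (1/c) \<odot> (complex_of_real c \<odot> \<one>)" by simp
  then have "(\<one> \<oplus> x \<otimes> x) \<otimes> b = \<one>"
    using c(1) x by (simp add: smult_smult)
  with b show ?thesis by (auto simp: S_def)
qed

text \<open>\<open>(1 - x\<^sup>2) / (1 + x\<^sup>2)\<close> and \<open>2 x / (1 + x\<^sup>2)\<close> are the cosine and the sine of an angle.\<close>

lemma (in seminormed) p_mult_resolvent:
  assumes x: "x \<in> carrier A" "star A x = x"
    and b: "b \<in> carrier A" "star A b = b" "x \<otimes> b = b \<otimes> x" "(\<one> \<oplus> x \<otimes> x) \<otimes> b = \<one>"
  shows "p (x \<otimes> b) \<le> 1 / 2"
proof -
  define t where "t = x \<otimes> x"
  have tc [simp]: "t \<in> carrier A" using x by (simp add: t_def)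
  define c where "c = (\<one> \<ominus> t) \<otimes> b"
  define s where "s = (x \<oplus> x) \<otimes> b"
  note [simp] = x(1) b(1)
  have tb: "t \<otimes> b = b \<otimes> t" 
    unfolding t_def using commute_mult[OF b(1) x(1) x(1) b(3)[symmetric] b(3)[symmetric]] by simp
  have xt: "x \<otimes> t = t \<otimes> x" by (simp add: t_def m_assoc)
  have tsa: "star A t = t" by (simp add: t_def star_mult x)
  have e: "(\<one> \<ominus> t) \<otimes> b = b \<otimes> (\<one> \<ominus> t)" by (simp add: a_minus_def l_distr r_distr l_minus r_minus tb)
  have e': "(\<one> \<ominus> t) \<otimes> (x \<oplus> x) = (x \<oplus> x) \<otimes> (\<one> \<ominus> t)"
    by (simp add: a_minus_def l_distr r_distr l_minus r_minus minus_add xt a_ac)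
  have f: "(x \<oplus> x) \<otimes> b = b \<otimes> (x \<oplus> x)" by (simp add: l_distr r_distr b)
  have swap: "(y \<otimes> b) \<otimes> (z \<otimes> b) = (y \<otimes> z) \<otimes> (b \<otimes> b)" if "y \<in> carrier A" "z \<in> carrier A" "z \<otimes> b = b \<otimes> z" for y z
  proof -
    have "(y \<otimes> b) \<otimes> (z \<otimes> b) = y \<otimes> (z \<otimes> b) \<otimes> b" using that by (simp add: m_assoc)
    also have "\<dots> = (y \<otimes> z) \<otimes> (b \<otimes> b)" using that(1,2) by (simp add: m_assoc)
    finally show ?thesis .
  qed
  have sw: "c \<otimes> c = (\<one> \<ominus> t) \<otimes> (\<one> \<ominus> t) \<otimes> (b \<otimes> b)" "s \<otimes> s = (x \<oplus> x) \<otimes> (x \<oplus> x) \<otimes> (b \<otimes> b)"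
    "c \<otimes> s = (\<one> \<ominus> t) \<otimes> (x \<oplus> x) \<otimes> (b \<otimes> b)" "s \<otimes> c = (x \<oplus> x) \<otimes> (\<one> \<ominus> t) \<otimes> (b \<otimes> b)"
    unfolding c_def s_def by (rule swap; simp add: e f)+
  have "c \<otimes> c \<oplus> s \<otimes> s = ((\<one> \<ominus> t) \<otimes> (\<one> \<ominus> t) \<oplus> (x \<oplus> x) \<otimes> (x \<oplus> x)) \<otimes> (b \<otimes> b)"
    unfolding sw by (rule l_distr[symmetric]) simp_all
  \<comment> \<open>The identity \<open>(1 - t)^2 + 4 t = (1 + t)^2\<close>, where
    \<open>4 t = (2 x)^2\<close>.\<close>
  also have "(\<one> \<ominus> t) \<otimes> (\<one> \<ominus> t) \<oplus> (x \<oplus> x) \<otimes> (x \<oplus> x) = (\<one> \<oplus> t) \<otimes> (\<one> \<oplus> t)"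
  proof -
    have "(x \<oplus> x) \<otimes> (x \<oplus> x) = t \<oplus> t \<oplus> t \<oplus> t" by (simp add: l_distr r_distr t_def a_assoc)
    moreover have "\<ominus> t \<oplus> (\<ominus> t \<oplus> (t \<otimes> t \<oplus> (t \<oplus> (t \<oplus> (t \<oplus> t))))) = t \<oplus> (t \<oplus> t \<otimes> t)"
    proof -
      have "\<ominus> t \<oplus> (\<ominus> t \<oplus> (t \<otimes> t \<oplus> (t \<oplus> (t \<oplus> (t \<oplus> t))))) = (\<ominus> t \<oplus> t) \<oplus> ((\<ominus> t \<oplus> t) \<oplus> (t \<oplus> (t \<oplus> t \<otimes> t)))"
        by (simp only: a_ac tc a_inv_closed m_closed a_closed)
      then show ?thesis by (simp add: l_neg)
    qed
    ultimately show ?thesis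
      by (simp add: a_minus_def l_distr r_distr l_minus r_minus minus_add a_assoc)
  qed
  also have "(\<one> \<oplus> t) \<otimes> (\<one> \<oplus> t) \<otimes> (b \<otimes> b) = \<one>"
  proof -
    have "(\<one> \<oplus> t) \<otimes> (\<one> \<oplus> t) \<otimes> (b \<otimes> b) = (\<one> \<oplus> t) \<otimes> (((\<one> \<oplus> t) \<otimes> b) \<otimes> b)"
      by (simp add: m_assoc)
    then show ?thesis using b(4) by (simp add: t_def)
  qed
  finally have "c \<otimes> c \<oplus> s \<otimes> s = \<one>" .
  moreover have "c \<otimes> s = s \<otimes> c" unfolding sw e' ..
  moreover have "star A c = c" "star A s = s" using x b e f by (simp_all add: c_def s_def star_mult star_minus star_add tsa)
  ultimately have "p s \<le> 1" by (intro p_cos_sin(2)[of c s]) (simp_all add: c_def s_def)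
  moreover have "s = 2 \<odot> (x \<otimes> b)" using smult_add_left[of "x \<otimes> b" 1 1] by (simp add: s_def l_distr)
  ultimately show ?thesis by (simp add: p_smult)
qed

section \<open>Bounded lifting along a morphism, and completeness of dense images\<close>

context
  fixes E :: "('e, 'm) cstar_scheme" and A :: "('a, 'k) cstar_scheme" and f
  assumes E: "complete_cstar E" and A: "pre_cstar A" and f: "f \<in> star_hom E A"
begin

interpretation E: complete_cstar E by (fact E)
interpretation A: pre_cstar A by (fact A)

text \<open>Splits off from \<open>x\<close> a piece of norm at most
  \<open>r = cnorm A (f x)\<close> so that the image of the rest shrinks. With
  \<open>y = x / (2 r)\<close> and \<open>b\<close> the inverse of \<open>1 + y^2\<close>, the piece
  is \<open>x b = 2 r y b\<close>, where \<open>y b\<close> has norm at most 1/2. The rest is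
  \<open>x y^2 b = x^3 b / (4 r^2)\<close>, whose image has norm at most
  \<open>r / 4\<close>.\<close>

lemma lift_step:
  assumes x: "x \<in> carrier E" "star E x = x"
  shows "\<exists>x' \<in> carrier E. star E x' = x' \<and> cnorm E (x \<ominus>\<^bsub>E\<^esub> x') \<le> cnorm A (f x) \<and>
    cnorm A (f x') \<le> cnorm A (f x) * (1/2)"
proof (cases "cnorm A (f x) = 0")
  case True
  then show ?thesis using x by (intro bexI[of _ x]) simp_all
next
  case False
  note fx [simp] = star_homD(1)[OF f]
  define r where "r = cnorm A (f x)"
  have r: "0 < r" using False x A.p_nonneg[of "f x"] unfolding r_def by (simp add: less_le del: A.p_nonneg)
  define l where "l = complex_of_real (1 / (2 * r))"
  define y where "y = l \<odot>\<^bsub>E\<^esub> x"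
  have y: "y \<in> carrier E" "star E y = y" using x by (simp_all add: y_def l_def E.star_smult)
  obtain b where b: "b \<in> carrier E" "cnorm E b \<le> 1" "star E b = b" "y \<otimes>\<^bsub>E\<^esub> b = b \<otimes>\<^bsub>E\<^esub> y"
    "(\<one>\<^bsub>E\<^esub> \<oplus>\<^bsub>E\<^esub> y \<otimes>\<^bsub>E\<^esub> y) \<otimes>\<^bsub>E\<^esub> b = \<one>\<^bsub>E\<^esub>"
    using E.resolvent[OF y] by blast
  note [simp] = x(1) b(1) y(1)
  have xy: "x = (2 * complex_of_real r) \<odot>\<^bsub>E\<^esub> y" using r x by (simp add: y_def l_def E.smult_smult)
  have xb: "x \<otimes>\<^bsub>E\<^esub> b = b \<otimes>\<^bsub>E\<^esub> x" by (simp add: xy E.smult_mult_left E.smult_mult_right b)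
  define x' where "x' = x \<ominus>\<^bsub>E\<^esub> x \<otimes>\<^bsub>E\<^esub> b"
  have x'c [simp]: "x' \<in> carrier E" by (simp add: x'_def)
  have "star E x' = x'" using x b xb by (simp add: x'_def E.star_minus E.star_mult)
  moreover have "cnorm E (x \<ominus>\<^bsub>E\<^esub> x') \<le> r"
  proof -
    have "x \<ominus>\<^bsub>E\<^esub> x' = x \<otimes>\<^bsub>E\<^esub> b"
      by (simp add: x'_def E.minus_eq_smult E.smult_add_right E.smult_smult flip: E.a_assoc)
        (simp add: E.minus_eq_smult[symmetric])
    also have "\<dots> = (2 * complex_of_real r) \<odot>\<^bsub>E\<^esub> (y \<otimes>\<^bsub>E\<^esub> b)"
      by (simp add: xy E.smult_mult_left)
    finally show ?thesis using E.p_mult_resolvent[OF y b(1,3,4,5)] r by (simp add: E.p_smult norm_mult)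
  qed
  moreover have "cnorm A (f x') \<le> r * (1/2)"
  proof -
    have "x' = x \<otimes>\<^bsub>E\<^esub> (\<one>\<^bsub>E\<^esub> \<ominus>\<^bsub>E\<^esub> b)"
      by (simp add: x'_def a_minus_def E.r_distr E.r_minus)
    also have "\<one>\<^bsub>E\<^esub> \<ominus>\<^bsub>E\<^esub> b = y \<otimes>\<^bsub>E\<^esub> y \<otimes>\<^bsub>E\<^esub> b"
      by (subst b(5)[symmetric]) (simp add: a_minus_def E.l_distr E.a_ac E.r_neg2)
    also have "x \<otimes>\<^bsub>E\<^esub> (y \<otimes>\<^bsub>E\<^esub> y \<otimes>\<^bsub>E\<^esub> b) = (l * l) \<odot>\<^bsub>E\<^esub> (x \<otimes>\<^bsub>E\<^esub> (x \<otimes>\<^bsub>E\<^esub> (x \<otimes>\<^bsub>E\<^esub> b)))"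
      by (simp add: y_def E.smult_mult_left E.smult_mult_right E.smult_smult E.m_assoc)
    finally have "cnorm A (f x') = (cmod l)\<^sup>2 * cnorm A (f x \<otimes>\<^bsub>A\<^esub> (f x \<otimes>\<^bsub>A\<^esub> (f x \<otimes>\<^bsub>A\<^esub> f b)))"
      by (simp add: star_homD[OF f] A.p_smult norm_mult power2_eq_square)
    also have "\<dots> \<le> (cmod l)\<^sup>2 * (r * (r * (r * 1)))"
    proof (intro mult_left_mono)
      have n: "cnorm A (f x \<otimes>\<^bsub>A\<^esub> z) \<le> r * d" if "z \<in> carrier A" "cnorm A z \<le> d" for z d
        using order_trans[OF A.p_mult[of "f x" z] mult_left_mono[of "cnorm A z" d "cnorm A (f x)"]] that
        by (simp add: r_def)
      have "cnorm A (f b) \<le> 1" using star_hom_contractive[OF E A f, of b] b by simp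
      then show "cnorm A (f x \<otimes>\<^bsub>A\<^esub> (f x \<otimes>\<^bsub>A\<^esub> (f x \<otimes>\<^bsub>A\<^esub> f b))) \<le> r * (r * (r * 1))"
        by (intro n) simp_all
    qed simp
    also have "\<dots> = r * (1/4)" using r by (simp add: l_def norm_divide power2_eq_square norm_mult field_simps)
    also have "\<dots> \<le> r * (1/2)" using r by (intro mult_left_mono) simp_all
    finally show ?thesis .
  qed
  ultimately show ?thesis unfolding r_def by (intro bexI[OF _ x'c]) blast
qed

text \<open>Iterating \<open>lift_step\<close> gives a Cauchy sequence starting at \<open>x\<close>
  whose limit \<open>l\<close> is annihilated by \<open>f\<close>. The pieces split off have total
  norm at most \<open>r + r/2 + r/4 + ... = 2 r\<close>, so \<open>x - l\<close> is a lift of the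
  required size.\<close>

lemma lift_self_adjoint:
  assumes x: "x \<in> carrier E" "star E x = x"
  shows "\<exists>z \<in> carrier E. f z = f x \<and> cnorm E z \<le> 2 * cnorm A (f x)"
proof -
  note [simp] = star_homD(1)[OF f]
  define r where "r = cnorm A (f x)"
  have r: "0 \<le> r" using x by (simp add: r_def)
  have "\<exists>X. \<forall>k. (X k \<in> carrier E \<and> star E (X k) = X k \<and> (k = 0 \<longrightarrow> X k = x)) \<and>
      (cnorm E (X k \<ominus>\<^bsub>E\<^esub> X (Suc k)) \<le> cnorm A (f (X k)) \<and>
       cnorm A (f (X (Suc k))) \<le> cnorm A (f (X k)) * (1/2))"
  proof (intro dependent_nat_choice)
    fix y and k :: nat assume "y \<in> carrier E \<and> star E y = y \<and> (k = 0 \<longrightarrow> y = x)"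
    then show "\<exists>y'. (y' \<in> carrier E \<and> star E y' = y' \<and> (Suc k = 0 \<longrightarrow> y' = x)) \<and>
       cnorm E (y \<ominus>\<^bsub>E\<^esub> y') \<le> cnorm A (f y) \<and> cnorm A (f y') \<le> cnorm A (f y) * (1/2)"
      using lift_step[of y] by auto
  qed (use x in auto)
  then obtain X where X [simp]: "\<And>k. X k \<in> carrier E" and X0: "X 0 = x"
    and step: "\<And>k. cnorm E (X k \<ominus>\<^bsub>E\<^esub> X (Suc k)) \<le> cnorm A (f (X k))"
    and dec: "\<And>k. cnorm A (f (X (Suc k))) \<le> cnorm A (f (X k)) * (1/2)" by blast
  have fX: "cnorm A (f (X k)) \<le> r * (1/2) ^ k" for k
  proof (induction k)
    case (Suc k)
    then show ?case using dec[of k] by simp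
  qed (simp add: X0 r_def)
  have le: "cnorm E (X (Suc k) \<ominus>\<^bsub>E\<^esub> X k) \<le> r * (1/2) ^ k" for k
    using step[of k] fX[of k] by (simp add: E.p_minus_commute[of "X (Suc k)"])
  have "X \<in> cauchy_seqs E (cnorm E)"
    by (rule E.geometric_cauchy[OF _ _ _ r le]) simp_all
  then obtain l where l: "E.conv X l" using E.cauchy_conv by blast
  note [simp] = E.conv_carrier(2)[OF l]
  \<comment> \<open>Partial sums of the geometric series, in the form that the induction
    reproduces.\<close>
  have dist: "cnorm E (x \<ominus>\<^bsub>E\<^esub> X k) \<le> 2 * r - 2 * r * (1/2) ^ k" for k
  proof (induction k)
    case (Suc k)
    have "cnorm E (x \<ominus>\<^bsub>E\<^esub> X (Suc k)) \<le> cnorm E (x \<ominus>\<^bsub>E\<^esub> X k) + cnorm E (X k \<ominus>\<^bsub>E\<^esub> X (Suc k))"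
      using x by (intro E.p_triangle) simp_all
    also have "\<dots> \<le> 2 * r - 2 * r * (1/2) ^ k + r * (1/2) ^ k"
      using Suc le[of k] by (simp add: E.p_minus_commute[of "X (Suc k)"])
    finally show ?case by simp
  qed (use x in \<open>simp add: X0\<close>)
  have "cnorm E (x \<ominus>\<^bsub>E\<^esub> l) \<le> 2 * r"
  proof (rule LIMSEQ_le_const2[OF E.conv_norm[OF E.conv_minus[OF E.conv_const[OF x(1)] l]]])
    have "cnorm E (x \<ominus>\<^bsub>E\<^esub> X k) \<le> 2 * r" for k
      using dist[of k] r by (smt (verit) mult_nonneg_nonneg zero_le_power zero_le_divide_iff)
    then show "\<exists>N. \<forall>n\<ge>N. cnorm E (x \<ominus>\<^bsub>E\<^esub> X n) \<le> 2 * r" by blast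
  qed
  moreover have "f l = \<zero>\<^bsub>A\<^esub>"
  proof (rule A.definite)
    have "cnorm A (f l) \<le> e" if e: "0 < e" for e
    proof -
      obtain N where N: "\<And>k. k \<ge> N \<Longrightarrow> cnorm E (X k \<ominus>\<^bsub>E\<^esub> l) < e / 2"
        using l LIMSEQ_D[of "\<lambda>k. cnorm E (X k \<ominus>\<^bsub>E\<^esub> l)" 0 "e/2"] e by (auto simp: E.conv_def)
      have "(\<lambda>k. r * (1/2) ^ k) \<longlonglongrightarrow> r * 0" by (intro tendsto_mult_left LIMSEQ_power_zero) simp
      from LIMSEQ_D[OF this, of "e/2"] obtain M where M: "\<And>k. k \<ge> M \<Longrightarrow> r * (1/2) ^ k < e / 2" 
        using e r by auto
      let ?k = "max N M"
      have "cnorm A (f l) \<le> cnorm A (f (X ?k)) + cnorm A (f (l \<ominus>\<^bsub>E\<^esub> X ?k))"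
        using A.p_abs_diff[of "f l" "f (X ?k)"] star_hom_minus[OF _ _ f, of l "X ?k"] E A by simp
      also have "cnorm A (f (l \<ominus>\<^bsub>E\<^esub> X ?k)) \<le> cnorm E (l \<ominus>\<^bsub>E\<^esub> X ?k)"
        by (rule star_hom_contractive[OF E A f]) simp
      finally show ?thesis using N[of ?k] M[of ?k] fX[of ?k] by (simp add: E.p_minus_commute[of l])
    qed
    then have "cnorm A (f l) \<le> 0" using field_le_epsilon[of "cnorm A (f l)" 0] by fastforce
    then show "cnorm A (f l) = 0" by (rule antisym) simp
  qed simp
  then have "f (x \<ominus>\<^bsub>E\<^esub> l) = f x"
    using star_hom_minus[OF _ _ f, of x l] E A x by simp
  ultimately show ?thesis unfolding r_def using x by (intro bexI[of _ "x \<ominus>\<^bsub>E\<^esub> l"]) simp_all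
qed

text \<open>Real and imaginary parts are lifted separately, each with constant 2.\<close>

lemma lift_bounded:
  assumes x: "x \<in> carrier E"
  shows "\<exists>z \<in> carrier E. f z = f x \<and> cnorm E z \<le> 4 * cnorm A (f x)"
proof -
  note [simp] = star_homD[OF f] x
  define a where "a = (1/2) \<odot>\<^bsub>E\<^esub> (x \<oplus>\<^bsub>E\<^esub> star E x)"
  define b where "b = (-\<i>/2) \<odot>\<^bsub>E\<^esub> (x \<oplus>\<^bsub>E\<^esub> (-1) \<odot>\<^bsub>E\<^esub> star E x)"
  have ab: "a \<in> carrier E" "b \<in> carrier E" "star E a = a" "star E b = b"
    by (simp_all add: a_def b_def E.star_smult E.star_add E.smult_add_right E.smult_smult E.a_comm)
  have x_eq: "x = a \<oplus>\<^bsub>E\<^esub> \<i> \<odot>\<^bsub>E\<^esub> b"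
  proof -
    have "a \<oplus>\<^bsub>E\<^esub> \<i> \<odot>\<^bsub>E\<^esub> b = ((1/2) \<odot>\<^bsub>E\<^esub> x \<oplus>\<^bsub>E\<^esub> (1/2) \<odot>\<^bsub>E\<^esub> x) \<oplus>\<^bsub>E\<^esub> ((1/2) \<odot>\<^bsub>E\<^esub> star E x \<oplus>\<^bsub>E\<^esub> (-1/2) \<odot>\<^bsub>E\<^esub> star E x)"
      by (simp add: a_def b_def E.smult_add_right E.smult_smult E.a_ac)
    also have "\<dots> = x"
      using E.smult_add_left[of x "1/2" "1/2"] E.smult_add_left[of "star E x" "1/2" "-1/2"] by simp
    finally show ?thesis by simp
  qed
  have n: "cnorm A (f a) \<le> cnorm A (f x)" "cnorm A (f b) \<le> cnorm A (f x)"
    using A.p_add[of "f x" "star A (f x)"] A.p_add[of "f x" "(-1) \<odot>\<^bsub>A\<^esub> star A (f x)"]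
    by (simp_all add: a_def b_def A.p_smult)
  obtain z w where z: "z \<in> carrier E" "f z = f a" "cnorm E z \<le> 2 * cnorm A (f a)"
    and w: "w \<in> carrier E" "f w = f b" "cnorm E w \<le> 2 * cnorm A (f b)"
    using lift_self_adjoint[OF ab(1,3)] lift_self_adjoint[OF ab(2,4)] by blast
  have "f (z \<oplus>\<^bsub>E\<^esub> \<i> \<odot>\<^bsub>E\<^esub> w) = f x" by (subst x_eq) (simp add: z w ab)
  moreover have "cnorm E (z \<oplus>\<^bsub>E\<^esub> \<i> \<odot>\<^bsub>E\<^esub> w) \<le> 4 * cnorm A (f x)"
    using E.p_add[of z "\<i> \<odot>\<^bsub>E\<^esub> w"] z w n by (simp add: E.p_smult)
  ultimately show ?thesis using z w by (intro bexI[of _ "z \<oplus>\<^bsub>E\<^esub> \<i> \<odot>\<^bsub>E\<^esub> w"]) simp_all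
qed

text \<open>A quantitative version of the closedness of the range of a morphism. Along a fast Cauchy
  sequence of approximants \<open>f (x k)\<close>, consecutive differences have lifts
  \<open>z k\<close> of summable norm. The partial sums of these lifts converge in \<open>E\<close>,
  and the image of their limit is the limit wanted.\<close>

theorem complete_if_dense_image:
  assumes dense: "\<And>a e. a \<in> carrier A \<Longrightarrow> 0 < e \<Longrightarrow> \<exists>x \<in> carrier E. cnorm A (a \<ominus>\<^bsub>A\<^esub> f x) < e"
  shows "complete_cstar A"
proof (rule complete_cstarI)
  note [simp] = star_homD(1)[OF f]
  show "star_algebra A" "cstar_seminorm A (cnorm A)" "\<And>x. x \<in> carrier A \<Longrightarrow> cnorm A x = 0 \<Longrightarrow> x = \<zero>\<^bsub>A\<^esub>"
    using A A.sn A.definite by auto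
  fix X assume X: "X \<in> cauchy_seqs A (cnorm A)"
  note [simp] = A.cauchy_carrier[OF X]
  define d :: "nat \<Rightarrow> real" where "d k = (1/2) ^ k" for k
  have d: "0 < d k" "d (Suc k) \<le> d k" for k by (simp_all add: d_def)
  have "\<forall>k. \<exists>N. \<forall>i\<ge>N. \<forall>j\<ge>N. cnorm A (X i \<ominus>\<^bsub>A\<^esub> X j) < d k"
    using A.cauchyD[OF X] d by blast
  then obtain N where N: "\<And>k i j. i \<ge> N k \<Longrightarrow> j \<ge> N k \<Longrightarrow> cnorm A (X i \<ominus>\<^bsub>A\<^esub> X j) < d k"
    by metis
  have "\<forall>k. \<exists>x \<in> carrier E. cnorm A (X (N k) \<ominus>\<^bsub>A\<^esub> f x) < d k"
    using dense d by simp
  then obtain x where x [simp]: "\<And>k. x k \<in> carrier E" and xd: "\<And>k. cnorm A (X (N k) \<ominus>\<^bsub>A\<^esub> f (x k)) < d k"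
    by metis
  \<comment> \<open>\<open>N\<close> is not known to be increasing; whichever of \<open>N k\<close>
    and \<open>N (Suc k)\<close> is the smaller, both indices lie beyond it.\<close>
  have NN: "cnorm A (X (N k) \<ominus>\<^bsub>A\<^esub> X (N (Suc k))) < d k" for k
    using N[of k "N k" "N (Suc k)"] N[of "Suc k" "N k" "N (Suc k)"] d(2)[of k]
    by (cases "N k \<le> N (Suc k)") auto
  \<comment> \<open>Three errors of at most \<open>d k\<close> each; \<open>lift_bounded\<close>
    turns the constant 3 into 12.\<close>
  have fx: "cnorm A (f (x (Suc k) \<ominus>\<^bsub>E\<^esub> x k)) \<le> 3 * d k" for k
  proof -
    have "cnorm A (f (x (Suc k)) \<ominus>\<^bsub>A\<^esub> f (x k)) \<le> cnorm A (f (x (Suc k)) \<ominus>\<^bsub>A\<^esub> X (N (Suc k))) + cnorm A (X (N (Suc k)) \<ominus>\<^bsub>A\<^esub> f (x k))"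
      by (rule A.p_triangle) simp_all
    moreover have "cnorm A (X (N (Suc k)) \<ominus>\<^bsub>A\<^esub> f (x k)) \<le> cnorm A (X (N (Suc k)) \<ominus>\<^bsub>A\<^esub> X (N k)) + cnorm A (X (N k) \<ominus>\<^bsub>A\<^esub> f (x k))"
      by (rule A.p_triangle) simp_all
    ultimately show ?thesis
      using xd[of k] xd[of "Suc k"] NN[of k] d(2)[of k] star_hom_minus[OF _ _ f, of "x (Suc k)" "x k"] E A
        A.p_minus_commute[of "f (x (Suc k))" "X (N (Suc k))"] A.p_minus_commute[of "X (N k)" "X (N (Suc k))"]
      by simp
  qed
  have "\<forall>k. \<exists>z \<in> carrier E. f z = f (x (Suc k) \<ominus>\<^bsub>E\<^esub> x k) \<and> cnorm E z \<le> 12 * d k"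
  proof
    fix k
    obtain z where "z \<in> carrier E" "f z = f (x (Suc k) \<ominus>\<^bsub>E\<^esub> x k)"
      "cnorm E z \<le> 4 * cnorm A (f (x (Suc k) \<ominus>\<^bsub>E\<^esub> x k))"
      using lift_bounded[of "x (Suc k) \<ominus>\<^bsub>E\<^esub> x k"] by auto
    with fx[of k] show "\<exists>z \<in> carrier E. f z = f (x (Suc k) \<ominus>\<^bsub>E\<^esub> x k) \<and> cnorm E z \<le> 12 * d k"
      by (intro bexI[of _ z]) auto
  qed
  then obtain z where z [simp]: "\<And>k. z k \<in> carrier E" and fz: "\<And>k. f (z k) = f (x (Suc k) \<ominus>\<^bsub>E\<^esub> x k)"
    and zd: "\<And>k. cnorm E (z k) \<le> 12 * d k" by metis
  define Z where "Z = rec_nat (x 0) (\<lambda>k s. s \<oplus>\<^bsub>E\<^esub> z k)"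
  have Zc [simp]: "Z k \<in> carrier E" for k by (induction k) (simp_all add: Z_def)
  have Zs: "Z (Suc k) = Z k \<oplus>\<^bsub>E\<^esub> z k" for k by (simp add: Z_def)
  have fZ: "f (Z k) = f (x k)" for k
  proof (induction k)
    case (Suc k)
    have "f (Z (Suc k)) = f (x k) \<oplus>\<^bsub>A\<^esub> (f (x (Suc k)) \<ominus>\<^bsub>A\<^esub> f (x k))"
      using star_hom_minus[OF _ _ f, of "x (Suc k)" "x k"] E A by (simp add: Zs star_homD[OF f] Suc fz)
    also have "\<dots> = f (x (Suc k))"
      by (simp add: A.add_minus_cancel)
    finally show ?case .
  qed (simp add: Z_def)
  have "Z (Suc k) \<ominus>\<^bsub>E\<^esub> Z k = z k" for k
    by (simp add: Zs E.add_minus_cancel')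
  then have "Z \<in> cauchy_seqs E (cnorm E)"
    by (intro E.geometric_cauchy[where r="1/2" and K=12]) (use zd in \<open>simp_all add: d_def\<close>)
  then obtain l where l: "E.conv Z l" using E.cauchy_conv by blast
  note [simp] = E.conv_carrier(2)[OF l]
  have "(\<lambda>k. cnorm A (X k \<ominus>\<^bsub>A\<^esub> f l)) \<longlonglongrightarrow> 0"
  proof (rule LIMSEQ_I)
    fix e :: real assume e: "0 < e"
    obtain M where M: "\<And>k. k \<ge> M \<Longrightarrow> cnorm E (Z k \<ominus>\<^bsub>E\<^esub> l) < e / 3"
      using l LIMSEQ_D[of "\<lambda>k. cnorm E (Z k \<ominus>\<^bsub>E\<^esub> l)" 0 "e/3"] e by (auto simp: E.conv_def)
    have "d \<longlonglongrightarrow> 0" unfolding d_def by (rule LIMSEQ_power_zero) simp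
    from LIMSEQ_D[OF this, of "e/3"] obtain M' where M': "\<And>k. k \<ge> M' \<Longrightarrow> d k < e / 3"
      using e by (auto simp: d_def)
    let ?k = "max M M'"
    have "cnorm A (X j \<ominus>\<^bsub>A\<^esub> f l) < e" if j: "j \<ge> N ?k" for j
    proof -
      have "cnorm A (X j \<ominus>\<^bsub>A\<^esub> f l) \<le> cnorm A (X j \<ominus>\<^bsub>A\<^esub> X (N ?k)) + cnorm A (X (N ?k) \<ominus>\<^bsub>A\<^esub> f l)"
        by (rule A.p_triangle) simp_all
      moreover have "cnorm A (X (N ?k) \<ominus>\<^bsub>A\<^esub> f l) \<le> cnorm A (X (N ?k) \<ominus>\<^bsub>A\<^esub> f (x ?k)) + cnorm A (f (x ?k) \<ominus>\<^bsub>A\<^esub> f l)"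
        by (rule A.p_triangle) simp_all
      moreover have "cnorm A (f (x ?k) \<ominus>\<^bsub>A\<^esub> f l) \<le> cnorm E (Z ?k \<ominus>\<^bsub>E\<^esub> l)"
        using star_hom_contractive[OF E A f, of "Z ?k \<ominus>\<^bsub>E\<^esub> l"] star_hom_minus[OF _ _ f, of "Z ?k" l] E A
        by (simp add: fZ)
      ultimately show ?thesis
        using N[of ?k j "N ?k"] j xd[of ?k] M[of ?k] M'[of ?k] by simp
    qed
    then show "\<exists>no. \<forall>n\<ge>no. norm (cnorm A (X n \<ominus>\<^bsub>A\<^esub> f l) - 0) < e" by auto
  qed
  then have "A.conv X (f l)" by (simp add: A.conv_def)
  then show "\<exists>l. A.conv X l" by blast
qed

end

section \<open>Generators\<close>

context star_algebra
begin

lemma star_gen_closed: 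
  assumes "G \<subseteq> carrier A" "x \<in> star_gen A G" shows "x \<in> carrier A"
  using assms(2) by induction (use assms(1) in auto)

lemma star_gen_zero: "\<zero> \<in> star_gen A G"
  using star_gen.smult[OF star_gen.one[of A G], where c=0] by simp

lemma star_gen_subset: 
  assumes "H \<subseteq> star_gen A G" "x \<in> star_gen A H" shows "x \<in> star_gen A G"
  using assms(2) by induction (use assms(1) in \<open>auto intro: star_gen.intros\<close>)

lemma star_algebra_star_gen:
  assumes "G \<subseteq> carrier A" shows "star_algebra (A\<lparr>carrier := star_gen A G\<rparr>)"
  by (rule star_algebra_if_inj[where A=A and k="\<lambda>x. x"])
    (use star_gen_closed[OF assms] star_gen_zero in \<open>auto intro: star_gen.intros star_algebra_axioms\<close>)

end

lemma star_gen_image: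
  assumes "star_algebra A" "f \<in> star_hom A D" "G \<subseteq> carrier A" "x \<in> star_gen A G"
  shows "f x \<in> star_gen D (f ` G)"
  using assms(4)
proof induction
  case one
  then show ?case using star_homD(4)[OF assms(2)] star_gen.one by metis
qed (auto simp: star_homD[OF assms(2)] star_algebra.star_gen_closed[OF assms(1,3)] intro: star_gen.intros)

lemma star_gen_eq:
  assumes "star_algebra A" "f \<in> star_hom A D" "g \<in> star_hom A D" "G \<subseteq> carrier A"
    and "\<And>x. x \<in> G \<Longrightarrow> f x = g x" "x \<in> star_gen A G"
  shows "f x = g x"
  using assms(6)
  by induction (auto simp: star_homD[OF assms(2)] star_homD[OF assms(3)] assms(5)
      star_algebra.star_gen_closed[OF assms(1,4)])

section \<open>The closed subalgebra generated by a set\<close>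

definition gen_closure :: "('a, 'm) cstar_scheme \<Rightarrow> 'a set \<Rightarrow> 'a set" where
  "gen_closure A G = {x \<in> carrier A. \<forall>e > 0. \<exists>y \<in> star_gen A G. cnorm A (x \<ominus>\<^bsub>A\<^esub> y) < e}"

lemma generates_iff: "generates_cstar A G \<longleftrightarrow> carrier A \<subseteq> gen_closure A G"
  by (auto simp: generates_cstar_def gen_closure_def)

context pre_cstar
begin

lemma gen_closure_iff:
  assumes "G \<subseteq> carrier A"
  shows "x \<in> gen_closure A G \<longleftrightarrow> (\<exists>X. (\<forall>k. X k \<in> star_gen A G) \<and> conv X x)"
proof
  assume x: "x \<in> gen_closure A G"
  then have "\<forall>k. \<exists>y \<in> star_gen A G. cnorm A (x \<ominus> y) < 1 / Suc k"
    by (simp add: gen_closure_def del: of_nat_Suc)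
  then obtain X where X: "\<And>k. X k \<in> star_gen A G" "\<And>k. cnorm A (x \<ominus> X k) < 1 / Suc k" by metis
  have "conv X x"
    by (rule conv_approx) (use X x star_gen_closed[OF assms] in \<open>auto simp: gen_closure_def p_minus_commute\<close>)
  with X show "\<exists>X. (\<forall>k. X k \<in> star_gen A G) \<and> conv X x" by blast
next
  assume "\<exists>X. (\<forall>k. X k \<in> star_gen A G) \<and> conv X x"
  then obtain X where X: "\<And>k. X k \<in> star_gen A G" "conv X x" by blast
  show "x \<in> gen_closure A G"
    unfolding gen_closure_def
  proof (intro CollectI conjI allI impI)
    fix e :: real assume "0 < e"
    then obtain k where "cnorm A (X k \<ominus> x) < e"
      using X(2) LIMSEQ_D[of "\<lambda>k. cnorm A (X k \<ominus> x)" 0 e] by (auto simp: conv_def)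
    then show "\<exists>y\<in>star_gen A G. cnorm A (x \<ominus> y) < e"
      using X conv_carrier[OF X(2)] by (intro bexI[of _ "X k"]) (auto simp: p_minus_commute)
  qed (rule conv_carrier(2)[OF X(2)])
qed

text \<open>The closure of a *-subalgebra is closed under the operations, because they are
  continuous, so generating from it and closing again adds nothing.\<close>

lemma gen_closure_trans:
  assumes G: "G \<subseteq> carrier A" and H: "H \<subseteq> gen_closure A G" and x: "x \<in> gen_closure A H"
  shows "x \<in> gen_closure A G"
proof -
  have Hc: "H \<subseteq> carrier A" using H by (auto simp: gen_closure_def)
  have gen: "y \<in> gen_closure A G" if "y \<in> star_gen A H" for y
    using that
  proof induction
    case (gen x)
    then show ?case using H by auto
  next
    case one
    then show ?case unfolding gen_closure_iff[OF G]
      by (intro exI[of _ "\<lambda>_. \<one>"]) (auto intro: star_gen.one conv_const)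
  next
    case (add x y)
    then obtain X Y where "\<forall>k. X k \<in> star_gen A G" "conv X x" "\<forall>k. Y k \<in> star_gen A G" "conv Y y"
      unfolding gen_closure_iff[OF G] by blast
    then show ?case unfolding gen_closure_iff[OF G]
      by (intro exI[of _ "\<lambda>k. X k \<oplus> Y k"]) (simp add: star_gen.add conv_add)
  next
    case (mult x y)
    then obtain X Y where "\<forall>k. X k \<in> star_gen A G" "conv X x" "\<forall>k. Y k \<in> star_gen A G" "conv Y y"
      unfolding gen_closure_iff[OF G] by blast
    then show ?case unfolding gen_closure_iff[OF G]
      by (intro exI[of _ "\<lambda>k. X k \<otimes> Y k"]) (simp add: star_gen.mult conv_mult)
  next
    case (smult x c)
    then obtain X where "\<forall>k. X k \<in> star_gen A G" "conv X x"
      unfolding gen_closure_iff[OF G] by blast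
    then show ?case unfolding gen_closure_iff[OF G]
      by (intro exI[of _ "\<lambda>k. c \<odot> X k"]) (simp add: star_gen.smult conv_smult)
  next
    case (star x)
    then obtain X where "\<forall>k. X k \<in> star_gen A G" "conv X x"
      unfolding gen_closure_iff[OF G] by blast
    then show ?case unfolding gen_closure_iff[OF G]
      by (intro exI[of _ "\<lambda>k. star A (X k)"]) (simp add: star_gen.star conv_star)
  qed
  show ?thesis
    unfolding gen_closure_def
  proof (intro CollectI conjI allI impI)
    show xc: "x \<in> carrier A" using x by (simp add: gen_closure_def)
    fix e :: real assume "0 < e"
    then have e: "0 < e / 2" by simp
    obtain y where y: "y \<in> star_gen A H" "cnorm A (x \<ominus> y) < e / 2"
      using x e unfolding gen_closure_def by blast
    obtain z where z: "z \<in> star_gen A G" "cnorm A (y \<ominus> z) < e / 2"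
      using gen[OF y(1)] e unfolding gen_closure_def by blast
    have "cnorm A (x \<ominus> z) < e"
      using p_triangle[of x y z] xc y z star_gen_closed[OF G z(1)] star_gen_closed[OF Hc y(1)] by simp
    with z(1) show "\<exists>y\<in>star_gen A G. cnorm A (x \<ominus> y) < e" by blast
  qed
qed

lemma star_gen_in_closure: "G \<subseteq> carrier A \<Longrightarrow> x \<in> star_gen A G \<Longrightarrow> x \<in> gen_closure A G"
  unfolding gen_closure_iff
  by (intro exI[of _ "\<lambda>_. x"]) (auto intro: conv_const star_gen_closed)

lemma generates_cstar_trans:
  assumes "generates_cstar A H" "G \<subseteq> carrier A" "H \<subseteq> gen_closure A G"
  shows "generates_cstar A G"
  using assms gen_closure_trans by (auto simp: generates_iff)

end

lemma contraction_conv: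
  assumes A: "complete_cstar A" and D: "pre_cstar D" and f: "f \<in> star_hom A D"
    and X: "seminormed.conv A (cnorm A) X x"
  shows "seminormed.conv D (cnorm D) (\<lambda>k. f (X k)) (f x)"
proof -
  interpret A: complete_cstar A by fact
  interpret D: pre_cstar D by fact
  note c = A.conv_carrier[OF X]
  have "(\<lambda>k. cnorm D (f (X k) \<ominus>\<^bsub>D\<^esub> f x)) \<longlonglongrightarrow> 0"
  proof (rule tendsto_sandwich[OF _ _ tendsto_const])
    show "\<forall>\<^sub>F k in sequentially. cnorm D (f (X k) \<ominus>\<^bsub>D\<^esub> f x) \<le> cnorm A (X k \<ominus>\<^bsub>A\<^esub> x)"
    proof (intro always_eventually allI)
      fix k
      show "cnorm D (f (X k) \<ominus>\<^bsub>D\<^esub> f x) \<le> cnorm A (X k \<ominus>\<^bsub>A\<^esub> x)"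
        using star_hom_contractive[OF A D f, of "X k \<ominus>\<^bsub>A\<^esub> x"] star_hom_minus[OF _ _ f, of "X k" x] A D c 
        by simp
    qed
    show "(\<lambda>k. cnorm A (X k \<ominus>\<^bsub>A\<^esub> x)) \<longlonglongrightarrow> 0" using X by (simp add: A.conv_def)
  qed (use c star_homD(1)[OF f] in \<open>auto intro!: always_eventually D.p_nonneg\<close>)
  with c show ?thesis by (simp add: D.conv_def star_homD[OF f])
qed

text \<open>Morphisms are continuous by \<open>star_hom_contractive\<close>, so agreement spreads
  from \<open>G\<close> to the *-algebra that it generates and from there to limits.\<close>

theorem star_hom_eqI:
  assumes A: "complete_cstar A" and D: "pre_cstar D" and fg: "f \<in> star_hom A D" "g \<in> star_hom A D"
    and G: "G \<subseteq> carrier A" "generates_cstar A G" "\<And>x. x \<in> G \<Longrightarrow> f x = g x"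
    and x: "x \<in> carrier A"
  shows "f x = g x"
proof -
  interpret A: complete_cstar A by fact
  interpret D: pre_cstar D by fact
  obtain X where X: "\<And>k. X k \<in> star_gen A G" "A.conv X x"
    using G(2) x A.gen_closure_iff[OF G(1), of x] unfolding generates_iff by blast
  have "f (X k) = g (X k)" for k
    by (rule star_gen_eq[OF A.star_algebra_axioms fg G(1) G(3) X(1)])
  then show ?thesis
    using contraction_conv[OF A D fg(1) X(2)] contraction_conv[OF A D fg(2) X(2)] D.conv_unique by simp
qed

lemma star_hom_gen_closure:
  assumes A: "complete_cstar A" and D: "pre_cstar D" and f: "f \<in> star_hom A D"
    and G: "G \<subseteq> carrier A" "generates_cstar A G" and H: "H \<subseteq> carrier D" "f ` G \<subseteq> star_gen D H"
    and x: "x \<in> carrier A"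
  shows "f x \<in> gen_closure D H"
proof -
  interpret A: complete_cstar A by fact
  interpret D: pre_cstar D by fact
  obtain X where X: "\<And>k. X k \<in> star_gen A G" "A.conv X x"
    using G(2) x A.gen_closure_iff[OF G(1), of x] unfolding generates_iff by blast
  have "f (X k) \<in> star_gen D H" for k
    by (rule D.star_gen_subset[OF H(2) star_gen_image[OF A.star_algebra_axioms f G(1) X(1)]])
  then show ?thesis
    using contraction_conv[OF A D f X(2)] unfolding D.gen_closure_iff[OF H(1)]
    by (intro exI[of _ "\<lambda>k. f (X k)"]) simp
qed

section \<open>Opposite algebras and the complex numbers\<close>

lemma opposite_simps [simp]:
  "carrier (opposite A) = carrier A" "\<one>\<^bsub>opposite A\<^esub> = \<one>\<^bsub>A\<^esub>" "\<zero>\<^bsub>opposite A\<^esub> = \<zero>\<^bsub>A\<^esub>"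
  "x \<oplus>\<^bsub>opposite A\<^esub> y = x \<oplus>\<^bsub>A\<^esub> y" "x \<otimes>\<^bsub>opposite A\<^esub> y = y \<otimes>\<^bsub>A\<^esub> x" "c \<odot>\<^bsub>opposite A\<^esub> x = c \<odot>\<^bsub>A\<^esub> x"
  "star (opposite A) = star A"
  by (simp_all add: opposite_def)

lemma cnorm_opposite [simp]: "cnorm (opposite A) = cnorm A"
  by (simp add: opposite_def)

lemma star_algebra_opposite:
  assumes "star_algebra A" shows "star_algebra (opposite A)"
proof -
  interpret star_algebra A by fact
  show ?thesis
    by (rule star_algebraI) (simp_all add: a_ac m_assoc l_distr r_distr smult_add_left smult_add_right
        smult_mult_left smult_mult_right star_add star_mult star_smult smult_smult)
qed

lemma opposite_minus:
  assumes "star_algebra A" "x \<in> carrier A" "y \<in> carrier A"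
  shows "x \<ominus>\<^bsub>opposite A\<^esub> y = x \<ominus>\<^bsub>A\<^esub> y"
  using assms star_algebra.minus_eq_smult[OF assms] 
    star_algebra.minus_eq_smult[OF star_algebra_opposite[OF assms(1)], of x y] by simp

lemma complete_cstar_opposite:
  assumes "complete_cstar A" shows "complete_cstar (opposite A)"
proof -
  interpret complete_cstar A by fact
  have sa: "star_algebra (opposite A)" by (rule star_algebra_opposite) (rule star_algebra_axioms)
  \<comment> \<open>The C*-identity of \<open>opposite A\<close> concerns
    \<open>x \<otimes> star A x\<close>; it is the one of \<open>A\<close> for the adjoint of
    \<open>x\<close>.\<close>
  have m: "x \<otimes>\<^bsub>A\<^esub> star A x \<in> carrier A" "cnorm A (x \<otimes>\<^bsub>A\<^esub> star A x) = (cnorm A x)\<^sup>2" if "x \<in> carrier A" for x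
    using p_star_mult[of "star A x"] that by simp_all
  have m': "cnorm A (y \<otimes>\<^bsub>A\<^esub> x) \<le> cnorm A x * cnorm A y" if "x \<in> carrier A" "y \<in> carrier A" for x y
    using p_mult[of y x] that by (simp add: mult.commute)
  have sn': "cstar_seminorm (opposite A) (cnorm A)"
    unfolding cstar_seminorm_def using m m' by (simp add: p_smult p_add)
  interpret o: seminormed "opposite A" "cnorm A"
    by (intro seminormed.intro seminormed_axioms.intro sa sn')
  show ?thesis
  proof (rule complete_cstarI)
    fix X assume X: "X \<in> cauchy_seqs (opposite A) (cnorm (opposite A))"
    then have "X k \<in> carrier A" for k by (simp add: cauchy_seqs_def)
    then have "X i \<ominus>\<^bsub>opposite A\<^esub> X j = X i \<ominus>\<^bsub>A\<^esub> X j" for i j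
      by (intro opposite_minus star_algebra_axioms)
    with X have "X \<in> cauchy_seqs A (cnorm A)" by (simp add: cauchy_seqs_def)
    from cauchy_conv[OF this] obtain l where "conv X l" ..
    then have "o.conv X l"
      using opposite_minus[OF star_algebra_axioms] by (simp add: conv_def o.conv_def)
    then show "\<exists>l. seminormed.conv (opposite A) (cnorm (opposite A)) X l" by auto
  qed (use sa sn' definite in auto)
qed

lemma complex_cstar_simps [simp]:
  "carrier complex_cstar = UNIV" "\<one>\<^bsub>complex_cstar\<^esub> = 1" "\<zero>\<^bsub>complex_cstar\<^esub> = 0"
  "x \<oplus>\<^bsub>complex_cstar\<^esub> y = x + y" "x \<otimes>\<^bsub>complex_cstar\<^esub> y = x * y" "c \<odot>\<^bsub>complex_cstar\<^esub> x = c * x"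
  "star complex_cstar = cnj" "cnorm complex_cstar = cmod"
  by (simp_all add: complex_cstar_def)

lemma star_algebra_complex: "star_algebra complex_cstar"
  by (rule star_algebraI) (simp_all add: algebra_simps)

lemma complex_cstar_minus: "x \<ominus>\<^bsub>complex_cstar\<^esub> y = x - y"
  by (simp add: star_algebra.minus_eq_smult[OF star_algebra_complex])

lemma complete_cstar_complex: "complete_cstar complex_cstar"
proof -
  have sn': "cstar_seminorm complex_cstar cmod"
    by (simp add: cstar_seminorm_def norm_mult norm_triangle_ineq power2_eq_square)
  interpret seminormed complex_cstar cmod
    by (intro seminormed.intro seminormed_axioms.intro star_algebra_complex sn')
  show ?thesis
  proof (rule complete_cstarI)
    fix X assume "X \<in> cauchy_seqs complex_cstar (cnorm complex_cstar)"
    then have "Cauchy X" by (auto simp: cauchy_seqs_def complex_cstar_minus Cauchy_iff)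
    then obtain l where "X \<longlonglongrightarrow> l" using Cauchy_convergent convergent_def by blast
    then have "(\<lambda>k. cmod (X k - l)) \<longlonglongrightarrow> 0" by (rule tendsto_norm_zero[OF LIM_zero])
    then show "\<exists>l. seminormed.conv complex_cstar (cnorm complex_cstar) X l"
      by (auto simp: conv_def complex_cstar_minus)
  qed (use star_algebra_complex sn' in auto)
qed

section \<open>Universal C*-algebras\<close>

text \<open>\<open>bounded\<close> makes the \<open>Sup\<close> in \<open>universal_seminorm\<close>
  a genuine supremum.\<close>

locale universal = star_algebra P for P :: "('a, 'm) star_alg_scheme" (structure) +
  fixes R :: "'a set"
  assumes bounded: "x \<in> carrier P \<Longrightarrow>
    \<exists>K. \<forall>p. cstar_seminorm P p \<and> (\<forall>r \<in> R. p r = 0) \<longrightarrow> p x \<le> K"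
begin

abbreviation "adm p \<equiv> cstar_seminorm P p \<and> (\<forall>r \<in> R. p r = 0)"
abbreviation "us \<equiv> universal_seminorm P R"

lemma us_upper: 
  assumes "adm p" "x \<in> carrier P" shows "p x \<le> us x"
  unfolding universal_seminorm_def
proof (rule cSup_upper)
  obtain K where "\<And>p. adm p \<Longrightarrow> p x \<le> K" using bounded[OF assms(2)] by blast
  then show "bdd_above {p x |p. adm p}" by (auto simp: bdd_above_def)
qed (use assms in blast)

text \<open>Supplies a member of the set whose supremum is taken, as \<open>cSup_least\<close>
  demands.\<close>

lemma adm_zero: "adm (\<lambda>_. 0)"
  by (simp add: cstar_seminorm_def)

lemma us_least: 
  assumes "\<And>p. adm p \<Longrightarrow> p x \<le> K" shows "us x \<le> K"
  unfolding universal_seminorm_def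
  by (rule cSup_least) (use assms adm_zero in blast)+

lemma us_vanishes: "r \<in> R \<Longrightarrow> r \<in> carrier P \<Longrightarrow> us r = 0"
  using us_upper[OF adm_zero, of r] us_least[of r 0] by force

text \<open>Each axiom passes from the admissible seminorms to their supremum. The C*-identity does
  so because squaring is monotone on nonnegative numbers; one of its two inequalities is obtained
  after taking square roots.\<close>

lemma cstar_seminorm_us: "cstar_seminorm P us"
proof -
  have sem: "seminormed P p" if "adm p" for p
    using that by (intro seminormed.intro seminormed_axioms.intro star_algebra_axioms) blast
  have nonneg: "0 \<le> us x" if "x \<in> carrier P" for x
    using us_upper[OF adm_zero that] by simp
  have smult_le: "us (c \<odot> x) \<le> cmod c * us x" if x: "x \<in> carrier P" for c x
  proof (rule us_least)
    fix p assume p: "adm p"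
    interpret seminormed P p by (rule sem[OF p])
    show "p (c \<odot> x) \<le> cmod c * us x" using x us_upper[OF p x] by (simp add: p_smult mult_left_mono)
  qed
  show ?thesis
    unfolding cstar_seminorm_def
  proof (intro ballI conjI allI)
    fix x assume x: "x \<in> carrier P"
    then show "0 \<le> us x" by (rule nonneg)
    show "us (star P x \<otimes> x) = (us x)\<^sup>2"
    proof (rule antisym)
      show "us (star P x \<otimes> x) \<le> (us x)\<^sup>2"
      proof (rule us_least)
        fix p assume p: "adm p"
        interpret seminormed P p by (rule sem[OF p])
        show "p (star P x \<otimes> x) \<le> (us x)\<^sup>2" using x us_upper[OF p x] by (simp add: p_star_mult power_mono)
      qed
      have "us x \<le> sqrt (us (star P x \<otimes> x))"
      proof (rule us_least)
        fix p assume p: "adm p"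
        interpret seminormed P p by (rule sem[OF p])
        show "p x \<le> sqrt (us (star P x \<otimes> x))" using x us_upper[OF p, of "star P x \<otimes> x"]
          by (intro real_le_rsqrt) (simp add: p_star_mult)
      qed
      then show "(us x)\<^sup>2 \<le> us (star P x \<otimes> x)"
        using nonneg[OF x] nonneg[of "star P x \<otimes> x"] x
        by (metis m_closed power_mono real_sqrt_pow2 star_closed)
    qed
    \<comment> \<open>One inequality is \<open>smult_le\<close> for \<open>c\<close>, the other is
      \<open>smult_le\<close> for the inverse of \<open>c\<close>.\<close>
    show "us (c \<odot> x) = cmod c * us x" for c
    proof (cases "c = 0")
      case True
      then show ?thesis using smult_le[OF x, of 0] nonneg[of \<zero>] x by simp
    next
      case False
      have "us x = us (inverse c \<odot> (c \<odot> x))" using False x by (simp add: smult_smult)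
      also have "\<dots> \<le> cmod (inverse c) * us (c \<odot> x)" using x by (intro smult_le) simp
      finally have "cmod c * us x \<le> us (c \<odot> x)" using False by (simp add: norm_divide divide_simps mult.commute)
      with smult_le[OF x] show ?thesis by (intro antisym) simp_all
    qed
    fix y assume y: "y \<in> carrier P"
    show "us (x \<oplus> y) \<le> us x + us y"
    proof (rule us_least)
      fix p assume p: "adm p"
      interpret seminormed P p by (rule sem[OF p])
      show "p (x \<oplus> y) \<le> us x + us y" using p_add[OF x y] us_upper[OF p x] us_upper[OF p y] by simp
    qed
    show "us (x \<otimes> y) \<le> us x * us y"
    proof (rule us_least)
      fix p assume p: "adm p"
      interpret seminormed P p by (rule sem[OF p])
      have "p x * p y \<le> us x * us y"
        using us_upper[OF p x] us_upper[OF p y] nonneg x y by (intro mult_mono) simp_all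
      then show "p (x \<otimes> y) \<le> us x * us y" using p_mult[OF x y] by simp
    qed
  qed
qed

sublocale us: seminormed P us
  by unfold_locales (rule cstar_seminorm_us)

lemma complete_cstar_universal: "complete_cstar (universal_cstar P R)"
  unfolding universal_cstar_def by (rule us.complete_cstar_completion)

lemma universal_map_emb: "universal_map P R x = us.emb x"
  by (simp add: universal_map_def us.emb_def)

lemma universal_map_star_hom: "universal_map P R \<in> star_hom P (universal_cstar P R)"
  using us.emb_star_hom star_hom_cong[OF star_algebra_axioms] 
  unfolding universal_cstar_def universal_map_emb by blast

lemma cnorm_universal_map: "x \<in> carrier P \<Longrightarrow> cnorm (universal_cstar P R) (universal_map P R x) = us x"
  unfolding universal_cstar_def universal_map_emb by (rule us.cnorm_emb)

lemma universal_map_vanishes: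
  assumes "r \<in> R" "r \<in> carrier P" shows "universal_map P R r = \<zero>\<^bsub>universal_cstar P R\<^esub>"
  by (rule pre_cstar.definite)
    (use assms cnorm_universal_map us_vanishes complete_cstar_universal star_homD[OF universal_map_star_hom] in auto)

lemma universal_map_dense:
  "S \<in> carrier (universal_cstar P R) \<Longrightarrow> 0 < e \<Longrightarrow>
    \<exists>x \<in> carrier P. cnorm (universal_cstar P R) (S \<ominus>\<^bsub>universal_cstar P R\<^esub> universal_map P R x) < e"
  unfolding universal_cstar_def universal_map_emb by (rule us.emb_dense)

text \<open>The norm of \<open>D\<close> pulled back along \<open>f\<close> is admissible, hence
  dominated by the universal seminorm, so \<open>f\<close> extends by continuity.\<close>

theorem universal_extension:
  assumes D: "complete_cstar D" and f: "f \<in> star_hom P D" and R: "\<And>r. r \<in> R \<Longrightarrow> f r = \<zero>\<^bsub>D\<^esub>"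
  shows "\<exists>h \<in> star_hom (universal_cstar P R) D. \<forall>x \<in> carrier P. h (universal_map P R x) = f x"
proof (rule extend_contraction)
  interpret D: complete_cstar D by fact
  fix x assume x: "x \<in> carrier P"
  have "adm (\<lambda>x. cnorm D (f x))"
    using cstar_seminorm_pullback[OF star_algebra_axioms f D.seminormed_axioms] R by simp
  from us_upper[OF this x] show "cnorm D (f x) \<le> cnorm (universal_cstar P R) (universal_map P R x)"
    by (simp add: cnorm_universal_map x)
qed (use complete_cstar_universal universal_map_star_hom universal_map_dense f D star_algebra_axioms in auto)

lemma generates_universal:
  assumes G: "G \<subseteq> carrier P" "carrier P \<subseteq> star_gen P G"
  shows "generates_cstar (universal_cstar P R) (universal_map P R ` G)"
  unfolding generates_cstar_def
proof (intro ballI allI impI)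
  fix S and e :: real assume "S \<in> carrier (universal_cstar P R)" "0 < e"
  from universal_map_dense[OF this] obtain x where x: "x \<in> carrier P"
    "cnorm (universal_cstar P R) (S \<ominus>\<^bsub>universal_cstar P R\<^esub> universal_map P R x) < e" by blast
  then show "\<exists>y\<in>star_gen (universal_cstar P R) (universal_map P R ` G).
      cnorm (universal_cstar P R) (S \<ominus>\<^bsub>universal_cstar P R\<^esub> y) < e"
    using star_gen_image[OF star_algebra_axioms universal_map_star_hom G(1), of x] G(2) by blast
qed

end

text \<open>Elements on which all admissible seminorms have a common bound are closed under the
  *-algebra operations, so generators decide.\<close>

lemma universalI:
  fixes P :: "('a, 'm) star_alg_scheme" (structure)
  assumes P: "star_algebra P" and G: "G \<subseteq> carrier P" "carrier P \<subseteq> star_gen P G"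
    and bounded: "\<And>g. g \<in> G \<Longrightarrow> \<exists>K. \<forall>p. cstar_seminorm P p \<and> (\<forall>r \<in> R. p r = 0) \<longrightarrow> p g \<le> K"
  shows "universal P R"
proof -
  interpret star_algebra P by fact
  let ?adm = "\<lambda>p. cstar_seminorm P p \<and> (\<forall>r \<in> R. p r = 0)"
  have sem: "seminormed P p" if "?adm p" for p
    using that by (intro seminormed.intro seminormed_axioms.intro star_algebra_axioms) blast
  have "\<exists>K. \<forall>p. ?adm p \<longrightarrow> p x \<le> K" if "x \<in> star_gen P G" for x
    using that
  proof induction
    case (gen x)
    then show ?case by (rule bounded)
  next
    case one
    show ?case using seminormed.p_one[OF sem] by blast
  next
    case (add x y)
    then obtain K L where *: "\<forall>p. ?adm p \<longrightarrow> p x \<le> K" "\<forall>p. ?adm p \<longrightarrow> p y \<le> L" by blast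
    show ?case
    proof (intro exI[of _ "K + L"] allI impI)
      fix p assume p: "?adm p"
      show "p (x \<oplus> y) \<le> K + L"
        using * p seminormed.p_add[OF sem[OF p], of x y] add.hyps star_gen_closed[OF G(1)] by fastforce
    qed
  next
    case (mult x y)
    then obtain K L where *: "\<forall>p. ?adm p \<longrightarrow> p x \<le> K" "\<forall>p. ?adm p \<longrightarrow> p y \<le> L" by blast
    show ?case
    proof (intro exI[of _ "K * L"] allI impI)
      fix p assume p: "?adm p"
      interpret seminormed P p by (rule sem[OF p])
      note c = mult.hyps[THEN star_gen_closed[OF G(1)]]
      have "p x * p y \<le> K * L" 
        using *(1)[rule_format, OF p] *(2)[rule_format, OF p] p_nonneg[OF c(1)] p_nonneg[OF c(2)]
        by (intro mult_mono) linarith+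
      then show "p (x \<otimes> y) \<le> K * L" using p_mult[OF c] by simp
    qed
  next
    case (smult x c)
    then obtain K where *: "\<forall>p. ?adm p \<longrightarrow> p x \<le> K" by blast
    show ?case
    proof (intro exI[of _ "cmod c * K"] allI impI)
      fix p assume p: "?adm p"
      interpret seminormed P p by (rule sem[OF p])
      show "p (c \<odot> x) \<le> cmod c * K"
        using *[rule_format, OF p] p_smult[OF star_gen_closed[OF G(1) smult.hyps]] by (simp add: mult_left_mono)
    qed
  next
    case (star x)
    then obtain K where *: "\<forall>p. ?adm p \<longrightarrow> p x \<le> K" by blast
    show ?case
    proof (intro exI[of _ K] allI impI)
      fix p assume p: "?adm p"
      interpret seminormed P p by (rule sem[OF p])
      show "p (star P x) \<le> K" using *[rule_format, OF p] p_star[OF star_gen_closed[OF G(1) star.hyps]] by simp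
    qed
  qed
  then show ?thesis
    using G(2) by unfold_locales blast
qed

section \<open>Algebras of involutive monoids\<close>

lemma star_gen_image_converse:
  assumes "star_algebra A" "f \<in> star_hom A D" "G \<subseteq> carrier A" "y \<in> star_gen D (f ` G)"
  shows "\<exists>x \<in> star_gen A G. y = f x"
  using assms(4)
proof induction
  case one
  then show ?case using star_homD(4)[OF assms(2)] star_gen.one by metis
next
  case (star x)
  then obtain a where "a \<in> star_gen A G" "x = f a" by blast
  then show ?case
    by (intro bexI[of _ "star A a"] star_gen.star) (simp_all add: star_homD[OF assms(2)] star_algebra.star_gen_closed[OF assms(1,3)])
next
  case (smult x z)
  then obtain a where "a \<in> star_gen A G" "x = f a" by blast
  then show ?case
    by (intro bexI[of _ "z \<odot>\<^bsub>A\<^esub> a"] star_gen.smult) (simp_all add: star_homD[OF assms(2)] star_algebra.star_gen_closed[OF assms(1,3)])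
next
  case (add x y)
  then obtain a b where "a \<in> star_gen A G" "x = f a" "b \<in> star_gen A G" "y = f b" by blast
  then show ?case
    by (intro bexI[of _ "a \<oplus>\<^bsub>A\<^esub> b"] star_gen.add) (simp_all add: star_homD[OF assms(2)] star_algebra.star_gen_closed[OF assms(1,3)])
next
  case (mult x y)
  then obtain a b where "a \<in> star_gen A G" "x = f a" "b \<in> star_gen A G" "y = f b" by blast
  then show ?case
    by (intro bexI[of _ "a \<otimes>\<^bsub>A\<^esub> b"] star_gen.mult) (simp_all add: star_homD[OF assms(2)] star_algebra.star_gen_closed[OF assms(1,3)])
qed (auto intro: star_gen.gen)

text \<open>The linear extension of \<open>\<phi>\<close> from points to finitely supported
  functions, evaluated at \<open>f\<close>. Convolution and involution are expressed through it, so
  that the axioms turn into rearrangements of nested \<open>lin\<close>.\<close>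

definition lin :: "('a \<Rightarrow> complex) \<Rightarrow> ('a \<Rightarrow> complex) \<Rightarrow> complex" where
  "lin f \<phi> = (\<Sum>x \<in> supp f. f x * \<phi> x)"

lemma lin_superset: "finite S \<Longrightarrow> supp f \<subseteq> S \<Longrightarrow> lin f \<phi> = (\<Sum>x \<in> S. f x * \<phi> x)"
  unfolding lin_def by (rule sum.mono_neutral_left) (auto simp: supp_def)

lemma lin_add_left:
  assumes "finite (supp f)" "finite (supp g)"
  shows "lin (\<lambda>z. f z + g z) \<phi> = lin f \<phi> + lin g \<phi>"
proof -
  let ?S = "supp f \<union> supp g"
  have "lin (\<lambda>z. f z + g z) \<phi> = (\<Sum>x \<in> ?S. (f x + g x) * \<phi> x)"
    using assms by (intro lin_superset) (auto simp: supp_def)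
  also have "\<dots> = (\<Sum>x \<in> ?S. f x * \<phi> x) + (\<Sum>x \<in> ?S. g x * \<phi> x)"
    by (simp add: distrib_right sum.distrib)
  finally show ?thesis using assms by (simp add: lin_superset[of ?S])
qed

lemma lin_smult_left: 
  assumes "finite (supp f)" shows "lin (\<lambda>z. c * f z) \<phi> = c * lin f \<phi>"
proof -
  have "lin (\<lambda>z. c * f z) \<phi> = (\<Sum>x \<in> supp f. c * f x * \<phi> x)"
    using assms by (intro lin_superset) (auto simp: supp_def)
  then show ?thesis by (simp add: lin_def sum_distrib_left mult.assoc)
qed

lemma lin_add_right: "lin f (\<lambda>x. \<phi> x + \<psi> x) = lin f \<phi> + lin f \<psi>"
  by (simp add: lin_def distrib_left sum.distrib)

lemma lin_smult_right: "lin f (\<lambda>x. c * \<phi> x) = c * lin f \<phi>"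
  by (simp add: lin_def sum_distrib_left algebra_simps)

lemma lin_cong: "(\<And>x. x \<in> supp f \<Longrightarrow> \<phi> x = \<psi> x) \<Longrightarrow> lin f \<phi> = lin f \<psi>"
  by (simp add: lin_def)

lemma lin_swap: "lin f (\<lambda>x. lin g (\<lambda>y. \<phi> x y)) = lin g (\<lambda>y. lin f (\<lambda>x. \<phi> x y))"
  unfolding lin_def sum_distrib_left by (subst sum.swap) (simp add: algebra_simps)

text \<open>\<open>of_bool (x = z)\<close> is the Kronecker symbol; pairing with it reads off a
  coefficient.\<close>

lemma lin_point: 
  assumes "finite (supp f)" shows "lin f (\<lambda>x. of_bool (x = z)) = f z"
proof -
  have "lin f (\<lambda>x. of_bool (x = z)) = (\<Sum>x \<in> insert z (supp f). f x * of_bool (x = z))"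
    using assms by (intro lin_superset) auto
  also have "\<dots> = f z"
    using assms by (subst sum.remove[of _ z]) (auto intro!: sum.neutral)
  finally show ?thesis .
qed

lemma lin_nonzeroD: "lin f \<phi> \<noteq> 0 \<Longrightarrow> \<exists>x \<in> supp f. \<phi> x \<noteq> 0"
  unfolding lin_def by (rule ccontr) (simp add: sum.neutral)

lemma cnj_of_bool [simp]: "cnj (of_bool b) = of_bool b"
  by (cases b) simp_all

lemma supp_delta [simp]: "supp (delta x) = {x}"
  by (auto simp: supp_def delta_def)

lemma delta_same [simp]: "delta x x = 1"
  by (simp add: delta_def)

lemma lin_delta [simp]: "lin (delta x) \<phi> = \<phi> x"
  by (simp add: lin_def)

locale involutive_monoid = monoid M for M (structure) +
  fixes s :: "'a \<Rightarrow> 'a"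
  assumes s_closed [simp]: "x \<in> carrier M \<Longrightarrow> s x \<in> carrier M"
    and s_s [simp]: "x \<in> carrier M \<Longrightarrow> s (s x) = x"
    and s_mult: "x \<in> carrier M \<Longrightarrow> y \<in> carrier M \<Longrightarrow> s (x \<otimes> y) = s y \<otimes> s x"
begin

abbreviation "MA \<equiv> monoid_star_alg M s"

lemma MA_simps [simp]:
  "\<one>\<^bsub>MA\<^esub> = delta \<one>" "\<zero>\<^bsub>MA\<^esub> = (\<lambda>_. 0)" "f \<oplus>\<^bsub>MA\<^esub> g = (\<lambda>z. f z + g z)" "c \<odot>\<^bsub>MA\<^esub> f = (\<lambda>z. c * f z)"
  by (simp_all add: monoid_star_alg_def)

lemma MA_carrier: "f \<in> carrier MA \<longleftrightarrow> finite (supp f) \<and> supp f \<subseteq> carrier M"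
  by (simp add: monoid_star_alg_def)

lemma MA_mult: "f \<otimes>\<^bsub>MA\<^esub> g = (\<lambda>z. lin f (\<lambda>x. lin g (\<lambda>y. of_bool (x \<otimes> y = z))))"
  by (auto simp: monoid_star_alg_def lin_def sum_distrib_left fun_eq_iff intro!: sum.cong)

lemma MA_star: "star MA f = (\<lambda>z. cnj (lin f (\<lambda>x. of_bool (s x = z))))"
  by (auto simp: monoid_star_alg_def lin_def fun_eq_iff intro!: sum.cong)

lemma supp_mult: "supp (f \<otimes>\<^bsub>MA\<^esub> g) \<subseteq> (\<lambda>(x, y). x \<otimes> y) ` (supp f \<times> supp g)"
proof
  fix z assume "z \<in> supp (f \<otimes>\<^bsub>MA\<^esub> g)"
  then have "lin f (\<lambda>x. lin g (\<lambda>y. of_bool (x \<otimes> y = z))) \<noteq> 0" by (simp add: MA_mult supp_def)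
  then obtain x where x: "x \<in> supp f" "lin g (\<lambda>y. of_bool (x \<otimes> y = z)) \<noteq> 0"
    by (blast dest: lin_nonzeroD)
  then obtain y where "y \<in> supp g" "x \<otimes> y = z"
    using lin_nonzeroD[OF x(2)] by auto
  with x show "z \<in> (\<lambda>(x, y). x \<otimes> y) ` (supp f \<times> supp g)" by auto
qed

lemma supp_star: "supp (star MA f) \<subseteq> s ` supp f"
proof
  fix z assume "z \<in> supp (star MA f)"
  then have "lin f (\<lambda>x. of_bool (s x = z)) \<noteq> 0" by (simp add: MA_star supp_def)
  then obtain x where "x \<in> supp f" "s x = z"
    using lin_nonzeroD by fastforce
  then show "z \<in> s ` supp f" by auto
qed

lemma MA_mult_closed:
  assumes "f \<in> carrier MA" "g \<in> carrier MA" shows "f \<otimes>\<^bsub>MA\<^esub> g \<in> carrier MA"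
proof -
  have "finite ((\<lambda>(x, y). x \<otimes> y) ` (supp f \<times> supp g))" "(\<lambda>(x, y). x \<otimes> y) ` (supp f \<times> supp g) \<subseteq> carrier M"
    using assms by (auto simp: MA_carrier)
  with supp_mult[of f g] show ?thesis by (meson MA_carrier finite_subset subset_trans)
qed

lemma MA_star_closed:
  assumes "f \<in> carrier MA" shows "star MA f \<in> carrier MA"
proof -
  have "finite (s ` supp f)" "s ` supp f \<subseteq> carrier M" using assms by (auto simp: MA_carrier)
  with supp_star[of f] show ?thesis by (meson MA_carrier finite_subset subset_trans)
qed

text \<open>Every product of points of the two supports lies in the finite set \<open>?S\<close>, so
  the sum over \<open>z\<close> collapses. Associativity of convolution is thereby reduced to
  associativity in \<open>M\<close>.\<close>

lemma lin_mult:
  assumes "f \<in> carrier MA" "g \<in> carrier MA"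
  shows "lin (f \<otimes>\<^bsub>MA\<^esub> g) \<phi> = lin f (\<lambda>x. lin g (\<lambda>y. \<phi> (x \<otimes> y)))"
proof -
  let ?S = "(\<lambda>(x, y). x \<otimes> y) ` (supp f \<times> supp g)"
  have fin: "finite ?S" using assms by (auto simp: MA_carrier)
  have "lin (f \<otimes>\<^bsub>MA\<^esub> g) \<phi> = (\<Sum>z \<in> ?S. lin f (\<lambda>x. lin g (\<lambda>y. of_bool (x \<otimes> y = z))) * \<phi> z)"
    using lin_superset[OF fin supp_mult] by (simp add: MA_mult)
  also have "\<dots> = (\<Sum>z \<in> ?S. \<phi> z * lin f (\<lambda>x. lin g (\<lambda>y. of_bool (x \<otimes> y = z))))"
    by (simp add: mult.commute)
  also have "\<dots> = (\<Sum>z \<in> ?S. lin f (\<lambda>x. lin g (\<lambda>y. \<phi> z * of_bool (x \<otimes> y = z))))"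
    by (simp add: lin_smult_right)
  also have "\<dots> = lin f (\<lambda>x. \<Sum>z \<in> ?S. lin g (\<lambda>y. \<phi> z * of_bool (x \<otimes> y = z)))"
    unfolding lin_def[of f] sum_distrib_left by (rule sum.swap)
  also have "\<dots> = lin f (\<lambda>x. lin g (\<lambda>y. \<Sum>z \<in> ?S. \<phi> z * of_bool (x \<otimes> y = z)))"
    unfolding lin_def[of g] sum_distrib_left by (subst sum.swap) (rule refl)
  also have "\<dots> = lin f (\<lambda>x. lin g (\<lambda>y. \<phi> (x \<otimes> y)))"
  proof (intro lin_cong)
    fix x y assume "x \<in> supp f" "y \<in> supp g"
    then have "x \<otimes> y \<in> ?S" by auto
    with fin show "(\<Sum>z \<in> ?S. \<phi> z * of_bool (x \<otimes> y = z)) = \<phi> (x \<otimes> y)"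
      by (subst sum.remove[of _ "x \<otimes> y"]) (auto intro!: sum.neutral)
  qed
  finally show ?thesis .
qed

lemma lin_star:
  assumes "f \<in> carrier MA"
  shows "lin (star MA f) \<phi> = cnj (lin f (\<lambda>x. cnj (\<phi> (s x))))"
proof -
  let ?S = "s ` supp f"
  have fin: "finite ?S" using assms by (auto simp: MA_carrier)
  have "lin (star MA f) \<phi> = (\<Sum>z \<in> ?S. cnj (lin f (\<lambda>x. of_bool (s x = z))) * \<phi> z)"
    using lin_superset[OF fin supp_star] by (simp add: MA_star)
  also have "\<dots> = cnj (\<Sum>z \<in> ?S. cnj (\<phi> z) * lin f (\<lambda>x. of_bool (s x = z)))"
    by (simp add: mult.commute)
  also have "\<dots> = cnj (\<Sum>z \<in> ?S. lin f (\<lambda>x. cnj (\<phi> z) * of_bool (s x = z)))"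
    by (simp add: lin_smult_right)
  also have "\<dots> = cnj (lin f (\<lambda>x. \<Sum>z \<in> ?S. cnj (\<phi> z) * of_bool (s x = z)))"
    unfolding lin_def sum_distrib_left by (subst sum.swap) (rule refl)
  also have "\<dots> = cnj (lin f (\<lambda>x. cnj (\<phi> (s x))))"
  proof (intro arg_cong[where f=cnj] lin_cong)
    fix x assume "x \<in> supp f"
    then have "s x \<in> ?S" by auto
    with fin show "(\<Sum>z \<in> ?S. cnj (\<phi> z) * of_bool (s x = z)) = cnj (\<phi> (s x))"
      by (subst sum.remove[of _ "s x"]) (auto intro!: sum.neutral)
  qed
  finally show ?thesis .
qed

lemma supp_add: "supp (\<lambda>z. f z + g z) \<subseteq> supp f \<union> supp g" and supp_smult: "supp (\<lambda>z. c * f z) \<subseteq> supp f"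
  by (auto simp: supp_def)

lemma MA_add_closed: "f \<in> carrier MA \<Longrightarrow> g \<in> carrier MA \<Longrightarrow> (\<lambda>z. f z + g z) \<in> carrier MA"
  using supp_add[of f g] by (simp add: MA_carrier) (meson finite_Un finite_subset le_sup_iff subset_trans)

lemma MA_smult_closed: "f \<in> carrier MA \<Longrightarrow> (\<lambda>z. c * f z) \<in> carrier MA"
  using supp_smult[of c f] by (simp add: MA_carrier) (meson finite_subset subset_trans)

lemma MA_finite: "f \<in> carrier MA \<Longrightarrow> finite (supp f)" and MA_supp: "f \<in> carrier MA \<Longrightarrow> x \<in> supp f \<Longrightarrow> x \<in> carrier M"
  by (auto simp: MA_carrier)

lemma delta_closed [simp]: "x \<in> carrier M \<Longrightarrow> delta x \<in> carrier MA"
  by (simp add: MA_carrier)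

lemma star_algebra_MA: "star_algebra MA"
proof (rule star_algebraI)
  fix f g h :: "'a \<Rightarrow> complex"
  assume f: "f \<in> carrier MA"
  note ff = MA_finite[OF f] and sf = MA_supp[OF f]
  show "\<one>\<^bsub>MA\<^esub> \<otimes>\<^bsub>MA\<^esub> f = f"
  proof
    fix z
    have "(\<one>\<^bsub>MA\<^esub> \<otimes>\<^bsub>MA\<^esub> f) z = lin f (\<lambda>y. of_bool (y = z))"
      unfolding MA_mult MA_simps lin_delta by (rule lin_cong) (simp add: sf)
    then show "(\<one>\<^bsub>MA\<^esub> \<otimes>\<^bsub>MA\<^esub> f) z = f z" using ff by (simp add: lin_point)
  qed
  show "f \<otimes>\<^bsub>MA\<^esub> \<one>\<^bsub>MA\<^esub> = f"
  proof
    fix z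
    have "(f \<otimes>\<^bsub>MA\<^esub> \<one>\<^bsub>MA\<^esub>) z = lin f (\<lambda>y. of_bool (y = z))"
      unfolding MA_mult MA_simps lin_delta by (rule lin_cong) (simp add: sf)
    then show "(f \<otimes>\<^bsub>MA\<^esub> \<one>\<^bsub>MA\<^esub>) z = f z" using ff by (simp add: lin_point)
  qed
  show "star MA (star MA f) = f"
  proof
    fix z
    have "star MA (star MA f) z = lin f (\<lambda>x. of_bool (s (s x) = z))"
      by (subst MA_star) (simp add: lin_star f)
    also have "\<dots> = lin f (\<lambda>x. of_bool (x = z))" by (rule lin_cong) (simp add: sf)
    finally show "star MA (star MA f) z = f z" using ff by (simp add: lin_point)
  qed
  show "star MA (c \<odot>\<^bsub>MA\<^esub> f) = cnj c \<odot>\<^bsub>MA\<^esub> star MA f" for c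
    using ff by (simp add: MA_star lin_smult_left)
  show "f \<oplus>\<^bsub>MA\<^esub> g \<in> carrier MA" if "g \<in> carrier MA"
    using f that by (simp add: MA_add_closed)
  show "c \<odot>\<^bsub>MA\<^esub> f \<in> carrier MA" for c using f by (simp add: MA_smult_closed)
  show "star MA f \<in> carrier MA" by (rule MA_star_closed[OF f])
  assume g: "g \<in> carrier MA"
  show "f \<otimes>\<^bsub>MA\<^esub> g \<in> carrier MA" by (rule MA_mult_closed[OF f g])
  note fg = MA_finite[OF g] and sg = MA_supp[OF g]
  show "star MA (f \<oplus>\<^bsub>MA\<^esub> g) = star MA f \<oplus>\<^bsub>MA\<^esub> star MA g"
    using ff fg by (simp add: MA_star lin_add_left)
  show "(c \<odot>\<^bsub>MA\<^esub> f) \<otimes>\<^bsub>MA\<^esub> g = c \<odot>\<^bsub>MA\<^esub> (f \<otimes>\<^bsub>MA\<^esub> g)" "f \<otimes>\<^bsub>MA\<^esub> (c \<odot>\<^bsub>MA\<^esub> g) = c \<odot>\<^bsub>MA\<^esub> (f \<otimes>\<^bsub>MA\<^esub> g)" for c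
    using ff fg by (simp_all add: MA_mult lin_smult_left lin_smult_right)
  show "star MA (f \<otimes>\<^bsub>MA\<^esub> g) = star MA g \<otimes>\<^bsub>MA\<^esub> star MA f"
  proof
    fix z
    have "star MA (f \<otimes>\<^bsub>MA\<^esub> g) z = cnj (lin f (\<lambda>x. lin g (\<lambda>y. of_bool (s (x \<otimes> y) = z))))"
      by (subst MA_star) (simp add: lin_mult f g)
    also have "\<dots> = cnj (lin g (\<lambda>y. lin f (\<lambda>x. of_bool (s (x \<otimes> y) = z))))"
      by (subst lin_swap) (rule refl)
    also have "\<dots> = cnj (lin g (\<lambda>y. lin f (\<lambda>x. of_bool (s y \<otimes> s x = z))))"
      by (intro arg_cong[where f=cnj] lin_cong) (simp add: s_mult sf sg)
    also have "\<dots> = (star MA g \<otimes>\<^bsub>MA\<^esub> star MA f) z"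
      by (subst MA_mult) (simp add: lin_star f g)
    finally show "star MA (f \<otimes>\<^bsub>MA\<^esub> g) z = (star MA g \<otimes>\<^bsub>MA\<^esub> star MA f) z" .
  qed
  assume h: "h \<in> carrier MA"
  note fh = MA_finite[OF h] and sh = MA_supp[OF h]
  show "(f \<oplus>\<^bsub>MA\<^esub> g) \<otimes>\<^bsub>MA\<^esub> h = f \<otimes>\<^bsub>MA\<^esub> h \<oplus>\<^bsub>MA\<^esub> g \<otimes>\<^bsub>MA\<^esub> h"
    "h \<otimes>\<^bsub>MA\<^esub> (f \<oplus>\<^bsub>MA\<^esub> g) = h \<otimes>\<^bsub>MA\<^esub> f \<oplus>\<^bsub>MA\<^esub> h \<otimes>\<^bsub>MA\<^esub> g"
    using ff fg by (simp_all add: MA_mult lin_add_left lin_add_right)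
  show "f \<otimes>\<^bsub>MA\<^esub> g \<otimes>\<^bsub>MA\<^esub> h = f \<otimes>\<^bsub>MA\<^esub> (g \<otimes>\<^bsub>MA\<^esub> h)"
  proof
    fix z
    have "(f \<otimes>\<^bsub>MA\<^esub> g \<otimes>\<^bsub>MA\<^esub> h) z = lin f (\<lambda>x. lin g (\<lambda>y. lin h (\<lambda>k. of_bool (x \<otimes> y \<otimes> k = z))))"
      by (subst MA_mult) (simp add: lin_mult f g)
    also have "\<dots> = lin f (\<lambda>x. lin g (\<lambda>y. lin h (\<lambda>k. of_bool (x \<otimes> (y \<otimes> k) = z))))"
      by (intro lin_cong) (simp add: m_assoc sf sg sh)
    also have "\<dots> = (f \<otimes>\<^bsub>MA\<^esub> (g \<otimes>\<^bsub>MA\<^esub> h)) z"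
      by (subst MA_mult) (simp add: lin_mult g h)
    finally show "(f \<otimes>\<^bsub>MA\<^esub> g \<otimes>\<^bsub>MA\<^esub> h) z = (f \<otimes>\<^bsub>MA\<^esub> (g \<otimes>\<^bsub>MA\<^esub> h)) z" .
  qed
qed (auto simp: algebra_simps MA_carrier supp_def[of "\<lambda>_. 0"])

sublocale MA: star_algebra MA
  by (rule star_algebra_MA)

lemma delta_mult [simp]: "delta x \<otimes>\<^bsub>MA\<^esub> delta y = delta (x \<otimes> y)"
  by (auto simp: MA_mult delta_def fun_eq_iff lin_def supp_def)

lemma delta_star [simp]: "star MA (delta x) = delta (s x)"
  by (auto simp: MA_star delta_def fun_eq_iff lin_def supp_def)

text \<open>Induction on the support, from which one point is removed at a time.\<close>

lemma MA_induct [consumes 1, case_names zero add delta]: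
  assumes "f \<in> carrier MA" and zero: "P (\<lambda>_. 0)"
    and add: "\<And>f g. f \<in> carrier MA \<Longrightarrow> g \<in> carrier MA \<Longrightarrow> P f \<Longrightarrow> P g \<Longrightarrow> P (f \<oplus>\<^bsub>MA\<^esub> g)"
    and delta: "\<And>c x. x \<in> carrier M \<Longrightarrow> P (c \<odot>\<^bsub>MA\<^esub> delta x)"
  shows "P f"
  using MA_finite[OF assms(1)] assms(1)
proof (induction "supp f" arbitrary: f rule: finite_induct)
  case empty
  then have "f = (\<lambda>_. 0)" by (auto simp: supp_def)
  then show ?case using zero by simp
next
  case (insert x F)
  define g where "g = f(x := 0)"
  have x: "x \<in> carrier M" using insert by (auto simp: MA_carrier)
  have "supp g = F" using insert(2,4) by (auto simp: g_def supp_def)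
  then have "P g" "g \<in> carrier MA" using insert by (auto simp: MA_carrier)
  moreover have "f = g \<oplus>\<^bsub>MA\<^esub> (f x \<odot>\<^bsub>MA\<^esub> delta x)" by (auto simp: g_def fun_eq_iff delta_def)
  ultimately show ?case using add[of g "f x \<odot>\<^bsub>MA\<^esub> delta x"] delta[OF x] x by (metis MA.smult_closed' delta_closed)
qed

lemma MA_star_gen:
  assumes "\<And>x. x \<in> carrier M \<Longrightarrow> delta x \<in> star_gen MA G"
  shows "carrier MA \<subseteq> star_gen MA G"
proof
  fix f assume "f \<in> carrier MA"
  then show "f \<in> star_gen MA G"
  proof (induction rule: MA_induct)
    case zero
    then show ?case using MA.star_gen_zero by simp
  next
    case (add f g)
    then show ?case by (intro star_gen.add)
  next
    case (delta c x)
    then show ?case by (intro star_gen.smult assms)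
  qed
qed

text \<open>\<open>h\<close> extends \<open>\<phi>\<close> linearly. The laws to be checked are
  linear or conjugate-linear in each argument, so \<open>MA_induct\<close> reduces them to the
  assumptions on \<open>\<phi>\<close>.\<close>

theorem MA_extension:
  assumes D: "star_algebra D"
    and \<phi>: "\<And>x. x \<in> carrier M \<Longrightarrow> \<phi> x \<in> carrier D" "\<phi> \<one> = \<one>\<^bsub>D\<^esub>"
      "\<And>x y. x \<in> carrier M \<Longrightarrow> y \<in> carrier M \<Longrightarrow> \<phi> (x \<otimes> y) = \<phi> x \<otimes>\<^bsub>D\<^esub> \<phi> y"
      "\<And>x. x \<in> carrier M \<Longrightarrow> \<phi> (s x) = star D (\<phi> x)"
  shows "\<exists>h \<in> star_hom MA D. \<forall>x \<in> carrier M. h (delta x) = \<phi> x"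
proof -
  interpret D: star_algebra D by fact
  define h where "h f = (\<Oplus>\<^bsub>D\<^esub>x \<in> supp f. f x \<odot>\<^bsub>D\<^esub> \<phi> x)" for f
  \<comment> \<open>Summation over any finite superset of the support lets \<open>f\<close>,
    \<open>g\<close> and their sum share one index set.\<close>
  have h_superset: "h f = (\<Oplus>\<^bsub>D\<^esub>x \<in> S. f x \<odot>\<^bsub>D\<^esub> \<phi> x)" if "finite S" "supp f \<subseteq> S" "S \<subseteq> carrier M" for f S
  proof -
    have "(\<Oplus>\<^bsub>D\<^esub>x \<in> S. f x \<odot>\<^bsub>D\<^esub> \<phi> x) = (\<Oplus>\<^bsub>D\<^esub>x \<in> supp f \<union> (S - supp f). f x \<odot>\<^bsub>D\<^esub> \<phi> x)"
      using that by (intro arg_cong[where f="finsum D _"]) auto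
    also have "\<dots> = h f \<oplus>\<^bsub>D\<^esub> (\<Oplus>\<^bsub>D\<^esub>x \<in> S - supp f. f x \<odot>\<^bsub>D\<^esub> \<phi> x)"
      unfolding h_def using that \<phi>(1)
      by (intro abelian_monoid.finsum_Un_disjoint[OF D.abelian_monoid_A]) (auto intro: finite_subset)
    also have "(\<Oplus>\<^bsub>D\<^esub>x \<in> S - supp f. f x \<odot>\<^bsub>D\<^esub> \<phi> x) = (\<Oplus>\<^bsub>D\<^esub>x \<in> S - supp f. \<zero>\<^bsub>D\<^esub>)"
      using that \<phi>(1) by (intro abelian_monoid.finsum_cong'[OF D.abelian_monoid_A]) (auto simp: supp_def)
    also have "\<dots> = \<zero>\<^bsub>D\<^esub>" by (rule abelian_monoid.finsum_zero[OF D.abelian_monoid_A])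
    finally show ?thesis
      using \<phi>(1) that by (simp add: h_def subset_eq Pi_iff abelian_monoid.finsum_closed[OF D.abelian_monoid_A])
  qed
  have hc [simp]: "h f \<in> carrier D" if "f \<in> carrier MA" for f
    unfolding h_def using \<phi>(1) MA_supp[OF that]
    by (intro abelian_monoid.finsum_closed[OF D.abelian_monoid_A]) auto
  have h_delta: "h (c \<odot>\<^bsub>MA\<^esub> delta x) = c \<odot>\<^bsub>D\<^esub> \<phi> x" if "x \<in> carrier M" for c x
  proof -
    have "h (c \<odot>\<^bsub>MA\<^esub> delta x) = (\<Oplus>\<^bsub>D\<^esub>y \<in> {x}. (c \<odot>\<^bsub>MA\<^esub> delta x) y \<odot>\<^bsub>D\<^esub> \<phi> y)"
      by (rule h_superset) (use that in \<open>auto simp: supp_def delta_def\<close>)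
    also have "\<dots> = c \<odot>\<^bsub>D\<^esub> \<phi> x"
      using \<phi>(1)[OF that] by (simp add: abelian_monoid.finsum_insert[OF D.abelian_monoid_A]
        abelian_monoid.finsum_empty[OF D.abelian_monoid_A])
    finally show ?thesis .
  qed
  have h_zero: "h (\<lambda>_. 0) = \<zero>\<^bsub>D\<^esub>" by (simp add: h_def supp_def)
  have h_add: "h (f \<oplus>\<^bsub>MA\<^esub> g) = h f \<oplus>\<^bsub>D\<^esub> h g" if "f \<in> carrier MA" "g \<in> carrier MA" for f g
  proof -
    let ?S = "supp f \<union> supp g"
    have S: "finite ?S" "?S \<subseteq> carrier M" using that by (auto simp: MA_carrier)
    have "h (f \<oplus>\<^bsub>MA\<^esub> g) = (\<Oplus>\<^bsub>D\<^esub>x \<in> ?S. f x \<odot>\<^bsub>D\<^esub> \<phi> x \<oplus>\<^bsub>D\<^esub> g x \<odot>\<^bsub>D\<^esub> \<phi> x)"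
    proof -
      have "h (f \<oplus>\<^bsub>MA\<^esub> g) = (\<Oplus>\<^bsub>D\<^esub>x \<in> ?S. (f \<oplus>\<^bsub>MA\<^esub> g) x \<odot>\<^bsub>D\<^esub> \<phi> x)"
        using S supp_add[of f g] by (intro h_superset) auto
      also have "\<dots> = (\<Oplus>\<^bsub>D\<^esub>x \<in> ?S. f x \<odot>\<^bsub>D\<^esub> \<phi> x \<oplus>\<^bsub>D\<^esub> g x \<odot>\<^bsub>D\<^esub> \<phi> x)"
        using S(2) \<phi>(1) by (intro abelian_monoid.finsum_cong'[OF D.abelian_monoid_A]) 
          (auto simp: D.smult_add_left subset_eq)
      finally show ?thesis .
    qed
    also have "\<dots> = (\<Oplus>\<^bsub>D\<^esub>x \<in> ?S. f x \<odot>\<^bsub>D\<^esub> \<phi> x) \<oplus>\<^bsub>D\<^esub> (\<Oplus>\<^bsub>D\<^esub>x \<in> ?S. g x \<odot>\<^bsub>D\<^esub> \<phi> x)"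
      using S \<phi>(1) by (intro abelian_monoid.finsum_addf[OF D.abelian_monoid_A]) auto
    finally show ?thesis using h_superset[OF S(1) _ S(2), of f] h_superset[OF S(1) _ S(2), of g] by auto
  qed
  have h_smult: "h (c \<odot>\<^bsub>MA\<^esub> f) = c \<odot>\<^bsub>D\<^esub> h f" if "f \<in> carrier MA" for c f
    using that
  proof (induction rule: MA_induct)
    case (add f g)
    then show ?case using h_add[of f g] h_add[of "c \<odot>\<^bsub>MA\<^esub> f" "c \<odot>\<^bsub>MA\<^esub> g"] 
      by (simp add: MA.smult_add_right D.smult_add_right del: MA_simps)
  next
    case (delta d x)
    then show ?case using h_delta[of x "c * d"] h_delta[of x d] \<phi>(1)
      by (simp add: MA.smult_smult D.smult_smult del: MA_simps)
  qed (simp add: h_zero)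
  have h_mult: "h (f \<otimes>\<^bsub>MA\<^esub> g) = h f \<otimes>\<^bsub>D\<^esub> h g" if f: "f \<in> carrier MA" and g: "g \<in> carrier MA" for f g
    using f
  proof (induction rule: MA_induct)
    case zero
    then show ?case using MA.smult_mult_left[of "\<lambda>_. 0" g 0] D.smult_mult_left[of "\<zero>\<^bsub>D\<^esub>" "h g" 0] g MA.zero_closed
      by (simp add: h_zero)
  next
    case (add f f')
    then show ?case using g
      by (simp add: h_add MA.l_distr D.l_distr del: MA_simps)
  next
    case (delta c x)
    note x = this
    show ?case using g
    proof (induction rule: MA_induct)
      case zero
      then show ?case 
        using MA.smult_mult_right[of "delta x" "\<lambda>_. 0" 0] D.smult_mult_right[of "h (c \<odot>\<^bsub>MA\<^esub> delta x)" "\<zero>\<^bsub>D\<^esub>" 0] x 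
          MA.zero_closed MA.smult_mult_right[of "c \<odot>\<^bsub>MA\<^esub> delta x" "\<lambda>_. 0" 0]
        by (simp add: h_zero MA_smult_closed)
    next
      case (add f f')
      then show ?case using x
        by (simp add: h_add MA.r_distr D.r_distr del: MA_simps)
    next
      case (delta d y)
      then show ?case using x \<phi>(1) h_delta[of "x \<otimes> y" "c * d"]
        by (simp add: h_delta MA.smult_mult_left MA.smult_mult_right D.smult_mult_left D.smult_mult_right
            MA.smult_smult D.smult_smult \<phi>(3) del: MA_simps)
    qed
  qed
  have h_star: "h (star MA f) = star D (h f)" if "f \<in> carrier MA" for f
    using that
  proof (induction rule: MA_induct)
    case zero
    then show ?case using MA.star_zero by (simp add: h_zero)
  next
    case (add f g)
    then show ?case by (simp add: h_add MA.star_add D.star_add del: MA_simps)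
  next
    case (delta c x)
    then show ?case using \<phi>(1) by (simp add: h_delta MA.star_smult D.star_smult \<phi>(4) del: MA_simps)
  qed
  have "h \<in> star_hom MA D"
    using h_delta[of \<one> 1] \<phi>(2)
    by (intro star_homI) (simp_all add: h_mult h_add h_star h_smult del: MA_simps(2-))
  moreover have "h (delta x) = \<phi> x" if "x \<in> carrier M" for x
    using h_delta[OF that, of 1] \<phi>(1)[OF that] by simp
  ultimately show ?thesis by blast
qed

end

section \<open>Free algebras and the quantum permutation group\<close>

abbreviation word_monoid :: "'g set \<Rightarrow> ('g \<times> bool) list monoid" where
  "word_monoid G \<equiv> \<lparr>carrier = lists (G \<times> UNIV), mult = (@), one = []\<rparr>"

abbreviation word_star :: "('g \<times> bool) list \<Rightarrow> ('g \<times> bool) list" where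
  "word_star \<equiv> (\<lambda>w. rev (map (\<lambda>(g, b). (g, \<not> b)) w))"

lemma involutive_words: "involutive_monoid (word_monoid G) word_star"
proof (unfold_locales)
  fix x assume "x \<in> carrier (word_monoid G)"
  then show "word_star x \<in> carrier (word_monoid G)" by (auto simp: lists_eq_set)
  show "word_star (word_star x) = x" by (simp add: rev_map o_def case_prod_beta)
qed auto

lemma star_algebra_free: "star_algebra (free_star_alg G)"
  unfolding free_star_alg_def by (rule involutive_monoid.star_algebra_MA[OF involutive_words])

lemma free_gen_closed: "g \<in> G \<Longrightarrow> free_gen g \<in> carrier (free_star_alg G)"
  unfolding free_star_alg_def free_gen_def
  by (rule involutive_monoid.delta_closed[OF involutive_words]) simp

text \<open>A letter marked \<open>True\<close> is the adjoint of a generator, and words are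
  products of letters.\<close>

lemma free_star_gen: "carrier (free_star_alg G) \<subseteq> star_gen (free_star_alg G) (free_gen ` G)"
proof -
  interpret W: involutive_monoid "word_monoid G" word_star by (rule involutive_words)
  show ?thesis
    unfolding free_star_alg_def
  proof (rule W.MA_star_gen)
    fix w assume "w \<in> carrier (word_monoid G)"
    then have "set w \<subseteq> G \<times> UNIV" by (auto simp: lists_eq_set)
    then show "delta w \<in> star_gen W.MA (free_gen ` G)"
    proof (induction w)
      case Nil
      then show ?case using star_gen.one[of W.MA] by simp
    next
      case (Cons l w)
      obtain g b where l: "l = (g, b)" "g \<in> G" using Cons by (cases l) auto
      have g: "free_gen g \<in> star_gen W.MA (free_gen ` G)" using l by (auto intro: star_gen.gen)
      have "delta [(g, b)] \<in> star_gen W.MA (free_gen ` G)"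
        using g star_gen.star[OF g] by (cases b) (simp_all add: free_gen_def)
      from star_gen.mult[OF this Cons.IH] Cons.prems l show ?case by simp
    qed
  qed
qed

text \<open>Words are sent to the products of the values of their letters; reversal of words matches
  the order reversal of adjoints.\<close>

theorem free_extension:
  assumes D: "star_algebra D" and \<gamma>: "\<And>g. g \<in> G \<Longrightarrow> \<gamma> g \<in> carrier D"
  shows "\<exists>h \<in> star_hom (free_star_alg G) D. \<forall>g \<in> G. h (free_gen g) = \<gamma> g"
proof -
  interpret W: involutive_monoid "word_monoid G" word_star by (rule involutive_words)
  interpret D: star_algebra D by (fact D)
  define L where "L l = (if snd l then star D (\<gamma> (fst l)) else \<gamma> (fst l))" for l
  define \<phi> where "\<phi> w = foldr (\<lambda>l a. L l \<otimes>\<^bsub>D\<^esub> a) w \<one>\<^bsub>D\<^esub>" for w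
  have L [simp]: "L l \<in> carrier D" if "fst l \<in> G" for l using that \<gamma> by (simp add: L_def)
  have \<phi>c: "\<phi> w \<in> carrier D" if "w \<in> lists (G \<times> UNIV)" for w
    using that by induction (auto simp: \<phi>_def)
  have \<phi>m: "\<phi> (v @ w) = \<phi> v \<otimes>\<^bsub>D\<^esub> \<phi> w" if "v \<in> lists (G \<times> UNIV)" "w \<in> lists (G \<times> UNIV)" for v w
    using that(1)
  proof induction
    case Nil
    then show ?case using \<phi>c[OF that(2)] by (simp add: \<phi>_def)
  next
    case (Cons l v)
    then have "\<phi> (l # v @ w) = L l \<otimes>\<^bsub>D\<^esub> \<phi> (v @ w)" "\<phi> (l # v) = L l \<otimes>\<^bsub>D\<^esub> \<phi> v" by (simp_all add: \<phi>_def)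
    with Cons(1,3) \<phi>c[OF Cons(2)] \<phi>c[OF that(2)] show ?case by (auto simp: D.m_assoc)
  qed
  have \<phi>1: "\<phi> [l] = L l" if "fst l \<in> G" for l using that by (simp add: \<phi>_def)
  have \<phi>s: "\<phi> (word_star w) = star D (\<phi> w)" if "w \<in> lists (G \<times> UNIV)" for w
    using that
  proof induction
    case Nil
    then show ?case by (simp add: \<phi>_def)
  next
    case (Cons l w)
    obtain g b where l: "l = (g, b)" "g \<in> G" using Cons by (cases l) auto
    have ws: "word_star w \<in> lists (G \<times> UNIV)" using Cons by (auto simp: lists_eq_set)
    have "\<phi> (word_star (l # w)) = \<phi> (word_star w) \<otimes>\<^bsub>D\<^esub> \<phi> [(g, \<not> b)]"
      using \<phi>m[OF ws, of "[(g, \<not> b)]"] l by simp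
    also have "\<dots> = star D (\<phi> w) \<otimes>\<^bsub>D\<^esub> star D (L l)"
      using Cons l \<gamma> by (simp add: \<phi>1 L_def)
    also have "\<dots> = star D (L l \<otimes>\<^bsub>D\<^esub> \<phi> w)" using l \<phi>c[OF Cons(2)] by (simp add: D.star_mult)
    finally show ?case by (simp add: \<phi>_def)
  qed
  obtain h where h: "h \<in> star_hom W.MA D" "\<forall>w \<in> carrier (word_monoid G). h (delta w) = \<phi> w"
    using W.MA_extension[OF D, of \<phi>] \<phi>c \<phi>m \<phi>s by (auto simp: \<phi>_def)
  have "h (free_gen g) = \<gamma> g" if "g \<in> G" for g
    using h(2) \<phi>1[of "(g, False)"] that by (simp add: free_gen_def L_def)
  with h show ?thesis unfolding free_star_alg_def by blast
qed

lemma seminorm_eqI: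
  assumes "seminormed P p" "p (x \<ominus>\<^bsub>P\<^esub> y) = 0" "x \<in> carrier P" "y \<in> carrier P"
  shows "p x = p y"
  using seminormed.p_abs_diff[OF assms(1,3,4)] assms(2) by simp

text \<open>A seminorm that vanishes on the relations cannot tell a generator \<open>x\<close> from
  its adjoint or its square. Hence \<open>p x ^ 2 = p x\<close>, and 1 is a common bound.\<close>

lemma universal_A_s: "universal (free_star_alg ({..<n} \<times> {..<n})) (magic_relations n)"
proof (rule universalI[OF star_algebra_free _ free_star_gen])
  let ?G = "{..<n} \<times> {..<n}"
  let ?P = "free_star_alg ?G"
  fix x assume "x \<in> free_gen ` ?G"
  then obtain i j where x: "x = free_gen (i, j)" and ij: "i < n" "j < n" by auto
  show "\<exists>K. \<forall>p. cstar_seminorm ?P p \<and> (\<forall>r\<in>magic_relations n. p r = 0) \<longrightarrow> p x \<le> K"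
  proof (intro exI[of _ 1] allI impI)
    fix p assume p: "cstar_seminorm ?P p \<and> (\<forall>r\<in>magic_relations n. p r = 0)"
    interpret P: seminormed ?P p
      using p by (intro seminormed.intro seminormed_axioms.intro star_algebra_free) blast
    have xc [simp]: "x \<in> carrier ?P" unfolding x by (rule free_gen_closed) (use ij in simp)
    have "star ?P x \<ominus>\<^bsub>?P\<^esub> x \<in> magic_relations n" "x \<otimes>\<^bsub>?P\<^esub> x \<ominus>\<^bsub>?P\<^esub> x \<in> magic_relations n"
      using ij unfolding magic_relations_def Let_def x by blast+
    with p have r: "p (star ?P x \<ominus>\<^bsub>?P\<^esub> x) = 0" "p (x \<otimes>\<^bsub>?P\<^esub> x \<ominus>\<^bsub>?P\<^esub> x) = 0" by blast+
    have "(p x)\<^sup>2 = p (star ?P x \<otimes>\<^bsub>?P\<^esub> x)" by (simp add: P.p_star_mult)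
    also have "\<dots> = p (x \<otimes>\<^bsub>?P\<^esub> x)"
    proof (rule seminorm_eqI[OF P.seminormed_axioms])
      have "p (star ?P x \<otimes>\<^bsub>?P\<^esub> x \<ominus>\<^bsub>?P\<^esub> x \<otimes>\<^bsub>?P\<^esub> x) \<le> 0"
        using P.p_mult_diff[of "star ?P x" x x x] r by simp
      then show "p (star ?P x \<otimes>\<^bsub>?P\<^esub> x \<ominus>\<^bsub>?P\<^esub> x \<otimes>\<^bsub>?P\<^esub> x) = 0" by (rule antisym) simp
    qed simp_all
    also have "\<dots> = p x" by (rule seminorm_eqI[OF P.seminormed_axioms]) (simp_all add: r(2))
    finally have "p x * p x = p x * 1" by (simp add: power2_eq_square)
    then show "p x \<le> 1" by (simp only: mult_cancel_left) auto
  qed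
qed (auto intro!: free_gen_closed)

lemma complete_cstar_A_s: "complete_cstar (A_s n)"
  unfolding A_s_def by (rule universal.complete_cstar_universal[OF universal_A_s])

lemma entries_image: "f ` entries n u = entries n (\<lambda>i j. f (u i j))"
  by (auto simp: entries_def)

lemma A_s_gen_closed: "i < n \<Longrightarrow> j < n \<Longrightarrow> A_s_gen n i j \<in> carrier (A_s n)"
  unfolding A_s_def A_s_gen_def
  by (rule star_homD(1)[OF universal.universal_map_star_hom[OF universal_A_s]]) (simp add: free_gen_closed)

lemma generates_A_s: "generates_cstar (A_s n) (entries n (A_s_gen n))"
proof -
  have "entries n (A_s_gen n) = universal_map (free_star_alg ({..<n} \<times> {..<n})) (magic_relations n) `
      free_gen ` ({..<n} \<times> {..<n})"
    unfolding entries_def A_s_gen_def by auto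
  then show ?thesis
    unfolding A_s_def
    by (simp only:) (intro universal.generates_universal[OF universal_A_s _ free_star_gen] image_subsetI free_gen_closed)
qed

section \<open>Magic unitaries and the universal property of the free quantum permutation
  algebra\<close>

lemma magic_unitaryD:
  assumes "magic_unitary A n u" "i < n" "j < n"
  shows "u i j \<in> carrier A" "star A (u i j) = u i j" "u i j \<otimes>\<^bsub>A\<^esub> u i j = u i j"
    "(\<Oplus>\<^bsub>A\<^esub>k \<in> {..<n}. u i k) = \<one>\<^bsub>A\<^esub>" "(\<Oplus>\<^bsub>A\<^esub>k \<in> {..<n}. u k i) = \<one>\<^bsub>A\<^esub>"
    "k < n \<Longrightarrow> j \<noteq> k \<Longrightarrow> u i j \<otimes>\<^bsub>A\<^esub> u i k = \<zero>\<^bsub>A\<^esub>" "k < n \<Longrightarrow> j \<noteq> k \<Longrightarrow> u j i \<otimes>\<^bsub>A\<^esub> u k i = \<zero>\<^bsub>A\<^esub>"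
  using assms by (auto simp: magic_unitary_def projection_def)

lemma magic_unitary_entries: "magic_unitary A n u \<Longrightarrow> entries n u \<subseteq> carrier A"
  by (auto simp: entries_def dest: magic_unitaryD)

text \<open>The elements of \<open>magic_relations\<close> are the equations of a magic unitary
  moved to one side, so the morphism that the free algebra has to \<open>D\<close> annihilates
  them.\<close>

theorem A_s_universal:
  assumes D: "complete_cstar D" and u: "magic_unitary D n u"
  shows "\<exists>\<sigma> \<in> star_hom (A_s n) D. \<forall>i < n. \<forall>j < n. \<sigma> (A_s_gen n i j) = u i j"
proof -
  let ?G = "{..<n} \<times> {..<n}"
  let ?P = "free_star_alg ?G"
  interpret D: complete_cstar D by (fact D)
  interpret P: star_algebra ?P by (rule star_algebra_free)
  note uD = magic_unitaryD[OF u]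
  have "u (fst g) (snd g) \<in> carrier D" if "g \<in> ?G" for g using that uD(1) by auto
  from free_extension[OF D.star_algebra_axioms this] obtain f
    where f: "f \<in> star_hom ?P D" "\<forall>g \<in> ?G. f (free_gen g) = u (fst g) (snd g)" ..
  have fg: "f (free_gen (i, j)) = u i j" if "i < n" "j < n" for i j using f(2) that by simp
  have xc [simp]: "free_gen (i, j) \<in> carrier ?P" if "i < n" "j < n" for i j
    by (rule free_gen_closed) (use that in simp)
  note fm = star_hom_minus[OF P.star_algebra_axioms D.star_algebra_axioms f(1)]
  note fs = star_hom_finsum[OF P.star_algebra_axioms D.star_algebra_axioms f(1)]
  have sums: "f (\<Oplus>\<^bsub>?P\<^esub>j \<in> {..<n}. free_gen (i, j)) = \<one>\<^bsub>D\<^esub>" "f (\<Oplus>\<^bsub>?P\<^esub>j \<in> {..<n}. free_gen (j, i)) = \<one>\<^bsub>D\<^esub>"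
    "(\<Oplus>\<^bsub>?P\<^esub>j \<in> {..<n}. free_gen (i, j)) \<in> carrier ?P" "(\<Oplus>\<^bsub>?P\<^esub>j \<in> {..<n}. free_gen (j, i)) \<in> carrier ?P"
    if i: "i < n" for i
  proof -
    have "f (\<Oplus>\<^bsub>?P\<^esub>j \<in> {..<n}. free_gen (i, j)) = (\<Oplus>\<^bsub>D\<^esub>j \<in> {..<n}. f (free_gen (i, j)))"
      by (rule fs) (use i in simp)
    also have "\<dots> = (\<Oplus>\<^bsub>D\<^esub>j \<in> {..<n}. u i j)"
      by (rule abelian_monoid.finsum_cong'[OF D.abelian_monoid_A]) (use i fg uD(1) in auto)
    finally show "f (\<Oplus>\<^bsub>?P\<^esub>j \<in> {..<n}. free_gen (i, j)) = \<one>\<^bsub>D\<^esub>" using uD(4)[OF i i] by simp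
    have "f (\<Oplus>\<^bsub>?P\<^esub>j \<in> {..<n}. free_gen (j, i)) = (\<Oplus>\<^bsub>D\<^esub>j \<in> {..<n}. f (free_gen (j, i)))"
      by (rule fs) (use i in simp)
    also have "\<dots> = (\<Oplus>\<^bsub>D\<^esub>j \<in> {..<n}. u j i)"
      by (rule abelian_monoid.finsum_cong'[OF D.abelian_monoid_A]) (use i fg uD(1) in auto)
    finally show "f (\<Oplus>\<^bsub>?P\<^esub>j \<in> {..<n}. free_gen (j, i)) = \<one>\<^bsub>D\<^esub>" using uD(5)[OF i i] by simp
    show "(\<Oplus>\<^bsub>?P\<^esub>j \<in> {..<n}. free_gen (i, j)) \<in> carrier ?P" "(\<Oplus>\<^bsub>?P\<^esub>j \<in> {..<n}. free_gen (j, i)) \<in> carrier ?P"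
      using i by (auto intro!: abelian_monoid.finsum_closed[OF P.abelian_monoid_A])
  qed
  have "f r = \<zero>\<^bsub>D\<^esub>" if "r \<in> magic_relations n" for r
    using that unfolding magic_relations_def Let_def
    by (auto simp: fm star_homD[OF f(1)] fg uD sums)
  then obtain h where "h \<in> star_hom (A_s n) D"
    "\<forall>x \<in> carrier ?P. h (universal_map ?P (magic_relations n) x) = f x"
    using universal.universal_extension[OF universal_A_s D f(1)] unfolding A_s_def by blast
  then show ?thesis unfolding A_s_gen_def using fg by (intro bexI[of _ h]) auto
qed

text \<open>Every quantum permutation algebra is a quotient of a free one, hence complete.\<close>

lemma complete_cstar_if_factorizes:
  assumes A: "quantum_permutation_algebra n A u" and "factorizes n D \<pi> A u"
  shows "complete_cstar A"
proof -
  interpret A: pre_cstar A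
    using A by (auto simp: quantum_permutation_algebra_def intro: cstar_algebra_pre)
  interpret E: complete_cstar "A_s n" by (rule complete_cstar_A_s)
  have u: "magic_unitary A n u" and gen: "generates_cstar A (entries n u)"
    using A by (auto simp: quantum_permutation_algebra_def)
  obtain \<sigma> where \<sigma>: "\<sigma> \<in> star_hom (A_s n) A" "\<forall>i < n. \<forall>j < n. \<sigma> (A_s_gen n i j) = u i j"
    using assms(2) by (auto simp: factorizes_def)
  have e: "entries n u = \<sigma> ` entries n (A_s_gen n)"
    unfolding entries_image using \<sigma>(2) by (auto simp: entries_def) metis+
  have ec: "entries n (A_s_gen n) \<subseteq> carrier (A_s n)" using A_s_gen_closed by (auto simp: entries_def)
  show ?thesis
  proof (rule complete_if_dense_image[OF E.complete_cstar_axioms A.pre_cstar_axioms \<sigma>(1)])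
    fix a and r :: real assume "a \<in> carrier A" "0 < r"
    then obtain y where y: "y \<in> star_gen A (entries n u)" "cnorm A (a \<ominus>\<^bsub>A\<^esub> y) < r"
      using gen by (auto simp: generates_cstar_def)
    then obtain x where "x \<in> star_gen (A_s n) (entries n (A_s_gen n))" "y = \<sigma> x"
      using star_gen_image_converse[OF E.star_algebra_axioms \<sigma>(1) ec] unfolding e by blast
    with y E.star_gen_closed[OF ec] show "\<exists>x\<in>carrier (A_s n). cnorm A (a \<ominus>\<^bsub>A\<^esub> \<sigma> x) < r" by blast
  qed
qed

text \<open>Of the factorization of \<open>\<pi>\<close> only the second map \<open>\<rho>\<close>
  is kept; its values on the entries of \<open>u\<close> are the values of \<open>\<pi>\<close> on
  the generators.\<close>

lemma hopf_image_forD: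
  assumes "hopf_image_for n D U A u"
  shows "quantum_permutation_algebra n A u" "complete_cstar A"
    "\<exists>\<rho> \<in> star_hom A D. \<forall>i < n. \<forall>j < n. \<rho> (u i j) = U i j"
proof -
  obtain \<pi> where \<pi>: "\<pi> \<in> star_hom (A_s n) D" "\<forall>i < n. \<forall>j < n. \<pi> (A_s_gen n i j) = U i j"
    "quantum_permutation_algebra n A u" "factorizes n D \<pi> A u"
    using assms by (auto simp: hopf_image_for_def hopf_image_def)
  then show "quantum_permutation_algebra n A u" "complete_cstar A"
    by (auto intro: complete_cstar_if_factorizes)
  obtain \<sigma> \<rho> where "\<rho> \<in> star_hom A D" "\<forall>i < n. \<forall>j < n. \<sigma> (A_s_gen n i j) = u i j"
    "\<forall>x \<in> carrier (A_s n). \<pi> x = \<rho> (\<sigma> x)"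
    using \<pi>(4) by (auto simp: factorizes_def)
  then show "\<exists>\<rho> \<in> star_hom A D. \<forall>i < n. \<forall>j < n. \<rho> (u i j) = U i j"
    using \<pi>(2) A_s_gen_closed by (metis (no_types, lifting))
qed

section \<open>Maximal tensor products\<close>

locale cstar_pair = A: complete_cstar A + B: complete_cstar B
  for A :: "('a, 'm) cstar_scheme" and B :: "('b, 'n) cstar_scheme"
begin

abbreviation "AB \<equiv> max_tensor A B"
abbreviation "PA \<equiv> pair_alg A B"
abbreviation "rel \<equiv> bilinear_relations A B"
abbreviation "te \<equiv> tensor_elem A B"
abbreviation "i1 a \<equiv> te a \<one>\<^bsub>B\<^esub>"
abbreviation "i2 b \<equiv> te \<one>\<^bsub>A\<^esub> b"

lemma involutive_pairs: "involutive_monoid (A \<times>\<times> B) (\<lambda>(a, b). (star A a, star B b))"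
proof -
  interpret monoid "A \<times>\<times> B"
    by (rule DirProd_monoid) (rule ring.is_monoid[OF A.ring_A] ring.is_monoid[OF B.ring_A])+
  show ?thesis
    by unfold_locales (auto simp: DirProd_def A.star_mult B.star_mult)
qed

sublocale W: involutive_monoid "A \<times>\<times> B" "\<lambda>(a, b). (star A a, star B b)"
  rewrites "monoid_star_alg (A \<times>\<times> B) (\<lambda>(a, b). (star A a, star B b)) = PA"
  by (rule involutive_pairs) (simp add: pair_alg_def)

abbreviation "pr a b \<equiv> (delta (a, b) :: 'a \<times> 'b \<Rightarrow> complex)"

lemma pr_closed [simp]: "a \<in> carrier A \<Longrightarrow> b \<in> carrier B \<Longrightarrow> pr a b \<in> carrier PA"
  by (rule W.delta_closed) simp

lemma pr_mult: "pr a b \<otimes>\<^bsub>PA\<^esub> pr a' b' = pr (a \<otimes>\<^bsub>A\<^esub> a') (b \<otimes>\<^bsub>B\<^esub> b')"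
  using W.delta_mult[of "(a, b)" "(a', b')"] by (simp add: DirProd_def)

lemma pr_star: "star PA (pr a b) = pr (star A a) (star B b)"
  using W.delta_star[of "(a, b)"] by simp

lemma pr_one: "\<one>\<^bsub>PA\<^esub> = pr \<one>\<^bsub>A\<^esub> \<one>\<^bsub>B\<^esub>"
  using W.MA_simps(1) by simp

lemma relI:
  "a \<in> carrier A \<Longrightarrow> a' \<in> carrier A \<Longrightarrow> b \<in> carrier B \<Longrightarrow> pr (a \<oplus>\<^bsub>A\<^esub> a') b \<ominus>\<^bsub>PA\<^esub> (pr a b \<oplus>\<^bsub>PA\<^esub> pr a' b) \<in> rel"
  "a \<in> carrier A \<Longrightarrow> b \<in> carrier B \<Longrightarrow> b' \<in> carrier B \<Longrightarrow> pr a (b \<oplus>\<^bsub>B\<^esub> b') \<ominus>\<^bsub>PA\<^esub> (pr a b \<oplus>\<^bsub>PA\<^esub> pr a b') \<in> rel"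
  "a \<in> carrier A \<Longrightarrow> b \<in> carrier B \<Longrightarrow> pr (c \<odot>\<^bsub>A\<^esub> a) b \<ominus>\<^bsub>PA\<^esub> c \<odot>\<^bsub>PA\<^esub> pr a b \<in> rel"
  "a \<in> carrier A \<Longrightarrow> b \<in> carrier B \<Longrightarrow> pr a (c \<odot>\<^bsub>B\<^esub> b) \<ominus>\<^bsub>PA\<^esub> c \<odot>\<^bsub>PA\<^esub> pr a b \<in> rel"
  unfolding bilinear_relations_def Let_def by blast+

lemma relE:
  assumes "r \<in> rel"
  obtains a a' b where "a \<in> carrier A" "a' \<in> carrier A" "b \<in> carrier B" 
      "r = pr (a \<oplus>\<^bsub>A\<^esub> a') b \<ominus>\<^bsub>PA\<^esub> (pr a b \<oplus>\<^bsub>PA\<^esub> pr a' b)"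
  | a b b' where "a \<in> carrier A" "b \<in> carrier B" "b' \<in> carrier B"
      "r = pr a (b \<oplus>\<^bsub>B\<^esub> b') \<ominus>\<^bsub>PA\<^esub> (pr a b \<oplus>\<^bsub>PA\<^esub> pr a b')"
  | c a b where "a \<in> carrier A" "b \<in> carrier B" "r = pr (c \<odot>\<^bsub>A\<^esub> a) b \<ominus>\<^bsub>PA\<^esub> c \<odot>\<^bsub>PA\<^esub> pr a b"
  | c a b where "a \<in> carrier A" "b \<in> carrier B" "r = pr a (c \<odot>\<^bsub>B\<^esub> b) \<ominus>\<^bsub>PA\<^esub> c \<odot>\<^bsub>PA\<^esub> pr a b"
  using assms unfolding bilinear_relations_def Let_def
  by (elim UnE CollectE exE conjE) (rule that(1) that(2) that(3) that(4), assumption+)+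

lemma rel_closed: "r \<in> rel \<Longrightarrow> r \<in> carrier PA"
  by (erule relE) (simp_all del: W.MA_simps)

text \<open>A pair factors as \<open>(a, 1) (1, b)\<close>, so the two legs suffice.\<close>

lemma pr_star_gen:
  "carrier PA \<subseteq> star_gen PA ((\<lambda>a. pr a \<one>\<^bsub>B\<^esub>) ` carrier A \<union> (\<lambda>b. pr \<one>\<^bsub>A\<^esub> b) ` carrier B)"
proof (rule W.MA_star_gen)
  fix x assume "x \<in> carrier (A \<times>\<times> B)"
  then obtain a b where x: "x = (a, b)" "a \<in> carrier A" "b \<in> carrier B" by auto
  have dx: "delta x = pr a \<one>\<^bsub>B\<^esub> \<otimes>\<^bsub>PA\<^esub> pr \<one>\<^bsub>A\<^esub> b" using x by (simp add: pr_mult)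
  show "delta x \<in> star_gen PA ((\<lambda>a. pr a \<one>\<^bsub>B\<^esub>) ` carrier A \<union> (\<lambda>b. pr \<one>\<^bsub>A\<^esub> b) ` carrier B)"
    unfolding dx using x(2,3) by (intro star_gen.mult star_gen.gen) auto
qed

text \<open>Vanishing on the bilinearity relations makes an admissible seminorm a C*-seminorm on
  each leg, and \<open>seminorm_le_cnorm\<close> then bounds it independently of \<open>p\<close>.
  This is why the maximal tensor norm is finite.\<close>

lemma seminorm_legs:
  assumes p: "cstar_seminorm PA p" "\<And>r. r \<in> rel \<Longrightarrow> p r = 0"
  shows "a \<in> carrier A \<Longrightarrow> p (pr a \<one>\<^bsub>B\<^esub>) \<le> cnorm A a" "b \<in> carrier B \<Longrightarrow> p (pr \<one>\<^bsub>A\<^esub> b) \<le> cnorm B b"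
proof -
  interpret P: seminormed PA p
    by (intro seminormed.intro seminormed_axioms.intro W.star_algebra_MA p)
  have eq: "p x = p y" if "x \<ominus>\<^bsub>PA\<^esub> y \<in> rel" "x \<in> carrier PA" "y \<in> carrier PA" for x y
    by (rule seminorm_eqI[OF P.seminormed_axioms]) (use that p in auto)
  have "cstar_seminorm A (\<lambda>a. p (pr a \<one>\<^bsub>B\<^esub>))"
    unfolding cstar_seminorm_def
  proof (intro ballI conjI allI)
    fix a assume a: "a \<in> carrier A"
    then show "0 \<le> p (pr a \<one>\<^bsub>B\<^esub>)" by simp
    show "p (pr (star A a \<otimes>\<^bsub>A\<^esub> a) \<one>\<^bsub>B\<^esub>) = (p (pr a \<one>\<^bsub>B\<^esub>))\<^sup>2"
      using P.p_star_mult[of "pr a \<one>\<^bsub>B\<^esub>"] a by (simp add: pr_mult pr_star)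
    show "p (pr (c \<odot>\<^bsub>A\<^esub> a) \<one>\<^bsub>B\<^esub>) = cmod c * p (pr a \<one>\<^bsub>B\<^esub>)" for c
      using eq[OF relI(3)[of a "\<one>\<^bsub>B\<^esub>" c]] P.p_smult[of "pr a \<one>\<^bsub>B\<^esub>" c] a by (simp del: W.MA_simps)
    fix a' assume a': "a' \<in> carrier A"
    show "p (pr (a \<oplus>\<^bsub>A\<^esub> a') \<one>\<^bsub>B\<^esub>) \<le> p (pr a \<one>\<^bsub>B\<^esub>) + p (pr a' \<one>\<^bsub>B\<^esub>)"
      using eq[OF relI(1)[of a a' "\<one>\<^bsub>B\<^esub>"]] P.p_add[of "pr a \<one>\<^bsub>B\<^esub>" "pr a' \<one>\<^bsub>B\<^esub>"] a a' by (simp del: W.MA_simps)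
    show "p (pr (a \<otimes>\<^bsub>A\<^esub> a') \<one>\<^bsub>B\<^esub>) \<le> p (pr a \<one>\<^bsub>B\<^esub>) * p (pr a' \<one>\<^bsub>B\<^esub>)"
      using P.p_mult[of "pr a \<one>\<^bsub>B\<^esub>" "pr a' \<one>\<^bsub>B\<^esub>"] a a' by (simp add: pr_mult)
  qed
  then show "a \<in> carrier A \<Longrightarrow> p (pr a \<one>\<^bsub>B\<^esub>) \<le> cnorm A a" by (rule A.seminorm_le_cnorm)
  have "cstar_seminorm B (\<lambda>b. p (pr \<one>\<^bsub>A\<^esub> b))"
    unfolding cstar_seminorm_def
  proof (intro ballI conjI allI)
    fix b assume b: "b \<in> carrier B"
    then show "0 \<le> p (pr \<one>\<^bsub>A\<^esub> b)" by simp
    show "p (pr \<one>\<^bsub>A\<^esub> (star B b \<otimes>\<^bsub>B\<^esub> b)) = (p (pr \<one>\<^bsub>A\<^esub> b))\<^sup>2"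
      using P.p_star_mult[of "pr \<one>\<^bsub>A\<^esub> b"] b by (simp add: pr_mult pr_star)
    show "p (pr \<one>\<^bsub>A\<^esub> (c \<odot>\<^bsub>B\<^esub> b)) = cmod c * p (pr \<one>\<^bsub>A\<^esub> b)" for c
      using eq[OF relI(4)[of "\<one>\<^bsub>A\<^esub>" b c]] P.p_smult[of "pr \<one>\<^bsub>A\<^esub> b" c] b by (simp del: W.MA_simps)
    fix b' assume b': "b' \<in> carrier B"
    show "p (pr \<one>\<^bsub>A\<^esub> (b \<oplus>\<^bsub>B\<^esub> b')) \<le> p (pr \<one>\<^bsub>A\<^esub> b) + p (pr \<one>\<^bsub>A\<^esub> b')"
      using eq[OF relI(2)[of "\<one>\<^bsub>A\<^esub>" b b']] P.p_add[of "pr \<one>\<^bsub>A\<^esub> b" "pr \<one>\<^bsub>A\<^esub> b'"] b b' by (simp del: W.MA_simps)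
    show "p (pr \<one>\<^bsub>A\<^esub> (b \<otimes>\<^bsub>B\<^esub> b')) \<le> p (pr \<one>\<^bsub>A\<^esub> b) * p (pr \<one>\<^bsub>A\<^esub> b')"
      using P.p_mult[of "pr \<one>\<^bsub>A\<^esub> b" "pr \<one>\<^bsub>A\<^esub> b'"] b b' by (simp add: pr_mult)
  qed
  then show "b \<in> carrier B \<Longrightarrow> p (pr \<one>\<^bsub>A\<^esub> b) \<le> cnorm B b" by (rule B.seminorm_le_cnorm)
qed

lemma universal_pair: "universal PA rel"
proof (rule universalI[OF W.star_algebra_MA _ pr_star_gen])
  fix g assume "g \<in> (\<lambda>a. pr a \<one>\<^bsub>B\<^esub>) ` carrier A \<union> (\<lambda>b. pr \<one>\<^bsub>A\<^esub> b) ` carrier B"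
  then show "\<exists>K. \<forall>p. cstar_seminorm PA p \<and> (\<forall>r\<in>rel. p r = 0) \<longrightarrow> p g \<le> K"
    using seminorm_legs by blast
qed auto

sublocale U: universal PA rel by (rule universal_pair)

lemma complete_cstar_tensor: "complete_cstar AB"
  unfolding max_tensor_def by (rule U.complete_cstar_universal)

sublocale AB: complete_cstar AB by (rule complete_cstar_tensor)

lemma um_hom: "universal_map PA rel \<in> star_hom PA AB"
  unfolding max_tensor_def by (rule U.universal_map_star_hom)

lemma um_eq: 
  assumes "x \<ominus>\<^bsub>PA\<^esub> y \<in> rel" "x \<in> carrier PA" "y \<in> carrier PA"
  shows "universal_map PA rel x = universal_map PA rel y"
proof -
  have "universal_map PA rel x \<ominus>\<^bsub>AB\<^esub> universal_map PA rel y = \<zero>\<^bsub>AB\<^esub>"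
    using star_hom_minus[OF W.star_algebra_MA AB.star_algebra_axioms um_hom assms(2,3)]
      U.universal_map_vanishes[OF assms(1) rel_closed[OF assms(1)]] by (simp add: max_tensor_def)
  then show ?thesis using AB.minus_eq_zeroD assms star_homD(1)[OF um_hom] by blast
qed

lemma te_closed [simp]: "a \<in> carrier A \<Longrightarrow> b \<in> carrier B \<Longrightarrow> te a b \<in> carrier AB"
  unfolding tensor_elem_def by (rule star_homD(1)[OF um_hom]) simp

lemma te_mult: 
  assumes "a \<in> carrier A" "b \<in> carrier B" "a' \<in> carrier A" "b' \<in> carrier B"
  shows "te a b \<otimes>\<^bsub>AB\<^esub> te a' b' = te (a \<otimes>\<^bsub>A\<^esub> a') (b \<otimes>\<^bsub>B\<^esub> b')"
  using star_homD(2)[OF um_hom, of "pr a b" "pr a' b'"] assms by (simp add: tensor_elem_def pr_mult)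

lemma te_star: 
  assumes "a \<in> carrier A" "b \<in> carrier B"
  shows "star AB (te a b) = te (star A a) (star B b)"
  using star_homD(5)[OF um_hom, of "pr a b"] assms by (simp add: tensor_elem_def pr_star)

lemma te_one: "te \<one>\<^bsub>A\<^esub> \<one>\<^bsub>B\<^esub> = \<one>\<^bsub>AB\<^esub>"
  using star_homD(4)[OF um_hom] unfolding tensor_elem_def pr_one by simp

lemma te_bilinear:
  "a \<in> carrier A \<Longrightarrow> a' \<in> carrier A \<Longrightarrow> b \<in> carrier B \<Longrightarrow> te (a \<oplus>\<^bsub>A\<^esub> a') b = te a b \<oplus>\<^bsub>AB\<^esub> te a' b"
  "a \<in> carrier A \<Longrightarrow> b \<in> carrier B \<Longrightarrow> b' \<in> carrier B \<Longrightarrow> te a (b \<oplus>\<^bsub>B\<^esub> b') = te a b \<oplus>\<^bsub>AB\<^esub> te a b'"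
  "a \<in> carrier A \<Longrightarrow> b \<in> carrier B \<Longrightarrow> te (c \<odot>\<^bsub>A\<^esub> a) b = c \<odot>\<^bsub>AB\<^esub> te a b"
  "a \<in> carrier A \<Longrightarrow> b \<in> carrier B \<Longrightarrow> te a (c \<odot>\<^bsub>B\<^esub> b) = c \<odot>\<^bsub>AB\<^esub> te a b"
  unfolding tensor_elem_def
  using um_eq[OF relI(1)] um_eq[OF relI(2)] um_eq[OF relI(3)] um_eq[OF relI(4)]
  by (simp_all add: star_homD(3,6)[OF um_hom] del: W.MA_simps)

lemma i1_hom: "(\<lambda>a. i1 a) \<in> star_hom A AB"
  by (rule star_homI) (simp_all add: te_mult te_star te_one te_bilinear)

lemma i2_hom: "(\<lambda>b. i2 b) \<in> star_hom B AB"
  by (rule star_homI) (simp_all add: te_mult te_star te_one te_bilinear)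

lemma te_factor:
  assumes "a \<in> carrier A" "b \<in> carrier B"
  shows "te a b = i1 a \<otimes>\<^bsub>AB\<^esub> i2 b" "i1 a \<otimes>\<^bsub>AB\<^esub> i2 b = i2 b \<otimes>\<^bsub>AB\<^esub> i1 a"
  using assms by (simp_all add: te_mult)

lemma generates_legs: "generates_cstar AB ((\<lambda>a. i1 a) ` carrier A \<union> (\<lambda>b. i2 b) ` carrier B)"
proof -
  have "(\<lambda>a. i1 a) ` carrier A \<union> (\<lambda>b. i2 b) ` carrier B =
    universal_map PA rel ` ((\<lambda>a. pr a \<one>\<^bsub>B\<^esub>) ` carrier A \<union> (\<lambda>b. pr \<one>\<^bsub>A\<^esub> b) ` carrier B)"
    by (simp add: image_Un image_image tensor_elem_def)
  moreover have "(\<lambda>a. pr a \<one>\<^bsub>B\<^esub>) ` carrier A \<union> (\<lambda>b. pr \<one>\<^bsub>A\<^esub> b) ` carrier B \<subseteq> carrier PA" by auto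
  ultimately show ?thesis
    unfolding max_tensor_def using U.generates_universal[OF _ pr_star_gen] by metis
qed

text \<open>Each leg lies in the closure of what its own generators produce, since the leg
  embeddings are continuous.\<close>

lemma generates_tensor:
  assumes GA: "GA \<subseteq> carrier A" "generates_cstar A GA" and GB: "GB \<subseteq> carrier B" "generates_cstar B GB"
  shows "generates_cstar AB ((\<lambda>a. i1 a) ` GA \<union> (\<lambda>b. i2 b) ` GB)"
proof (rule AB.generates_cstar_trans[OF generates_legs])
  let ?G = "(\<lambda>a. i1 a) ` GA \<union> (\<lambda>b. i2 b) ` GB"
  show G: "?G \<subseteq> carrier AB" using GA GB by auto
  have "i1 a \<in> gen_closure AB ?G" if "a \<in> carrier A" for a
    by (rule star_hom_gen_closure[OF A.complete_cstar_axioms AB.pre_cstar_axioms i1_hom GA G _ that])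
      (auto intro: star_gen.gen)
  moreover have "i2 b \<in> gen_closure AB ?G" if "b \<in> carrier B" for b
    by (rule star_hom_gen_closure[OF B.complete_cstar_axioms AB.pre_cstar_axioms i2_hom GB G _ that])
      (auto intro: star_gen.gen)
  ultimately show "(\<lambda>a. i1 a) ` carrier A \<union> (\<lambda>b. i2 b) ` carrier B \<subseteq> gen_closure AB ?G" by blast
qed

lemma tensor_hom_eqI:
  assumes "pre_cstar D" "f \<in> star_hom AB D" "g \<in> star_hom AB D"
    and "\<And>a b. a \<in> carrier A \<Longrightarrow> b \<in> carrier B \<Longrightarrow> f (te a b) = g (te a b)" "x \<in> carrier AB"
  shows "f x = g x"
  by (rule star_hom_eqI[OF AB.complete_cstar_axioms assms(1-3) _ generates_legs _ assms(5)])
    (use assms(4) in auto)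

section \<open>The universal property of the maximal tensor product\<close>

definition commuting where
  "commuting D f g \<longleftrightarrow> f \<in> star_hom A D \<and> g \<in> star_hom B D \<and>
    (\<forall>a \<in> carrier A. \<forall>b \<in> carrier B. f a \<otimes>\<^bsub>D\<^esub> g b = g b \<otimes>\<^bsub>D\<^esub> f a)"

text \<open>The prescription \<open>f a \<otimes> g b\<close> is multiplicative and compatible with
  adjoints because values of \<open>f\<close> can be moved past values of \<open>g\<close>. The
  bilinearity relations go to zero by linearity of both maps.\<close>

theorem tensor_universal:
  assumes D: "complete_cstar D" and fg: "commuting D f g"
  shows "\<exists>h \<in> star_hom AB D. \<forall>a \<in> carrier A. \<forall>b \<in> carrier B. h (te a b) = f a \<otimes>\<^bsub>D\<^esub> g b"
proof -
  interpret D: complete_cstar D by fact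
  have f: "f \<in> star_hom A D" and g: "g \<in> star_hom B D"
    and comm: "a \<in> carrier A \<Longrightarrow> b \<in> carrier B \<Longrightarrow> f a \<otimes>\<^bsub>D\<^esub> g b = g b \<otimes>\<^bsub>D\<^esub> f a" for a b
    using fg by (auto simp: commuting_def)
  define \<phi> where "\<phi> x = f (fst x) \<otimes>\<^bsub>D\<^esub> g (snd x)" for x
  note [simp] = star_homD(1)[OF f] star_homD(1)[OF g]
  have "\<exists>h \<in> star_hom PA D. \<forall>x \<in> carrier (A \<times>\<times> B). h (delta x) = \<phi> x"
  proof (rule W.MA_extension[OF D.star_algebra_axioms])
    fix x assume "x \<in> carrier (A \<times>\<times> B)"
    then obtain a b where x: "x = (a, b)" "a \<in> carrier A" "b \<in> carrier B" by auto
    then show "\<phi> x \<in> carrier D" by (simp add: \<phi>_def)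
    show "\<phi> ((\<lambda>(a, b). (star A a, star B b)) x) = star D (\<phi> x)"
      using x comm[of "star A a" "star B b"] by (simp add: \<phi>_def star_homD[OF f] star_homD[OF g] D.star_mult)
    fix y assume "y \<in> carrier (A \<times>\<times> B)"
    then obtain a' b' where y: "y = (a', b')" "a' \<in> carrier A" "b' \<in> carrier B" by auto
    have "f a \<otimes>\<^bsub>D\<^esub> f a' \<otimes>\<^bsub>D\<^esub> (g b \<otimes>\<^bsub>D\<^esub> g b') = f a \<otimes>\<^bsub>D\<^esub> (f a' \<otimes>\<^bsub>D\<^esub> g b) \<otimes>\<^bsub>D\<^esub> g b'"
      using x y by (simp add: D.m_assoc)
    also have "\<dots> = f a \<otimes>\<^bsub>D\<^esub> g b \<otimes>\<^bsub>D\<^esub> (f a' \<otimes>\<^bsub>D\<^esub> g b')"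
      unfolding comm[OF y(2) x(3)] using x y by (simp add: D.m_assoc)
    finally show "\<phi> (x \<otimes>\<^bsub>A \<times>\<times> B\<^esub> y) = \<phi> x \<otimes>\<^bsub>D\<^esub> \<phi> y"
      using x y by (simp add: \<phi>_def DirProd_def star_homD[OF f] star_homD[OF g])
  next
    show "\<phi> \<one>\<^bsub>A \<times>\<times> B\<^esub> = \<one>\<^bsub>D\<^esub>" by (simp add: \<phi>_def star_homD[OF f] star_homD[OF g])
  qed
  then obtain k where k: "k \<in> star_hom PA D" "\<forall>x \<in> carrier (A \<times>\<times> B). k (delta x) = \<phi> x" by blast
  have kp: "k (pr a b) = f a \<otimes>\<^bsub>D\<^esub> g b" if "a \<in> carrier A" "b \<in> carrier B" for a b
    using k(2) that by (simp add: \<phi>_def)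
  note km = star_hom_minus[OF W.star_algebra_MA D.star_algebra_axioms k(1)]
  have "k r = \<zero>\<^bsub>D\<^esub>" if "r \<in> rel" for r
    using that
    by (cases rule: relE) (simp_all add: km kp star_homD(3,6)[OF k(1)] star_homD[OF f] star_homD[OF g]
        D.l_distr D.r_distr D.smult_mult_left D.smult_mult_right del: W.MA_simps)
  from U.universal_extension[OF D k(1) this] obtain h
    where h: "h \<in> star_hom AB D" "\<forall>x \<in> carrier PA. h (universal_map PA rel x) = k x"
    unfolding max_tensor_def by blast
  have "h (te a b) = f a \<otimes>\<^bsub>D\<^esub> g b" if "a \<in> carrier A" "b \<in> carrier B" for a b
    using h(2) that kp by (simp add: tensor_elem_def)
  with h(1) show ?thesis by blast
qed

text \<open>Discharges the definite description in \<open>tensor_ext\<close>: restricting the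
  universal morphism to the carrier gives existence, and elementary tensors generate, which gives
  uniqueness.\<close>

lemma the_tensor_hom:
  assumes D: "complete_cstar D" and fg: "commuting D f g"
    and F: "\<And>a b. a \<in> carrier A \<Longrightarrow> b \<in> carrier B \<Longrightarrow> F a b = f a \<otimes>\<^bsub>D\<^esub> g b"
  shows "tensor_ext A B D F \<in> star_hom AB D"
    "a \<in> carrier A \<Longrightarrow> b \<in> carrier B \<Longrightarrow> tensor_ext A B D F (te a b) = f a \<otimes>\<^bsub>D\<^esub> g b"
proof -
  interpret D: complete_cstar D by fact
  obtain h where h: "h \<in> star_hom AB D" "\<forall>a \<in> carrier A. \<forall>b \<in> carrier B. h (te a b) = f a \<otimes>\<^bsub>D\<^esub> g b"
    using tensor_universal[OF D fg] by blast
  let ?P = "\<lambda>h. h \<in> star_hom AB D \<and> h \<in> extensional (carrier AB) \<and>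
     (\<forall>a \<in> carrier A. \<forall>b \<in> carrier B. h (te a b) = F a b)"
  have r: "restrict h (carrier AB) \<in> star_hom AB D"
    by (rule star_hom_cong[OF AB.star_algebra_axioms h(1)]) simp
  have ex: "?P (restrict h (carrier AB))"
    using h(2) r F by simp
  have un: "k = k'" if "?P k" "?P k'" for k k'
  proof (rule extensionalityI[of _ "carrier AB"])
    fix x assume x: "x \<in> carrier AB"
    have k: "k \<in> star_hom AB D" "k' \<in> star_hom AB D" using that by blast+
    show "k x = k' x"
      by (rule tensor_hom_eqI[OF D.pre_cstar_axioms k _ x]) (use that in metis)
  qed (use that in blast)+
  have "?P (tensor_ext A B D F)"
    unfolding tensor_ext_def by (rule theI[where P="?P", OF ex]) (use un ex in blast)
  then show "tensor_ext A B D F \<in> star_hom AB D"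
    "a \<in> carrier A \<Longrightarrow> b \<in> carrier B \<Longrightarrow> tensor_ext A B D F (te a b) = f a \<otimes>\<^bsub>D\<^esub> g b"
    using F by (blast, metis)
qed

end

lemma cstar_pair_intro: "complete_cstar A \<Longrightarrow> complete_cstar B \<Longrightarrow> cstar_pair A B"
  by (rule cstar_pair.intro)

text \<open>The legs of \<open>C \<otimes> D\<close> commute, so \<open>f\<close> and
  \<open>g\<close> followed by them form a commuting pair.\<close>

lemma tensor_map_hom:
  assumes A: "complete_cstar A" and B: "complete_cstar B" and C: "complete_cstar C" and D: "complete_cstar D"
    and f: "f \<in> star_hom A C" and g: "g \<in> star_hom B D"
  shows "tensor_map A B C D f g \<in> star_hom (max_tensor A B) (max_tensor C D)"
    "a \<in> carrier A \<Longrightarrow> b \<in> carrier B \<Longrightarrow>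
      tensor_map A B C D f g (tensor_elem A B a b) = tensor_elem C D (f a) (g b)"
proof -
  interpret AB: cstar_pair A B by (rule cstar_pair_intro[OF A B])
  interpret CD: cstar_pair C D by (rule cstar_pair_intro[OF C D])
  note [simp] = star_homD(1)[OF f] star_homD(1)[OF g]
  have c: "AB.commuting (max_tensor C D) (\<lambda>a. CD.i1 (f a)) (\<lambda>b. CD.i2 (g b))"
    unfolding AB.commuting_def
    using star_hom_comp[OF f CD.i1_hom] star_hom_comp[OF g CD.i2_hom] CD.te_factor(2) by simp
  have F: "tensor_elem C D (f a) (g b) = CD.i1 (f a) \<otimes>\<^bsub>max_tensor C D\<^esub> CD.i2 (g b)"
    if "a \<in> carrier A" "b \<in> carrier B" for a b using that by (intro CD.te_factor) simp_all
  show "tensor_map A B C D f g \<in> star_hom (max_tensor A B) (max_tensor C D)"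
    "a \<in> carrier A \<Longrightarrow> b \<in> carrier B \<Longrightarrow>
      tensor_map A B C D f g (tensor_elem A B a b) = tensor_elem C D (f a) (g b)"
    unfolding tensor_map_def using AB.the_tensor_hom[OF CD.complete_cstar_tensor c F] F by auto
qed

section \<open>Bounded operators on Hilbert spaces\<close>

lemma cinner_add_right: "cinner x (y + z) = cinner x y + cinner x z"
  by (subst (1 2 3) cinner_commute) (simp add: cinner_add_left)

lemma cinner_scaleC_right: "cinner x (scaleC c y) = cnj c * cinner x y"
  by (subst (1 2) cinner_commute) (simp add: cinner_scaleC_left)

lemma scaleC_one [simp]: "scaleC 1 x = x"
  using scaleC_of_real[of 1 x] by simp

lemma scaleC_zero_left [simp]: "scaleC 0 x = 0"
  using scaleC_of_real[of 0 x] by simp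

lemma scaleC_zero_right [simp]: "scaleC c 0 = 0"
  using scaleC_scaleC[of c 0 0] by simp

lemma cinner_scaleR_left: "cinner (r *\<^sub>R x) y = complex_of_real r * cinner x y"
  and cinner_scaleR_right: "cinner x (r *\<^sub>R y) = complex_of_real r * cinner x y"
  by (simp_all add: cinner_scaleC_left cinner_scaleC_right flip: scaleC_of_real)

lemma cinner_zero [simp]: "cinner 0 x = 0" "cinner x 0 = 0"
  using cinner_scaleR_left[of 0 x x] cinner_scaleR_right[of x 0 x] by simp_all

lemma cinner_minus_right: "cinner z (x - y) = cinner z x - cinner z y"
  using cinner_add_right[of z x "(-1) *\<^sub>R y"] cinner_scaleR_right[of z "-1" y] by simp

lemma norm_add_sq: "(norm (x + y))\<^sup>2 = (norm x)\<^sup>2 + 2 * Re (cinner x y) + (norm y)\<^sup>2"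
proof -
  have "complex_of_real ((norm (x + y))\<^sup>2) = cinner (x + y) (x + y)" by (rule cinner_self[symmetric])
  also have "\<dots> = cinner x x + (cinner x y + cnj (cinner x y)) + cinner y y"
    using cinner_commute[of y x] by (simp add: cinner_add_left cinner_add_right)
  also have "\<dots> = complex_of_real ((norm x)\<^sup>2 + 2 * Re (cinner x y) + (norm y)\<^sup>2)"
    by (simp add: cinner_self complex_add_cnj)
  finally show ?thesis by (simp only: of_real_eq_iff)
qed

lemma norm_scaleC: "norm (scaleC c x) = cmod c * norm x"
proof -
  have "complex_of_real ((norm (scaleC c x))\<^sup>2) = cinner (scaleC c x) (scaleC c x)" by (rule cinner_self[symmetric])
  also have "\<dots> = (c * cnj c) * cinner x x" by (simp add: cinner_scaleC_left cinner_scaleC_right)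
  also have "\<dots> = complex_of_real ((cmod c * norm x)\<^sup>2)"
    by (simp add: cinner_self complex_norm_square[symmetric] power_mult_distrib)
  finally have "(norm (scaleC c x))\<^sup>2 = (cmod c * norm x)\<^sup>2" by (simp only: of_real_eq_iff)
  then show ?thesis by (simp add: power2_eq_iff_nonneg)
qed

text \<open>Cauchy-Schwarz read off from the triangle inequality of the norm: expanding
  \<open>norm (x + y) ^ 2\<close> bounds the real part, and multiplying \<open>x\<close> by a phase
  makes the inner product real.\<close>

lemma cinner_bound: "cmod (cinner x y) \<le> norm x * norm y"
proof -
  have re: "Re (cinner x y) \<le> norm x * norm y" for x
  proof -
    have "(norm (x + y))\<^sup>2 \<le> (norm x + norm y)\<^sup>2" by (intro power_mono norm_triangle_ineq) simp
    then show ?thesis by (simp add: norm_add_sq power2_sum)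
  qed
  show ?thesis
  proof (cases "cinner x y = 0")
    case False
    define c where "c = cnj (cinner x y) / complex_of_real (cmod (cinner x y))"
    have c: "cmod c = 1" using False by (simp add: c_def norm_divide)
    have "c * cinner x y = complex_of_real (cmod (cinner x y))"
      using False complex_norm_square[of "cinner x y"]
      by (simp add: c_def power2_eq_square divide_simps mult.commute)
    then have "cmod (cinner x y) = Re (cinner (scaleC c x) y)" by (simp add: cinner_scaleC_left)
    also have "\<dots> \<le> norm (scaleC c x) * norm y" by (rule re)
    finally show ?thesis by (simp add: norm_scaleC c)
  qed simp
qed

lemma cinner_eqI: "(\<And>x. cinner x y = cinner x z) \<Longrightarrow> y = z"
  using cinner_self[of "y - z"] by (simp add: cinner_minus_right)

lemma bounded_linear_scaleC: "bounded_linear (scaleC c :: 'h::chilbert_space \<Rightarrow> 'h)"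
proof
  fix x y :: 'h and r :: real
  show "scaleC c (x + y) = scaleC c x + scaleC c y" by (rule scaleC_add_right)
  show "scaleC c (r *\<^sub>R x) = r *\<^sub>R scaleC c x"
    by (simp add: scaleC_scaleC mult.commute flip: scaleC_of_real)
  show "\<exists>K. \<forall>x :: 'h. norm (scaleC c x) \<le> norm x * K"
    by (intro exI[of _ "cmod c"]) (simp add: norm_scaleC mult.commute)
qed

lemma bounded_linear_cinner_left: "bounded_linear (\<lambda>x :: 'h::chilbert_space. cinner x y)"
proof
  show "\<exists>K. \<forall>x :: 'h. norm (cinner x y) \<le> norm x * K"
    by (intro exI[of _ "norm y"]) (simp add: cinner_bound)
qed (simp_all add: cinner_add_left cinner_scaleR_left scaleR_conv_of_real)

text \<open>The representing vector minimizes \<open>\<parallel>x\<parallel>\<^sup>2 - 2 Re (\<phi> x)\<close>.\<close>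

theorem riesz:
  fixes \<phi> :: "'h::chilbert_space \<Rightarrow> complex"
  assumes \<phi>: "bounded_linear \<phi>" and scaleC: "\<And>c x. \<phi> (scaleC c x) = c * \<phi> x"
  shows "\<exists>z. \<forall>x. \<phi> x = cinner x z"
proof -
  interpret \<phi>: bounded_linear \<phi> by fact
  obtain K where K: "\<And>x. cmod (\<phi> x) \<le> norm x * K" using \<phi>.bounded by blast
  define f where "f x = (norm x)\<^sup>2 - 2 * Re (\<phi> x)" for x
  have f_bound: "- K\<^sup>2 \<le> f x" for x
  proof -
    have "Re (\<phi> x) \<le> norm x * K" using complex_Re_le_cmod K order_trans by blast
    moreover have "0 \<le> (norm x - K)\<^sup>2" by simp
    ultimately show ?thesis by (simp add: f_def power2_diff)
  qed
  define d where "d = Inf (range f)"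
  have bdd: "bdd_below (range f)" using f_bound by (auto simp: bdd_below_def)
  have d_le: "d \<le> f x" for x unfolding d_def by (rule cInf_lower) (simp_all add: bdd)
  have "\<exists>x. f x < d + 1 / Suc k" for k
    using cInf_lessD[of "range f" "d + 1 / Suc k"] by (auto simp: d_def)
  then obtain X where X: "\<And>k. f (X k) < d + 1 / Suc k" by metis
  \<comment> \<open>The parallelogram law: \<open>f\<close> differs from the squared norm by a
    real-linear term, so its convexity defect at the midpoint measures the distance. Minimizing
    sequences are therefore Cauchy.\<close>
  have para: "(norm (x - y))\<^sup>2 = 2 * (f x + f y - 2 * f ((1/2) *\<^sub>R (x + y)))" for x y
  proof -
    have "(norm (x - y))\<^sup>2 = (norm x)\<^sup>2 - 2 * Re (cinner x y) + (norm y)\<^sup>2"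
      using norm_add_sq[of x "(-1) *\<^sub>R y"] cinner_scaleR_right[of x "-1" y] by simp
    then show ?thesis
      by (simp add: f_def \<phi>.scaleR \<phi>.add norm_add_sq power2_eq_square[of "norm (x + y) / 2"] 
          power2_eq_square[of "norm (x + y)", symmetric] power_divide cinner_scaleR_left
          cinner_scaleR_right algebra_simps)
  qed
  have "Cauchy X"
  proof (rule metric_CauchyI)
    fix e :: real assume e: "0 < e"
    then have "0 < e\<^sup>2 / 4" by simp
    then obtain N where N: "1 / Suc N < e\<^sup>2 / 4" using nat_approx_posE by blast
    have "dist (X m) (X n) < e" if "m \<ge> N" "n \<ge> N" for m n
    proof -
      have b: "1 / Suc k < e\<^sup>2 / 4" if "k \<ge> N" for k
      proof -
        have "1 / real (Suc k) \<le> 1 / real (Suc N)" using that by (intro divide_left_mono) auto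
        with N show ?thesis by simp
      qed
      have "(norm (X m - X n))\<^sup>2 < e\<^sup>2"
        using para[of "X m" "X n"] d_le[of "(1/2) *\<^sub>R (X m + X n)"] X[of m] X[of n] b[OF that(1)] b[OF that(2)]
        by simp
      then show ?thesis using e by (simp add: dist_norm power_less_imp_less_base)
    qed
    then show "\<exists>M. \<forall>m\<ge>M. \<forall>n\<ge>M. dist (X m) (X n) < e" by blast
  qed
  then obtain z where z: "X \<longlonglongrightarrow> z" using Cauchy_convergent convergent_def by blast
  have fz: "f z \<le> d"
  proof (rule LIMSEQ_le)
    show "(\<lambda>k. f (X k)) \<longlonglongrightarrow> f z"
      unfolding f_def by (intro tendsto_intros z \<phi>.tendsto)
    show "(\<lambda>k. d + 1 / Suc k) \<longlonglongrightarrow> d"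
      using tendsto_add[OF tendsto_const[of d] lim_1_over_n[THEN LIMSEQ_Suc]] by simp
  qed (use X less_imp_le in blast)
  have re: "Re (\<phi> h) = Re (cinner h z)" for h
  proof -
    define a where "a = Re (cinner h z) - Re (\<phi> h)"
    define q where "q = (norm h)\<^sup>2"
    have q: "0 \<le> q" by (simp add: q_def)
    \<comment> \<open>Moving away from \<open>z\<close> in the direction \<open>h\<close> cannot
      take \<open>f\<close> below its minimum.\<close>
    have "0 \<le> 2 * s * a + s\<^sup>2 * q" for s :: real
    proof -
      have "f z \<le> f (s *\<^sub>R h + z)" using fz d_le order_trans by blast
      then show ?thesis
        using cinner_commute[of z h]
        by (simp add: f_def norm_add_sq \<phi>.add \<phi>.scaleR cinner_scaleR_left cinner_scaleR_right a_def q_def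
            power_mult_distrib algebra_simps)
    qed
    \<comment> \<open>The optimal \<open>s\<close> would be \<open>- a / q\<close>; replacing
      \<open>q\<close> by \<open>q + 1\<close> avoids division by zero and still forces
      \<open>a = 0\<close>.\<close>
    from this[of "- a / (q + 1)"] have "0 \<le> 2 * (- a / (q + 1)) * a + (- a / (q + 1))\<^sup>2 * q" .
    also have "\<dots> = - (a\<^sup>2 * (q + 2)) / (q + 1)\<^sup>2"
      using q by (simp add: divide_simps power2_eq_square) (simp add: algebra_simps)
    finally have "a\<^sup>2 * (q + 2) \<le> 0" using q by (simp add: zero_le_divide_iff divide_le_0_iff)
    with q have "a = 0" by (simp add: mult_le_0_iff)
    then show ?thesis by (simp add: a_def)
  qed
  have "\<phi> h = cinner h z" for h
  proof (rule complex_eqI)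
    show "Im (\<phi> h) = Im (cinner h z)"
      using re[of "scaleC \<i> h"] by (simp add: scaleC cinner_scaleC_left)
  qed (rule re)
  then show ?thesis by blast
qed

section \<open>Bounded operators form a C*-algebra\<close>

lemma bounded_ops_carrier: 
  "T \<in> carrier bounded_ops \<longleftrightarrow> (\<forall>c x. blinfun_apply T (scaleC c x) = scaleC c (blinfun_apply T x))"
  by (simp add: bounded_ops_def)

lemma bounded_ops_simps [simp]:
  "S \<otimes>\<^bsub>bounded_ops\<^esub> T = S o\<^sub>L T" "\<one>\<^bsub>bounded_ops\<^esub> = id_blinfun" "\<zero>\<^bsub>bounded_ops\<^esub> = 0" "S \<oplus>\<^bsub>bounded_ops\<^esub> T = S + T"
  "star bounded_ops = adjoint_op" "cnorm bounded_ops = norm"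
  by (simp_all add: bounded_ops_def)

lemma bounded_ops_smult [simp]: "blinfun_apply (c \<odot>\<^bsub>bounded_ops\<^esub> T) x = scaleC c (blinfun_apply T x)"
proof -
  have "bounded_linear (\<lambda>x. scaleC c (blinfun_apply T x))"
    by (rule bounded_linear_compose[OF bounded_linear_scaleC blinfun.bounded_linear_right])
  then show ?thesis by (simp add: bounded_ops_def bounded_linear_Blinfun_apply)
qed

lemma adjoint_unique:
  assumes "\<And>x y. cinner (blinfun_apply T x) y = cinner x (blinfun_apply S y)"
  shows "adjoint_op T = S"
  unfolding adjoint_op_def
proof (rule the_equality)
  fix R assume R: "\<forall>x y. cinner (blinfun_apply T x) y = cinner x (blinfun_apply R y)"
  show "R = S"
  proof (rule blinfun_eqI, rule cinner_eqI)
    fix y x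
    show "cinner x (blinfun_apply R y) = cinner x (blinfun_apply S y)" using R assms[of x y] by metis
  qed
qed (use assms in blast)

text \<open>\<open>riesz\<close> yields the vectors \<open>S y\<close> one at a time. They are
  determined by inner products, which makes \<open>S\<close> linear, and Cauchy-Schwarz bounds
  them.\<close>

lemma adjoint_exists:
  fixes T :: "'h::chilbert_space \<Rightarrow>\<^sub>L 'h"
  assumes T: "T \<in> carrier bounded_ops"
  shows "\<exists>S \<in> carrier bounded_ops. (\<forall>x y. cinner (blinfun_apply T x) y = cinner x (blinfun_apply S y)) \<and> norm S \<le> norm T"
proof -
  have "\<exists>z. \<forall>x. cinner (blinfun_apply T x) y = cinner x z" for y
  proof (rule riesz)
    show "bounded_linear (\<lambda>x. cinner (blinfun_apply T x) y)"
      by (rule bounded_linear_compose[OF bounded_linear_cinner_left blinfun.bounded_linear_right])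
    show "cinner (blinfun_apply T (scaleC c x)) y = c * cinner (blinfun_apply T x) y" for c x
      using T by (simp add: bounded_ops_carrier cinner_scaleC_left)
  qed
  then obtain S where S: "\<And>x y. cinner (blinfun_apply T x) y = cinner x (S y)" by metis
  have bound: "norm (S y) \<le> norm y * norm T" for y
  proof -
    have "(norm (S y))\<^sup>2 = cmod (cinner (blinfun_apply T (S y)) y)"
      by (simp add: S cinner_self norm_power)
    also have "\<dots> \<le> norm (blinfun_apply T (S y)) * norm y" by (rule cinner_bound)
    also have "\<dots> \<le> norm T * norm (S y) * norm y" by (intro mult_right_mono norm_blinfun) simp
    finally have "norm (S y) * norm (S y) \<le> norm (S y) * (norm y * norm T)"
      by (simp add: power2_eq_square mult_ac)
    then show ?thesis by (cases "S y = 0") auto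
  qed
  have sC: "S (scaleC c y) = scaleC c (S y)" for c y
    by (rule cinner_eqI) (simp add: cinner_scaleC_right flip: S)
  have lin: "bounded_linear S"
  proof
    show "S (x + y) = S x + S y" for x y
      by (rule cinner_eqI) (simp add: cinner_add_right flip: S)
    show "S (r *\<^sub>R x) = r *\<^sub>R S x" for r x
      by (simp add: sC flip: scaleC_of_real)
    show "\<exists>K. \<forall>x. norm (S x) \<le> norm x * K" using bound by blast
  qed
  have "norm (Blinfun S) \<le> norm T"
    by (rule norm_blinfun_bound) (use bound lin in \<open>simp_all add: bounded_linear_Blinfun_apply mult.commute\<close>)
  then show ?thesis
    by (intro bexI[of _ "Blinfun S"]) (simp_all add: bounded_ops_carrier bounded_linear_Blinfun_apply lin S sC)
qed

lemma adjoint: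
  assumes T: "T \<in> carrier bounded_ops"
  shows "adjoint_op T \<in> carrier bounded_ops" "cinner (blinfun_apply T x) y = cinner x (blinfun_apply (adjoint_op T) y)"
    "cinner (blinfun_apply (adjoint_op T) x) y = cinner x (blinfun_apply T y)" "norm (adjoint_op T) \<le> norm T"
proof -
  obtain S where S: "S \<in> carrier bounded_ops" "\<And>x y. cinner (blinfun_apply T x) y = cinner x (blinfun_apply S y)" "norm S \<le> norm T"
    using adjoint_exists[OF T] by blast
  with adjoint_unique[OF S(2)] show "adjoint_op T \<in> carrier bounded_ops" "norm (adjoint_op T) \<le> norm T"
    and *: "cinner (blinfun_apply T x) y = cinner x (blinfun_apply (adjoint_op T) y)" for x y by simp_all
  show "cinner (blinfun_apply (adjoint_op T) x) y = cinner x (blinfun_apply T y)"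
    using *[of y x] cinner_commute[of x "blinfun_apply T y"] cinner_commute[of "blinfun_apply (adjoint_op T) x" y] by simp
qed

lemma star_algebra_bounded_ops: "star_algebra (bounded_ops :: ('h::chilbert_space \<Rightarrow>\<^sub>L 'h) cstar)"
proof (rule star_algebraI)
  fix S T :: "'h \<Rightarrow>\<^sub>L 'h" assume S: "S \<in> carrier bounded_ops"
  show "star bounded_ops S \<in> carrier bounded_ops" using adjoint(1)[OF S] by simp
  show "star bounded_ops (star bounded_ops S) = S" unfolding bounded_ops_simps by (rule adjoint_unique) (rule adjoint(3)[OF S])
  show "star bounded_ops (c \<odot>\<^bsub>bounded_ops\<^esub> S) = cnj c \<odot>\<^bsub>bounded_ops\<^esub> star bounded_ops S" for c
    unfolding bounded_ops_simps
    by (rule adjoint_unique) (simp add: cinner_scaleC_left cinner_scaleC_right adjoint(2)[OF S])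
  assume T: "T \<in> carrier bounded_ops"
  show "star bounded_ops (S \<oplus>\<^bsub>bounded_ops\<^esub> T) = star bounded_ops S \<oplus>\<^bsub>bounded_ops\<^esub> star bounded_ops T"
    unfolding bounded_ops_simps
    by (rule adjoint_unique) (simp add: blinfun.add_left cinner_add_left cinner_add_right adjoint(2)[OF S] adjoint(2)[OF T])
  show "star bounded_ops (S \<otimes>\<^bsub>bounded_ops\<^esub> T) = star bounded_ops T \<otimes>\<^bsub>bounded_ops\<^esub> star bounded_ops S"
    unfolding bounded_ops_simps by (rule adjoint_unique) (simp add: adjoint(2)[OF S] adjoint(2)[OF T])
qed (auto simp: bounded_ops_carrier blinfun.add_left scaleC_add_right scaleC_add_left scaleC_scaleC
      blinfun.add_right mult.commute intro!: blinfun_eqI)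

lemma bounded_ops_minus: "S \<in> carrier bounded_ops \<Longrightarrow> T \<in> carrier bounded_ops \<Longrightarrow> S \<ominus>\<^bsub>bounded_ops\<^esub> T = S - T"
  using scaleC_of_real[of "-1"]
  by (simp add: star_algebra.minus_eq_smult[OF star_algebra_bounded_ops])
    (intro blinfun_eqI, simp add: blinfun.add_left blinfun.diff_left blinfun.minus_left)

lemma cstar_seminorm_bounded_ops: "cstar_seminorm (bounded_ops :: ('h::chilbert_space \<Rightarrow>\<^sub>L 'h) cstar) norm"
  unfolding cstar_seminorm_def
proof (intro ballI conjI allI)
  fix S :: "'h \<Rightarrow>\<^sub>L 'h" assume S: "S \<in> carrier bounded_ops"
  show "0 \<le> norm S" by simp
  show "norm (star bounded_ops S \<otimes>\<^bsub>bounded_ops\<^esub> S) = (norm S)\<^sup>2"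
  proof (rule antisym)
    have "norm (adjoint_op S o\<^sub>L S) \<le> norm (adjoint_op S) * norm S" by (rule norm_blinfun_compose)
    also have "\<dots> \<le> norm S * norm S" using adjoint(4)[OF S] by (intro mult_right_mono) simp_all
    finally show "norm (star bounded_ops S \<otimes>\<^bsub>bounded_ops\<^esub> S) \<le> (norm S)\<^sup>2" by (simp add: power2_eq_square)
    \<comment> \<open>The square of \<open>norm (S x)\<close> is the inner product of
      \<open>x\<close> with the image of \<open>x\<close> under
      \<open>adjoint_op S o\<^sub>L S\<close>.\<close>
    have "norm S \<le> sqrt (norm (adjoint_op S o\<^sub>L S))"
    proof (rule norm_blinfun_bound)
      fix x
      have "(norm (blinfun_apply S x))\<^sup>2 = cmod (cinner x (blinfun_apply (adjoint_op S o\<^sub>L S) x))"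
        using cinner_self[of "blinfun_apply S x"] adjoint(2)[OF S, of x "blinfun_apply S x"] by (simp add: norm_power)
      also have "\<dots> \<le> norm x * norm (blinfun_apply (adjoint_op S o\<^sub>L S) x)" by (rule cinner_bound)
      also have "\<dots> \<le> norm x * (norm (adjoint_op S o\<^sub>L S) * norm x)" by (intro mult_left_mono norm_blinfun) simp
      also have "\<dots> = (sqrt (norm (adjoint_op S o\<^sub>L S)) * norm x)\<^sup>2"
        by (simp add: power_mult_distrib power2_eq_square)
      finally show "norm (blinfun_apply S x) \<le> sqrt (norm (adjoint_op S o\<^sub>L S)) * norm x"
        by (rule power2_le_imp_le) simp
    qed simp
    from power_mono[OF this, of 2] show "(norm S)\<^sup>2 \<le> norm (star bounded_ops S \<otimes>\<^bsub>bounded_ops\<^esub> S)" by simp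
  qed
  have le: "norm (c \<odot>\<^bsub>bounded_ops\<^esub> S) \<le> cmod c * norm S" for c and S :: "'h \<Rightarrow>\<^sub>L 'h"
    by (rule norm_blinfun_bound) (simp_all add: norm_scaleC mult_left_mono norm_blinfun mult.assoc)
  show "norm (c \<odot>\<^bsub>bounded_ops\<^esub> S) = cmod c * norm S" for c
  proof (cases "c = 0")
    case True
    then show ?thesis using le[of 0 S] by simp
  next
    case False
    have "S = inverse c \<odot>\<^bsub>bounded_ops\<^esub> (c \<odot>\<^bsub>bounded_ops\<^esub> S)" using False by (intro blinfun_eqI) (simp add: scaleC_scaleC)
    then have "norm S \<le> cmod (inverse c) * norm (c \<odot>\<^bsub>bounded_ops\<^esub> S)" using le[of "inverse c" "c \<odot>\<^bsub>bounded_ops\<^esub> S"] by simp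
    then have "cmod c * norm S \<le> norm (c \<odot>\<^bsub>bounded_ops\<^esub> S)" using False by (simp add: norm_divide divide_simps mult.commute)
    with le show ?thesis by (intro antisym)
  qed
  fix T :: "'h \<Rightarrow>\<^sub>L 'h" assume T: "T \<in> carrier bounded_ops"
  show "norm (S \<oplus>\<^bsub>bounded_ops\<^esub> T) \<le> norm S + norm T" by (simp add: norm_triangle_ineq)
  show "norm (S \<otimes>\<^bsub>bounded_ops\<^esub> T) \<le> norm S * norm T" by (simp add: norm_blinfun_compose)
qed

text \<open>The real-linear bounded operators are complete; what remains is that complex linearity
  survives the pointwise limit.\<close>

lemma complete_cstar_bounded_ops: "complete_cstar (bounded_ops :: ('h::chilbert_space \<Rightarrow>\<^sub>L 'h) cstar)"
proof -
  interpret seminormed "bounded_ops :: ('h \<Rightarrow>\<^sub>L 'h) cstar" norm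
    by (intro seminormed.intro seminormed_axioms.intro star_algebra_bounded_ops cstar_seminorm_bounded_ops)
  show ?thesis
  proof (rule complete_cstarI)
    fix X assume X: "X \<in> cauchy_seqs (bounded_ops :: ('h \<Rightarrow>\<^sub>L 'h) cstar) (cnorm bounded_ops)"
    then have c: "X k \<in> carrier bounded_ops" for k by (simp add: cauchy_seqs_def)
    with X have "Cauchy X" by (auto simp: cauchy_seqs_def Cauchy_iff bounded_ops_minus)
    then obtain L where L: "X \<longlonglongrightarrow> L" using Cauchy_convergent convergent_def by blast
    have ap: "(\<lambda>k. blinfun_apply (X k) x) \<longlonglongrightarrow> blinfun_apply L x" for x
      by (rule blinfun.tendsto[OF L tendsto_const])
    have "blinfun_apply L (scaleC z x) = scaleC z (blinfun_apply L x)" for z x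
    proof (rule LIMSEQ_unique[OF ap])
      show "(\<lambda>k. blinfun_apply (X k) (scaleC z x)) \<longlonglongrightarrow> scaleC z (blinfun_apply L x)"
        using bounded_linear.tendsto[OF bounded_linear_scaleC ap] c by (simp add: bounded_ops_carrier)
    qed
    then have Lc: "L \<in> carrier bounded_ops" by (simp add: bounded_ops_carrier)
    have "(\<lambda>k. norm (X k - L)) \<longlonglongrightarrow> 0" using L by (simp add: LIM_zero tendsto_norm_zero)
    then show "\<exists>l. seminormed.conv bounded_ops (cnorm bounded_ops) X l" using c Lc by (auto simp: conv_def bounded_ops_minus)
  qed (use star_algebra_bounded_ops cstar_seminorm_bounded_ops in auto)
qed

section \<open>Tensor products of operators\<close>

text \<open>Every element is a combination of unitaries: a self-adjoint one, scaled below norm 1, is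
  a cosine and so half the sum of a unitary and its adjoint. The rule serves to construct
  \<open>S \<otimes> 1\<close>, which is immediate only for isometric \<open>S\<close>.\<close>

lemma (in complete_cstar) isometry_induct [consumes 1, case_names isometry add smult]:
  assumes x: "x \<in> carrier A"
    and isometry: "\<And>u. u \<in> carrier A \<Longrightarrow> star A u \<otimes> u = \<one> \<Longrightarrow> P u"
    and add: "\<And>x y. x \<in> carrier A \<Longrightarrow> y \<in> carrier A \<Longrightarrow> P x \<Longrightarrow> P y \<Longrightarrow> P (x \<oplus> y)"
    and smult: "\<And>c x. x \<in> carrier A \<Longrightarrow> P x \<Longrightarrow> P (c \<odot> x)"
  shows "P x"
proof -
  have sa: "P a" if a: "a \<in> carrier A" "star A a = a" for a
  proof -
    define r where "r = cnorm A a + 1"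
    have r: "cnorm A a < r" "0 < r" using a by (simp_all add: r_def add_nonneg_pos)
    define b where "b = complex_of_real (1 / r) \<odot> a"
    have b: "b \<in> carrier A" "star A b = b" "cnorm A b < 1"
      using a r by (simp_all add: b_def star_smult p_smult norm_divide)
    obtain y where y: "y \<in> carrier A" "star A y = y" "b \<otimes> y = y \<otimes> b" "b \<otimes> b \<oplus> y \<otimes> y = \<one>"
      using cos_sin_exists[OF b] by blast
    define u where "u = b \<oplus> \<i> \<odot> y"
    have u: "u \<in> carrier A" using b y by (simp add: u_def)
    have "P u" using unitary_cos_sin(1)[OF b(1,2) y] u by (intro isometry) (simp_all add: u_def)
    moreover have "P (star A u)" using unitary_cos_sin(2)[OF b(1,2) y] u by (intro isometry) (simp_all add: u_def)
    ultimately have "P ((1/2) \<odot> (u \<oplus> star A u))" using u by (intro smult add) simp_all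
    then have "P b" using cos_sin_halves(1)[OF b(1,2) y(1,2)] by (simp add: u_def)
    then have "P (complex_of_real r \<odot> b)" using b by (intro smult)
    then show ?thesis using r a by (simp add: b_def smult_smult)
  qed
  define a where "a = (1/2) \<odot> (x \<oplus> star A x)"
  define b where "b = (-\<i>/2) \<odot> (x \<oplus> (-1) \<odot> star A x)"
  have ab: "a \<in> carrier A" "b \<in> carrier A" "star A a = a" "star A b = b"
    using x by (simp_all add: a_def b_def star_smult star_add smult_add_right smult_smult a_comm)
  have "a \<oplus> \<i> \<odot> b = ((1/2) \<odot> x \<oplus> (1/2) \<odot> x) \<oplus> ((1/2) \<odot> star A x \<oplus> (-1/2) \<odot> star A x)"
    using x by (simp add: a_def b_def smult_add_right smult_smult a_ac)
  also have "\<dots> = x"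
    using smult_add_left[of x "1/2" "1/2"] smult_add_left[of "star A x" "1/2" "-1/2"] x by simp
  finally show ?thesis using add[OF ab(1) _ sa[OF ab(1,3)] smult[OF ab(2) sa[OF ab(2,4)], of \<i>]] ab by simp
qed

lemma blinfun_eq_on_dense:
  fixes V W :: "'x::real_normed_vector \<Rightarrow>\<^sub>L 'y::real_normed_vector"
  assumes "closure (span G) = UNIV" "\<And>x. x \<in> G \<Longrightarrow> blinfun_apply V x = blinfun_apply W x"
  shows "V = W"
proof (rule blinfun_eqI)
  fix x
  let ?E = "{x. blinfun_apply V x = blinfun_apply W x}"
  have "closed ?E" by (intro closed_Collect_eq continuous_intros)
  moreover have "subspace ?E"
    by (auto simp: subspace_def blinfun.add_right blinfun.scaleR_right blinfun.zero_right)
  then have "span G \<subseteq> ?E" using assms(2) by (intro span_minimal) auto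
  ultimately have "closure (span G) \<subseteq> ?E" by (rule closure_minimal[rotated])
  then show "blinfun_apply V x = blinfun_apply W x" using assms(1) by auto
qed

lemma closure_subspace:
  fixes S :: "'x::real_normed_vector set"
  assumes S: "subspace S" shows "subspace (closure S)"
  unfolding subspace_def
proof (intro conjI ballI allI)
  show "0 \<in> closure S" using subspace_0[OF S] closure_subset by blast
  fix x assume "x \<in> closure S"
  then obtain X where X: "\<And>k. X k \<in> S" "X \<longlonglongrightarrow> x" unfolding closure_sequential by blast
  show "c *\<^sub>R x \<in> closure S" for c
    unfolding closure_sequential using X subspace_scale[OF S]
    by (intro exI[of _ "\<lambda>k. c *\<^sub>R X k"]) (auto intro: tendsto_intros)
  fix y assume "y \<in> closure S"
  then obtain Y where Y: "\<And>k. Y k \<in> S" "Y \<longlonglongrightarrow> y" unfolding closure_sequential by blast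
  show "x + y \<in> closure S"
    unfolding closure_sequential using X Y subspace_add[OF S]
    by (intro exI[of _ "\<lambda>k. X k + Y k"]) (auto intro: tendsto_intros)
qed

text \<open>A definition on linear combinations would need an argument for well-definedness. Instead
  the closed span \<open>\<Gamma>\<close> of the pairs \<open>(g i, h i)\<close> is shown to be a
  graph: both components of each of its elements have the same norm.\<close>

lemma isometry_extension:
  fixes g h :: "'i \<Rightarrow> 'l::chilbert_space"
  assumes gh: "\<And>i j. cinner (g i) (g j) = cinner (h i) (h j)" and dense: "closure (span (range g)) = UNIV"
  shows "\<exists>W. \<forall>i. blinfun_apply W (g i) = h i"
proof -
  define S where "S = span (range (\<lambda>i. (g i, h i)))"
  define \<Gamma> where "\<Gamma> = closure S"
  have inner1: "cinner (fst v) (g i) = cinner (snd v) (h i)" if "v \<in> S" for v i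
    using that unfolding S_def
    by (induction rule: span_induct_alt) (auto simp: cinner_add_left cinner_scaleR_left gh)
  have inner: "cinner (fst v) (fst w) = cinner (snd v) (snd w)" if "v \<in> S" "w \<in> S" for v w
    using that(2) unfolding S_def
    by (induction rule: span_induct_alt) (auto simp: cinner_add_right cinner_scaleR_right inner1[OF that(1)])
  have norm_S: "norm (fst v) = norm (snd v)" if "v \<in> S" for v
  proof -
    have "complex_of_real ((norm (fst v))\<^sup>2) = complex_of_real ((norm (snd v))\<^sup>2)"
      using inner[OF that that] by (simp only: cinner_self)
    then show ?thesis by (simp only: of_real_eq_iff power2_eq_iff_nonneg norm_ge_zero)
  qed
  have "closed {v :: 'l \<times> 'l. norm (fst v) = norm (snd v)}"
    by (intro closed_Collect_eq continuous_intros)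
  then have norm_\<Gamma>: "norm (fst v) = norm (snd v)" if "v \<in> \<Gamma>" for v
    using closure_minimal[of S "{v. norm (fst v) = norm (snd v)}"] norm_S that unfolding \<Gamma>_def by blast
  have sub: "subspace \<Gamma>" unfolding \<Gamma>_def S_def by (rule closure_subspace[OF subspace_span])
  have fst_S: "span (range g) = fst ` S"
  proof -
    have "span (fst ` range (\<lambda>i. (g i, h i))) = fst ` S"
      unfolding S_def by (rule linear_span_image[OF linear_fst])
    then show ?thesis by (simp add: image_image)
  qed
  \<comment> \<open>Second components of a sequence in \<open>S\<close> are Cauchy whenever the
    first components are, and the space is complete.\<close>
  have total: "\<exists>w. (z, w) \<in> \<Gamma>" for z
  proof -
    have "z \<in> closure (fst ` S)" using dense unfolding fst_S by simp
    from this[unfolded closure_sequential] obtain Z where "(\<forall>k. Z k \<in> fst ` S) \<and> Z \<longlonglongrightarrow> z" ..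
    then have Z: "\<forall>k. \<exists>v. v \<in> S \<and> Z k = fst v" "Z \<longlonglongrightarrow> z" unfolding image_iff Bex_def by blast+
    from choice[OF Z(1)] obtain V where V: "\<And>k. V k \<in> S" "\<And>k. Z k = fst (V k)" by blast
    have "Cauchy (\<lambda>k. snd (V k))"
    proof (rule metric_CauchyI)
      fix e :: real assume "0 < e"
      then obtain M where M: "\<And>m n. m \<ge> M \<Longrightarrow> n \<ge> M \<Longrightarrow> dist (Z m) (Z n) < e"
        using LIMSEQ_imp_Cauchy[OF Z(2)] by (meson metric_CauchyD)
      have "dist (snd (V m)) (snd (V n)) = dist (Z m) (Z n)" for m n
        using norm_S[of "V m - V n"] V by (simp add: S_def span_diff dist_norm)
      with M show "\<exists>M. \<forall>m\<ge>M. \<forall>n\<ge>M. dist (snd (V m)) (snd (V n)) < e" by auto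
    qed
    then obtain w where w: "(\<lambda>k. snd (V k)) \<longlonglongrightarrow> w" using Cauchy_convergent convergent_def by blast
    have "(\<lambda>k. (fst (V k), snd (V k))) \<longlonglongrightarrow> (z, w)"
      using Z(2) w by (intro tendsto_Pair) (simp_all add: V(2)[symmetric])
    then have "V \<longlonglongrightarrow> (z, w)" by simp
    then show ?thesis unfolding \<Gamma>_def closure_sequential using V(1) by blast
  qed
  then obtain w where w: "\<And>z. (z, w z) \<in> \<Gamma>" by metis
  \<comment> \<open>The difference of two pairs with equal first components has first component 0,
    hence a second component of norm 0.\<close>
  have uniq: "w z = y" if "(z, y) \<in> \<Gamma>" for z y
    using norm_\<Gamma>[OF subspace_diff[OF sub w[of z] that]] by simp
  have "bounded_linear w"
  proof
    show "w (x + y) = w x + w y" for x y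
      using subspace_add[OF sub w[of x] w[of y]] by (intro uniq) simp
    show "w (r *\<^sub>R x) = r *\<^sub>R w x" for r x
      using subspace_scale[OF sub w[of x], of r] by (intro uniq) simp
    show "\<exists>K. \<forall>x. norm (w x) \<le> norm x * K"
      using norm_\<Gamma>[OF w] by (intro exI[of _ 1]) simp
  qed
  moreover have "w (g i) = h i" for i
    by (rule uniq) (auto simp: \<Gamma>_def S_def intro!: subsetD[OF closure_subset] span_base)
  ultimately show ?thesis by (intro exI[of _ "Blinfun w"]) (simp add: bounded_linear_Blinfun_apply)
qed

section \<open>Operators on a Hilbert space tensor product\<close>

locale hilbert_tensor_product =
  fixes t :: "'h::chilbert_space \<Rightarrow> 'k::chilbert_space \<Rightarrow> 'l::chilbert_space"
  assumes t: "hilbert_tensor t"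
begin

lemma t_add: "t (x + x') y = t x y + t x' y" "t x (y + y') = t x y + t x y'"
  and t_scaleC: "t (scaleC c x) y = scaleC c (t x y)" "t x (scaleC c y) = scaleC c (t x y)"
  and t_cinner: "cinner (t x y) (t x' y') = cinner x x' * cinner y y'"
  and t_dense: "closure (span {t x y | x y. True}) = UNIV"
  using t unfolding hilbert_tensor_def by blast+

lemma op_eqI:
  assumes "\<And>x y. blinfun_apply V (t x y) = blinfun_apply W (t x y)" shows "V = W"
  by (rule blinfun_eq_on_dense[OF t_dense]) (use assms in auto)

lemma vec_eqI:
  assumes "\<And>x y. cinner (t x y) v = cinner (t x y) w" shows "v = w"
proof (rule cinner_eqI)
  fix z
  have "Blinfun (\<lambda>z. cinner z v) = Blinfun (\<lambda>z. cinner z w)"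
    by (rule op_eqI) (simp add: bounded_linear_Blinfun_apply bounded_linear_cinner_left assms)
  then show "cinner z v = cinner z w"
    by (metis bounded_linear_Blinfun_apply bounded_linear_cinner_left)
qed

text \<open>Commuting with a scalar is an equality of real-linear bounded operators, so density of
  the span of elementary tensors applies to it.\<close>

lemma BO_if_t:
  assumes "\<And>c x y. blinfun_apply W (scaleC c (t x y)) = scaleC c (blinfun_apply W (t x y))"
  shows "W \<in> carrier bounded_ops"
proof -
  have "W o\<^sub>L Blinfun (scaleC c) = Blinfun (scaleC c) o\<^sub>L W" for c
    by (rule op_eqI) (simp add: bounded_linear_Blinfun_apply bounded_linear_scaleC assms)
  then have "blinfun_apply (W o\<^sub>L Blinfun (scaleC c)) x = blinfun_apply (Blinfun (scaleC c) o\<^sub>L W) x" for c x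
    by simp
  then show ?thesis by (simp add: bounded_ops_carrier bounded_linear_Blinfun_apply bounded_linear_scaleC)
qed

text \<open>For isometric \<open>S\<close> the map from \<open>t x y\<close> to
  \<open>t (S x) y\<close> preserves inner products of elementary tensors, so
  \<open>isometry_extension\<close> applies; the other cases are linear.\<close>

lemma amplify_left:
  assumes "S \<in> carrier bounded_ops"
  shows "\<exists>W. \<forall>x y. blinfun_apply W (t x y) = t (blinfun_apply S x) y"
  using assms
proof (induction rule: complete_cstar.isometry_induct[OF complete_cstar_bounded_ops, consumes 1, case_names isometry add smult])
  case (isometry u)
  have u: "cinner (blinfun_apply u x) (blinfun_apply u x') = cinner x x'" for x x'
    using adjoint(2)[OF isometry(1), of x "blinfun_apply u x'"] isometry(2)
    by (metis blinfun_apply_blinfun_compose blinfun_apply_id_blinfun bounded_ops_simps(1,2,5) id_apply)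
  have "range (\<lambda>(x, y). t x y) = {t x y | x y. True}" by auto
  then obtain W where "\<forall>p. blinfun_apply W (case p of (x, y) \<Rightarrow> t x y) = (case p of (x, y) \<Rightarrow> t (blinfun_apply u x) y)"
    using isometry_extension[of "\<lambda>(x, y). t x y" "\<lambda>(x, y). t (blinfun_apply u x) y"] t_dense
    by (auto simp: t_cinner u)
  then show ?case by auto
next
  case (add S S')
  then obtain W W' where "\<forall>x y. blinfun_apply W (t x y) = t (blinfun_apply S x) y"
    "\<forall>x y. blinfun_apply W' (t x y) = t (blinfun_apply S' x) y" by blast
  then show ?case by (intro exI[of _ "W + W'"]) (simp add: blinfun.add_left t_add)
next
  case (smult c S)
  then obtain W where "\<forall>x y. blinfun_apply W (t x y) = t (blinfun_apply S x) y" by blast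
  then show ?case by (intro exI[of _ "c \<odot>\<^bsub>bounded_ops\<^esub> W"]) (simp add: t_scaleC)
qed

lemma amplify_right:
  assumes "S \<in> carrier bounded_ops"
  shows "\<exists>W. \<forall>x y. blinfun_apply W (t x y) = t x (blinfun_apply S y)"
  using assms
proof (induction rule: complete_cstar.isometry_induct[OF complete_cstar_bounded_ops, consumes 1, case_names isometry add smult])
  case (isometry u)
  have u: "cinner (blinfun_apply u x) (blinfun_apply u x') = cinner x x'" for x x'
    using adjoint(2)[OF isometry(1), of x "blinfun_apply u x'"] isometry(2)
    by (metis blinfun_apply_blinfun_compose blinfun_apply_id_blinfun bounded_ops_simps(1,2,5) id_apply)
  have "range (\<lambda>(x, y). t x y) = {t x y | x y. True}" by auto
  then obtain W where "\<forall>p. blinfun_apply W (case p of (x, y) \<Rightarrow> t x y) = (case p of (x, y) \<Rightarrow> t x (blinfun_apply u y))"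
    using isometry_extension[of "\<lambda>(x, y). t x y" "\<lambda>(x, y). t x (blinfun_apply u y)"] t_dense
    by (auto simp: t_cinner u)
  then show ?case by auto
next
  case (add S S')
  then obtain W W' where "\<forall>x y. blinfun_apply W (t x y) = t x (blinfun_apply S y)"
    "\<forall>x y. blinfun_apply W' (t x y) = t x (blinfun_apply S' y)" by blast
  then show ?case by (intro exI[of _ "W + W'"]) (simp add: blinfun.add_left t_add)
next
  case (smult c S)
  then obtain W where "\<forall>x y. blinfun_apply W (t x y) = t x (blinfun_apply S y)" by blast
  then show ?case by (intro exI[of _ "c \<odot>\<^bsub>bounded_ops\<^esub> W"]) (simp add: t_scaleC)
qed

text \<open>The description in \<open>op_tensor\<close> is satisfied by the product of the two
  amplifications, and by nothing else because elementary tensors span a dense subspace.\<close>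

lemma op_tensor_apply:
  assumes S: "S \<in> carrier bounded_ops" and T: "T \<in> carrier bounded_ops"
  shows "blinfun_apply (op_tensor t S T) (t x y) = t (blinfun_apply S x) (blinfun_apply T y)"
proof -
  obtain V W where "\<forall>x y. blinfun_apply V (t x y) = t (blinfun_apply S x) y"
    "\<forall>x y. blinfun_apply W (t x y) = t x (blinfun_apply T y)"
    using amplify_left[OF S] amplify_right[OF T] by blast
  then have VW: "\<forall>x y. blinfun_apply (V o\<^sub>L W) (t x y) = t (blinfun_apply S x) (blinfun_apply T y)" by simp
  have "op_tensor t S T = V o\<^sub>L W"
    unfolding op_tensor_def
  proof (rule the_equality)
    fix W' assume W': "\<forall>x y. blinfun_apply W' (t x y) = t (blinfun_apply S x) (blinfun_apply T y)"
    show "W' = V o\<^sub>L W" by (rule op_eqI) (simp only: VW[rule_format] W'[rule_format])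
  qed (rule VW)
  with VW show ?thesis by simp
qed

lemma op_tensor_closed:
  assumes S: "S \<in> carrier bounded_ops" and T: "T \<in> carrier bounded_ops" shows "op_tensor t S T \<in> carrier bounded_ops"
proof (rule BO_if_t)
  fix c x y
  show "blinfun_apply (op_tensor t S T) (scaleC c (t x y)) = scaleC c (blinfun_apply (op_tensor t S T) (t x y))"
    using op_tensor_apply[OF S T, of "scaleC c x" y] op_tensor_apply[OF S T, of x y] S
    by (simp add: t_scaleC bounded_ops_carrier)
qed

lemma op_tensor_star:
  assumes S: "S \<in> carrier bounded_ops" and T: "T \<in> carrier bounded_ops"
  shows "adjoint_op (op_tensor t S T) = op_tensor t (adjoint_op S) (adjoint_op T)"
proof (rule op_eqI, rule vec_eqI)
  fix x y x' y'
  show "cinner (t x' y') (blinfun_apply (adjoint_op (op_tensor t S T)) (t x y)) =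
      cinner (t x' y') (blinfun_apply (op_tensor t (adjoint_op S) (adjoint_op T)) (t x y))"
    using adjoint(2)[OF op_tensor_closed[OF S T], of "t x' y'" "t x y"] adjoint(2)[OF S] adjoint(2)[OF T]
    by (simp add: op_tensor_apply S T adjoint t_cinner)
qed

lemma id_bounded_ops [simp]: "id_blinfun \<in> carrier bounded_ops"
  by (simp add: bounded_ops_carrier)

lemma op_tensor_left_hom: "(\<lambda>S. op_tensor t S id_blinfun) \<in> star_hom bounded_ops bounded_ops"
proof (rule star_homI)
  note cl = star_algebra.m_closed[OF star_algebra_bounded_ops] star_algebra.a_closed[OF star_algebra_bounded_ops]
    star_algebra.smult_closed'[OF star_algebra_bounded_ops]
  have ad: "adjoint_op (id_blinfun :: 'k \<Rightarrow>\<^sub>L 'k) = id_blinfun" by (rule adjoint_unique) simp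
  fix S S' :: "'h \<Rightarrow>\<^sub>L 'h" assume S: "S \<in> carrier bounded_ops"
  show "op_tensor t S id_blinfun \<in> carrier bounded_ops" using S by (simp add: op_tensor_closed)
  show "op_tensor t (star bounded_ops S) id_blinfun = star bounded_ops (op_tensor t S id_blinfun)"
    using S ad by (simp add: op_tensor_star)
  show "op_tensor t (c \<odot>\<^bsub>bounded_ops\<^esub> S) id_blinfun = c \<odot>\<^bsub>bounded_ops\<^esub> op_tensor t S id_blinfun" for c
    using cl(3)[OF S, of c] S by (intro op_eqI) (simp add: op_tensor_apply t_scaleC)
  assume S': "S' \<in> carrier bounded_ops"
  show "op_tensor t (S \<otimes>\<^bsub>bounded_ops\<^esub> S') id_blinfun = op_tensor t S id_blinfun \<otimes>\<^bsub>bounded_ops\<^esub> op_tensor t S' id_blinfun"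
    using cl(1)[OF S S'] S S' by (intro op_eqI) (simp add: op_tensor_apply)
  show "op_tensor t (S \<oplus>\<^bsub>bounded_ops\<^esub> S') id_blinfun = op_tensor t S id_blinfun \<oplus>\<^bsub>bounded_ops\<^esub> op_tensor t S' id_blinfun"
    using cl(2)[OF S S'] S S' by (intro op_eqI) (simp add: op_tensor_apply blinfun.add_left t_add)
next
  show "op_tensor t \<one>\<^bsub>bounded_ops\<^esub> id_blinfun = \<one>\<^bsub>bounded_ops\<^esub>" by (intro op_eqI) (simp add: op_tensor_apply)
qed

lemma op_tensor_right_hom: "(\<lambda>T. op_tensor t id_blinfun T) \<in> star_hom bounded_ops bounded_ops"
proof (rule star_homI)
  note cl = star_algebra.m_closed[OF star_algebra_bounded_ops] star_algebra.a_closed[OF star_algebra_bounded_ops]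
    star_algebra.smult_closed'[OF star_algebra_bounded_ops]
  have ad: "adjoint_op (id_blinfun :: 'h \<Rightarrow>\<^sub>L 'h) = id_blinfun" by (rule adjoint_unique) simp
  fix S S' :: "'k \<Rightarrow>\<^sub>L 'k" assume S: "S \<in> carrier bounded_ops"
  show "op_tensor t id_blinfun S \<in> carrier bounded_ops" using S by (simp add: op_tensor_closed)
  show "op_tensor t id_blinfun (star bounded_ops S) = star bounded_ops (op_tensor t id_blinfun S)"
    using S ad by (simp add: op_tensor_star)
  show "op_tensor t id_blinfun (c \<odot>\<^bsub>bounded_ops\<^esub> S) = c \<odot>\<^bsub>bounded_ops\<^esub> op_tensor t id_blinfun S" for c
    using cl(3)[OF S, of c] S by (intro op_eqI) (simp add: op_tensor_apply t_scaleC)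
  assume S': "S' \<in> carrier bounded_ops"
  show "op_tensor t id_blinfun (S \<otimes>\<^bsub>bounded_ops\<^esub> S') = op_tensor t id_blinfun S \<otimes>\<^bsub>bounded_ops\<^esub> op_tensor t id_blinfun S'"
    using cl(1)[OF S S'] S S' by (intro op_eqI) (simp add: op_tensor_apply)
  show "op_tensor t id_blinfun (S \<oplus>\<^bsub>bounded_ops\<^esub> S') = op_tensor t id_blinfun S \<oplus>\<^bsub>bounded_ops\<^esub> op_tensor t id_blinfun S'"
    using cl(2)[OF S S'] S S' by (intro op_eqI) (simp add: op_tensor_apply blinfun.add_left t_add)
next
  show "op_tensor t id_blinfun \<one>\<^bsub>bounded_ops\<^esub> = \<one>\<^bsub>bounded_ops\<^esub>" by (intro op_eqI) (simp add: op_tensor_apply)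
qed

lemma op_tensor_factor:
  assumes S: "S \<in> carrier bounded_ops" and T: "T \<in> carrier bounded_ops"
  shows "op_tensor t S id_blinfun \<otimes>\<^bsub>bounded_ops\<^esub> op_tensor t id_blinfun T = op_tensor t S T"
    "op_tensor t id_blinfun T \<otimes>\<^bsub>bounded_ops\<^esub> op_tensor t S id_blinfun = op_tensor t S T"
  using S T by (auto intro!: op_eqI simp: op_tensor_apply)

end

theorem tensor_representation:
  assumes t: "hilbert_tensor t" and A: "complete_cstar A" and B: "complete_cstar B"
    and r: "r \<in> star_hom A bounded_ops" and s: "s \<in> star_hom B bounded_ops"
  shows "\<exists>h \<in> star_hom (max_tensor A B) bounded_ops. \<forall>a \<in> carrier A. \<forall>b \<in> carrier B.
    h (tensor_elem A B a b) = op_tensor t (r a) (s b)"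
proof -
  interpret hilbert_tensor_product t by unfold_locales (rule t)
  interpret cstar_pair A B by (rule cstar_pair_intro[OF A B])
  note [simp] = star_homD(1)[OF r] star_homD(1)[OF s]
  have "commuting bounded_ops (\<lambda>a. op_tensor t (r a) id_blinfun) (\<lambda>b. op_tensor t id_blinfun (s b))"
    unfolding commuting_def
    using star_hom_comp[OF r op_tensor_left_hom] star_hom_comp[OF s op_tensor_right_hom]
    by (auto simp: op_tensor_factor simp del: bounded_ops_simps)
  from tensor_universal[OF complete_cstar_bounded_ops this] show ?thesis
    by (simp add: op_tensor_factor del: bounded_ops_simps)
qed

section \<open>Tensor products of quantum permutation algebras\<close>

text \<open>\<open>hopf_tensor\<close> and \<open>transport\<close> attach Hopf maps to a
  \<open>cstar\<close> record, which produces a record of another type. The norm is left out on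
  purpose: \<open>max_tensor\<close> and \<open>star_hom\<close> depend only on the fields listed
  here.\<close>

definition same_star :: "('a, 'm) star_alg_scheme \<Rightarrow> ('a, 'n) star_alg_scheme \<Rightarrow> bool" where
  "same_star A A' \<longleftrightarrow> carrier A = carrier A' \<and> mult A = mult A' \<and> one A = one A' \<and> zero A = zero A' \<and>
    add A = add A' \<and> smult A = smult A' \<and> star A = star A'"

lemma same_star_hom: 
  "same_star A A' \<Longrightarrow> star_hom A D = star_hom A' D" "same_star D D' \<Longrightarrow> star_hom A D = star_hom A D'"
  by (simp_all add: same_star_def star_hom_def ring_hom_def)

lemma max_tensor_cong:
  assumes "same_star A A'" "same_star B B'"
  shows "max_tensor A B = max_tensor A' B'" "tensor_elem A B = tensor_elem A' B'"
proof -
  have "A \<times>\<times> B = A' \<times>\<times> B'" using assms by (simp add: DirProd_def same_star_def)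
  then have p: "pair_alg A B = pair_alg A' B'" using assms by (simp add: pair_alg_def same_star_def)
  have r: "bilinear_relations A B = bilinear_relations A' B'"
    using assms unfolding bilinear_relations_def p same_star_def by simp
  show "max_tensor A B = max_tensor A' B'" by (simp add: max_tensor_def p r)
  show "tensor_elem A B = tensor_elem A' B'" by (simp add: tensor_elem_def p r fun_eq_iff)
qed

lemma tensor_map_cong:
  assumes "same_star A A'" "same_star B B'" "same_star C C'" "same_star D D'"
  shows "tensor_map A B C D = tensor_map A' B' C' D'"
  using assms(1,2) max_tensor_cong[OF assms(1,2)] max_tensor_cong[OF assms(3,4)]
  by (simp add: tensor_map_def tensor_ext_def same_star_def fun_eq_iff)

lemma complete_cstar_if_iso:
  fixes T :: "('a, 'm) cstar_scheme" and A :: "('b, 'k) cstar_scheme"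
  assumes A: "complete_cstar A" and T: "star_algebra T"
    and k: "k \<in> star_hom T A" and onto: "k ` carrier T = carrier A"
    and norm: "\<And>x. x \<in> carrier T \<Longrightarrow> cnorm T x = cnorm A (k x)" and inj: "inj_on k (carrier T)"
  shows "complete_cstar T"
proof -
  interpret A: complete_cstar A by fact
  interpret T: star_algebra T by fact
  note [simp] = star_homD(1)[OF k]
  have "cstar_seminorm T (\<lambda>x. cnorm A (k x))"
    by (rule cstar_seminorm_pullback[OF T k A.seminormed_axioms])
  then have sn: "cstar_seminorm T (cnorm T)" by (simp add: cstar_seminorm_def norm)
  interpret T: seminormed T "cnorm T"
    by (intro seminormed.intro seminormed_axioms.intro T sn)
  have dist: "cnorm T (x \<ominus>\<^bsub>T\<^esub> y) = cnorm A (k x \<ominus>\<^bsub>A\<^esub> k y)" if "x \<in> carrier T" "y \<in> carrier T" for x y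
    using that by (simp add: norm star_hom_minus[OF T A.star_algebra_axioms k])
  show ?thesis
  proof (rule complete_cstarI[OF T sn])
    fix x assume x: "x \<in> carrier T" "cnorm T x = 0"
    then have "k x = k \<zero>\<^bsub>T\<^esub>" using A.definite[of "k x"] star_hom_zero[OF T A.star_algebra_axioms k] by (simp add: norm)
    then show "x = \<zero>\<^bsub>T\<^esub>" using inj_onD[OF inj] x by simp
  next
    fix X assume X: "X \<in> cauchy_seqs T (cnorm T)"
    note [simp] = T.cauchy_carrier[OF X]
    have "(\<lambda>i. k (X i)) \<in> cauchy_seqs A (cnorm A)" using X by (simp add: cauchy_seqs_def dist)
    then obtain l where l: "A.conv (\<lambda>i. k (X i)) l" using A.cauchy_conv by blast
    then obtain y where "y \<in> carrier T" "l = k y" using onto A.conv_carrier(2)[OF l] by blast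
    with l show "\<exists>l. T.conv X l" by (auto simp: T.conv_def A.conv_def dist)
  qed
qed

lemma complete_cstar_cong:
  assumes A: "complete_cstar A" and s: "same_star T A" and "cnorm T = cnorm A"
  shows "complete_cstar T"
proof (rule complete_cstar_if_iso[where k="\<lambda>x. x", OF A])
  show "star_algebra T"
    by (rule star_algebra_if_inj[where k="\<lambda>x. x" and A=A])
      (use s A star_algebra.a_closed[of A] star_algebra.m_closed[of A] star_algebra.smult_closed'[of A]
        star_algebra.star_closed[of A] star_algebra.zero_closed[of A] star_algebra.one_closed[of A]
        in \<open>auto simp: same_star_def\<close>)
  show "(\<lambda>x. x) \<in> star_hom T A" using star_hom_id same_star_hom(1)[OF s] by blast
qed (use s assms in \<open>auto simp: same_star_def\<close>)

text \<open>\<open>H\<close> is closed under adjoints so that the induction step for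
  \<open>star\<close> can conjugate: \<open>f (star A x) \<otimes> z\<close> is the adjoint of
  \<open>star D z \<otimes> f x\<close>.\<close>

lemma commute_with_generators:
  assumes A: "complete_cstar A" and D: "pre_cstar D" and f: "f \<in> star_hom A D"
    and G: "G \<subseteq> carrier A" "generates_cstar A G"
    and H: "H \<subseteq> carrier D" "\<And>y. y \<in> H \<Longrightarrow> star D y \<in> H"
    and comm: "\<And>a y. a \<in> G \<Longrightarrow> y \<in> H \<Longrightarrow> f a \<otimes>\<^bsub>D\<^esub> y = y \<otimes>\<^bsub>D\<^esub> f a"
    and a: "a \<in> carrier A" and y: "y \<in> H"
  shows "f a \<otimes>\<^bsub>D\<^esub> y = y \<otimes>\<^bsub>D\<^esub> f a"
proof -
  interpret A: complete_cstar A by fact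
  interpret D: pre_cstar D by fact
  have gen: "\<forall>y \<in> H. f a \<otimes>\<^bsub>D\<^esub> y = y \<otimes>\<^bsub>D\<^esub> f a" if "a \<in> star_gen A G" for a
    using that
  proof induction
    case (gen x)
    then show ?case using comm by blast
  next
    case one
    then show ?case using H by (auto simp: star_homD(4)[OF f] D.l_one)
  next
    case (add x y)
    note c = star_homD(1)[OF f A.star_gen_closed[OF G(1) add.hyps(1)]] star_homD(1)[OF f A.star_gen_closed[OF G(1) add.hyps(2)]]
    show ?case
      using add.IH H(1) c A.star_gen_closed[OF G(1)] add.hyps
      by (auto simp: star_homD(3)[OF f] D.l_distr D.r_distr subset_eq)
  next
    case (mult x y)
    note c = star_homD(1)[OF f A.star_gen_closed[OF G(1) mult.hyps(1)]] star_homD(1)[OF f A.star_gen_closed[OF G(1) mult.hyps(2)]]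
    show ?case
    proof
      fix z assume z: "z \<in> H"
      then have "z \<otimes>\<^bsub>D\<^esub> (f x \<otimes>\<^bsub>D\<^esub> f y) = f x \<otimes>\<^bsub>D\<^esub> f y \<otimes>\<^bsub>D\<^esub> z"
        using mult.IH H(1) c by (intro D.commute_mult) auto
      then show "f (x \<otimes>\<^bsub>A\<^esub> y) \<otimes>\<^bsub>D\<^esub> z = z \<otimes>\<^bsub>D\<^esub> f (x \<otimes>\<^bsub>A\<^esub> y)"
        using A.star_gen_closed[OF G(1)] mult.hyps by (simp add: star_homD(2)[OF f])
    qed
  next
    case (smult x c)
    then show ?case
      using H(1) A.star_gen_closed[OF G(1) smult.hyps] star_homD(1)[OF f]
      by (auto simp: star_homD(6)[OF f] D.smult_mult_left D.smult_mult_right subset_eq)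
  next
    case (star x)
    show ?case
    proof
      fix z assume z: "z \<in> H"
      note c = A.star_gen_closed[OF G(1) star.hyps] star_homD(1)[OF f A.star_gen_closed[OF G(1) star.hyps]]
      have zc: "z \<in> carrier D" "star D z \<in> carrier D" using z H by auto
      have "star D (f x \<otimes>\<^bsub>D\<^esub> star D z) = star D (star D z \<otimes>\<^bsub>D\<^esub> f x)" using star.IH H(2)[OF z] by simp
      then show "f (star A x) \<otimes>\<^bsub>D\<^esub> z = z \<otimes>\<^bsub>D\<^esub> f (star A x)"
        using c zc by (simp add: star_homD(5)[OF f] D.star_mult)
    qed
  qed
  obtain X where X: "\<And>k. X k \<in> star_gen A G" "A.conv X a"
    using G(2) a A.gen_closure_iff[OF G(1), of a] unfolding generates_iff by blast
  note fX = contraction_conv[OF A D f X(2)]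
  have yc: "y \<in> carrier D" using y H by blast
  have "f (X k) \<otimes>\<^bsub>D\<^esub> y = y \<otimes>\<^bsub>D\<^esub> f (X k)" for k using gen[OF X(1)] y by blast
  then show ?thesis
    using D.conv_mult[OF fX D.conv_const[OF yc]] D.conv_mult[OF D.conv_const[OF yc] fX] D.conv_unique by simp
qed

text \<open>Two passes: all of \<open>A\<close> against the generators of \<open>B\<close>, then all
  of \<open>B\<close> against the image of \<open>A\<close>, which is closed under adjoints.\<close>

lemma commuting_homs:
  assumes A: "complete_cstar A" and B: "complete_cstar B" and D: "pre_cstar D"
    and f: "f \<in> star_hom A D" and g: "g \<in> star_hom B D"
    and GA: "GA \<subseteq> carrier A" "generates_cstar A GA" and GB: "GB \<subseteq> carrier B" "generates_cstar B GB"
    and star: "\<And>b. b \<in> GB \<Longrightarrow> star B b \<in> GB"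
    and comm: "\<And>a b. a \<in> GA \<Longrightarrow> b \<in> GB \<Longrightarrow> f a \<otimes>\<^bsub>D\<^esub> g b = g b \<otimes>\<^bsub>D\<^esub> f a"
    and ab: "a \<in> carrier A" "b \<in> carrier B"
  shows "f a \<otimes>\<^bsub>D\<^esub> g b = g b \<otimes>\<^bsub>D\<^esub> f a"
proof -
  interpret A: complete_cstar A by fact
  note fc = star_homD(1)[OF f] and gc = star_homD(1)[OF g]
  have 1: "f a \<otimes>\<^bsub>D\<^esub> y = y \<otimes>\<^bsub>D\<^esub> f a" if "a \<in> carrier A" "y \<in> g ` GB" for a y
  proof (rule commute_with_generators[OF A D f GA, where H="g ` GB"])
    show "star D y \<in> g ` GB" if "y \<in> g ` GB" for y
      using that star GB(1) star_homD(5)[OF g] by (auto simp: image_iff subset_eq) metis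
  qed (use that comm gc GB in auto)
  have "g b \<otimes>\<^bsub>D\<^esub> f a = f a \<otimes>\<^bsub>D\<^esub> g b"
  proof (rule commute_with_generators[OF B D g GB, where H="f ` carrier A"])
    show "star D y \<in> f ` carrier A" if "y \<in> f ` carrier A" for y
      using that star_homD(5)[OF f] by (auto simp: image_iff) (metis A.star_closed)
  qed (use 1 ab fc in auto)
  then show ?thesis by simp
qed

lemma ring_is_semiring: "ring A \<Longrightarrow> semiring A"
proof -
  assume "ring A"
  then interpret ring A .
  show ?thesis by (rule semiring_axioms)
qed

text \<open>Distributivity with the pair \<open>(i, j)\<close> encoded as \<open>i * m + j\<close>.
  The induction step adds the block from \<open>n * m\<close> to \<open>n * m + m\<close>, on which
  the quotient is constantly \<open>n\<close>.\<close>

lemma (in star_algebra) finsum_div_mod: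
  fixes n m :: nat
  assumes x: "\<And>i. i < n \<Longrightarrow> x i \<in> carrier A" and y: "\<And>j. j < m \<Longrightarrow> y j \<in> carrier A"
  shows "(\<Oplus>q \<in> {..<n * m}. x (q div m) \<otimes> y (q mod m)) = (\<Oplus>i \<in> {..<n}. x i) \<otimes> (\<Oplus>j \<in> {..<m}. y j)"
  using x
proof (induction n)
  case 0
  then show ?case using y
    by (simp add: abelian_monoid.finsum_empty[OF abelian_monoid_A] semiring.l_null[OF ring_is_semiring[OF ring_A]]
      abelian_monoid.finsum_closed[OF abelian_monoid_A] Pi_iff)
next
  case (Suc n)
  note fc = abelian_monoid.finsum_closed[OF abelian_monoid_A]
  have "(\<lambda>j. n * m + j) ` {..<m} = {n * m..<n * m + m}"
    using image_add_atLeastLessThan[of "n * m" 0 m] by (simp add: lessThan_atLeast0 add.commute)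
  then have split: "{..<Suc n * m} = {..<n * m} \<union> (\<lambda>j. n * m + j) ` {..<m}" by auto
  have c: "x (q div m) \<otimes> y (q mod m) \<in> carrier A" if "q < Suc n * m" for q
  proof -
    have "0 < m" using that by (cases m) auto
    moreover have "q div m < Suc n" using that by (simp add: less_mult_imp_div_less)
    ultimately show ?thesis using Suc.prems y by simp
  qed
  have "(\<Oplus>q \<in> {..<Suc n * m}. x (q div m) \<otimes> y (q mod m)) =
    (\<Oplus>q \<in> {..<n * m}. x (q div m) \<otimes> y (q mod m)) \<oplus> (\<Oplus>q \<in> (\<lambda>j. n * m + j) ` {..<m}. x (q div m) \<otimes> y (q mod m))"
    unfolding split
    by (rule abelian_monoid.finsum_Un_disjoint[OF abelian_monoid_A]) (use c Suc.prems y in \<open>auto simp: split[symmetric]\<close>)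
  also have "(\<Oplus>q \<in> (\<lambda>j. n * m + j) ` {..<m}. x (q div m) \<otimes> y (q mod m)) =
      (\<Oplus>j \<in> {..<m}. x ((n * m + j) div m) \<otimes> y ((n * m + j) mod m))"
    by (rule abelian_monoid.finsum_reindex[OF abelian_monoid_A]) (use c Suc.prems y in \<open>auto simp: inj_on_def\<close>)
  also have "\<dots> = (\<Oplus>j \<in> {..<m}. x n \<otimes> y j)"
    by (rule abelian_monoid.finsum_cong'[OF abelian_monoid_A]) (use Suc.prems y in auto)
  also have "\<dots> = x n \<otimes> (\<Oplus>j \<in> {..<m}. y j)"
    by (rule semiring.finsum_rdistr[OF ring_is_semiring[OF ring_A], symmetric]) (use Suc.prems y in auto)
  also have "(\<Oplus>q \<in> {..<n * m}. x (q div m) \<otimes> y (q mod m)) = (\<Oplus>i \<in> {..<n}. x i) \<otimes> (\<Oplus>j \<in> {..<m}. y j)"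
    by (rule Suc.IH) (use Suc.prems in simp)
  also have "(\<Oplus>i \<in> {..<n}. x i) \<otimes> (\<Oplus>j \<in> {..<m}. y j) \<oplus> x n \<otimes> (\<Oplus>j \<in> {..<m}. y j) =
      ((\<Oplus>i \<in> {..<n}. x i) \<oplus> x n) \<otimes> (\<Oplus>j \<in> {..<m}. y j)"
    using Suc.prems y by (intro l_distr[symmetric] fc) auto
  also have "(\<Oplus>i \<in> {..<n}. x i) \<oplus> x n = (\<Oplus>i \<in> {..<Suc n}. x i)"
    using Suc.prems by (simp add: lessThan_Suc abelian_monoid.finsum_insert[OF abelian_monoid_A] Pi_iff a_comm fc)
  finally show ?case .
qed

section \<open>Fullness\<close>

lemma star_gen_sub: "star_gen (A\<lparr>carrier := S\<rparr>) G = star_gen A G"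
proof (intro equalityI subsetI)
  fix x assume "x \<in> star_gen (A\<lparr>carrier := S\<rparr>) G"
  then show "x \<in> star_gen A G" by induction (auto intro: star_gen.intros)
next
  fix x assume "x \<in> star_gen A G"
  then show "x \<in> star_gen (A\<lparr>carrier := S\<rparr>) G"
  proof induction
    case one
    then show ?case using star_gen.one[of "A\<lparr>carrier := S\<rparr>" G] by simp
  next
    case (add x y)
    then show ?case using star_gen.add[of x "A\<lparr>carrier := S\<rparr>" G y] by simp
  next
    case (mult x y)
    then show ?case using star_gen.mult[of x "A\<lparr>carrier := S\<rparr>" G y] by simp
  next
    case (smult x c)
    then show ?case using star_gen.smult[of x "A\<lparr>carrier := S\<rparr>" G c] by simp
  next
    case (star x)
    then show ?case using star_gen.star[of x "A\<lparr>carrier := S\<rparr>" G] by simp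
  qed (rule star_gen.gen)
qed

lemma star_hom_sub:
  assumes "f \<in> star_hom A D" "S \<subseteq> carrier A" shows "f \<in> star_hom (A\<lparr>carrier := S\<rparr>) D"
  using assms(2) by (intro star_homI) (auto simp: star_homD[OF assms(1)] subset_eq)

abbreviation "entry_alg A n u \<equiv> A\<lparr>carrier := star_gen A (entries n u)\<rparr>"

text \<open>The norm is itself a C*-seminorm on the algebra of entries, so once it dominates all
  others the supremum is a maximum attained by it.\<close>

lemma full_onI:
  assumes A: "pre_cstar A" and u: "entries n u \<subseteq> carrier A"
    and le: "\<And>q x. cstar_seminorm (entry_alg A n u) q \<Longrightarrow> x \<in> star_gen A (entries n u) \<Longrightarrow> q x \<le> cnorm A x"
  shows "full_on A n u"
  unfolding full_on_def
proof
  interpret A: pre_cstar A by fact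
  fix x assume x: "x \<in> star_gen A (entries n u)"
  have "cstar_seminorm (entry_alg A n u) (cnorm A)"
    using A.sn A.star_gen_closed[OF u] by (simp add: cstar_seminorm_def)
  then have "Sup {p x | p. cstar_seminorm (entry_alg A n u) p \<and> (\<forall>r \<in> {}. p r = 0)} = cnorm A x"
    by (intro cSup_eq_maximum) (use le x in auto)
  then show "cnorm A x = universal_seminorm (entry_alg A n u) {} x"
    unfolding universal_seminorm_def by simp
qed

text \<open>To read a bound off the supremum it has to be finite; it is, because the entries are
  projections and every C*-seminorm is at most 1 on them.\<close>

lemma full_onD:
  assumes A: "pre_cstar A" and u: "magic_unitary A n u" and full: "full_on A n u"
    and q: "cstar_seminorm (entry_alg A n u) q" and x: "x \<in> star_gen A (entries n u)"
  shows "q x \<le> cnorm A x"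
proof -
  interpret A: pre_cstar A by fact
  note E = magic_unitary_entries[OF u]
  have "universal (entry_alg A n u) {}"
  proof (rule universalI)
    show P: "star_algebra (entry_alg A n u)" by (rule A.star_algebra_star_gen[OF E])
    fix g assume "g \<in> entries n u"
    then obtain i j where g: "g = u i j" "i < n" "j < n" by (auto simp: entries_def)
    note ug = magic_unitaryD(1-3)[OF u g(2,3), folded g(1)]
    have "p g \<le> 1" if "cstar_seminorm (entry_alg A n u) p" for p
    proof -
      interpret seminormed "entry_alg A n u" p
        by (intro seminormed.intro seminormed_axioms.intro P that)
      show ?thesis by (rule p_projection) (use ug g in \<open>auto intro!: star_gen.gen simp: entries_def\<close>)
    qed
    then show "\<exists>K. \<forall>p. cstar_seminorm (entry_alg A n u) p \<and> (\<forall>r\<in>{}. p r = 0) \<longrightarrow> p g \<le> K" by blast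
  qed (auto simp: star_gen_sub intro: star_gen.gen)
  from universal.us_upper[OF this, of q x] q x full show ?thesis by (simp add: full_on_def)
qed

text \<open>Differs from \<open>quantum_permutation_algebra\<close> in asking for
  \<open>complete_cstar\<close> in place of \<open>cstar_algebra\<close>, so that it can be
  established for \<open>hopf_tensor A B\<close>, whose operations outside of the carrier are not
  under control.\<close>

definition qpa_on :: "nat \<Rightarrow> ('a, 'm) hopf_cstar_scheme \<Rightarrow> (nat \<Rightarrow> nat \<Rightarrow> 'a) \<Rightarrow> bool" where
  "qpa_on n A u \<longleftrightarrow>
     complete_cstar A \<and> magic_unitary A n u \<and> generates_cstar A (entries n u) \<and> full_on A n u \<and>
     comult A \<in> star_hom A (max_tensor A A) \<and>
     counit A \<in> star_hom A complex_cstar \<and>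
     antipode A \<in> star_hom A (opposite A) \<and>
     (\<forall>i < n. \<forall>j < n.
        comult A (u i j) =
          (\<Oplus>\<^bsub>max_tensor A A\<^esub>k \<in> {..<n}. tensor_elem A A (u i k) (u k j)) \<and>
        counit A (u i j) = (if i = j then 1 else 0) \<and>
        antipode A (u i j) = u j i)"

lemma qpa_onI: "quantum_permutation_algebra n A u \<Longrightarrow> complete_cstar A \<Longrightarrow> qpa_on n A u"
  by (simp add: quantum_permutation_algebra_def qpa_on_def)

lemma qpa_onD:
  assumes "qpa_on n A u"
  shows "complete_cstar A" "magic_unitary A n u" "generates_cstar A (entries n u)" "full_on A n u"
    "comult A \<in> star_hom A (max_tensor A A)" "counit A \<in> star_hom A complex_cstar"
    "antipode A \<in> star_hom A (opposite A)"
    "i < n \<Longrightarrow> j < n \<Longrightarrow> comult A (u i j) = (\<Oplus>\<^bsub>max_tensor A A\<^esub>k \<in> {..<n}. tensor_elem A A (u i k) (u k j))"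
    "i < n \<Longrightarrow> j < n \<Longrightarrow> counit A (u i j) = (if i = j then 1 else 0)"
    "i < n \<Longrightarrow> j < n \<Longrightarrow> antipode A (u i j) = u j i"
  using assms by (simp_all add: qpa_on_def)

lemma star_hom_opposite:
  "f \<in> star_hom A D \<Longrightarrow> f \<in> star_hom (opposite A) (opposite D)"
  by (rule star_homI) (simp_all add: star_homD)

lemma entriesE:
  assumes "x \<in> entries n u" obtains i j where "i < n" "j < n" "x = u i j"
  using assms by (auto simp: entries_def)

text \<open>Each compatibility condition equates two morphisms defined on \<open>A\<close>, so it is
  decided on the entries of \<open>u\<close>.\<close>

lemma hopf_quotientI:
  assumes A: "qpa_on n A u" and C: "qpa_on n C w" and \<phi>: "\<phi> \<in> star_hom A C"
    and onto: "\<phi> ` carrier A = carrier C" and gen: "\<And>i j. i < n \<Longrightarrow> j < n \<Longrightarrow> \<phi> (u i j) = w i j"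
  shows "hopf_quotient A C"
proof -
  note A = qpa_onD[OF A] and C = qpa_onD[OF C]
  interpret A: complete_cstar A by (rule A)
  interpret C: complete_cstar C by (rule C)
  interpret AA: cstar_pair A A ..
  interpret CC: cstar_pair C C ..
  note E = magic_unitary_entries[OF A(2)]
  note uc = magic_unitaryD(1)[OF A(2)] and wc = magic_unitaryD(1)[OF C(2)]
  note tm = tensor_map_hom[OF A(1) A(1) C(1) C(1) \<phi> \<phi>]
  show ?thesis
    unfolding hopf_quotient_def
  proof (intro bexI[OF _ \<phi>] conjI ballI onto)
    fix x assume x: "x \<in> carrier A"
    show "comult C (\<phi> x) = tensor_map A A C C \<phi> \<phi> (comult A x)"
    proof (rule star_hom_eqI[OF A(1) CC.AB.pre_cstar_axioms star_hom_comp[OF \<phi> C(5)] star_hom_comp[OF A(5) tm(1)] E A(3) _ x])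
      fix y assume "y \<in> entries n u"
      then obtain i j where ij: "i < n" "j < n" "y = u i j" by (rule entriesE)
      have "tensor_map A A C C \<phi> \<phi> (comult A y) =
          (\<Oplus>\<^bsub>max_tensor C C\<^esub>k \<in> {..<n}. tensor_map A A C C \<phi> \<phi> (tensor_elem A A (u i k) (u k j)))"
        unfolding ij(3) A(8)[OF ij(1,2)]
        by (rule star_hom_finsum[OF AA.AB.star_algebra_axioms CC.AB.star_algebra_axioms tm(1)]) (use ij uc in auto)
      also have "\<dots> = (\<Oplus>\<^bsub>max_tensor C C\<^esub>k \<in> {..<n}. tensor_elem C C (w i k) (w k j))"
        by (rule abelian_monoid.finsum_cong'[OF CC.AB.abelian_monoid_A]) (use ij uc wc gen tm(2) in auto)
      finally show "comult C (\<phi> y) = tensor_map A A C C \<phi> \<phi> (comult A y)"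
        using C(8)[OF ij(1,2)] ij gen by simp
    qed
    show "counit C (\<phi> x) = counit A x"
    proof (rule star_hom_eqI[OF A(1) _ star_hom_comp[OF \<phi> C(6)] A(6) E A(3) _ x])
      show "pre_cstar complex_cstar" by (simp add: complete_cstar_complex)
    qed (auto elim!: entriesE simp: A C gen)
    \<comment> \<open>Both sides are morphisms into the opposite algebra, where the comparison takes
      place.\<close>
    show "antipode C (\<phi> x) = \<phi> (antipode A x)"
    proof (rule star_hom_eqI[OF A(1) _ star_hom_comp[OF \<phi> C(7)] star_hom_comp[OF A(7) star_hom_opposite[OF \<phi>]] E A(3) _ x])
      show "pre_cstar (opposite C)" by (simp add: complete_cstar_opposite C)
    qed (auto elim!: entriesE simp: A C gen)
  qed
qed

lemma hopf_tensor_simps [simp]: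
  "carrier (hopf_tensor A B) = carrier (max_tensor A B)" "mult (hopf_tensor A B) = mult (max_tensor A B)"
  "one (hopf_tensor A B) = one (max_tensor A B)" "zero (hopf_tensor A B) = zero (max_tensor A B)"
  "add (hopf_tensor A B) = add (max_tensor A B)" "smult (hopf_tensor A B) = smult (max_tensor A B)"
  "star (hopf_tensor A B) = star (max_tensor A B)" "cnorm (hopf_tensor A B) = cnorm (max_tensor A B)"
  "comult (hopf_tensor A B) = (\<lambda>z. middle_swap A B
            (tensor_map A B (max_tensor A A) (max_tensor B B) (comult A) (comult B) z))"
  "counit (hopf_tensor A B) = tensor_ext A B complex_cstar (\<lambda>a b. counit A a * counit B b)"
  "antipode (hopf_tensor A B) = tensor_ext A B (opposite (max_tensor A B))
            (\<lambda>a b. tensor_elem A B (antipode A a) (antipode B b))"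
  by (simp_all add: hopf_tensor_def cstar.defs hopf_cstar.defs)

lemma same_star_hopf_tensor: "same_star (hopf_tensor A B) (max_tensor A B)"
  by (simp add: same_star_def)

lemma opposite_cong: "same_star A A' \<Longrightarrow> same_star (opposite A) (opposite A')"
  by (auto simp: same_star_def opposite_def)

section \<open>The Hopf structure of the tensor product\<close>

locale qpa_pair =
  fixes A :: "('a, 'x) hopf_cstar_scheme" and B :: "('b, 'y) hopf_cstar_scheme"
    and n m :: nat and u :: "nat \<Rightarrow> nat \<Rightarrow> 'a" and v :: "nat \<Rightarrow> nat \<Rightarrow> 'b"
  assumes qA: "qpa_on n A u" and qB: "qpa_on m B v"
begin

lemmas hA = qpa_onD[OF qA] and hB = qpa_onD[OF qB]

sublocale cstar_pair A B by (rule cstar_pair_intro) (rule hA hB)+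
sublocale AA: cstar_pair A A ..
sublocale BB: cstar_pair B B ..
sublocale ABAB: cstar_pair AB AB ..
sublocale AABB: cstar_pair "max_tensor A A" "max_tensor B B" ..

abbreviation "H \<equiv> hopf_tensor A B"
abbreviation "T4 \<equiv> max_tensor AB AB"

lemma uc [simp]: "i < n \<Longrightarrow> j < n \<Longrightarrow> u i j \<in> carrier A" and vc [simp]: "i < m \<Longrightarrow> j < m \<Longrightarrow> v i j \<in> carrier B"
  using magic_unitaryD(1)[OF hA(2)] magic_unitaryD(1)[OF hB(2)] by auto

abbreviation "gens \<equiv> (\<lambda>a. i1 a) ` entries n u \<union> (\<lambda>b. i2 b) ` entries m v"

lemma gens_closed: "gens \<subseteq> carrier AB"
  using magic_unitary_entries[OF hA(2)] magic_unitary_entries[OF hB(2)] by auto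

lemma generates_gens: "generates_cstar AB gens"
  by (rule generates_tensor) (rule magic_unitary_entries hA hB)+

text \<open>\<open>F\<close> and \<open>G\<close> are the two halves of the middle swap:
  \<open>a \<otimes> a'\<close> goes to \<open>(a \<otimes> 1) \<otimes> (a' \<otimes> 1)\<close>,
  and \<open>b \<otimes> b'\<close> goes to
  \<open>(1 \<otimes> b) \<otimes> (1 \<otimes> b')\<close>. Their ranges commute and their products
  are the values that \<open>middle_swap\<close> prescribes.\<close>

definition "F = tensor_map A A AB AB (\<lambda>a. i1 a) (\<lambda>a. i1 a)"
definition "G = tensor_map B B AB AB (\<lambda>b. i2 b) (\<lambda>b. i2 b)"

lemma F_hom: "F \<in> star_hom (max_tensor A A) T4"
  and F_te: "a \<in> carrier A \<Longrightarrow> a' \<in> carrier A \<Longrightarrow> F (tensor_elem A A a a') = tensor_elem AB AB (i1 a) (i1 a')"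
  unfolding F_def by (rule tensor_map_hom[OF hA(1) hA(1) AB.complete_cstar_axioms AB.complete_cstar_axioms i1_hom i1_hom]; assumption?)+

lemma G_hom: "G \<in> star_hom (max_tensor B B) T4"
  and G_te: "b \<in> carrier B \<Longrightarrow> b' \<in> carrier B \<Longrightarrow> G (tensor_elem B B b b') = tensor_elem AB AB (i2 b) (i2 b')"
  unfolding G_def by (rule tensor_map_hom[OF hB(1) hB(1) AB.complete_cstar_axioms AB.complete_cstar_axioms i2_hom i2_hom]; assumption?)+

lemma FG_commute:
  assumes "x \<in> carrier (max_tensor A A)" "y \<in> carrier (max_tensor B B)"
  shows "F x \<otimes>\<^bsub>T4\<^esub> G y = G y \<otimes>\<^bsub>T4\<^esub> F x"
proof (rule commuting_homs[OF AA.AB.complete_cstar_axioms BB.AB.complete_cstar_axioms ABAB.AB.pre_cstar_axioms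
      F_hom G_hom _ AA.generates_legs _ BB.generates_legs _ _ assms])
  fix b assume "b \<in> (\<lambda>b. BB.i1 b) ` carrier B \<union> (\<lambda>b. BB.i2 b) ` carrier B"
  then show "star (max_tensor B B) b \<in> (\<lambda>b. BB.i1 b) ` carrier B \<union> (\<lambda>b. BB.i2 b) ` carrier B"
    by (auto simp: BB.te_star)
next
  fix x y assume "x \<in> (\<lambda>a. AA.i1 a) ` carrier A \<union> (\<lambda>a. AA.i2 a) ` carrier A"
    "y \<in> (\<lambda>b. BB.i1 b) ` carrier B \<union> (\<lambda>b. BB.i2 b) ` carrier B"
  then obtain a a' b b' where xy: "x = tensor_elem A A a a'" "a \<in> carrier A" "a' \<in> carrier A"
    "y = tensor_elem B B b b'" "b \<in> carrier B" "b' \<in> carrier B" by blast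
  then show "F x \<otimes>\<^bsub>T4\<^esub> G y = G y \<otimes>\<^bsub>T4\<^esub> F x"
    by (simp add: F_te G_te ABAB.te_mult te_mult)
qed auto

text \<open>Discharges the definite description in \<open>middle_swap\<close>. It prescribes values
  only on tensors of elementary tensors, so uniqueness rests on the legs of
  \<open>A \<otimes> A\<close> and \<open>B \<otimes> B\<close> being generators.\<close>

lemma middle_swap:
  "middle_swap A B \<in> star_hom (max_tensor (max_tensor A A) (max_tensor B B)) T4"
  "x \<in> carrier (max_tensor A A) \<Longrightarrow> y \<in> carrier (max_tensor B B) \<Longrightarrow>
    middle_swap A B (tensor_elem (max_tensor A A) (max_tensor B B) x y) = F x \<otimes>\<^bsub>T4\<^esub> G y"
proof -
  let ?X = "max_tensor (max_tensor A A) (max_tensor B B)"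
  let ?te = "tensor_elem (max_tensor A A) (max_tensor B B)"
  let ?P = "\<lambda>h. h \<in> star_hom ?X T4 \<and> h \<in> extensional (carrier ?X) \<and>
        (\<forall>a \<in> carrier A. \<forall>a' \<in> carrier A. \<forall>b \<in> carrier B. \<forall>b' \<in> carrier B.
           h (?te (tensor_elem A A a a') (tensor_elem B B b b')) =
           tensor_elem AB AB (te a b) (te a' b'))"
  have "AABB.commuting T4 F G" unfolding AABB.commuting_def using F_hom G_hom FG_commute by blast
  from AABB.tensor_universal[OF ABAB.complete_cstar_tensor this] obtain h
    where h: "h \<in> star_hom ?X T4" "\<forall>x \<in> carrier (max_tensor A A). \<forall>y \<in> carrier (max_tensor B B).
      h (?te x y) = F x \<otimes>\<^bsub>T4\<^esub> G y" ..
  define k where "k = restrict h (carrier ?X)"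
  have k_te: "k (?te x y) = F x \<otimes>\<^bsub>T4\<^esub> G y" if "x \<in> carrier (max_tensor A A)" "y \<in> carrier (max_tensor B B)" for x y
    using h(2) that by (simp add: k_def)
  have k: "?P k"
  proof (intro conjI ballI)
    show "k \<in> star_hom ?X T4"
      by (rule star_hom_cong[OF AABB.AB.star_algebra_axioms h(1)]) (simp add: k_def)
    show "k \<in> extensional (carrier ?X)" by (simp add: k_def)
    fix a a' b b' assume "a \<in> carrier A" "a' \<in> carrier A" "b \<in> carrier B" "b' \<in> carrier B"
    then show "k (?te (tensor_elem A A a a') (tensor_elem B B b b')) = tensor_elem AB AB (te a b) (te a' b')"
      by (simp add: k_te F_te G_te ABAB.te_mult te_mult)
  qed
  have uniq: "k' = k" if k': "?P k'" for k'
  proof (rule extensionalityI[of _ "carrier ?X"])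
    let ?GA = "(\<lambda>a. AA.i1 a) ` carrier A \<union> (\<lambda>a. AA.i2 a) ` carrier A"
    let ?GB = "(\<lambda>b. BB.i1 b) ` carrier B \<union> (\<lambda>b. BB.i2 b) ` carrier B"
    have g: "?GA \<subseteq> carrier (max_tensor A A)" "?GB \<subseteq> carrier (max_tensor B B)" by auto
    let ?GG = "(\<lambda>a. AABB.i1 a) ` ?GA \<union> (\<lambda>b. AABB.i2 b) ` ?GB"
    fix x assume x: "x \<in> carrier ?X"
    have hh: "k' \<in> star_hom ?X T4" "k \<in> star_hom ?X T4" using k k' by blast+
    show "k' x = k x"
    proof (rule star_hom_eqI[OF AABB.AB.complete_cstar_axioms ABAB.AB.pre_cstar_axioms hh _ 
        AABB.generates_tensor[OF g(1) AA.generates_legs g(2) BB.generates_legs] _ x])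
      show "?GG \<subseteq> carrier ?X" by auto
      fix y assume "y \<in> ?GG"
      then obtain a a' b b' where "y = ?te (tensor_elem A A a a') (tensor_elem B B b b')"
        "a \<in> carrier A" "a' \<in> carrier A" "b \<in> carrier B" "b' \<in> carrier B"
        \<comment> \<open>The units of \<open>A \<otimes> A\<close> and \<open>B \<otimes> B\<close>
          are written as elementary tensors, which brings every generator into the prescribed
          form.\<close>
        unfolding AA.te_one[symmetric] BB.te_one[symmetric] by blast
      then show "k' y = k y" using k k' by simp
    qed
  qed (use k k' in blast)+
  have "middle_swap A B = k"
    unfolding middle_swap_def Let_def by (rule the_equality) (use k uniq in blast)+
  then show "middle_swap A B \<in> star_hom ?X T4"
    "x \<in> carrier (max_tensor A A) \<Longrightarrow> y \<in> carrier (max_tensor B B) \<Longrightarrow> middle_swap A B (?te x y) = F x \<otimes>\<^bsub>T4\<^esub> G y"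
    using k k_te by simp_all
qed

lemma comult_H_hom: "comult H \<in> star_hom AB T4"
  unfolding hopf_tensor_simps
  by (rule star_hom_comp[OF tensor_map_hom(1)[OF hA(1) hB(1) AA.complete_cstar_tensor BB.complete_cstar_tensor hA(5) hB(5)] middle_swap(1)])

text \<open>In this product form the sums defining the two comultiplications multiply out by
  \<open>finsum_div_mod\<close>.\<close>

lemma comult_H: 
  assumes "a \<in> carrier A" "b \<in> carrier B"
  shows "comult H (te a b) = F (comult A a) \<otimes>\<^bsub>T4\<^esub> G (comult B b)"
  using assms star_homD(1)[OF hA(5)] star_homD(1)[OF hB(5)]
  by (simp add: tensor_map_hom(2)[OF hA(1) hB(1) AA.complete_cstar_tensor BB.complete_cstar_tensor hA(5) hB(5)] middle_swap(2))

lemma F_comult: 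
  assumes "i < n" "j < n"
  shows "F (comult A (u i j)) = (\<Oplus>\<^bsub>T4\<^esub>k \<in> {..<n}. tensor_elem AB AB (i1 (u i k)) (i1 (u k j)))"
proof -
  have "F (comult A (u i j)) = (\<Oplus>\<^bsub>T4\<^esub>k \<in> {..<n}. F (tensor_elem A A (u i k) (u k j)))"
    unfolding hA(8)[OF assms]
    by (rule star_hom_finsum[OF AA.AB.star_algebra_axioms ABAB.AB.star_algebra_axioms F_hom]) (use assms in simp)
  also have "\<dots> = (\<Oplus>\<^bsub>T4\<^esub>k \<in> {..<n}. tensor_elem AB AB (i1 (u i k)) (i1 (u k j)))"
    by (rule abelian_monoid.finsum_cong'[OF ABAB.AB.abelian_monoid_A]) (use assms F_te in auto)
  finally show ?thesis .
qed

lemma G_comult: 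
  assumes "i < m" "j < m"
  shows "G (comult B (v i j)) = (\<Oplus>\<^bsub>T4\<^esub>k \<in> {..<m}. tensor_elem AB AB (i2 (v i k)) (i2 (v k j)))"
proof -
  have "G (comult B (v i j)) = (\<Oplus>\<^bsub>T4\<^esub>k \<in> {..<m}. G (tensor_elem B B (v i k) (v k j)))"
    unfolding hB(8)[OF assms]
    by (rule star_hom_finsum[OF BB.AB.star_algebra_axioms ABAB.AB.star_algebra_axioms G_hom]) (use assms in simp)
  also have "\<dots> = (\<Oplus>\<^bsub>T4\<^esub>k \<in> {..<m}. tensor_elem AB AB (i2 (v i k)) (i2 (v k j)))"
    by (rule abelian_monoid.finsum_cong'[OF ABAB.AB.abelian_monoid_A]) (use assms G_te in auto)
  finally show ?thesis .
qed

lemma counit_H: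
  "counit H \<in> star_hom AB complex_cstar"
  "a \<in> carrier A \<Longrightarrow> b \<in> carrier B \<Longrightarrow> counit H (te a b) = counit A a * counit B b"
proof -
  have "commuting complex_cstar (counit A) (counit B)" using hA(6) hB(6) by (simp add: commuting_def)
  from the_tensor_hom[OF complete_cstar_complex this, of "\<lambda>a b. counit A a * counit B b"]
  show "counit H \<in> star_hom AB complex_cstar"
    "a \<in> carrier A \<Longrightarrow> b \<in> carrier B \<Longrightarrow> counit H (te a b) = counit A a * counit B b" by simp_all
qed

lemma antipode_H:
  "antipode H \<in> star_hom AB (opposite AB)"
  "a \<in> carrier A \<Longrightarrow> b \<in> carrier B \<Longrightarrow> antipode H (te a b) = te (antipode A a) (antipode B b)"
proof -
  note [simp] = star_homD(1)[OF hA(7), simplified] star_homD(1)[OF hB(7), simplified]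
  have "commuting (opposite AB) (\<lambda>a. i1 (antipode A a)) (\<lambda>b. i2 (antipode B b))"
    using star_hom_comp[OF hA(7) star_hom_opposite[OF i1_hom]] star_hom_comp[OF hB(7) star_hom_opposite[OF i2_hom]]
    by (simp add: commuting_def te_mult)
  from the_tensor_hom[OF complete_cstar_opposite[OF complete_cstar_tensor] this, 
      of "\<lambda>a b. te (antipode A a) (antipode B b)"]
  show "antipode H \<in> star_hom AB (opposite AB)"
    "a \<in> carrier A \<Longrightarrow> b \<in> carrier B \<Longrightarrow> antipode H (te a b) = te (antipode A a) (antipode B b)"
    by (simp_all add: te_mult)
qed

section \<open>The magic unitary of the tensor product\<close>

definition W :: "nat \<Rightarrow> nat \<Rightarrow> ('a, 'b) tens" where
  "W p q = te (u (p div m) (q div m)) (v (p mod m) (q mod m))"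

lemma index: "p < n * m \<Longrightarrow> p div m < n" "p < n * m \<Longrightarrow> p mod m < m"
  by (simp add: less_mult_imp_div_less) (cases "m = 0"; simp)

lemma te_zero: "b \<in> carrier B \<Longrightarrow> te \<zero>\<^bsub>A\<^esub> b = \<zero>\<^bsub>AB\<^esub>" "a \<in> carrier A \<Longrightarrow> te a \<zero>\<^bsub>B\<^esub> = \<zero>\<^bsub>AB\<^esub>"
  using te_bilinear(3)[of "\<zero>\<^bsub>A\<^esub>" b 0] te_bilinear(4)[of a "\<zero>\<^bsub>B\<^esub>" 0] by simp_all

lemma W_factor: "p < n * m \<Longrightarrow> q < n * m \<Longrightarrow> 
    W p q = i1 (u (p div m) (q div m)) \<otimes>\<^bsub>AB\<^esub> i2 (v (p mod m) (q mod m))"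
  unfolding W_def by (rule te_factor) (simp_all add: index)

lemma W_sums:
  assumes p: "p < n * m"
  shows "(\<Oplus>\<^bsub>AB\<^esub>q \<in> {..<n * m}. W p q) = \<one>\<^bsub>AB\<^esub>" "(\<Oplus>\<^bsub>AB\<^esub>q \<in> {..<n * m}. W q p) = \<one>\<^bsub>AB\<^esub>"
proof -
  note i = index[OF p]
  note i1sum = star_hom_finsum[OF A.star_algebra_axioms AB.star_algebra_axioms i1_hom, symmetric]
  note i2sum = star_hom_finsum[OF B.star_algebra_axioms AB.star_algebra_axioms i2_hom, symmetric]
  have "(\<Oplus>\<^bsub>AB\<^esub>q \<in> {..<n * m}. W p q) = 
      (\<Oplus>\<^bsub>AB\<^esub>q \<in> {..<n * m}. i1 (u (p div m) (q div m)) \<otimes>\<^bsub>AB\<^esub> i2 (v (p mod m) (q mod m)))"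
    by (rule abelian_monoid.finsum_cong'[OF AB.abelian_monoid_A]) (use p i index W_factor in auto)
  also have "\<dots> = (\<Oplus>\<^bsub>AB\<^esub>j \<in> {..<n}. i1 (u (p div m) j)) \<otimes>\<^bsub>AB\<^esub> (\<Oplus>\<^bsub>AB\<^esub>j \<in> {..<m}. i2 (v (p mod m) j))"
    by (rule AB.finsum_div_mod) (use i in simp_all)
  also have "\<dots> = \<one>\<^bsub>AB\<^esub>"
    using i i1sum[of "{..<n}" "u (p div m)"] i2sum[of "{..<m}" "v (p mod m)"]
      magic_unitaryD(4)[OF hA(2) i(1) i(1)] magic_unitaryD(4)[OF hB(2) i(2) i(2)] by (simp add: te_one)
  finally show "(\<Oplus>\<^bsub>AB\<^esub>q \<in> {..<n * m}. W p q) = \<one>\<^bsub>AB\<^esub>" .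
  have "(\<Oplus>\<^bsub>AB\<^esub>q \<in> {..<n * m}. W q p) = 
      (\<Oplus>\<^bsub>AB\<^esub>q \<in> {..<n * m}. i1 (u (q div m) (p div m)) \<otimes>\<^bsub>AB\<^esub> i2 (v (q mod m) (p mod m)))"
    by (rule abelian_monoid.finsum_cong'[OF AB.abelian_monoid_A]) (use p i index W_factor in auto)
  also have "\<dots> = (\<Oplus>\<^bsub>AB\<^esub>j \<in> {..<n}. i1 (u j (p div m))) \<otimes>\<^bsub>AB\<^esub> (\<Oplus>\<^bsub>AB\<^esub>j \<in> {..<m}. i2 (v j (p mod m)))"
    by (rule AB.finsum_div_mod) (use i in simp_all)
  also have "\<dots> = \<one>\<^bsub>AB\<^esub>"
    using i i1sum[of "{..<n}" "\<lambda>j. u j (p div m)"] i2sum[of "{..<m}" "\<lambda>j. v j (p mod m)"]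
      magic_unitaryD(5)[OF hA(2) i(1) i(1)] magic_unitaryD(5)[OF hB(2) i(2) i(2)] by (simp add: te_one)
  finally show "(\<Oplus>\<^bsub>AB\<^esub>q \<in> {..<n * m}. W q p) = \<one>\<^bsub>AB\<^esub>" .
qed

lemma div_mod_neq: "(p :: nat) \<noteq> q \<Longrightarrow> p div m \<noteq> q div m \<or> p mod m \<noteq> q mod m"
  by (metis div_mult_mod_eq)

text \<open>Distinct indices differ in the quotient or in the remainder, so at least one tensor
  factor of the product of two entries is zero.\<close>

lemma magic_W: "magic_unitary AB (n * m) W"
  unfolding magic_unitary_def
proof (intro conjI allI impI)
  fix p assume p: "p < n * m"
  show "(\<Oplus>\<^bsub>AB\<^esub>q \<in> {..<n * m}. W p q) = \<one>\<^bsub>AB\<^esub>" "(\<Oplus>\<^bsub>AB\<^esub>q \<in> {..<n * m}. W q p) = \<one>\<^bsub>AB\<^esub>"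
    by (rule W_sums[OF p])+
  fix q assume q: "q < n * m"
  note i = index[OF p] index[OF q]
  note uD = magic_unitaryD[OF hA(2)] and vD = magic_unitaryD[OF hB(2)]
  show "projection AB (W p q)"
    using i by (simp add: projection_def W_def te_star te_mult uD vD)
  fix r assume r: "r < n * m" and qr: "q \<noteq> r"
  note k = index[OF r]
  show "W p q \<otimes>\<^bsub>AB\<^esub> W p r = \<zero>\<^bsub>AB\<^esub>"
  proof (cases "q div m = r div m")
    case True
    then have "q mod m \<noteq> r mod m" using div_mod_neq[OF qr] by simp
    then show ?thesis using i k by (simp add: W_def te_mult vD(6) te_zero)
  next
    case False
    then show ?thesis using i k by (simp add: W_def te_mult uD(6) te_zero)
  qed
  show "W q p \<otimes>\<^bsub>AB\<^esub> W r p = \<zero>\<^bsub>AB\<^esub>"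
  proof (cases "q div m = r div m")
    case True
    then have "q mod m \<noteq> r mod m" using div_mod_neq[OF qr] by simp
    then show ?thesis using i k by (simp add: W_def te_mult vD(7) te_zero)
  next
    case False
    then show ?thesis using i k by (simp add: W_def te_mult uD(7) te_zero)
  qed
qed

lemma comult_W:
  assumes p: "p < n * m" and q: "q < n * m"
  shows "comult H (W p q) = (\<Oplus>\<^bsub>T4\<^esub>k \<in> {..<n * m}. tensor_elem AB AB (W p k) (W k q))"
proof -
  note i = index[OF p] index[OF q]
  have "comult H (W p q) = F (comult A (u (p div m) (q div m))) \<otimes>\<^bsub>T4\<^esub> G (comult B (v (p mod m) (q mod m)))"
    unfolding W_def by (rule comult_H) (use i in simp_all)
  also have "\<dots> = (\<Oplus>\<^bsub>T4\<^esub>k \<in> {..<n * m}. 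
      tensor_elem AB AB (i1 (u (p div m) (k div m))) (i1 (u (k div m) (q div m))) \<otimes>\<^bsub>T4\<^esub>
      tensor_elem AB AB (i2 (v (p mod m) (k mod m))) (i2 (v (k mod m) (q mod m))))"
    unfolding F_comult[OF i(1) i(3)] G_comult[OF i(2) i(4)]
    by (rule ABAB.AB.finsum_div_mod[symmetric]) (use i in simp_all)
  also have "\<dots> = (\<Oplus>\<^bsub>T4\<^esub>k \<in> {..<n * m}. tensor_elem AB AB (W p k) (W k q))"
    by (rule abelian_monoid.finsum_cong'[OF ABAB.AB.abelian_monoid_A])
      (use i index p q in \<open>auto simp: W_factor ABAB.te_mult W_def[symmetric]\<close>)
  finally show ?thesis .
qed

text \<open>The row that is summed is row 0, which exists because both sizes are positive.\<close>

lemma gens_in_star_gen: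
  assumes "0 < n" "0 < m" shows "gens \<subseteq> star_gen AB (entries (n * m) W)"
proof -
  let ?E = "entries (n * m) W"
  have E: "?E \<subseteq> carrier AB" by (rule magic_unitary_entries[OF magic_W])
  have fin: "(\<Oplus>\<^bsub>AB\<^esub>k \<in> {..<N}. x k) \<in> star_gen AB ?E" if "\<And>k. k < N \<Longrightarrow> x k \<in> star_gen AB ?E" for N :: nat and x
    using that
  proof (induction N)
    case 0
    then show ?case using AB.star_gen_zero by (simp add: abelian_monoid.finsum_empty[OF AB.abelian_monoid_A])
  next
    case (Suc N)
    then show ?case
      using AB.star_gen_closed[OF E]
      by (simp add: lessThan_Suc abelian_monoid.finsum_insert[OF AB.abelian_monoid_A] Pi_iff star_gen.add)
  qed
  have Wgen: "te (u i j) (v a b) \<in> star_gen AB ?E" if "i < n" "j < n" "a < m" "b < m" for i j a b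
  proof -
    have te_W: "te (u i j) (v a b) = W (i * m + a) (j * m + b)" using that by (simp add: W_def)
    have "i * m + a < n * m" if "i < n" "a < m" for i a
    proof -
      have "i * m + a < Suc i * m" using that by simp
      also have "\<dots> \<le> n * m" using that by (intro mult_le_mono1) simp
      finally show ?thesis .
    qed
    with that show ?thesis unfolding te_W entries_def by (intro star_gen.gen) blast
  qed
  have "i1 (u i j) \<in> star_gen AB ?E" if ij: "i < n" "j < n" for i j
  proof -
    have "i1 (u i j) = te (u i j) (\<Oplus>\<^bsub>B\<^esub>b \<in> {..<m}. v 0 b)"
      using magic_unitaryD(4)[OF hB(2), of 0 0] assms by simp
    also have "\<dots> = i1 (u i j) \<otimes>\<^bsub>AB\<^esub> i2 (\<Oplus>\<^bsub>B\<^esub>b \<in> {..<m}. v 0 b)"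
      using ij assms by (intro te_factor) (auto intro!: abelian_monoid.finsum_closed[OF B.abelian_monoid_A])
    also have "i2 (\<Oplus>\<^bsub>B\<^esub>b \<in> {..<m}. v 0 b) = (\<Oplus>\<^bsub>AB\<^esub>b \<in> {..<m}. i2 (v 0 b))"
      using assms by (intro star_hom_finsum[OF B.star_algebra_axioms AB.star_algebra_axioms i2_hom]) simp
    also have "i1 (u i j) \<otimes>\<^bsub>AB\<^esub> (\<Oplus>\<^bsub>AB\<^esub>b \<in> {..<m}. i2 (v 0 b)) = (\<Oplus>\<^bsub>AB\<^esub>b \<in> {..<m}. i1 (u i j) \<otimes>\<^bsub>AB\<^esub> i2 (v 0 b))"
      using ij assms by (intro semiring.finsum_rdistr[OF ring_is_semiring[OF AB.ring_A]]) auto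
    also have "\<dots> = (\<Oplus>\<^bsub>AB\<^esub>b \<in> {..<m}. te (u i j) (v 0 b))"
      using ij assms by (intro abelian_monoid.finsum_cong'[OF AB.abelian_monoid_A]) (auto simp: te_mult)
    finally show ?thesis using ij assms by (simp only:) (intro fin Wgen)
  qed
  moreover have "i2 (v a b) \<in> star_gen AB ?E" if ab: "a < m" "b < m" for a b
  proof -
    have "i2 (v a b) = te (\<Oplus>\<^bsub>A\<^esub>j \<in> {..<n}. u 0 j) (v a b)"
      using magic_unitaryD(4)[OF hA(2), of 0 0] assms by simp
    also have "\<dots> = i1 (\<Oplus>\<^bsub>A\<^esub>j \<in> {..<n}. u 0 j) \<otimes>\<^bsub>AB\<^esub> i2 (v a b)"
      using ab assms by (intro te_factor) (auto intro!: abelian_monoid.finsum_closed[OF A.abelian_monoid_A])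
    also have "i1 (\<Oplus>\<^bsub>A\<^esub>j \<in> {..<n}. u 0 j) = (\<Oplus>\<^bsub>AB\<^esub>j \<in> {..<n}. i1 (u 0 j))"
      using assms by (intro star_hom_finsum[OF A.star_algebra_axioms AB.star_algebra_axioms i1_hom]) simp
    also have "(\<Oplus>\<^bsub>AB\<^esub>j \<in> {..<n}. i1 (u 0 j)) \<otimes>\<^bsub>AB\<^esub> i2 (v a b) = (\<Oplus>\<^bsub>AB\<^esub>j \<in> {..<n}. i1 (u 0 j) \<otimes>\<^bsub>AB\<^esub> i2 (v a b))"
      using ab assms by (intro semiring.finsum_ldistr[OF ring_is_semiring[OF AB.ring_A]]) auto
    also have "\<dots> = (\<Oplus>\<^bsub>AB\<^esub>j \<in> {..<n}. te (u 0 j) (v a b))"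
      using ab assms by (intro abelian_monoid.finsum_cong'[OF AB.abelian_monoid_A]) (auto simp: te_mult)
    finally show ?thesis using ab assms by (simp only:) (intro fin Wgen)
  qed
  ultimately show ?thesis by (auto elim!: entriesE)
qed

lemma generates_W:
  assumes "0 < n" "0 < m" shows "generates_cstar AB (entries (n * m) W)"
proof (rule AB.generates_cstar_trans[OF generates_gens])
  show E: "entries (n * m) W \<subseteq> carrier AB" by (rule magic_unitary_entries[OF magic_W])
  show "gens \<subseteq> gen_closure AB (entries (n * m) W)"
    using AB.star_gen_in_closure[OF E] gens_in_star_gen[OF assms] by blast
qed

end

lemma same_star_minus: "same_star A A' \<Longrightarrow> a_minus A = a_minus A'"
  by (simp add: same_star_def fun_eq_iff a_minus_def a_inv_def m_inv_def)

lemma same_star_finsum: "same_star A A' \<Longrightarrow> finsum A = finsum A'"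
  unfolding same_star_def by (intro ext) (simp add: finsum_def finprod_def)

lemma same_star_gen_le: 
  assumes "same_star A A'" "x \<in> star_gen A' G" shows "x \<in> star_gen A G"
  using assms(2,1)
  by induction (use star_gen.one[of A] star_gen.add[of _ A] star_gen.mult[of _ A] star_gen.smult[of _ A]
      star_gen.star[of _ A] star_gen.gen[of _ _ A] in \<open>auto simp: same_star_def\<close>)

lemma same_star_gen: "same_star A A' \<Longrightarrow> star_gen A G = star_gen A' G"
  using same_star_gen_le[of A A' _ G] same_star_gen_le[of A' A _ G] by (auto simp: same_star_def)

lemma magic_unitary_image:
  assumes A: "star_algebra A" and D: "star_algebra D" and f: "f \<in> star_hom A D" and u: "magic_unitary A n u"
  shows "magic_unitary D n (\<lambda>i j. f (u i j))"
proof -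
  note uD = magic_unitaryD[OF u] and fs = star_hom_finsum[OF A D f, symmetric]
  show ?thesis
    unfolding magic_unitary_def projection_def
  proof (intro conjI allI impI)
    fix i assume i: "i < n"
    have "(\<Oplus>\<^bsub>D\<^esub>j \<in> {..<n}. f (u i j)) = f (\<Oplus>\<^bsub>A\<^esub>j \<in> {..<n}. u i j)"
      by (rule fs[of "{..<n}" "u i"]) (use i uD(1) in simp)
    then show "(\<Oplus>\<^bsub>D\<^esub>j \<in> {..<n}. f (u i j)) = \<one>\<^bsub>D\<^esub>" using uD(4)[OF i i] star_homD(4)[OF f] by simp
    have "(\<Oplus>\<^bsub>D\<^esub>j \<in> {..<n}. f (u j i)) = f (\<Oplus>\<^bsub>A\<^esub>j \<in> {..<n}. u j i)"
      by (rule fs[of "{..<n}" "\<lambda>j. u j i"]) (use i uD(1) in simp)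
    then show "(\<Oplus>\<^bsub>D\<^esub>j \<in> {..<n}. f (u j i)) = \<one>\<^bsub>D\<^esub>" using uD(5)[OF i i] star_homD(4)[OF f] by simp
    fix j assume j: "j < n"
    note c = uD(1)[OF i j] uD(1)[OF j i]
    show "f (u i j) \<in> carrier D" "star D (f (u i j)) = f (u i j)" "f (u i j) \<otimes>\<^bsub>D\<^esub> f (u i j) = f (u i j)"
      using star_homD(1)[OF f c(1)] star_homD(5)[OF f c(1)] star_homD(2)[OF f c(1) c(1)] uD(2,3)[OF i j] by simp_all
    fix k assume k: "k < n" and jk: "j \<noteq> k"
    show "f (u i j) \<otimes>\<^bsub>D\<^esub> f (u i k) = \<zero>\<^bsub>D\<^esub>" "f (u j i) \<otimes>\<^bsub>D\<^esub> f (u k i) = \<zero>\<^bsub>D\<^esub>"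
      using star_homD(2)[OF f c(1) uD(1)[OF i k]] star_homD(2)[OF f c(2) uD(1)[OF k i]] 
        uD(6)[OF i j k jk] uD(7)[OF i j k jk] star_hom_zero[OF A D f] by simp_all
  qed
qed

text \<open>Lets all clauses be checked in the underlying algebra \<open>A\<close>, of which
  \<open>H\<close> is the extension by Hopf maps.\<close>

lemma qpa_on_cong:
  assumes s: "same_star H A" and n: "cnorm H = cnorm A"
    and A: "complete_cstar A" "magic_unitary A n u" "generates_cstar A (entries n u)" "full_on A n u"
    and hopf: "comult H \<in> star_hom A (max_tensor A A)" "counit H \<in> star_hom A complex_cstar"
      "antipode H \<in> star_hom A (opposite A)"
      "\<And>i j. i < n \<Longrightarrow> j < n \<Longrightarrow> comult H (u i j) = (\<Oplus>\<^bsub>max_tensor A A\<^esub>k \<in> {..<n}. tensor_elem A A (u i k) (u k j))"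
      "\<And>i j. i < n \<Longrightarrow> j < n \<Longrightarrow> counit H (u i j) = (if i = j then 1 else 0)"
      "\<And>i j. i < n \<Longrightarrow> j < n \<Longrightarrow> antipode H (u i j) = u j i"
  shows "qpa_on n H u"
  unfolding qpa_on_def
proof (intro conjI allI impI)
  show H: "complete_cstar H" by (rule complete_cstar_cong[OF A(1) s n])
  show "magic_unitary H n u"
    using A(2) s unfolding magic_unitary_def projection_def same_star_finsum[OF s] same_star_def by simp
  show "generates_cstar H (entries n u)"
    using A(3) s unfolding generates_cstar_def same_star_minus[OF s] same_star_gen[OF s] n same_star_def by simp
  show "full_on H n u"
  proof (rule full_onI)
    show "pre_cstar H" using H by simp
    show "entries n u \<subseteq> carrier H" using magic_unitary_entries[OF A(2)] s by (simp add: same_star_def)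
    fix q x assume q: "cstar_seminorm (entry_alg H n u) q" and x: "x \<in> star_gen H (entries n u)"
    have "cstar_seminorm (entry_alg A n u) q"
      using q s unfolding cstar_seminorm_def same_star_gen[OF s] same_star_def by simp
    then show "q x \<le> cnorm H x"
      using full_onD[OF _ A(2,4)] A(1) x n same_star_gen[OF s] by simp
  qed
  show "comult H \<in> star_hom H (max_tensor H H)"
    using hopf(1) by (simp add: max_tensor_cong[OF s s] same_star_hom(1)[OF s])
  show "counit H \<in> star_hom H complex_cstar" using hopf(2) by (simp add: same_star_hom(1)[OF s])
  show "antipode H \<in> star_hom H (opposite H)"
    using hopf(3) by (simp add: same_star_hom(1)[OF s] same_star_hom(2)[OF opposite_cong[OF s]])
qed (use hopf in \<open>simp_all add: max_tensor_cong[OF s s]\<close>)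

section \<open>Fullness of the tensor product\<close>

context qpa_pair
begin

text \<open>Given a C*-seminorm \<open>q\<close> on the algebra of entries, fullness of
  \<open>A\<close> and \<open>B\<close> provides morphisms from both into the completion for
  \<open>q\<close>, and they commute. The universal property merges them into a morphism on
  \<open>A \<otimes> B\<close> that extends \<open>Q.emb\<close>, and its contractivity says that
  \<open>q\<close> is below the norm.\<close>

lemma full_W:
  assumes nm: "0 < n" "0 < m"
  shows "full_on AB (n * m) W"
proof (rule full_onI[OF AB.pre_cstar_axioms magic_unitary_entries[OF magic_W]])
  let ?E = "entries (n * m) W"
  let ?P = "entry_alg AB (n * m) W"
  fix q x assume q: "cstar_seminorm ?P q" and x: "x \<in> star_gen AB ?E"
  note Ec = magic_unitary_entries[OF magic_W]
  have P: "star_algebra ?P" by (rule AB.star_algebra_star_gen[OF Ec])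
  interpret Q: seminormed ?P q
    by (intro seminormed.intro seminormed_axioms.intro P q)
  let ?D = "completion ?P q"
  have D: "complete_cstar ?D" by (rule Q.complete_cstar_completion)
  interpret D: complete_cstar ?D by (rule D)
  have legs: "i1 a \<in> star_gen AB ?E" if "a \<in> star_gen A (entries n u)" for a
    using star_gen_image[OF A.star_algebra_axioms i1_hom magic_unitary_entries[OF hA(2)] that]
      gens_in_star_gen[OF nm] by (rule_tac AB.star_gen_subset[of "(\<lambda>a. i1 a) ` entries n u"]) auto
  have legs': "i2 b \<in> star_gen AB ?E" if "b \<in> star_gen B (entries m v)" for b
    using star_gen_image[OF B.star_algebra_axioms i2_hom magic_unitary_entries[OF hB(2)] that]
      gens_in_star_gen[OF nm] by (rule_tac AB.star_gen_subset[of "(\<lambda>b. i2 b) ` entries m v"]) auto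
  have incA: "(\<lambda>a. i1 a) \<in> star_hom (entry_alg A n u) ?P"
    using legs A.star_gen_closed[OF magic_unitary_entries[OF hA(2)]]
    by (intro star_homI) (simp_all add: star_homD[OF i1_hom])
  have incB: "(\<lambda>b. i2 b) \<in> star_hom (entry_alg B m v) ?P"
    using legs' B.star_gen_closed[OF magic_unitary_entries[OF hB(2)]]
    by (intro star_homI) (simp_all add: star_homD[OF i2_hom])
  have PA: "star_algebra (entry_alg A n u)" "star_algebra (entry_alg B m v)"
    by (rule A.star_algebra_star_gen[OF magic_unitary_entries[OF hA(2)]] B.star_algebra_star_gen[OF magic_unitary_entries[OF hB(2)]])+
  \<comment> \<open>Pulled back along the leg, \<open>q\<close> is a C*-seminorm on the entry
    algebra of \<open>A\<close>, hence below the norm of \<open>A\<close> by fullness. This is the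
    contractivity needed to extend to all of \<open>A\<close>.\<close>
  have "\<exists>f \<in> star_hom A ?D. \<forall>a \<in> carrier (entry_alg A n u). f a = Q.emb (i1 a)"
  proof (rule extend_contraction[OF A.pre_cstar_axioms D PA(1) _ star_hom_comp[OF incA Q.emb_star_hom]])
    show "(\<lambda>a. a) \<in> star_hom (entry_alg A n u) A"
      by (rule star_hom_sub[OF star_hom_id]) (use A.star_gen_closed[OF magic_unitary_entries[OF hA(2)]] in blast)
    show "\<exists>y\<in>carrier (entry_alg A n u). cnorm A (a \<ominus>\<^bsub>A\<^esub> y) < e" if "a \<in> carrier A" "0 < e" for a and e :: real
      using hA(3) that by (simp add: generates_cstar_def)
    show "cnorm ?D (Q.emb (i1 a)) \<le> cnorm A a" if "a \<in> carrier (entry_alg A n u)" for a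
      using full_onD[OF A.pre_cstar_axioms hA(2,4) cstar_seminorm_pullback[OF PA(1) incA Q.seminormed_axioms]] that legs
      by (simp add: Q.cnorm_emb)
  qed
  then obtain f where f: "f \<in> star_hom A ?D" "\<And>a. a \<in> star_gen A (entries n u) \<Longrightarrow> f a = Q.emb (i1 a)" by auto
  have "\<exists>g \<in> star_hom B ?D. \<forall>b \<in> carrier (entry_alg B m v). g b = Q.emb (i2 b)"
  proof (rule extend_contraction[OF B.pre_cstar_axioms D PA(2) _ star_hom_comp[OF incB Q.emb_star_hom]])
    show "(\<lambda>b. b) \<in> star_hom (entry_alg B m v) B"
      by (rule star_hom_sub[OF star_hom_id]) (use B.star_gen_closed[OF magic_unitary_entries[OF hB(2)]] in blast)
    show "\<exists>y\<in>carrier (entry_alg B m v). cnorm B (b \<ominus>\<^bsub>B\<^esub> y) < e" if "b \<in> carrier B" "0 < e" for b and e :: real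
      using hB(3) that by (simp add: generates_cstar_def)
    show "cnorm ?D (Q.emb (i2 b)) \<le> cnorm B b" if "b \<in> carrier (entry_alg B m v)" for b
      using full_onD[OF B.pre_cstar_axioms hB(2,4) cstar_seminorm_pullback[OF PA(2) incB Q.seminormed_axioms]] that legs'
      by (simp add: Q.cnorm_emb)
  qed
  then obtain g where g: "g \<in> star_hom B ?D" "\<And>b. b \<in> star_gen B (entries m v) \<Longrightarrow> g b = Q.emb (i2 b)" by auto
  have prods: "Q.emb (i1 a) \<otimes>\<^bsub>?D\<^esub> Q.emb (i2 b) = Q.emb (te a b)" "Q.emb (i2 b) \<otimes>\<^bsub>?D\<^esub> Q.emb (i1 a) = Q.emb (te a b)"
    if "a \<in> star_gen A (entries n u)" "b \<in> star_gen B (entries m v)" for a b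
    using star_homD(2)[OF Q.emb_star_hom, of "i1 a" "i2 b"] star_homD(2)[OF Q.emb_star_hom, of "i2 b" "i1 a"]
      legs[OF that(1)] legs'[OF that(2)] A.star_gen_closed[OF magic_unitary_entries[OF hA(2)] that(1)]
      B.star_gen_closed[OF magic_unitary_entries[OF hB(2)] that(2)] by (simp_all add: te_mult)
  have "f a \<otimes>\<^bsub>?D\<^esub> g b = g b \<otimes>\<^bsub>?D\<^esub> f a" if "a \<in> carrier A" "b \<in> carrier B" for a b
  proof (rule commuting_homs[OF A.complete_cstar_axioms B.complete_cstar_axioms D.pre_cstar_axioms f(1) g(1)
      magic_unitary_entries[OF hA(2)] hA(3) magic_unitary_entries[OF hB(2)] hB(3) _ _ that])
    show "star B b \<in> entries m v" if "b \<in> entries m v" for b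
      using that magic_unitaryD(2)[OF hB(2)] by (auto elim!: entriesE simp: entries_def)
    show "f a \<otimes>\<^bsub>?D\<^esub> g b = g b \<otimes>\<^bsub>?D\<^esub> f a" if "a \<in> entries n u" "b \<in> entries m v" for a b
      using that f(2) g(2) prods by (simp add: star_gen.gen)
  qed
  then have "commuting ?D f g" using f g by (simp add: commuting_def)
  from tensor_universal[OF D this] obtain h where h: "h \<in> star_hom AB ?D"
    "\<forall>a \<in> carrier A. \<forall>b \<in> carrier B. h (te a b) = f a \<otimes>\<^bsub>?D\<^esub> g b" ..
  have sub: "star_gen AB ?E \<subseteq> carrier AB" using AB.star_gen_closed[OF Ec] by blast
  have "h x = Q.emb x"
  proof (rule star_gen_eq[OF P star_hom_sub[OF h(1) sub] Q.emb_star_hom, of ?E])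
    show "?E \<subseteq> carrier ?P" by (auto intro: star_gen.gen)
    show "x \<in> star_gen ?P ?E" using x by (simp add: star_gen_sub)
    fix y assume "y \<in> ?E"
    then obtain r s where rs: "r < n * m" "s < n * m" "y = W r s" by (rule entriesE)
    have a: "u (r div m) (s div m) \<in> star_gen A (entries n u)" and b: "v (r mod m) (s mod m) \<in> star_gen B (entries m v)"
      using index[OF rs(1)] index[OF rs(2)] unfolding entries_def by (intro star_gen.gen; blast)+
    show "h y = Q.emb y"
      using h(2) index[OF rs(1)] index[OF rs(2)] by (simp add: rs(3) W_def f(2)[OF a] g(2)[OF b] prods[OF a b])
  qed
  then have "q x = cnorm ?D (h x)" using x by (simp add: Q.cnorm_emb)
  also have "\<dots> \<le> cnorm AB x" using star_hom_contractive[OF AB.complete_cstar_axioms D.pre_cstar_axioms h(1)] sub x by blast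
  finally show "q x \<le> cnorm AB x" .
qed

lemma qpa_on_hopf_tensor:
  assumes nm: "0 < n" "0 < m"
  shows "qpa_on (n * m) H W"
proof (rule qpa_on_cong[OF same_star_hopf_tensor _ AB.complete_cstar_axioms magic_W generates_W[OF nm] full_W[OF nm]
    comult_H_hom counit_H(1) antipode_H(1) comult_W])
  fix p q assume pq: "p < n * m" "q < n * m"
  note i = index[OF pq(1)] index[OF pq(2)]
  show "counit H (W p q) = (if p = q then 1 else 0)"
    using i div_mod_neq[of p q] unfolding W_def by (subst counit_H(2)) (auto simp: hA(9) hB(9))
  show "antipode H (W p q) = W q p"
    using i unfolding W_def by (subst antipode_H(2)) (auto simp: hA(10) hB(10))
qed simp_all

end

section \<open>Transport to sets of natural numbers\<close>

text \<open>Codes for *-polynomials in the entries with Gaussian rational coefficients. Their type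
  is countable and their values are dense.\<close>

datatype expr = Gen nat nat | One | Add expr expr | Mul expr expr | Smu rat rat expr | Sta expr

instance expr :: countable
  by countable_datatype

text \<open>Indices out of range get the value \<open>\<one>\<close>, so that every code denotes an
  element of the carrier.\<close>

primrec expr_val :: "('a, 'm) star_alg_scheme \<Rightarrow> nat \<Rightarrow> (nat \<Rightarrow> nat \<Rightarrow> 'a) \<Rightarrow> expr \<Rightarrow> 'a" where
  "expr_val A n u (Gen i j) = (if i < n \<and> j < n then u i j else \<one>\<^bsub>A\<^esub>)"
| "expr_val A n u One = \<one>\<^bsub>A\<^esub>"
| "expr_val A n u (Add e f) = expr_val A n u e \<oplus>\<^bsub>A\<^esub> expr_val A n u f"
| "expr_val A n u (Mul e f) = expr_val A n u e \<otimes>\<^bsub>A\<^esub> expr_val A n u f"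
| "expr_val A n u (Smu r s e) = Complex (of_rat r) (of_rat s) \<odot>\<^bsub>A\<^esub> expr_val A n u e"
| "expr_val A n u (Sta e) = star A (expr_val A n u e)"

lemma complex_rat_approx: "\<exists>R S. (\<lambda>k. Complex (of_rat (R k)) (of_rat (S k))) \<longlonglongrightarrow> c"
proof -
  have "\<exists>R. (\<lambda>k. real_of_rat (R k)) \<longlonglongrightarrow> x" for x :: real
  proof -
    have "\<exists>r. x < real_of_rat r \<and> real_of_rat r < x + 1 / Suc k" for k
      by (rule of_rat_dense) simp
    then obtain R where R: "\<And>k. x < real_of_rat (R k)" "\<And>k. real_of_rat (R k) < x + 1 / Suc k" by metis
    have "(\<lambda>k. real_of_rat (R k)) \<longlonglongrightarrow> x"
    proof (rule tendsto_sandwich[of "\<lambda>_. x" _ _ "\<lambda>k. x + 1 / Suc k"])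
      show "(\<lambda>k. x + 1 / Suc k) \<longlonglongrightarrow> x"
        using tendsto_add[OF tendsto_const[of x] lim_1_over_n[THEN LIMSEQ_Suc]] by simp
    qed (use R less_imp_le in \<open>auto intro!: always_eventually\<close>)
    then show ?thesis by blast
  qed
  then obtain R S where "(\<lambda>k. real_of_rat (R k)) \<longlonglongrightarrow> Re c" "(\<lambda>k. real_of_rat (S k)) \<longlonglongrightarrow> Im c" by meson
  from tendsto_Complex[OF this] show ?thesis by auto
qed

lemma (in pre_cstar) expr_dense:
  assumes E: "entries n u \<subseteq> carrier A" and gen: "generates_cstar A (entries n u)"
    and x: "x \<in> carrier A" and e: "0 < e"
  shows "\<exists>t. cnorm A (x \<ominus> expr_val A n u t) < e"
proof -
  have c [simp]: "expr_val A n u t \<in> carrier A" for t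
    using E by (induction t) (auto simp: entries_def)
  have lim: "\<exists>Y. conv (\<lambda>k. expr_val A n u (Y k)) y" if "y \<in> star_gen A (entries n u)" for y
    using that
  proof induction
    case (gen y)
    then obtain i j where "i < n" "j < n" "y = u i j" by (rule entriesE)
    with E gen show ?case by (intro exI[of _ "\<lambda>_. Gen i j"]) (auto intro: conv_const)
  next
    case one
    then show ?case by (intro exI[of _ "\<lambda>_. One"]) (simp add: conv_const)
  next
    case (add y z)
    then obtain Y Z where "conv (\<lambda>k. expr_val A n u (Y k)) y" "conv (\<lambda>k. expr_val A n u (Z k)) z" by blast
    then show ?case by (intro exI[of _ "\<lambda>k. Add (Y k) (Z k)"]) (simp add: conv_add)
  next
    case (mult y z)
    then obtain Y Z where "conv (\<lambda>k. expr_val A n u (Y k)) y" "conv (\<lambda>k. expr_val A n u (Z k)) z" by blast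
    then show ?case by (intro exI[of _ "\<lambda>k. Mul (Y k) (Z k)"]) (simp add: conv_mult)
  next
    case (star y)
    then obtain Y where "conv (\<lambda>k. expr_val A n u (Y k)) y" by blast
    then show ?case by (intro exI[of _ "\<lambda>k. Sta (Y k)"]) (simp add: conv_star)
  next
    case (smult y z)
    then obtain Y where Y: "conv (\<lambda>k. expr_val A n u (Y k)) y" by blast
    obtain R S where RS: "(\<lambda>k. Complex (of_rat (R k)) (of_rat (S k))) \<longlonglongrightarrow> z" using complex_rat_approx by blast
    define d where "d k = Complex (of_rat (R k)) (of_rat (S k))" for k
    \<comment> \<open>Scalars are approximated as multiples of \<open>\<one>\<close>, so that
      \<open>conv_mult\<close> handles the scalar and the vector at the same time.\<close>
    have dd: "d k \<odot> \<one> \<ominus> z \<odot> \<one> = (d k - z) \<odot> \<one>" for k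
      using smult_add_left[of \<one> "d k" "- z"] by (simp add: minus_eq_smult smult_smult)
    have "(\<lambda>k. cmod (d k - z)) \<longlonglongrightarrow> 0" using RS unfolding d_def by (rule tendsto_norm_zero[OF LIM_zero])
    from tendsto_mult_right[OF this, of "cnorm A \<one>"] have "conv (\<lambda>k. d k \<odot> \<one>) (z \<odot> \<one>)"
      by (simp add: conv_def dd p_smult)
    from conv_mult[OF this Y] have "conv (\<lambda>k. d k \<odot> expr_val A n u (Y k)) (z \<odot> y)"
      using conv_carrier[OF Y] by (simp add: smult_mult_left)
    then show ?case by (intro exI[of _ "\<lambda>k. Smu (R k) (S k) (Y k)"]) (simp add: d_def)
  qed
  have e2: "0 < e / 2" using e by simp
  obtain y where y: "y \<in> star_gen A (entries n u)" "cnorm A (x \<ominus> y) < e / 2"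
    using gen x e2 unfolding generates_cstar_def by blast
  obtain Y where Y: "conv (\<lambda>k. expr_val A n u (Y k)) y" using lim[OF y(1)] by blast
  then obtain k where "cnorm A (expr_val A n u (Y k) \<ominus> y) < e / 2"
    using LIMSEQ_D[of "\<lambda>k. cnorm A (expr_val A n u (Y k) \<ominus> y)" 0 "e / 2"] e2 by (auto simp: conv_def)
  then have "cnorm A (x \<ominus> expr_val A n u (Y k)) < e"
    using p_triangle[of x y "expr_val A n u (Y k)"] y(2) x conv_carrier(2)[OF Y]
    by (simp add: p_minus_commute[of y])
  then show ?thesis by blast
qed

text \<open>A point is determined by the balls of radius \<open>1 / Suc k\<close> around a countable
  dense set that contain it; \<open>prod_encode\<close> turns this set of balls into a set of
  numbers.\<close>

lemma (in pre_cstar) inj_into_nat_set: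
  assumes E: "entries n u \<subseteq> carrier A" and gen: "generates_cstar A (entries n u)"
  shows "\<exists>J :: 'a \<Rightarrow> nat set. inj_on J (carrier A)"
proof (intro exI inj_onI)
  let ?v = "expr_val A n u"
  define J where "J x = {prod_encode (to_nat t, k) | t k. cnorm A (x \<ominus> ?v t) < 1 / Suc k}" for x
  fix x y assume x: "x \<in> carrier A" and y: "y \<in> carrier A" and eq: "J x = J y"
  have c [simp]: "?v t \<in> carrier A" for t
    using E by (induction t) (auto simp: entries_def)
  have "cnorm A (x \<ominus> y) \<le> 0 + e" if e: "0 < e" for e
  proof -
    have "0 < e / 2" using e by simp
    then obtain k where k: "1 / Suc k < e / 2" using nat_approx_posE by blast
    obtain t where t: "cnorm A (x \<ominus> ?v t) < 1 / Suc k"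
      using expr_dense[OF E gen x, of "1 / Suc k"] by auto
    then have "prod_encode (to_nat t, k) \<in> J x" unfolding J_def by blast
    then have "prod_encode (to_nat t, k) \<in> J y" unfolding eq .
    then obtain t' k' where "prod_encode (to_nat t, k) = prod_encode (to_nat t', k')" "cnorm A (y \<ominus> ?v t') < 1 / Suc k'"
      unfolding J_def by blast
    then have "cnorm A (y \<ominus> ?v t) < 1 / Suc k" by (simp add: prod_encode_eq)
    with t k show ?thesis
      using p_triangle[of x "?v t" y] x y by (simp add: p_minus_commute[of "?v t" y])
  qed
  then have "cnorm A (x \<ominus> y) \<le> 0" by (rule field_le_epsilon)
  then show "x = y" using x y by (intro eq_if_norm antisym) simp_all
qed

text \<open>The structure of \<open>X\<close> is copied along the bijection \<open>J\<close> with
  inverse \<open>K\<close>. The copy is a \<open>cstar_algebra\<close> in the full sense and not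
  just complete, since its values outside of the carrier can be chosen.\<close>

theorem transport:
  fixes X :: "('a, 'm) hopf_cstar_scheme"
  assumes X: "qpa_on n X w"
  shows "\<exists>(T :: nat set hopf_cstar) J K. quantum_permutation_algebra n T (\<lambda>i j. J (w i j)) \<and> complete_cstar T \<and>
    J \<in> star_hom X T \<and> K \<in> star_hom T X \<and> (\<forall>x \<in> carrier X. K (J x) = x) \<and> J ` carrier X = carrier T"
proof -
  note X = qpa_onD[OF X]
  interpret X: complete_cstar X by (rule X)
  note E = magic_unitary_entries[OF X(2)]
  obtain J :: "'a \<Rightarrow> nat set" where J: "inj_on J (carrier X)"
    using X.inj_into_nat_set[OF E X(3)] by blast
  \<comment> \<open>Off the image the value is zero, so \<open>K\<close> always lands in the carrier
    of \<open>X\<close> and every distance in the copy, even between junk elements, is a distance in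
    \<open>X\<close>.\<close>
  define K where "K y = (if y \<in> J ` carrier X then inv_into (carrier X) J y else \<zero>\<^bsub>X\<^esub>)" for y
  have KJ [simp]: "K (J x) = x" if "x \<in> carrier X" for x
    using that J by (simp add: K_def inv_into_f_f)
  have Kc [simp]: "K y \<in> carrier X" for y
    by (auto simp: K_def inv_into_into)
  have JK: "J (K y) = y" if "y \<in> J ` carrier X" for y using that by auto
  define T0 :: "nat set cstar" where
    "T0 = \<lparr>carrier = J ` carrier X, mult = \<lambda>x y. J (K x \<otimes>\<^bsub>X\<^esub> K y), one = J \<one>\<^bsub>X\<^esub>, zero = J \<zero>\<^bsub>X\<^esub>,
      add = \<lambda>x y. J (K x \<oplus>\<^bsub>X\<^esub> K y), smult = \<lambda>c x. J (c \<odot>\<^bsub>X\<^esub> K x), star = \<lambda>x. J (star X (K x)),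
      cnorm = \<lambda>x. cnorm X (K x)\<rparr>"
  have f [simp]: "carrier T0 = J ` carrier X" "x \<otimes>\<^bsub>T0\<^esub> y = J (K x \<otimes>\<^bsub>X\<^esub> K y)" "\<one>\<^bsub>T0\<^esub> = J \<one>\<^bsub>X\<^esub>" "\<zero>\<^bsub>T0\<^esub> = J \<zero>\<^bsub>X\<^esub>"
      "x \<oplus>\<^bsub>T0\<^esub> y = J (K x \<oplus>\<^bsub>X\<^esub> K y)" "c \<odot>\<^bsub>T0\<^esub> x = J (c \<odot>\<^bsub>X\<^esub> K x)" "star T0 x = J (star X (K x))"
      "cnorm T0 x = cnorm X (K x)" for x y c
    by (simp_all add: T0_def)
  have sT0: "star_algebra T0"
    by (rule star_algebra_if_inj[where k=K and A=X]) (auto simp: inj_on_def X.star_algebra_axioms)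
  have K0: "K \<in> star_hom T0 X" by (rule star_homI) auto
  have J0: "J \<in> star_hom X T0" by (rule star_homI) auto
  have T0: "complete_cstar T0"
    by (rule complete_cstar_if_iso[OF X(1) sT0 K0]) (auto simp: inj_on_def image_image)
  define T :: "nat set hopf_cstar" where
    "T = cstar.extend T0 (hopf_cstar.fields (\<lambda>y. tensor_map X X T0 T0 J J (comult X (K y)))
      (\<lambda>y. counit X (K y)) (\<lambda>y. J (antipode X (K y))))"
  have TT0: "same_star T T0" "cnorm T = cnorm T0"
    by (simp_all add: T_def same_star_def cstar.defs hopf_cstar.defs)
  have hT: "comult T y = tensor_map X X T0 T0 J J (comult X (K y))" "counit T y = counit X (K y)"
    "antipode T y = J (antipode X (K y))" for y
    by (simp_all add: T_def cstar.defs hopf_cstar.defs)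
  let ?u = "\<lambda>i j. J (w i j)"
  interpret T0: complete_cstar T0 by (rule T0)
  interpret XX: cstar_pair X X ..
  interpret TT: cstar_pair T0 T0 ..
  note wc = magic_unitaryD(1)[OF X(2)]
  note tm = tensor_map_hom[OF X(1) X(1) T0 T0 J0 J0]
  have magic: "magic_unitary T0 n ?u"
    by (rule magic_unitary_image[OF X.star_algebra_axioms T0.star_algebra_axioms J0 X(2)])
  have Eu: "entries n ?u = J ` entries n w" by (simp add: entries_image)
  have gen: "generates_cstar T0 (entries n ?u)"
    unfolding generates_cstar_def
  proof (intro ballI allI impI)
    fix y and e :: real assume "y \<in> carrier T0" and e: "0 < e"
    then obtain x where x: "y = J x" "x \<in> carrier X" by auto
    then obtain z where z: "z \<in> star_gen X (entries n w)" "cnorm X (x \<ominus>\<^bsub>X\<^esub> z) < e"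
      using X(3) e by (auto simp: generates_cstar_def)
    have zc: "z \<in> carrier X" using X.star_gen_closed[OF E z(1)] .
    have "J z \<in> star_gen T0 (entries n ?u)"
      unfolding Eu by (rule star_gen_image[OF X.star_algebra_axioms J0 E z(1)])
    moreover have "y \<ominus>\<^bsub>T0\<^esub> J z = J (x \<ominus>\<^bsub>X\<^esub> z)"
      using star_hom_minus[OF X.star_algebra_axioms T0.star_algebra_axioms J0 x(2) zc] x(1) by simp
    then have "cnorm T0 (y \<ominus>\<^bsub>T0\<^esub> J z) < e" using z(2) zc x(2) by simp
    ultimately show "\<exists>z \<in> star_gen T0 (entries n ?u). cnorm T0 (y \<ominus>\<^bsub>T0\<^esub> z) < e" by blast
  qed
  have full: "full_on T0 n ?u"
  proof (rule full_onI[OF T0.pre_cstar_axioms magic_unitary_entries[OF magic]])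
    fix q y assume q: "cstar_seminorm (entry_alg T0 n ?u) q" and y: "y \<in> star_gen T0 (entries n ?u)"
    obtain x where x: "x \<in> star_gen X (entries n w)" "y = J x"
      using star_gen_image_converse[OF X.star_algebra_axioms J0 E] y unfolding Eu by blast
    have inc: "J \<in> star_hom (entry_alg X n w) (entry_alg T0 n ?u)"
      using X.star_gen_closed[OF E] star_gen_image[OF X.star_algebra_axioms J0 E]
      by (intro star_homI) (simp_all add: Eu)
    have "seminormed (entry_alg T0 n ?u) q"
      by (intro seminormed.intro seminormed_axioms.intro q T0.star_algebra_star_gen magic_unitary_entries[OF magic])
    from cstar_seminorm_pullback[OF X.star_algebra_star_gen[OF E] inc this]
    have "q (J x) \<le> cnorm X x" by (rule full_onD[OF X.pre_cstar_axioms X(2,4) _ x(1)])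
    then show "q y \<le> cnorm T0 y" using x X.star_gen_closed[OF E x(1)] by simp
  qed
  have qT: "qpa_on n T ?u"
  proof (rule qpa_on_cong[OF TT0 T0 magic gen full])
    show "comult T \<in> star_hom T0 (max_tensor T0 T0)"
      unfolding hT[abs_def] by (rule star_hom_comp[OF star_hom_comp[OF K0 X(5)] tm(1)])
    show "counit T \<in> star_hom T0 complex_cstar" unfolding hT[abs_def] by (rule star_hom_comp[OF K0 X(6)])
    show "antipode T \<in> star_hom T0 (opposite T0)"
      unfolding hT[abs_def] by (rule star_hom_comp[OF star_hom_comp[OF K0 X(7)] star_hom_opposite[OF J0]])
    fix i j assume ij: "i < n" "j < n"
    show "counit T (?u i j) = (if i = j then 1 else 0)" "antipode T (?u i j) = ?u j i"
      using ij wc by (simp_all add: hT X)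
    have "comult T (?u i j) = tensor_map X X T0 T0 J J (\<Oplus>\<^bsub>max_tensor X X\<^esub>k \<in> {..<n}. tensor_elem X X (w i k) (w k j))"
      using ij wc by (simp add: hT X)
    also have "\<dots> = (\<Oplus>\<^bsub>max_tensor T0 T0\<^esub>k \<in> {..<n}. tensor_map X X T0 T0 J J (tensor_elem X X (w i k) (w k j)))"
      by (rule star_hom_finsum[OF XX.AB.star_algebra_axioms TT.AB.star_algebra_axioms tm(1)]) (use ij wc in auto)
    also have "\<dots> = (\<Oplus>\<^bsub>max_tensor T0 T0\<^esub>k \<in> {..<n}. tensor_elem T0 T0 (?u i k) (?u k j))"
      by (rule abelian_monoid.finsum_cong'[OF TT.AB.abelian_monoid_A]) (use ij wc tm(2) in auto)
    finally show "comult T (?u i j) = (\<Oplus>\<^bsub>max_tensor T0 T0\<^esub>k \<in> {..<n}. tensor_elem T0 T0 (?u i k) (?u k j))" .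
  qed
  have "cstar_algebra T"
  proof (rule cstar_algebraI[OF qpa_onD(1)[OF qT]])
    \<comment> \<open>The operations of \<open>T0\<close> see \<open>y\<close> only through
      \<open>K y\<close>, so the description defining the additive inverse can be evaluated for
      every \<open>y\<close>, inside the carrier or not.\<close>
    have neg: "\<ominus>\<^bsub>T0\<^esub> y = J (\<ominus>\<^bsub>X\<^esub> K y)" for y
    proof -
      have "(THE z. z \<in> J ` carrier X \<and> J (K y \<oplus>\<^bsub>X\<^esub> K z) = J \<zero>\<^bsub>X\<^esub> \<and> J (K z \<oplus>\<^bsub>X\<^esub> K y) = J \<zero>\<^bsub>X\<^esub>) = J (\<ominus>\<^bsub>X\<^esub> K y)"
      proof (rule the_equality)
        fix z assume z: "z \<in> J ` carrier X \<and> J (K y \<oplus>\<^bsub>X\<^esub> K z) = J \<zero>\<^bsub>X\<^esub> \<and> J (K z \<oplus>\<^bsub>X\<^esub> K y) = J \<zero>\<^bsub>X\<^esub>"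
        then have "K z \<oplus>\<^bsub>X\<^esub> K y = \<zero>\<^bsub>X\<^esub>" using inj_onD[OF J] by simp
        then have "\<ominus>\<^bsub>X\<^esub> K y = K z" by (rule X.minus_equality) simp_all
        then show "z = J (\<ominus>\<^bsub>X\<^esub> K y)" using z JK by simp
      qed (simp add: X.r_neg X.l_neg)
      then show ?thesis by (simp add: a_inv_def m_inv_def)
    qed
    have dist: "cnorm T (x \<ominus>\<^bsub>T\<^esub> y) = cnorm X (K x \<ominus>\<^bsub>X\<^esub> K y)" for x y
      by (simp add: TT0 same_star_minus[OF TT0(1)] a_minus_def neg)
    show "0 \<le> cnorm T (x \<ominus>\<^bsub>T\<^esub> y)" for x y by (simp add: dist)
    show "cnorm T (x \<ominus>\<^bsub>T\<^esub> y) = cnorm T (y \<ominus>\<^bsub>T\<^esub> x)" for x y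
      unfolding dist by (rule X.p_minus_commute) simp_all
  qed
  then have "quantum_permutation_algebra n T ?u"
    using qT by (simp add: quantum_permutation_algebra_def qpa_on_def)
  moreover have "J \<in> star_hom X T" "K \<in> star_hom T X"
    using J0 K0 same_star_hom TT0(1) by blast+
  moreover have "J ` carrier X = carrier T" using TT0(1) by (simp add: same_star_def)
  ultimately show ?thesis using qpa_onD(1)[OF qT] KJ by blast
qed

section \<open>The Hopf image of a tensor product\<close>

declare hopf_tensor_simps(9-11) [simp del]

lemma scalar_hom:
  assumes "star_algebra A" shows "(\<lambda>z. z \<odot>\<^bsub>A\<^esub> \<one>\<^bsub>A\<^esub>) \<in> star_hom complex_cstar A"
proof -
  interpret star_algebra A by fact
  show ?thesis
    by (rule star_homI) (simp_all add: smult_add_left smult_mult_left smult_smult star_smult l_one)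
qed

context qpa_pair
begin

text \<open>
  If \<open>n = 0\<close> or \<open>m = 0\<close> then the algebra of the tensor product is \<open>\<complex>\<close>, although \<open>A \<otimes> B\<close> need not be
  generated by the empty matrix.
\<close>

lemma hopf_quotient_trivial:
  assumes "qpa_on 0 C w"
  shows "hopf_quotient H C"
proof -
  note C = qpa_onD[OF assms]
  interpret C: complete_cstar C by (rule C)
  interpret CC: cstar_pair C C ..
  note s = same_star_hopf_tensor[of A B]
  note sc = scalar_hom[OF C.star_algebra_axioms]
  \<comment> \<open>As \<open>C\<close> will turn out to consist of scalars, the counit of the
    tensor product followed by the inclusion of the scalars is the natural candidate.\<close>
  define \<phi> where "\<phi> x = counit H x \<odot>\<^bsub>C\<^esub> \<one>\<^bsub>C\<^esub>" for x
  have \<phi>: "\<phi> \<in> star_hom AB C"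
    unfolding \<phi>_def[abs_def] by (rule star_hom_comp[OF counit_H(1) sc])
  note tm = tensor_map_hom[OF AB.complete_cstar_axioms AB.complete_cstar_axioms C(1) C(1) \<phi> \<phi>]
  \<comment> \<open>No entries are available, so the empty set generates \<open>C\<close> and any
    two morphisms on \<open>C\<close> agree.\<close>
  have scalars: "c = counit C c \<odot>\<^bsub>C\<^esub> \<one>\<^bsub>C\<^esub>" if "c \<in> carrier C" for c
    by (rule star_hom_eqI[OF C(1) C.pre_cstar_axioms star_hom_id star_hom_comp[OF C(6) sc] _ C(3) _ that])
      (auto simp: entries_def)
  have counit_gens: "counit H (i1 (u i j)) = (if i = j then 1 else 0)" if "i < n" "j < n" for i j
    using that star_homD(4)[OF hB(6)] by (simp add: counit_H hA(9))
  have counit_gens': "counit H (i2 (v i j)) = (if i = j then 1 else 0)" if "i < m" "j < m" for i j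
    using that star_homD(4)[OF hA(6)] by (simp add: counit_H hB(9))
  have \<phi>1: "\<phi> (i1 (u i j)) = (if i = j then \<one>\<^bsub>C\<^esub> else \<zero>\<^bsub>C\<^esub>)" if "i < n" "j < n" for i j
    using that by (simp add: \<phi>_def counit_gens)
  have \<phi>2: "\<phi> (i2 (v i j)) = (if i = j then \<one>\<^bsub>C\<^esub> else \<zero>\<^bsub>C\<^esub>)" if "i < m" "j < m" for i j
    using that by (simp add: \<phi>_def counit_gens')
  \<comment> \<open>\<open>\<phi>\<close> sends the matrix \<open>x\<close> to the identity matrix,
    so at most one summand of the comultiplication formula survives.\<close>
  have delta_sum: "(\<Oplus>\<^bsub>CC.AB\<^esub>k \<in> {..<N}. tensor_map AB AB C C \<phi> \<phi> (tensor_elem AB AB (x i k) (x k j))) =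
      (if i = j then \<one>\<^bsub>CC.AB\<^esub> else \<zero>\<^bsub>CC.AB\<^esub>)"
    if ij: "i < N" "j < N" and x: "\<And>k l. k < N \<Longrightarrow> l < N \<Longrightarrow> x k l \<in> carrier AB"
      and \<phi>x: "\<And>k l. k < N \<Longrightarrow> l < N \<Longrightarrow> \<phi> (x k l) = (if k = l then \<one>\<^bsub>C\<^esub> else \<zero>\<^bsub>C\<^esub>)"
    for N i j :: nat and x
  proof -
    have "(\<Oplus>\<^bsub>CC.AB\<^esub>k \<in> {..<N}. tensor_map AB AB C C \<phi> \<phi> (tensor_elem AB AB (x i k) (x k j))) =
        (\<Oplus>\<^bsub>CC.AB\<^esub>k \<in> {..<N}. if i = k then CC.te \<one>\<^bsub>C\<^esub> (if k = j then \<one>\<^bsub>C\<^esub> else \<zero>\<^bsub>C\<^esub>) else \<zero>\<^bsub>CC.AB\<^esub>)"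
      by (rule abelian_monoid.finsum_cong'[OF CC.AB.abelian_monoid_A])
        (use ij x \<phi>x tm(2) CC.te_bilinear(3)[of "\<zero>\<^bsub>C\<^esub>" _ 0] in auto)
    also have "\<dots> = CC.te \<one>\<^bsub>C\<^esub> (if i = j then \<one>\<^bsub>C\<^esub> else \<zero>\<^bsub>C\<^esub>)"
      by (rule abelian_monoid.finsum_singleton[OF CC.AB.abelian_monoid_A]) (use ij in auto)
    also have "\<dots> = (if i = j then \<one>\<^bsub>CC.AB\<^esub> else \<zero>\<^bsub>CC.AB\<^esub>)"
      using CC.te_one CC.te_bilinear(4)[of "\<one>\<^bsub>C\<^esub>" "\<zero>\<^bsub>C\<^esub>" 0] by simp
    finally show ?thesis .
  qed
  note zeroC = star_hom_zero[OF C.star_algebra_axioms CC.AB.star_algebra_axioms C(5)]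
  have anti0: "antipode C \<zero>\<^bsub>C\<^esub> = \<zero>\<^bsub>C\<^esub>" "antipode C \<one>\<^bsub>C\<^esub> = \<one>\<^bsub>C\<^esub>"
    using star_hom_zero[OF C.star_algebra_axioms star_algebra_opposite[OF C.star_algebra_axioms] C(7)] star_homD(4)[OF C(7)]
    by simp_all
  show ?thesis
    unfolding hopf_quotient_def
  proof (intro bexI[of _ \<phi>] conjI ballI)
    show "\<phi> \<in> star_hom H C" using \<phi> same_star_hom(1)[OF s] by blast
    show "\<phi> ` carrier H = carrier C"
    proof (intro equalityI subsetI)
      fix c assume c: "c \<in> carrier C"
      have "\<phi> (counit C c \<odot>\<^bsub>AB\<^esub> \<one>\<^bsub>AB\<^esub>) = c"
        using scalars[OF c] star_homD(4,6)[OF counit_H(1)] by (simp add: \<phi>_def)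
      then show "c \<in> \<phi> ` carrier H" by (metis AB.one_closed AB.smult_closed' hopf_tensor_simps(1) imageI)
    qed (use star_homD(1)[OF \<phi>] in auto)
    fix x assume "x \<in> carrier H"
    then have x: "x \<in> carrier AB" by simp
    show "counit C (\<phi> x) = counit H x"
      using star_homD(4,6)[OF C(6)] by (simp add: \<phi>_def)
    have "comult C (\<phi> x) = tensor_map AB AB C C \<phi> \<phi> (comult H x)"
    proof (rule star_hom_eqI[OF AB.complete_cstar_axioms CC.AB.pre_cstar_axioms star_hom_comp[OF \<phi> C(5)]
          star_hom_comp[OF comult_H_hom tm(1)] gens_closed generates_gens _ x])
      fix y assume "y \<in> gens"
      then consider i j where "y = i1 (u i j)" "i < n" "j < n" | i j where "y = i2 (v i j)" "i < m" "j < m"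
        by (auto elim!: entriesE)
      then show "comult C (\<phi> y) = tensor_map AB AB C C \<phi> \<phi> (comult H y)"
      proof cases
        case (1 i j)
        have "comult H y = F (comult A (u i j))"
          using 1 star_homD(1)[OF F_hom star_homD(1)[OF hA(5)], of "u i j"] star_homD(4)[OF G_hom] star_homD(4)[OF hB(5)]
          by (simp add: comult_H)
        also have "tensor_map AB AB C C \<phi> \<phi> \<dots> =
            (\<Oplus>\<^bsub>CC.AB\<^esub>k \<in> {..<n}. tensor_map AB AB C C \<phi> \<phi> (tensor_elem AB AB (i1 (u i k)) (i1 (u k j))))"
          unfolding F_comult[OF 1(2,3)]
          by (rule star_hom_finsum[OF ABAB.AB.star_algebra_axioms CC.AB.star_algebra_axioms tm(1)]) (use 1 in simp)
        also have "\<dots> = (if i = j then \<one>\<^bsub>CC.AB\<^esub> else \<zero>\<^bsub>CC.AB\<^esub>)"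
          by (rule delta_sum) (use 1 \<phi>1 in simp_all)
        finally show ?thesis using 1 star_homD(4)[OF C(5)] zeroC by (simp add: \<phi>1)
      next
        case (2 i j)
        have "comult H y = G (comult B (v i j))"
          using 2 star_homD(1)[OF G_hom star_homD(1)[OF hB(5)], of "v i j"] star_homD(4)[OF F_hom] star_homD(4)[OF hA(5)]
          by (simp add: comult_H)
        also have "tensor_map AB AB C C \<phi> \<phi> \<dots> =
            (\<Oplus>\<^bsub>CC.AB\<^esub>k \<in> {..<m}. tensor_map AB AB C C \<phi> \<phi> (tensor_elem AB AB (i2 (v i k)) (i2 (v k j))))"
          unfolding G_comult[OF 2(2,3)]
          by (rule star_hom_finsum[OF ABAB.AB.star_algebra_axioms CC.AB.star_algebra_axioms tm(1)]) (use 2 in simp)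
        also have "\<dots> = (if i = j then \<one>\<^bsub>CC.AB\<^esub> else \<zero>\<^bsub>CC.AB\<^esub>)"
          by (rule delta_sum) (use 2 \<phi>2 in simp_all)
        finally show ?thesis using 2 star_homD(4)[OF C(5)] zeroC by (simp add: \<phi>2)
      qed
    qed
    then show "comult C (\<phi> x) = tensor_map H H C C \<phi> \<phi> (comult H x)"
      using tensor_map_cong[OF s s, of C C C C] by (simp add: same_star_def)
    show "antipode C (\<phi> x) = \<phi> (antipode H x)"
    proof (rule star_hom_eqI[OF AB.complete_cstar_axioms _ star_hom_comp[OF \<phi> C(7)]
          star_hom_comp[OF antipode_H(1) star_hom_opposite[OF \<phi>]] gens_closed generates_gens _ x])
      show "pre_cstar (opposite C)" by (simp add: complete_cstar_opposite C)
      fix y assume "y \<in> gens"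
      then consider i j where "y = i1 (u i j)" "i < n" "j < n" | i j where "y = i2 (v i j)" "i < m" "j < m"
        by (auto elim!: entriesE)
      then show "antipode C (\<phi> y) = \<phi> (antipode H y)"
      proof cases
        case (1 i j)
        then show ?thesis using star_homD(4)[OF hB(7)] by (auto simp: antipode_H hA(10) \<phi>1 anti0)
      next
        case (2 i j)
        then show ?thesis using star_homD(4)[OF hA(7)] by (auto simp: antipode_H hB(10) \<phi>2 anti0)
      qed
    qed
  qed
qed

end

theorem theorem3p5:
  fixes t :: "'h::chilbert_space \<Rightarrow> 'k::chilbert_space \<Rightarrow> 'l::chilbert_space"
    and U :: "nat \<Rightarrow> nat \<Rightarrow> 'h \<Rightarrow>\<^sub>L 'h" and V :: "nat \<Rightarrow> nat \<Rightarrow> 'k \<Rightarrow>\<^sub>L 'k"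
    and A :: "'a hopf_cstar" and u :: "nat \<Rightarrow> nat \<Rightarrow> 'a"
    and B :: "'b hopf_cstar" and v :: "nat \<Rightarrow> nat \<Rightarrow> 'b"
    and C :: "'c hopf_cstar" and w :: "nat \<Rightarrow> nat \<Rightarrow> 'c"
    and n m :: nat
  assumes "hilbert_tensor t"
    and "magic_unitary bounded_ops n U"
    and "magic_unitary bounded_ops m V"
    and "hopf_image_for n bounded_ops U A u"
    and "hopf_image_for m bounded_ops V B v"
    and "hopf_image_for (n * m) bounded_ops (magic_tensor t m U V) C w"
  shows "hopf_quotient (hopf_tensor A B) C"
proof -
  note A = hopf_image_forD[OF assms(4)] and B = hopf_image_forD[OF assms(5)] and C = hopf_image_forD[OF assms(6)]
  interpret qpa_pair A B n m u v
    by unfold_locales (rule qpa_onI[OF A(1,2)] qpa_onI[OF B(1,2)])+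
  have qC: "qpa_on (n * m) C w" by (rule qpa_onI[OF C(1,2)])
  show ?thesis
  proof (cases "n * m = 0")
    case True
    show ?thesis by (rule hopf_quotient_trivial[OF qC[unfolded True]])
  next
    case False
    then have nm: "0 < n" "0 < m" by simp_all
    note H = qpa_on_hopf_tensor[OF nm]
    let ?N = "n * m"
    note s = same_star_hopf_tensor[of A B]
    obtain T :: "nat set hopf_cstar" and J K
      where T: "quantum_permutation_algebra ?N T (\<lambda>p q. J (W p q))" "complete_cstar T"
      and J: "J \<in> star_hom H T" and K: "K \<in> star_hom T H"
      and KJ: "\<forall>x \<in> carrier H. K (J x) = x" and onto: "J ` carrier H = carrier T"
      using transport[OF H] by blast
    interpret T: complete_cstar T by (rule T(2))
    obtain r where r: "r \<in> star_hom A bounded_ops" "\<forall>i < n. \<forall>j < n. r (u i j) = U i j" using A(3) by blast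
    obtain r' where r': "r' \<in> star_hom B bounded_ops" "\<forall>i < m. \<forall>j < m. r' (v i j) = V i j" using B(3) by blast
    obtain h where h: "h \<in> star_hom AB bounded_ops"
      "\<forall>a \<in> carrier A. \<forall>b \<in> carrier B. h (te a b) = op_tensor t (r a) (r' b)"
      using tensor_representation[OF assms(1) A(2) B(2) r(1) r'(1)] by blast
    have h_W: "h (W p q) = magic_tensor t m U V p q" if "p < ?N" "q < ?N" for p q
      using index[OF that(1)] index[OF that(2)] h(2) r(2) r'(2) by (simp add: W_def magic_tensor_def)
    have hK: "(\<lambda>y. h (K y)) \<in> star_hom T bounded_ops"
      using star_hom_comp[OF _ h(1), of K T] K same_star_hom(2)[OF s] by blast
    have "magic_unitary T ?N (\<lambda>p q. J (W p q))" using T(1) by (simp add: quantum_permutation_algebra_def)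
    from A_s_universal[OF T(2) this] obtain \<sigma> where \<sigma>: "\<sigma> \<in> star_hom (A_s ?N) T"
      "\<forall>p < ?N. \<forall>q < ?N. \<sigma> (A_s_gen ?N p q) = J (W p q)" by blast
    obtain \<pi> where \<pi>: "\<pi> \<in> star_hom (A_s ?N) bounded_ops"
      "\<forall>p < ?N. \<forall>q < ?N. \<pi> (A_s_gen ?N p q) = magic_tensor t m U V p q"
      "hopf_image ?N bounded_ops \<pi> C w"
      using assms(6) by (auto simp: hopf_image_for_def)
    have WH: "W p q \<in> carrier H" if "p < ?N" "q < ?N" for p q
      using magic_unitaryD(1)[OF magic_W that] by simp
    \<comment> \<open>Two morphisms on the free algebra that agree on its generators.\<close>
    have "\<pi> x = h (K (\<sigma> x))" if "x \<in> carrier (A_s ?N)" for x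
    proof (rule star_hom_eqI[OF complete_cstar_A_s _ \<pi>(1) star_hom_comp[OF \<sigma>(1) hK] _ generates_A_s _ that])
      show "pre_cstar (bounded_ops :: ('l \<Rightarrow>\<^sub>L 'l) cstar)" by (simp add: complete_cstar_bounded_ops)
      show "entries ?N (A_s_gen ?N) \<subseteq> carrier (A_s ?N)" by (auto elim!: entriesE intro: A_s_gen_closed)
      fix y assume "y \<in> entries ?N (A_s_gen ?N)"
      then obtain p q where pq: "p < ?N" "q < ?N" and y: "y = A_s_gen ?N p q" by (rule entriesE)
      have "K (\<sigma> y) = W p q" unfolding y using \<sigma>(2) pq KJ WH[OF pq] by metis
      moreover have "\<pi> y = magic_tensor t m U V p q" unfolding y using \<pi>(2) pq by blast
      ultimately show "\<pi> y = h (K (\<sigma> y))" using h_W[OF pq] by (simp only:)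
    qed
    then have fac: "factorizes ?N bounded_ops \<pi> T (\<lambda>p q. J (W p q))"
      unfolding factorizes_def by (intro bexI[OF _ \<sigma>(1)] bexI[OF _ hK] conjI \<sigma>(2) ballI)
    \<comment> \<open>Minimality of \<open>C\<close> among the algebras through which
      \<open>\<pi>\<close> factors, tested against the copy \<open>T\<close>.\<close>
    have "\<exists>\<theta> \<in> star_hom T C. \<theta> ` carrier T = carrier C \<and> (\<forall>p < ?N. \<forall>q < ?N. \<theta> (J (W p q)) = w p q)"
      by (rule \<pi>(3)[unfolded hopf_image_def, THEN conjunct2, THEN conjunct2, rule_format, OF conjI[OF T(1) fac]])
    then obtain \<theta> where \<theta>: "\<theta> \<in> star_hom T C" "\<theta> ` carrier T = carrier C"
      "\<forall>p < ?N. \<forall>q < ?N. \<theta> (J (W p q)) = w p q" by (elim bexE conjE)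
    show ?thesis
    proof (rule hopf_quotientI[OF H qC star_hom_comp[OF J \<theta>(1)]])
      show "(\<lambda>x. \<theta> (J x)) ` carrier H = carrier C"
        using onto \<theta>(2) by (simp only: image_image[symmetric, of \<theta> J])
    qed (use \<theta>(3) in blast)
  qed
qed

end
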